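(* Let $K$ be a field of characteristic $p>0$, $B$ a $p$-basis of $K$ over $K^{p}$, and $R$ a discrete valuation ring geometrically integral over $K$. Suppose that $R$ is $B$-Japanese and that the residue field $L$ of $R$ is finite over $K$. For $n=1,2$ let $R(n)$ be the normalization of $R\otimes_K K^{1/p^n}$ in its field of fractions. Put $$g_{10}=\dim_{K^{1/p}}\big(R(1)/R\otimes_{K}K^{1/p}\big),\qquad g_{21}=\dim_{K^{1/p^{2}}}\big(R(2)/R(1)\otimes_{K^{1/p}}K^{1/p^{2}}\big).$$ Then $g_{10}\geq p\,g_{21}$.
   Context: $K(B^{1/p^n})=K(x^{1/p^n}\mid x\in B)$, which equals $K^{1/p^n}$ since $B$ is a $p$-basis. $R$ is $B$-Japanese if, for every natural number $n$, the normalization of $R\otimes_K K(B^{1/p^n})$ in its field of fractions is finite over $R\otimes_K K(B^{1/p^n})$. The $p$-basis $B$ may be infinite. *)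

theory Defs
  imports "HOL-Algebra.Algebra" "HOL-Library.Extended_Nat"
begin

section \<open>Linear algebra over a carrier-based ring\<close>

definition has_char :: "('k, 'm) ring_scheme \<Rightarrow> nat \<Rightarrow> bool" where
  "has_char K p \<longleftrightarrow> (\<forall>n::nat. add_pow K n \<one>\<^bsub>K\<^esub> = \<zero>\<^bsub>K\<^esub> \<longleftrightarrow> p dvd n)"

text \<open>The ring \<open>C\<close> as a module along a ring homomorphism \<open>\<sigma>\<close> into \<open>C\<close>.\<close>

definition ring_module :: "('c, 'm) ring_scheme \<Rightarrow> ('a \<Rightarrow> 'c) \<Rightarrow> ('a, 'c) module" where
  "ring_module C \<sigma> =
     \<lparr>carrier = carrier C, monoid.mult = (\<otimes>\<^bsub>C\<^esub>), one = \<one>\<^bsub>C\<^esub>, ring.zero = \<zero>\<^bsub>C\<^esub>, add = (\<oplus>\<^bsub>C\<^esub>),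
      smult = (\<lambda>a x. \<sigma> a \<otimes>\<^bsub>C\<^esub> x)\<rparr>"

text \<open>The library's module record extends the ring record, but the multiplication and the unit
  of a module are never used; they are left unspecified here.\<close>

definition quot_module :: "('a, 'c) module \<Rightarrow> 'c set \<Rightarrow> ('a, 'c set) module" where
  "quot_module M W =
     \<lparr>carrier = a_rcosets\<^bsub>M\<^esub> W, monoid.mult = undefined, one = undefined, ring.zero = W,
      add = set_add M, smult = (\<lambda>a U. \<Union>x\<in>U. W +>\<^bsub>M\<^esub> (a \<odot>\<^bsub>M\<^esub> x))\<rparr>"

definition lin_indep :: "('a, 'm) ring_scheme \<Rightarrow> ('a, 'c) module \<Rightarrow> 'i set \<Rightarrow> ('i \<Rightarrow> 'c) \<Rightarrow> bool" where
  "lin_indep F M I v \<longleftrightarrow> v \<in> I \<rightarrow> carrier M \<and>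
     (\<forall>S c. finite S \<and> S \<subseteq> I \<and> c \<in> S \<rightarrow> carrier F \<and>
        (\<Oplus>\<^bsub>M\<^esub>i\<in>S. c i \<odot>\<^bsub>M\<^esub> v i) = \<zero>\<^bsub>M\<^esub> \<longrightarrow> (\<forall>i\<in>S. c i = \<zero>\<^bsub>F\<^esub>))"

definition spanning :: "('a, 'm) ring_scheme \<Rightarrow> ('a, 'c) module \<Rightarrow> 'i set \<Rightarrow> ('i \<Rightarrow> 'c) \<Rightarrow> bool" where
  "spanning F M I v \<longleftrightarrow> v \<in> I \<rightarrow> carrier M \<and>
     (\<forall>x\<in>carrier M. \<exists>S c. finite S \<and> S \<subseteq> I \<and> c \<in> S \<rightarrow> carrier F \<and>
        x = (\<Oplus>\<^bsub>M\<^esub>i\<in>S. c i \<odot>\<^bsub>M\<^esub> v i))"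

definition finite_module :: "('a, 'm) ring_scheme \<Rightarrow> ('a, 'c) module \<Rightarrow> bool" where
  "finite_module F M \<longleftrightarrow> (\<exists>G. finite G \<and> G \<subseteq> carrier M \<and> spanning F M G (\<lambda>x. x))"

text \<open>The dimension of a vector space, with value \<open>\<infinity>\<close> if it is not finite.\<close>

definition vdim :: "('a, 'm) ring_scheme \<Rightarrow> ('a, 'c) module \<Rightarrow> enat" where
  "vdim F M = (SUP S\<in>{S. finite S \<and> S \<subseteq> carrier M \<and> lin_indep F M S (\<lambda>x. x)}. enat (card S))"


section \<open>\<open>p\<close>-bases\<close>

text \<open>A \<open>p\<close>-basis is a set \<open>B\<close> whose reduced monomials (finitely many factors from \<open>B\<close>, all
  exponents below \<open>p\<close>) form a basis of \<open>K\<close> over the subfield of \<open>p\<close>-th powers. Monomials are indexed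
  by their exponent functions, so that coincidences between monomials count as linear relations.\<close>

definition p_exponents :: "nat \<Rightarrow> 'k set \<Rightarrow> ('k \<Rightarrow> nat) set" where
  "p_exponents p B = {e. finite {b. e b \<noteq> 0} \<and> {b. e b \<noteq> 0} \<subseteq> B \<and> (\<forall>b. e b < p)}"

definition monomial :: "('k, 'm) ring_scheme \<Rightarrow> ('k \<Rightarrow> nat) \<Rightarrow> 'k" where
  "monomial K e = (\<Otimes>\<^bsub>K\<^esub>b\<in>{b. e b \<noteq> 0}. b [^]\<^bsub>K\<^esub> e b)"

definition p_basis :: "'k ring \<Rightarrow> nat \<Rightarrow> 'k set \<Rightarrow> bool" where
  "p_basis K p B \<longleftrightarrow> B \<subseteq> carrier K \<and>
     (let Kp = K\<lparr>carrier := (\<lambda>x. x [^]\<^bsub>K\<^esub> p) ` carrier K\<rparr>; V = ring_module K (\<lambda>c. c) in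
        lin_indep Kp V (p_exponents p B) (monomial K) \<and>
        spanning Kp V (p_exponents p B) (monomial K))"


section \<open>Roots inside the algebraic closure\<close>

text \<open>The library's algebraic closure does not contain \<open>K\<close> as a subset; the embedding is
  \<open>ac_emb K\<close>. All the fields below are subfields of this one closure.\<close>

type_synonym 'k ac = "('k list \<times> nat) multiset \<Rightarrow> 'k"

definition ac :: "'k ring \<Rightarrow> 'k ac ring" where
  "ac K = field.alg_closure K"

definition ac_emb :: "'k ring \<Rightarrow> 'k \<Rightarrow> 'k ac" where
  "ac_emb K = ring.indexed_const K"

definition p_roots :: "'k ring \<Rightarrow> nat \<Rightarrow> nat \<Rightarrow> 'k set \<Rightarrow> 'k ac set" where
  "p_roots K p n U = {x \<in> carrier (ac K). x [^]\<^bsub>ac K\<^esub> (p ^ n) \<in> ac_emb K ` U}"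

text \<open>The fields $K^{1/p^n}$ and $K(B^{1/p^n})$.\<close>

definition root_field :: "'k ring \<Rightarrow> nat \<Rightarrow> nat \<Rightarrow> 'k ac ring" where
  "root_field K p n = (ac K)\<lparr>carrier := p_roots K p n (carrier K)\<rparr>"

definition adjoin_roots :: "'k ring \<Rightarrow> nat \<Rightarrow> 'k set \<Rightarrow> nat \<Rightarrow> 'k ac ring" where
  "adjoin_roots K p B n =
     (ac K)\<lparr>carrier := generate_field (ac K) (ac_emb K ` carrier K \<union> p_roots K p n B)\<rparr>"


section \<open>Tensor products of commutative algebras\<close>

text \<open>The multiplicative monoid ring of \<open>A \<times> S\<close> over the integers; additively it is the free
  abelian group on \<open>A \<times> S\<close>.\<close>

definition pair_ring :: "'a ring \<Rightarrow> 's ring \<Rightarrow> ('a \<times> 's \<Rightarrow>\<^sub>0 int) ring" where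
  "pair_ring A S =
     \<lparr>carrier = {f. Poly_Mapping.keys f \<subseteq> carrier A \<times> carrier S},
      monoid.mult = (\<lambda>f g. frag_extend (\<lambda>(a, s). frag_extend (\<lambda>(b, t).
                frag_of (a \<otimes>\<^bsub>A\<^esub> b, s \<otimes>\<^bsub>S\<^esub> t)) g) f),
      one = frag_of (\<one>\<^bsub>A\<^esub>, \<one>\<^bsub>S\<^esub>), ring.zero = 0, add = (+)\<rparr>"

text \<open>\<open>\<alpha> : K \<rightarrow> A\<close> and \<open>\<sigma> : K \<rightarrow> S\<close> are the structure maps. The set of relations is stable, up to
  sign and summation, under multiplication by pairs, so the ideal it generates is also the subgroup
  it generates, and the quotient below is the usual tensor product of modules with its usual
  multiplication.\<close>

definition tensor_relations ::
    "'k ring \<Rightarrow> 'a ring \<Rightarrow> ('k \<Rightarrow> 'a) \<Rightarrow> 's ring \<Rightarrow> ('k \<Rightarrow> 's) \<Rightarrow> ('a \<times> 's \<Rightarrow>\<^sub>0 int) set" where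
  "tensor_relations K A \<alpha> S \<sigma> =
     {frag_of (a \<oplus>\<^bsub>A\<^esub> b, s) - frag_of (a, s) - frag_of (b, s) | a b s.
        a \<in> carrier A \<and> b \<in> carrier A \<and> s \<in> carrier S} \<union>
     {frag_of (a, s \<oplus>\<^bsub>S\<^esub> t) - frag_of (a, s) - frag_of (a, t) | a s t.
        a \<in> carrier A \<and> s \<in> carrier S \<and> t \<in> carrier S} \<union>
     {frag_of (\<alpha> k \<otimes>\<^bsub>A\<^esub> a, s) - frag_of (a, \<sigma> k \<otimes>\<^bsub>S\<^esub> s) | k a s.
        k \<in> carrier K \<and> a \<in> carrier A \<and> s \<in> carrier S}"

definition tensor_ideal ::
    "'k ring \<Rightarrow> 'a ring \<Rightarrow> ('k \<Rightarrow> 'a) \<Rightarrow> 's ring \<Rightarrow> ('k \<Rightarrow> 's) \<Rightarrow> ('a \<times> 's \<Rightarrow>\<^sub>0 int) set" where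
  "tensor_ideal K A \<alpha> S \<sigma> = genideal (pair_ring A S) (tensor_relations K A \<alpha> S \<sigma>)"

definition tensor ::
    "'k ring \<Rightarrow> 'a ring \<Rightarrow> ('k \<Rightarrow> 'a) \<Rightarrow> 's ring \<Rightarrow> ('k \<Rightarrow> 's) \<Rightarrow> ('a \<times> 's \<Rightarrow>\<^sub>0 int) set ring" where
  "tensor K A \<alpha> S \<sigma> = pair_ring A S Quot tensor_ideal K A \<alpha> S \<sigma>"

definition pure_tensor ::
    "'k ring \<Rightarrow> 'a ring \<Rightarrow> ('k \<Rightarrow> 'a) \<Rightarrow> 's ring \<Rightarrow> ('k \<Rightarrow> 's) \<Rightarrow> 'a \<Rightarrow> 's \<Rightarrow> ('a \<times> 's \<Rightarrow>\<^sub>0 int) set"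
  where
  "pure_tensor K A \<alpha> S \<sigma> a s = tensor_ideal K A \<alpha> S \<sigma> +>\<^bsub>pair_ring A S\<^esub> frag_of (a, s)"

text \<open>The homomorphism from a tensor product to \<open>C\<close> sending \<open>a \<otimes> s\<close> to \<open>f a \<cdot> g s\<close>, for
  homomorphisms \<open>f : A \<rightarrow> C\<close> and \<open>g : S \<rightarrow> C\<close> that agree on the base. Elements of the tensor product
  are cosets, on which the value below does not depend on the representative.\<close>

definition tensor_lift ::
    "('c, 'm) ring_scheme \<Rightarrow> ('a \<Rightarrow> 'c) \<Rightarrow> ('s \<Rightarrow> 'c) \<Rightarrow> ('a \<times> 's \<Rightarrow>\<^sub>0 int) set \<Rightarrow> 'c" where
  "tensor_lift C f g U =
     the_elem ((\<lambda>\<phi>. \<Oplus>\<^bsub>C\<^esub>z\<in>Poly_Mapping.keys \<phi>.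
        add_pow C (Poly_Mapping.lookup \<phi> z) (f (fst z) \<otimes>\<^bsub>C\<^esub> g (snd z))) ` U)"


section \<open>Fields of fractions and normalization\<close>

definition frac_rel :: "('d, 'm) ring_scheme \<Rightarrow> (('d \<times> 'd) \<times> ('d \<times> 'd)) set" where
  "frac_rel D = {((a, b), (c, d)). a \<in> carrier D \<and> b \<in> carrier D - {\<zero>\<^bsub>D\<^esub>} \<and>
     c \<in> carrier D \<and> d \<in> carrier D - {\<zero>\<^bsub>D\<^esub>} \<and> a \<otimes>\<^bsub>D\<^esub> d = c \<otimes>\<^bsub>D\<^esub> b}"

definition fraction :: "('d, 'm) ring_scheme \<Rightarrow> 'd \<Rightarrow> 'd \<Rightarrow> ('d \<times> 'd) set" where
  "fraction D a b = frac_rel D `` {(a, b)}"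

definition frac_field :: "('d, 'm) ring_scheme \<Rightarrow> ('d \<times> 'd) set ring" where
  "frac_field D =
     \<lparr>carrier = (carrier D \<times> (carrier D - {\<zero>\<^bsub>D\<^esub>})) // frac_rel D,
      monoid.mult = (\<lambda>U V. \<Union>(a, b)\<in>U. \<Union>(c, d)\<in>V. fraction D (a \<otimes>\<^bsub>D\<^esub> c) (b \<otimes>\<^bsub>D\<^esub> d)),
      one = fraction D \<one>\<^bsub>D\<^esub> \<one>\<^bsub>D\<^esub>, ring.zero = fraction D \<zero>\<^bsub>D\<^esub> \<one>\<^bsub>D\<^esub>,
      add = (\<lambda>U V. \<Union>(a, b)\<in>U. \<Union>(c, d)\<in>V.
               fraction D (a \<otimes>\<^bsub>D\<^esub> d \<oplus>\<^bsub>D\<^esub> c \<otimes>\<^bsub>D\<^esub> b) (b \<otimes>\<^bsub>D\<^esub> d))\<rparr>"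

definition frac_emb :: "('d, 'm) ring_scheme \<Rightarrow> 'd \<Rightarrow> ('d \<times> 'd) set" where
  "frac_emb D a = fraction D a \<one>\<^bsub>D\<^esub>"

text \<open>The extension \<open>a / b \<mapsto> h a / h b\<close> of an injective homomorphism \<open>h\<close> from \<open>D\<close> to a field \<open>C\<close>.\<close>

definition frac_lift :: "('c, 'm) ring_scheme \<Rightarrow> ('d \<Rightarrow> 'c) \<Rightarrow> ('d \<times> 'd) set \<Rightarrow> 'c" where
  "frac_lift C h U = the_elem ((\<lambda>(a, b). h a \<otimes>\<^bsub>C\<^esub> inv\<^bsub>C\<^esub> (h b)) ` U)"

text \<open>The library lists the coefficients of a polynomial starting with the leading one.\<close>

definition integral_over :: "'c ring \<Rightarrow> 'c set \<Rightarrow> 'c \<Rightarrow> bool" where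
  "integral_over C A x \<longleftrightarrow>
     (\<exists>q. polynomial\<^bsub>C\<^esub> A q \<and> q \<noteq> [] \<and> lead_coeff q = \<one>\<^bsub>C\<^esub> \<and> ring.eval C q x = \<zero>\<^bsub>C\<^esub>)"

definition normalization :: "('d, 'm) ring_scheme \<Rightarrow> ('d \<times> 'd) set ring" where
  "normalization D = (frac_field D)\<lparr>carrier :=
     {x \<in> carrier (frac_field D). integral_over (frac_field D) (frac_emb D ` carrier D) x}\<rparr>"


section \<open>Hypotheses on the algebra\<close>

definition dvr :: "'r ring \<Rightarrow> bool" where
  "dvr R \<longleftrightarrow> principal_domain R \<and> \<not> field R \<and> (\<exists>!M. maximalideal M R)"

definition max_ideal :: "'r ring \<Rightarrow> 'r set" where
  "max_ideal R = (THE M. maximalideal M R)"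

definition residue_field_finite :: "'k ring \<Rightarrow> 'r ring \<Rightarrow> ('k \<Rightarrow> 'r) \<Rightarrow> bool" where
  "residue_field_finite K R \<iota> \<longleftrightarrow>
     finite_module K (ring_module (R Quot max_ideal R) (\<lambda>k. max_ideal R +>\<^bsub>R\<^esub> \<iota> k))"

text \<open>A HOL formula cannot quantify over fields of all types, so the extension fields \<open>E\<close> of \<open>K\<close>
  range over all field structures on subsets of the type \<open>'k ac\<close>. Up to isomorphism these
  include an algebraic closure of \<open>K\<close> (for which alone being a domain already implies it for every
  extension), and every extension whose cardinality is at most that of the closure.\<close>

definition geometrically_integral :: "'k ring \<Rightarrow> 'r ring \<Rightarrow> ('k \<Rightarrow> 'r) \<Rightarrow> bool" where
  "geometrically_integral K R \<iota> \<longleftrightarrow>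
     (\<forall>(E :: 'k ac ring) \<epsilon>. field E \<and> \<epsilon> \<in> ring_hom K E \<longrightarrow> domain (tensor K R \<iota> E \<epsilon>))"

definition japanese :: "'k ring \<Rightarrow> nat \<Rightarrow> 'k set \<Rightarrow> 'r ring \<Rightarrow> ('k \<Rightarrow> 'r) \<Rightarrow> bool" where
  "japanese K p B R \<iota> \<longleftrightarrow>
     (\<forall>n. let D = tensor K R \<iota> (adjoin_roots K p B n) (ac_emb K) in
        finite_module D (ring_module (normalization D) (frac_emb D)))"


section \<open>The rings \<open>R(n)\<close> and their comparison maps\<close>

definition base_change :: "'k ring \<Rightarrow> 'r ring \<Rightarrow> ('k \<Rightarrow> 'r) \<Rightarrow> nat \<Rightarrow> nat \<Rightarrow> ('r \<times> 'k ac \<Rightarrow>\<^sub>0 int) set ring"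
  where
  "base_change K R \<iota> p n = tensor K R \<iota> (root_field K p n) (ac_emb K)"

definition bc_tensor ::
    "'k ring \<Rightarrow> 'r ring \<Rightarrow> ('k \<Rightarrow> 'r) \<Rightarrow> nat \<Rightarrow> nat \<Rightarrow> 'r \<Rightarrow> 'k ac \<Rightarrow> ('r \<times> 'k ac \<Rightarrow>\<^sub>0 int) set" where
  "bc_tensor K R \<iota> p n = pure_tensor K R \<iota> (root_field K p n) (ac_emb K)"

type_synonym ('k, 'r) bc_frac =
  "(('r \<times> 'k ac \<Rightarrow>\<^sub>0 int) set \<times> ('r \<times> 'k ac \<Rightarrow>\<^sub>0 int) set) set"

definition norm_bc :: "'k ring \<Rightarrow> 'r ring \<Rightarrow> ('k \<Rightarrow> 'r) \<Rightarrow> nat \<Rightarrow> nat \<Rightarrow> ('k, 'r) bc_frac ring" where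
  "norm_bc K R \<iota> p n = normalization (base_change K R \<iota> p n)"

text \<open>The structure map $K^{1/p^n} \to R(n)$.\<close>

definition norm_scalar :: "'k ring \<Rightarrow> 'r ring \<Rightarrow> ('k \<Rightarrow> 'r) \<Rightarrow> nat \<Rightarrow> nat \<Rightarrow> 'k ac \<Rightarrow> ('k, 'r) bc_frac" where
  "norm_scalar K R \<iota> p n s = frac_emb (base_change K R \<iota> p n) (bc_tensor K R \<iota> p n \<one>\<^bsub>R\<^esub> s)"

text \<open>For \<open>m \<le> n\<close>: the map $R \otimes_K K^{1/p^m} \to R \otimes_K K^{1/p^n}$ induced by the inclusion
  of fields, and the map it induces on fields of fractions, which sends \<open>R(m)\<close> into \<open>R(n)\<close>.\<close>

definition bc_map ::
    "'k ring \<Rightarrow> 'r ring \<Rightarrow> ('k \<Rightarrow> 'r) \<Rightarrow> nat \<Rightarrow> nat \<Rightarrow> nat \<Rightarrow>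
     ('r \<times> 'k ac \<Rightarrow>\<^sub>0 int) set \<Rightarrow> ('r \<times> 'k ac \<Rightarrow>\<^sub>0 int) set" where
  "bc_map K R \<iota> p m n =
     tensor_lift (base_change K R \<iota> p n)
       (\<lambda>a. bc_tensor K R \<iota> p n a \<one>\<^bsub>root_field K p n\<^esub>) (\<lambda>s. bc_tensor K R \<iota> p n \<one>\<^bsub>R\<^esub> s)"

definition norm_map ::
    "'k ring \<Rightarrow> 'r ring \<Rightarrow> ('k \<Rightarrow> 'r) \<Rightarrow> nat \<Rightarrow> nat \<Rightarrow> nat \<Rightarrow> ('k, 'r) bc_frac \<Rightarrow> ('k, 'r) bc_frac" where
  "norm_map K R \<iota> p m n =
     frac_lift (frac_field (base_change K R \<iota> p n))
       (\<lambda>t. frac_emb (base_change K R \<iota> p n) (bc_map K R \<iota> p m n t))"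

text \<open>The ring $R(m) \otimes_{K^{1/p^m}} K^{1/p^n}$ and its canonical (injective) map to \<open>R(n)\<close>, along
  which it is regarded as a subring of \<open>R(n)\<close>.\<close>

definition norm_base_change ::
    "'k ring \<Rightarrow> 'r ring \<Rightarrow> ('k \<Rightarrow> 'r) \<Rightarrow> nat \<Rightarrow> nat \<Rightarrow> nat \<Rightarrow> (('k, 'r) bc_frac \<times> 'k ac \<Rightarrow>\<^sub>0 int) set ring"
  where
  "norm_base_change K R \<iota> p m n =
     tensor (root_field K p m) (norm_bc K R \<iota> p m) (norm_scalar K R \<iota> p m)
       (root_field K p n) (\<lambda>s. s)"

definition norm_base_change_map ::
    "'k ring \<Rightarrow> 'r ring \<Rightarrow> ('k \<Rightarrow> 'r) \<Rightarrow> nat \<Rightarrow> nat \<Rightarrow> nat \<Rightarrow>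
     (('k, 'r) bc_frac \<times> 'k ac \<Rightarrow>\<^sub>0 int) set \<Rightarrow> ('k, 'r) bc_frac" where
  "norm_base_change_map K R \<iota> p m n =
     tensor_lift (norm_bc K R \<iota> p n) (norm_map K R \<iota> p m n) (norm_scalar K R \<iota> p n)"

end

theory Submission
  imports Defs
begin

text \<open>The \<open>p^n\<close>-th powers of the elements of $R \otimes_K K^{1/p^n}$ lie in the integrally closed ring \<open>R\<close>, so
  \<open>R(n)\<close> is the set of all \<open>x\<close> in the field of fractions with $x^{p^n} \in R$. Everything is compared inside the field of fractions of
  $R \otimes_K K^{1/p^2}$, after the Frobenius \<open>\<phi>\<close> has moved \<open>R(2)\<close> over $K^{1/p^2}$ to
  \<open>O2 = \<phi> R(2)\<close> over $k = K^{1/p}$. With \<open>O1 = R(1)\<close>, \<open>D = k R\<close>, \<open>P = \<phi> R(1)\<close> and \<open>C = k P\<close>, the two genera are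
  the \<open>k\<close>-dimensions of \<open>O1 / D\<close> and \<open>O2 / C\<close>. The dimension of a quotient \<open>V / W\<close> is
  treated as the supremum of the lengths of chains of subspaces between \<open>W\<close> and \<open>V\<close>.

  Let \<open>t\<close> be a uniformizer of \<open>R\<close>. As \<open>P\<close> is a discrete valuation ring between \<open>\<phi> R\<close> and \<open>R\<close>, and the residue
  field of \<open>R\<close> is finite over \<open>K\<close>, modulo every power of \<open>t\<close> the \<open>P\<close>-module \<open>R\<close> is generated by
  \<open>p\<close> elements (if the first genus is finite). The Japanese hypothesis provides an \<open>M\<close> with \<open>I = t^(p M) O2\<close>
  contained in \<open>C\<close>; put \<open>U = t^(p M) O1\<close>. Then \<open>D \<subseteq> U + C y\<^sub>1 + ... + C y\<^sub>p\<close>, so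
  \<open>dim (O1 / U) \<le> g10 + p dim (C / I)\<close>, while \<open>dim (O2 / I) = g21 + dim (C / I)\<close>. Moreover
  \<open>dim (O1 / U) = p M dim (O1 / t O1)\<close> and \<open>dim (O2 / I) = M dim (O2 / t^p O2) \<le> M dim (O1 / t O1)\<close>,
  hence \<open>p g21 + p dim (C / I) \<le> g10 + p dim (C / I)\<close>.\<close>

section \<open>Lengths of intervals in families of sets\<close>

text \<open>No field degree is available: K^(1/p) may be infinite over K, and nothing says that
  \<open>R\<close> is a finite module over \<open>P\<close>. Therefore neither genus is compared
  with the other directly. Both are embedded in longer intervals, from \<open>U\<close> to
  \<open>O1\<close> and from \<open>I\<close> to \<open>O2\<close>, that can be measured layer by
  layer. The factor \<open>p\<close> arises twice, and the two occurrences have to match. One comes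
  from \<open>q = t^p\<close>: the same power \<open>q^M\<close> cuts \<open>O1\<close> into
  \<open>p M\<close> layers but \<open>O2\<close> into only \<open>M\<close>. The other comes from
  the ramification \<open>v\<close> and the number \<open>m\<close> with \<open>v m = p\<close>,
  which bound the number of generators. So the unknown length of \<open>C / I\<close> appears
  \<open>p\<close> times on both sides and cancels. This requires it to be finite, which is the
  purpose of the conductor. Frobenius gives both genera the same field of scalars and places
  \<open>O2\<close> inside \<open>O1\<close>, so that the two filtrations can be compared at all.
  Chains are used instead of bases because sums, intersections, spans and semilinear maps act on
  chains directly; infinite values then need care only where a length is cancelled.\<close>

inductive flag :: "'a set set \<Rightarrow> 'a set \<Rightarrow> nat \<Rightarrow> 'a set \<Rightarrow> bool"
  for S :: "'a set set" and V :: "'a set" where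
  flag_0: "T \<in> S \<Longrightarrow> V \<subseteq> T \<Longrightarrow> flag S V 0 T"
| flag_Suc: "flag S V n T \<Longrightarrow> T \<subset> Y \<Longrightarrow> Y \<in> S \<Longrightarrow> flag S V (Suc n) Y"

text \<open>Only inclusions are required at both ends, so \<open>V\<close> and \<open>W\<close> need
  not belong to \<open>S\<close>, and enlarging the interval or the family cannot decrease the
  length.\<close>

definition len :: "'a set set \<Rightarrow> 'a set \<Rightarrow> 'a set \<Rightarrow> enat" where
  "len S V W = (SUP n\<in>{n. \<exists>T. T \<subseteq> W \<and> flag S V n T}. enat n)"

lemma flagD:
  assumes "flag S V n T"
  shows "T \<in> S" and "V \<subseteq> T"
  using assms by (induction) auto

lemma flag_enlarge:
  assumes "flag S V n T" and "T \<subseteq> Y" and "Y \<in> S"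
  shows "flag S V n Y"
  using assms
proof (cases rule: flag.cases)
  case flag_0
  then show ?thesis using assms by (auto intro!: flag.flag_0)
next
  case (flag_Suc m Z)
  then show ?thesis using assms by (auto intro!: flag.flag_Suc[of _ _ m Z])
qed

lemma flag_decrease:
  assumes "flag S V n T" and "m \<le> n"
  shows "flag S V m T"
  using assms
proof (induction arbitrary: m)
  case (flag_0 T)
  then show ?case by (auto intro: flag.flag_0)
next
  case (flag_Suc n T Y)
  show ?case
  proof (cases "m = Suc n")
    case True
    then show ?thesis using flag_Suc by (auto intro: flag.flag_Suc)
  next
    case False
    then have "flag S V m T" using flag_Suc by simp
    then show ?thesis using flag_Suc.hyps by (meson flag_enlarge psubset_imp_subset)
  qed
qed

lemma flag_transfer:
  assumes "flag S V n T" and "T \<subseteq> W"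
    and "\<And>T. T \<in> S \<Longrightarrow> V \<subseteq> T \<Longrightarrow> T \<subseteq> W \<Longrightarrow> h T \<in> S' \<and> V' \<subseteq> h T"
    and "\<And>T Y. T \<in> S \<Longrightarrow> Y \<in> S \<Longrightarrow> V \<subseteq> T \<Longrightarrow> T \<subset> Y \<Longrightarrow> Y \<subseteq> W \<Longrightarrow> h T \<subset> h Y"
  shows "flag S' V' n (h T)"
  using assms(1,2)
proof (induction)
  case (flag_0 T)
  then show ?case using assms(3) by (auto intro!: flag.flag_0)
next
  case (flag_Suc n T Y)
  have "T \<in> S" "V \<subseteq> T" using flagD flag_Suc by blast+
  then show ?case using flag_Suc assms(3)[of Y] assms(4)[of T Y]
    by (intro flag.flag_Suc[of _ _ n "h T"]) auto
qed

lemma len_leI: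
  assumes "\<And>n T. flag S V n T \<Longrightarrow> T \<subseteq> W \<Longrightarrow> enat n \<le> b"
  shows "len S V W \<le> b"
  unfolding len_def using assms by (auto intro!: SUP_least)

lemma flag_le_len:
  assumes "flag S V n T" and "T \<subseteq> W"
  shows "enat n \<le> len S V W"
  unfolding len_def using assms by (auto intro!: SUP_upper)

text \<open>An infinite supremum is attained by no single chain. Since chains can be shortened,
  there is nevertheless one of every finite length below it.\<close>

lemma len_geD:
  assumes "enat n \<le> len S V W" and "V \<in> S" and "V \<subseteq> W"
  obtains T where "flag S V n T" and "T \<subseteq> W"
proof (cases "n = 0")
  \<comment> \<open>A supremum over no chains at all would also be 0, so here the one-member chain
    \<open>V\<close> has to be supplied.\<close>
  case True
  then show ?thesis using that[of V] assms by (auto intro: flag_0)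
next
  case False
  have "\<exists>m T. flag S V m T \<and> T \<subseteq> W \<and> n \<le> m"
  proof (rule ccontr)
    assume neg: "\<not> ?thesis"
    have "len S V W \<le> enat (n - 1)"
      
    proof (rule len_leI)
      fix m T assume "flag S V m T" "T \<subseteq> W"
      then have "m < n" using neg by (meson not_le)
      then show "enat m \<le> enat (n - 1)" by simp
    qed
    with assms(1) have "enat n \<le> enat (n - 1)" by (rule order_trans)
    with False show False by simp
  qed
  then show ?thesis using that flag_decrease by metis
qed

text \<open>Most comparisons of lengths below are instances of this, with dilations, spans, images
  or preimages as \<open>h\<close>. Only strict monotonicity on the interval matters;
  \<open>h\<close> need not respect sums or intersections.\<close>

lemma len_transfer:
  assumes "\<And>T. T \<in> S \<Longrightarrow> V \<subseteq> T \<Longrightarrow> T \<subseteq> W \<Longrightarrow> h T \<in> S' \<and> V' \<subseteq> h T \<and> h T \<subseteq> W'"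
    and "\<And>T Y. T \<in> S \<Longrightarrow> Y \<in> S \<Longrightarrow> V \<subseteq> T \<Longrightarrow> T \<subset> Y \<Longrightarrow> Y \<subseteq> W \<Longrightarrow> h T \<subset> h Y"
  shows "len S V W \<le> len S' V' W'"
proof (rule len_leI)
  fix n T assume "flag S V n T" "T \<subseteq> W"
  then have "flag S' V' n (h T)"
  proof (rule flag_transfer)
    show "h Z \<in> S' \<and> V' \<subseteq> h Z" if "Z \<in> S" "V \<subseteq> Z" "Z \<subseteq> W" for Z
      using assms(1)[OF that] by simp
    show "h Z \<subset> h Y" if "Z \<in> S" "Y \<in> S" "V \<subseteq> Z" "Z \<subset> Y" "Y \<subseteq> W" for Z Y
      using assms(2)[OF that] .
  qed
  then show "enat n \<le> len S' V' W'"
    using assms(1)[of T] flagD[OF \<open>flag S V n T\<close>] \<open>T \<subseteq> W\<close>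
      flag_le_len[of S' V' n "h T" W'] by blast
qed

lemma len_mono:
  assumes "V' \<subseteq> V" and "W \<subseteq> W'" and "S \<subseteq> S'"
  shows "len S V W \<le> len S' V' W'"
  using assms by (intro len_transfer[where h = "\<lambda>T. T"]) auto

lemma len_trivial:
  assumes "W \<subseteq> V"
  shows "len S V W = 0"
proof -
  have "len S V W \<le> 0"
  proof (rule len_leI)
    fix n T assume "flag S V n T" "T \<subseteq> W"
    then show "enat n \<le> 0"
    proof cases
      case (flag_Suc m Y)
      then show ?thesis using flagD[OF flag_Suc(2)] assms \<open>T \<subseteq> W\<close> by blast
    qed (simp add: zero_enat_def)
  qed
  then show ?thesis by simp
qed

lemma len_pos:
  assumes "V \<in> S" and "W \<in> S" and "V \<subset> W"
  shows "1 \<le> len S V W"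
proof -
  have "flag S V (Suc 0) W" using assms by (auto intro: flag.intros)
  from flag_le_len[OF this order_refl] show ?thesis by (simp add: one_enat_def)
qed

text \<open>The lowest member of the upper chain contains \<open>V\<close>, hence \<open>T\<close>.
  Raising the top of the lower chain from \<open>T\<close> to that member costs no step, and the
  strict steps of both chains add up.\<close>

lemma flag_append:
  assumes "flag S V m Y" and "flag S U n T" and "T \<subseteq> V"
  shows "flag S U (n + m) Y"
  using assms
proof (induction)
  case (flag_0 Z)
  then show ?case using flag_enlarge[OF \<open>flag S U n T\<close>] by simp
next
  case (flag_Suc m Z Y)
  then show ?case by (auto intro: flag.flag_Suc)
qed

text \<open>Testing against finite numbers treats infinite lengths like finite ones, because every
  finite lower bound is witnessed by an actual chain.\<close>

lemma enat_leI:
  fixes a b :: enat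
  assumes "\<And>n. enat n \<le> a \<Longrightarrow> enat n \<le> b"
  shows "a \<le> b"
proof (cases a)
  case (enat n)
  then show ?thesis using assms by simp
next
  case infinity
  have "enat n \<le> b" for n using assms infinity by simp
  then have "b \<noteq> enat m" for m
    by (metis enat_ord_simps(1) not_less_eq_eq order_refl)
  then show ?thesis by (cases b) auto
qed

lemma enat_le_addE:
  fixes a b :: enat
  assumes "enat n \<le> a + b"
  obtains i j where "n = i + j" and "enat i \<le> a" and "enat j \<le> b"
proof (cases a)
  case (enat k)
  show ?thesis
  proof (cases "n \<le> k")
    case True
    then show ?thesis using that[of n 0] enat by (simp add: zero_enat_def[symmetric])
  next
    case False
    have "enat (n - k) \<le> b" using assms enat by (cases b) auto
    then show ?thesis using that[of k "n - k"] enat False by simp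
  qed
next
  case infinity
  then show ?thesis using that[of n 0] by (simp add: zero_enat_def[symmetric])
qed

lemma len_add_le:
  assumes "U \<in> S" and "V \<in> S" and "U \<subseteq> V" and "V \<subseteq> W"
  shows "len S U V + len S V W \<le> len S U W"
proof (rule enat_leI)
  fix n assume "enat n \<le> len S U V + len S V W"
  then obtain i j where n: "n = i + j" and ij: "enat i \<le> len S U V" "enat j \<le> len S V W"
    by (rule enat_le_addE)
  obtain T where T: "flag S U i T" "T \<subseteq> V" using len_geD[OF ij(1)] assms by blast
  obtain Y where Y: "flag S V j Y" "Y \<subseteq> W" using len_geD[OF ij(2)] assms by blast
  show "enat n \<le> len S U W"
    using flag_le_len[OF flag_append[OF Y(1) T] Y(2)] n by simp
qed

text \<open>In the applications \<open>j T = T + V\<close>, and the third assumption is the modular law.\<close>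

lemma len_le_add:
  assumes inter: "\<And>T. T \<in> S \<Longrightarrow> T \<inter> V \<in> S"
    and join: "\<And>T. T \<in> S \<Longrightarrow> j T \<in> S \<and> V \<subseteq> j T"
    and modular: "\<And>T Y. T \<in> S \<Longrightarrow> Y \<in> S \<Longrightarrow> T \<subseteq> Y \<Longrightarrow> T \<inter> V = Y \<inter> V \<Longrightarrow> j T = j Y \<Longrightarrow> T = Y"
    and mono: "\<And>T Y. T \<subseteq> Y \<Longrightarrow> j T \<subseteq> j Y"
    and W: "j W \<subseteq> W" and "U \<subseteq> V"
  shows "len S U W \<le> len S U V + len S V W"
proof (rule len_leI)
  fix n T assume "flag S U n T" "T \<subseteq> W"
  \<comment> \<open>By the modular law a strict step from \<open>T\<close> to \<open>Y\<close> is
    still strict after intersecting with \<open>V\<close> or after joining with \<open>V\<close>. So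
    each step is counted in \<open>a\<close> or in \<open>b\<close>.\<close>
  have "\<exists>a b. n \<le> a + b \<and> flag S U a (T \<inter> V) \<and> flag S V b (j T)"
    using \<open>flag S U n T\<close>
  proof (induction)
    case (flag_0 T)
    then have "flag S U 0 (T \<inter> V)" "flag S V 0 (j T)"
      using inter join \<open>U \<subseteq> V\<close> by (auto intro!: flag.flag_0)
    then show ?case by (metis add_0 le_refl)
  next
    case (flag_Suc n T Y)
    then obtain a b where ab: "n \<le> a + b" "flag S U a (T \<inter> V)" "flag S V b (j T)" by blast
    have TS: "T \<in> S" using flagD flag_Suc.hyps(1) by blast
    have *: "flag S U a (Y \<inter> V)" "flag S V b (j Y)"
      using flag_enlarge[OF ab(2)] flag_enlarge[OF ab(3)] flag_Suc.hyps inter join mono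
      by (meson Int_mono order_refl psubset_imp_subset)+
    show ?case
    proof (cases "T \<inter> V = Y \<inter> V")
      case False
      then have "flag S U (Suc a) (Y \<inter> V)"
        using flag_Suc.hyps ab(2) inter by (intro flag.flag_Suc[of _ _ a "T \<inter> V"]) auto
      then show ?thesis using * ab(1) by (metis add_Suc not_less_eq_eq)
    next
      case True
      then have "j T \<noteq> j Y" using modular[OF TS \<open>Y \<in> S\<close>] flag_Suc.hyps by blast
      then have "flag S V (Suc b) (j Y)"
        using flag_Suc.hyps ab(3) join mono[of T Y] by (intro flag.flag_Suc[of _ _ b "j T"]) auto
      then show ?thesis using * ab(1) by (metis add_Suc_right not_less_eq_eq)
    qed
  qed
  then obtain a b where ab: "n \<le> a + b" "flag S U a (T \<inter> V)" "flag S V b (j T)" by blast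
  have "enat a \<le> len S U V" "enat b \<le> len S V W"
    using flag_le_len ab(2,3) mono[OF \<open>T \<subseteq> W\<close>] W by (metis Int_lower2, metis order_trans)
  then have "enat a + enat b \<le> len S U V + len S V W" by (rule add_mono)
  then show "enat n \<le> len S U V + len S V W"
    using ab(1) by (metis enat_ord_simps(1) order_trans plus_enat_simps(1))
qed

section \<open>Subspaces of a ring\<close>

lemma mem_set_add: "x \<in> V <+>\<^bsub>G\<^esub> W \<longleftrightarrow> (\<exists>v\<in>V. \<exists>w\<in>W. x = v \<oplus>\<^bsub>G\<^esub> w)"
  by (auto simp: set_add_def')

context ring
begin

text \<open>The scalars may be any set. The same families thus describe vector spaces over
  \<open>k0\<close> and \<open>k1\<close> and modules over the rings \<open>P\<close>,
  \<open>A\<close> and \<open>C\<close>, and \<open>subsp_antimono\<close> passes between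
  them.\<close>

definition subsp :: "'a set \<Rightarrow> 'a set set" where
  "subsp k = {V. additive_subgroup V R \<and> (\<forall>a\<in>k. \<forall>v\<in>V. a \<otimes> v \<in> V)}"

definition dilate :: "'a \<Rightarrow> 'a set \<Rightarrow> 'a set" where
  "dilate x V = (\<lambda>v. x \<otimes> v) ` V"

text \<open>Linear combinations are built by one summand at a time, which replaces finite sums with
  coefficient families by rule induction.\<close>

inductive_set kspan :: "'a set \<Rightarrow> 'a set \<Rightarrow> 'a set" for k V where
  kspan_zero: "\<zero> \<in> kspan k V"
| kspan_add: "x \<in> kspan k V \<Longrightarrow> a \<in> k \<Longrightarrow> v \<in> V \<Longrightarrow> x \<oplus> a \<otimes> v \<in> kspan k V"

lemma subspI:
  assumes "V \<subseteq> carrier R" and "\<zero> \<in> V" and "\<And>u v. u \<in> V \<Longrightarrow> v \<in> V \<Longrightarrow> u \<oplus> v \<in> V"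
    and "\<And>v. v \<in> V \<Longrightarrow> \<ominus> v \<in> V" and "\<And>a v. a \<in> k \<Longrightarrow> v \<in> V \<Longrightarrow> a \<otimes> v \<in> V"
  shows "V \<in> subsp k"
proof -
  have "subgroup V (add_monoid R)"
    using assms by (intro add.subgroupI) (auto simp: a_inv_def)
  then show ?thesis using assms by (auto simp: subsp_def additive_subgroup_def)
qed

lemma subspD:
  assumes "V \<in> subsp k"
  shows "V \<subseteq> carrier R" and "\<zero> \<in> V" and "\<And>u v. u \<in> V \<Longrightarrow> v \<in> V \<Longrightarrow> u \<oplus> v \<in> V"
    and "\<And>v. v \<in> V \<Longrightarrow> \<ominus> v \<in> V" and "\<And>a v. a \<in> k \<Longrightarrow> v \<in> V \<Longrightarrow> a \<otimes> v \<in> V"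
    and "\<And>u v. u \<in> V \<Longrightarrow> v \<in> V \<Longrightarrow> u \<ominus> v \<in> V"
proof -
  interpret additive_subgroup V R using assms by (auto simp: subsp_def)
  show "V \<subseteq> carrier R" "\<zero> \<in> V" using a_subset zero_closed by auto
  show add: "\<And>u v. u \<in> V \<Longrightarrow> v \<in> V \<Longrightarrow> u \<oplus> v \<in> V" using a_closed by auto
  show neg: "\<And>v. v \<in> V \<Longrightarrow> \<ominus> v \<in> V" using a_inv_closed by auto
  show "\<And>a v. a \<in> k \<Longrightarrow> v \<in> V \<Longrightarrow> a \<otimes> v \<in> V" using assms by (auto simp: subsp_def)
  show "\<And>u v. u \<in> V \<Longrightarrow> v \<in> V \<Longrightarrow> u \<ominus> v \<in> V" using add neg by (simp add: a_minus_def)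
qed

lemma subsp_antimono: "k0 \<subseteq> k \<Longrightarrow> subsp k \<subseteq> subsp k0"
  by (auto simp: subsp_def)

lemma subsp_inter: "V \<in> subsp k \<Longrightarrow> W \<in> subsp k \<Longrightarrow> V \<inter> W \<in> subsp k"
  by (rule subspI) (auto dest: subspD)

lemma subsp_add:
  assumes "V \<in> subsp k" and "W \<in> subsp k" and "k \<subseteq> carrier R"
  shows "V <+>\<^bsub>R\<^esub> W \<in> subsp k"
proof (rule subspI)
  note D = subspD[OF assms(1)] subspD[OF assms(2)]
  note S = subsetD[OF D(1)] subsetD[OF D(7)] subsetD[OF assms(3)]
  show "V <+>\<^bsub>R\<^esub> W \<subseteq> carrier R"
  proof
    fix x assume "x \<in> V <+>\<^bsub>R\<^esub> W"
    then obtain v w where "v \<in> V" "w \<in> W" "x = v \<oplus> w" unfolding mem_set_add by blast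
    then show "x \<in> carrier R" using S by simp
  qed
  show "\<zero> \<in> V <+>\<^bsub>R\<^esub> W" using D by (auto simp: mem_set_add intro!: bexI[of _ \<zero>])
  show "x \<oplus> y \<in> V <+>\<^bsub>R\<^esub> W" if xy: "x \<in> V <+>\<^bsub>R\<^esub> W" "y \<in> V <+>\<^bsub>R\<^esub> W" for x y
  proof -
    obtain v w v' w' where *: "v \<in> V" "w \<in> W" "x = v \<oplus> w" "v' \<in> V" "w' \<in> W" "y = v' \<oplus> w'"
      using xy by (auto simp: mem_set_add)
    have "x \<oplus> y = (v \<oplus> v') \<oplus> (w \<oplus> w')" using * S by (simp add: a_ac)
    then show ?thesis using D(3)[OF *(1,4)] D(9)[OF *(2,5)] by (auto simp: mem_set_add)
  qed
  show "\<ominus> x \<in> V <+>\<^bsub>R\<^esub> W" if x: "x \<in> V <+>\<^bsub>R\<^esub> W" for x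
  proof -
    obtain v w where *: "v \<in> V" "w \<in> W" "x = v \<oplus> w" using x by (auto simp: mem_set_add)
    have "\<ominus> x = \<ominus> v \<oplus> \<ominus> w" using * S by (simp add: minus_add)
    then show ?thesis using D(4)[OF *(1)] D(10)[OF *(2)] by (auto simp: mem_set_add)
  qed
  show "a \<otimes> x \<in> V <+>\<^bsub>R\<^esub> W" if x: "x \<in> V <+>\<^bsub>R\<^esub> W" and a: "a \<in> k" for a x
  proof -
    obtain v w where *: "v \<in> V" "w \<in> W" "x = v \<oplus> w" using x by (auto simp: mem_set_add)
    have "a \<otimes> x = a \<otimes> v \<oplus> a \<otimes> w" using * S a by (simp add: r_distr)
    then show ?thesis using D(5)[OF a *(1)] D(11)[OF a *(2)] by (auto simp: mem_set_add)
  qed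
qed

lemma set_add_upper:
  assumes "V \<in> subsp k" and "W \<in> subsp k'"
  shows "V \<subseteq> V <+>\<^bsub>R\<^esub> W" and "W \<subseteq> V <+>\<^bsub>R\<^esub> W"
proof -
  note D = subspD[OF assms(1)] subspD[OF assms(2)]
  have "v = v \<oplus> \<zero>" "v = \<zero> \<oplus> v" if "v \<in> V \<union> W" for v
    using D(1) D(7) that by auto
  then show "V \<subseteq> V <+>\<^bsub>R\<^esub> W" "W \<subseteq> V <+>\<^bsub>R\<^esub> W"
    using D(2,8) unfolding mem_set_add subset_iff by blast+
qed

lemma set_add_least:
  assumes "Y \<in> subsp k" and "V \<subseteq> Y" and "W \<subseteq> Y"
  shows "V <+>\<^bsub>R\<^esub> W \<subseteq> Y"
proof
  fix x assume "x \<in> V <+>\<^bsub>R\<^esub> W"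
  then obtain v w where "v \<in> V" "w \<in> W" "x = v \<oplus> w" unfolding mem_set_add by blast
  then show "x \<in> Y" using subspD(3)[OF assms(1)] assms(2,3) by blast
qed

lemma set_add_monotone: "V \<subseteq> V' \<Longrightarrow> W \<subseteq> W' \<Longrightarrow> V <+>\<^bsub>R\<^esub> W \<subseteq> V' <+>\<^bsub>R\<^esub> W'"
  unfolding mem_set_add subset_iff by blast

lemma set_add_modular:
  assumes "T \<in> subsp k" and "Y \<in> subsp k" and "V \<in> subsp k'" and "T \<subseteq> Y"
    and "T \<inter> V = Y \<inter> V" and "T <+>\<^bsub>R\<^esub> V = Y <+>\<^bsub>R\<^esub> V"
  shows "T = Y"
proof
  show "Y \<subseteq> T"
  proof
    fix y assume y: "y \<in> Y"
    then have "y \<in> T <+>\<^bsub>R\<^esub> V" using set_add_upper(1)[OF assms(2,3)] assms(6) by blast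
    then obtain u v where uv: "u \<in> T" "v \<in> V" "y = u \<oplus> v" by (auto simp: mem_set_add)
    have c: "u \<in> carrier R" "v \<in> carrier R" using uv subspD(1) assms by blast+
    have "v = y \<ominus> u" using uv c by algebra
    then have "v \<in> Y" using y uv subspD(6)[OF assms(2)] assms(4) by blast
    then have "v \<in> T" using uv assms(5) by blast
    then show "y \<in> T" using uv subspD(3)[OF assms(1)] by blast
  qed
qed (fact assms(4))

lemma len_add:
  assumes "U \<in> subsp k" and "V \<in> subsp k" and "W \<in> subsp k" and "U \<subseteq> V" and "V \<subseteq> W"
    and "k \<subseteq> carrier R"
  shows "len (subsp k) U W = len (subsp k) U V + len (subsp k) V W"
proof (rule antisym)
  show "len (subsp k) U W \<le> len (subsp k) U V + len (subsp k) V W"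
  proof (rule len_le_add[where j = "\<lambda>T. T <+>\<^bsub>R\<^esub> V"])
    show "T \<in> subsp k \<Longrightarrow> T \<inter> V \<in> subsp k" for T using subsp_inter assms by blast
    show "T \<in> subsp k \<Longrightarrow> T <+>\<^bsub>R\<^esub> V \<in> subsp k \<and> V \<subseteq> T <+>\<^bsub>R\<^esub> V" for T
      using subsp_add set_add_upper assms by metis
    show "T = Y" if "T \<in> subsp k" "Y \<in> subsp k" "T \<subseteq> Y" "T \<inter> V = Y \<inter> V" "T <+>\<^bsub>R\<^esub> V = Y <+>\<^bsub>R\<^esub> V" for T Y
      using set_add_modular[OF that(1,2) assms(2) that(3-5)] .
    show "T \<subseteq> Y \<Longrightarrow> T <+>\<^bsub>R\<^esub> V \<subseteq> Y <+>\<^bsub>R\<^esub> V" for T Y by (rule set_add_monotone) auto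
    show "W <+>\<^bsub>R\<^esub> V \<subseteq> W" using set_add_least assms by blast
  qed (fact assms)
  show "len (subsp k) U V + len (subsp k) V W \<le> len (subsp k) U W"
    using len_add_le assms by blast
qed

lemma kspan_closed:
  assumes "k \<subseteq> carrier R" and "V \<subseteq> carrier R"
  shows "kspan k V \<subseteq> carrier R"
proof
  show "x \<in> carrier R" if "x \<in> kspan k V" for x
    using that assms by induction auto
qed

lemma kspan_subsp:
  assumes "subring k R" and "V \<subseteq> carrier R"
  shows "kspan k V \<in> subsp k"
proof -
  note k = subringE[OF assms(1)]
  note kc = subsetD[OF k(1)] subsetD[OF assms(2)]
  have C: "x \<in> kspan k V \<Longrightarrow> x \<in> carrier R" for x using kspan_closed k(1) assms by blast
  have add: "x \<oplus> y \<in> kspan k V" if "x \<in> kspan k V" "y \<in> kspan k V" for x y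
    using that(2)
  proof induction
    case kspan_zero
    then show ?case using that C by simp
  next
    case (kspan_add y a v)
    have "x \<oplus> (y \<oplus> a \<otimes> v) = (x \<oplus> y) \<oplus> a \<otimes> v"
      using C that(1) kspan_add kc by (simp add: a_assoc)
    then show ?case using kspan.kspan_add kspan_add by metis
  qed
  have smult: "b \<otimes> x \<in> kspan k V" if "x \<in> kspan k V" "b \<in> k" for x b
    using that(1)
  proof induction
    case kspan_zero
    then show ?case using kc that kspan.kspan_zero by simp
  next
    case (kspan_add y a v)
    have "b \<otimes> (y \<oplus> a \<otimes> v) = b \<otimes> y \<oplus> (b \<otimes> a) \<otimes> v"
      using C that(2) kspan_add kc by (simp add: r_distr m_assoc)
    then show ?case using kspan.kspan_add kspan_add k(6) that(2) by metis
  qed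
  show ?thesis
  proof (rule subspI)
    show "\<ominus> x \<in> kspan k V" if "x \<in> kspan k V" for x
    proof -
      have "\<ominus> x = (\<ominus> \<one>) \<otimes> x" using C[OF that] by algebra
      then show ?thesis using smult[OF that] k by metis
    qed
  qed (use add smult C kspan_zero in auto)
qed

lemma kspan_least:
  assumes "Y \<in> subsp k" and "V \<subseteq> Y"
  shows "kspan k V \<subseteq> Y"
proof
  show "x \<in> Y" if "x \<in> kspan k V" for x
    using that subspD[OF assms(1)] assms(2) by induction auto
qed

lemma kspan_superset:
  assumes "\<one> \<in> k" and "V \<subseteq> carrier R"
  shows "V \<subseteq> kspan k V"
proof
  fix v assume v: "v \<in> V"
  have "\<zero> \<oplus> \<one> \<otimes> v \<in> kspan k V" using v assms by (intro kspan_add kspan_zero)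
  then show "v \<in> kspan k V" using v assms by auto
qed

lemma kspan_mono: "V \<subseteq> W \<Longrightarrow> kspan k V \<subseteq> kspan k W"
proof
  show "x \<in> kspan k W" if "V \<subseteq> W" "x \<in> kspan k V" for x
    using that(2,1) by induction (auto intro: kspan_zero kspan_add)
qed

lemma subring_subsp: "subring k R \<Longrightarrow> k \<in> subsp k"
  using subringE by (intro subspI) auto

end

section \<open>Multiples of subspaces in a commutative ring\<close>

context cring
begin

lemma dilate_subsp:
  assumes "V \<in> subsp k" and "x \<in> carrier R" and "k \<subseteq> carrier R"
  shows "dilate x V \<in> subsp k"
proof (rule subspI)
  note D = subspD[OF assms(1)]
  note S = subsetD[OF D(1)] subsetD[OF assms(3)] assms(2)
  show "dilate x V \<subseteq> carrier R" using S by (auto simp: dilate_def)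
  show "\<zero> \<in> dilate x V" using D(2) assms(2) by (auto simp: dilate_def image_iff intro!: bexI[of _ \<zero>])
  show "u \<oplus> v \<in> dilate x V" if uv: "u \<in> dilate x V" "v \<in> dilate x V" for u v
  proof -
    obtain a b where "a \<in> V" "b \<in> V" "u = x \<otimes> a" "v = x \<otimes> b" using uv by (auto simp: dilate_def)
    moreover from this have "u \<oplus> v = x \<otimes> (a \<oplus> b)" using S by (simp add: r_distr)
    ultimately show ?thesis using D(3) by (auto simp: dilate_def)
  qed
  show "\<ominus> u \<in> dilate x V" if u: "u \<in> dilate x V" for u
  proof -
    obtain a where "a \<in> V" "u = x \<otimes> a" using u by (auto simp: dilate_def)
    moreover from this have "\<ominus> u = x \<otimes> (\<ominus> a)" using S by (simp add: r_minus)
    ultimately show ?thesis using D(4) by (auto simp: dilate_def)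
  qed
  show "b \<otimes> u \<in> dilate x V" if u: "u \<in> dilate x V" "b \<in> k" for u b
  proof -
    obtain a where "a \<in> V" "u = x \<otimes> a" using u by (auto simp: dilate_def)
    moreover from this have "b \<otimes> u = x \<otimes> (b \<otimes> a)" using S u(2) by (simp add: m_lcomm)
    ultimately show ?thesis using D(5) u by (auto simp: dilate_def)
  qed
qed

lemma dilate_mult:
  assumes "x \<in> carrier R" and "y \<in> carrier R" and "V \<subseteq> carrier R"
  shows "dilate x (dilate y V) = dilate (x \<otimes> y) V"
  using assms by (force simp: dilate_def m_assoc)

lemma dilate_one: "V \<subseteq> carrier R \<Longrightarrow> dilate \<one> V = V"
  by (force simp: dilate_def)

lemma dilate_mono: "V \<subseteq> W \<Longrightarrow> dilate x V \<subseteq> dilate x W"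
  by (auto simp: dilate_def)

text \<open>Multiplication by \<open>y\<close> induces a surjection of \<open>C / I\<close> onto \<open>(y C + N) / N\<close>.\<close>

lemma len_dilate_add_le:
  assumes C: "C \<in> subsp k" and N: "N \<in> subsp k" and k: "k \<subseteq> carrier R" and y: "y \<in> carrier R"
    and I: "I \<subseteq> C" "dilate y I \<subseteq> N"
  shows "len (subsp k) N (dilate y C <+>\<^bsub>R\<^esub> N) \<le> len (subsp k) I C"
proof (rule len_transfer[where h = "\<lambda>T. {c \<in> C. y \<otimes> c \<in> T}"])
  note S = subsetD[OF subspD(1)[OF C]] subsetD[OF k] y
  fix T assume T: "T \<in> subsp k" "N \<subseteq> T" "T \<subseteq> dilate y C <+>\<^bsub>R\<^esub> N"
  have "{c \<in> C. y \<otimes> c \<in> T} \<in> subsp k"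
  proof (rule subspI)
    show "\<zero> \<in> {c \<in> C. y \<otimes> c \<in> T}" using subspD[OF C] subspD[OF T(1)] y by simp
    show "u \<oplus> v \<in> {c \<in> C. y \<otimes> c \<in> T}" if "u \<in> {c \<in> C. y \<otimes> c \<in> T}" "v \<in> {c \<in> C. y \<otimes> c \<in> T}" for u v
      using that subspD[OF C] subspD[OF T(1)] S by (simp add: r_distr)
    show "\<ominus> u \<in> {c \<in> C. y \<otimes> c \<in> T}" if "u \<in> {c \<in> C. y \<otimes> c \<in> T}" for u
      using that subspD[OF C] subspD[OF T(1)] S by (simp add: r_minus)
    show "a \<otimes> u \<in> {c \<in> C. y \<otimes> c \<in> T}" if "a \<in> k" "u \<in> {c \<in> C. y \<otimes> c \<in> T}" for a u
    proof -
      have "y \<otimes> (a \<otimes> u) = a \<otimes> (y \<otimes> u)" using that S by (simp add: m_lcomm)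
      then show ?thesis using that subspD[OF C] subspD[OF T(1)] by simp
    qed
  qed (use S in auto)
  then show "{c \<in> C. y \<otimes> c \<in> T} \<in> subsp k \<and> I \<subseteq> {c \<in> C. y \<otimes> c \<in> T} \<and> {c \<in> C. y \<otimes> c \<in> T} \<subseteq> C"
    using I T by (auto simp: dilate_def)
next
  note S = subsetD[OF subspD(1)[OF C]] subsetD[OF subspD(1)[OF N]] y
  fix T Y assume T: "T \<in> subsp k" "Y \<in> subsp k" "N \<subseteq> T" "T \<subset> Y" "Y \<subseteq> dilate y C <+>\<^bsub>R\<^esub> N"
  obtain z where z: "z \<in> Y" "z \<notin> T" using T by blast
  then obtain c n where cn: "c \<in> C" "n \<in> N" "z = y \<otimes> c \<oplus> n"
    using subsetD[OF T(5) z(1)] unfolding mem_set_add dilate_def by blast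
  have n: "n \<in> T" "n \<in> Y" using cn T by auto
  have "y \<otimes> c = z \<ominus> n" using cn S by algebra
  then have "y \<otimes> c \<in> Y" using z n subspD(6)[OF T(2)] by metis
  moreover have "y \<otimes> c \<notin> T" using z n cn subspD(3)[OF T(1)] by blast
  ultimately show "{c \<in> C. y \<otimes> c \<in> T} \<subset> {c \<in> C. y \<otimes> c \<in> Y}" using T cn by blast
qed

end

lemma flag_SucE:
  assumes "flag S V (Suc n) Y"
  obtains T where "flag S V n T" and "T \<subset> Y"
  using assms by (cases rule: flag.cases) auto

section \<open>Lengths under multiplication and under extension of scalars\<close>

context field
begin

lemma dilate_inv:
  assumes "x \<in> carrier R" and "x \<noteq> \<zero>" and "V \<subseteq> carrier R"
  shows "dilate (inv x) (dilate x V) = V"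
proof -
  have "inv x \<in> carrier R" "inv x \<otimes> x = \<one>" using assms field_Units by auto
  then show ?thesis using assms by (simp add: dilate_mult dilate_one)
qed

lemma len_dilate_le:
  assumes "x \<in> carrier R" and "x \<noteq> \<zero>" and "V \<subseteq> carrier R" and "W \<subseteq> carrier R" and "k \<subseteq> carrier R"
  shows "len (subsp k) V W \<le> len (subsp k) (dilate x V) (dilate x W)"
proof (rule len_transfer[where h = "dilate x"])
  fix T assume "T \<in> subsp k" "V \<subseteq> T" "T \<subseteq> W"
  then show "dilate x T \<in> subsp k \<and> dilate x V \<subseteq> dilate x T \<and> dilate x T \<subseteq> dilate x W"
    using dilate_subsp dilate_mono assms by metis
next
  fix T Y assume T: "T \<in> subsp k" "Y \<in> subsp k" "V \<subseteq> T" "T \<subset> Y" "Y \<subseteq> W"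
  have "dilate x T \<noteq> dilate x Y"
    using dilate_inv[OF assms(1,2)] subspD(1)[OF T(1)] subspD(1)[OF T(2)] T(4) by (metis psubset_eq)
  then show "dilate x T \<subset> dilate x Y" using dilate_mono[of T Y x] T(4) by blast
qed

lemma len_dilate:
  assumes "x \<in> carrier R" and "x \<noteq> \<zero>" and "V \<subseteq> carrier R" and "W \<subseteq> carrier R" and "k \<subseteq> carrier R"
  shows "len (subsp k) (dilate x V) (dilate x W) = len (subsp k) V W"
proof (rule antisym[OF _ len_dilate_le[OF assms]])
  have "inv x \<in> carrier R" "inv x \<noteq> \<zero>" "\<And>V. V \<subseteq> carrier R \<Longrightarrow> dilate x V \<subseteq> carrier R"
    using assms(1,2) field_Units nonzero_imp_inverse_nonzero by (auto simp: dilate_def)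
  then have "len (subsp k) (dilate x V) (dilate x W)
      \<le> len (subsp k) (dilate (inv x) (dilate x V)) (dilate (inv x) (dilate x W))"
    using assms by (intro len_dilate_le) auto
  then show "len (subsp k) (dilate x V) (dilate x W) \<le> len (subsp k) V W"
    using assms by (simp add: dilate_inv)
qed

text \<open>Each layer between \<open>x^(i+1) V\<close> and \<open>x^i V\<close> is a copy of the
  layer between \<open>x V\<close> and \<open>V\<close>. The induction splits at \<open>x V\<close>,
  so that the lower part is the dilation by \<open>x\<close> of the previous case.\<close>

lemma len_dilate_pow:
  assumes V: "V \<in> subsp k" and x: "x \<in> carrier R" "x \<noteq> \<zero>" and k: "k \<subseteq> carrier R"
    and xV: "dilate x V \<subseteq> V"
  shows "dilate (x [^] n) V \<subseteq> V" (is ?A)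
    and "len (subsp k) (dilate (x [^] n) V) V = enat n * len (subsp k) (dilate x V) V" (is ?B)
proof -
  note Vc = subspD(1)[OF V]
  have "dilate (x [^] n) V \<subseteq> V \<and>
    len (subsp k) (dilate (x [^] n) V) V = enat n * len (subsp k) (dilate x V) V"
  proof (induction n)
    case 0
    then show ?case using Vc by (simp add: dilate_one len_trivial zero_enat_def[symmetric])
  next
    case (Suc n)
    have eq: "dilate (x [^] Suc n) V = dilate x (dilate (x [^] n) V)"
      using x Vc by (simp add: dilate_mult m_comm)
    have sub: "dilate (x [^] Suc n) V \<subseteq> dilate x V" using Suc eq dilate_mono by metis
    have "len (subsp k) (dilate (x [^] Suc n) V) V
      = len (subsp k) (dilate (x [^] Suc n) V) (dilate x V) + len (subsp k) (dilate x V) V"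
      using V x k sub xV by (intro len_add) (auto intro!: dilate_subsp)
    also have "len (subsp k) (dilate (x [^] Suc n) V) (dilate x V)
        = len (subsp k) (dilate (x [^] n) V) V"
      unfolding eq using Suc Vc x k by (intro len_dilate) auto
    also have "\<dots> = enat n * len (subsp k) (dilate x V) V" using Suc by simp
    finally have *: "len (subsp k) (dilate (x [^] Suc n) V) V
      = enat n * len (subsp k) (dilate x V) V + len (subsp k) (dilate x V) V" .
    have "enat (Suc n) = enat n + 1" by (simp add: one_enat_def)
    then have "enat (Suc n) * len (subsp k) (dilate x V) V
      = enat n * len (subsp k) (dilate x V) V + len (subsp k) (dilate x V) V"
      by (simp only: distrib_right mult_1)
    then show ?case using * sub xV by auto
  qed
  then show ?A ?B by auto
qed

text \<open>The length of \<open>V / x V\<close> does not change if \<open>V\<close> is replaced by a subspace of finite index: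
  compare the two chains \<open>x W \<subseteq> x V \<subseteq> V\<close> and \<open>x W \<subseteq> W \<subseteq> V\<close>.\<close>

lemma len_dilate_index:
  assumes V: "V \<in> subsp k" and W: "W \<in> subsp k" and "W \<subseteq> V" and x: "x \<in> carrier R" "x \<noteq> \<zero>"
    and k: "k \<subseteq> carrier R" and xV: "dilate x V \<subseteq> V" and xW: "dilate x W \<subseteq> W"
    and fin: "len (subsp k) W V \<noteq> \<infinity>"
  shows "len (subsp k) (dilate x W) W = len (subsp k) (dilate x V) V"
proof -
  have xs: "dilate x V \<in> subsp k" "dilate x W \<in> subsp k" using V W x k dilate_subsp by auto
  have xm: "dilate x W \<subseteq> dilate x V" using dilate_mono assms by blast
  have "len (subsp k) (dilate x W) W + len (subsp k) W V = len (subsp k) (dilate x W) V"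
    using len_add[OF xs(2) W V xW \<open>W \<subseteq> V\<close> k] by simp
  also have "\<dots> = len (subsp k) (dilate x W) (dilate x V) + len (subsp k) (dilate x V) V"
    using len_add[OF xs(2,1) V xm xV k] .
  also have "len (subsp k) (dilate x W) (dilate x V) = len (subsp k) W V"
    using subspD(1)[OF V] subspD(1)[OF W] x k by (intro len_dilate) auto
  \<comment> \<open>Both chains have the length of \<open>V / W\<close> as a summand; it may be
    cancelled because it is finite.\<close>
  finally show ?thesis using fin by (metis add.commute enat_add_left_cancel)
qed

text \<open>By \<open>len_dilate_add_le\<close> the quotient is bounded by the length of
  \<open>k\<close> over itself. That length is at most 1, because a subspace of \<open>k\<close>
  with a nonzero element contains the inverse times that element, hence everything.\<close>

lemma len_line_le:
  assumes k: "subfield k R" and A: "A \<in> subsp k" and x: "x \<in> carrier R"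
  shows "len (subsp k) A (dilate x k <+>\<^bsub>R\<^esub> A) \<le> 1"
proof -
  have kc: "k \<subseteq> carrier R" and kr: "subring k R" using subfieldE[OF k] by auto
  have "len (subsp k) {\<zero>} k \<le> 1"
  proof (rule len_leI)
    fix n T assume "flag (subsp k) {\<zero>} n T" "T \<subseteq> k"
    show "enat n \<le> 1"
    proof (rule ccontr)
      assume "\<not> ?thesis"
      \<comment> \<open>Two strict steps inside \<open>k\<close> would give a proper subspace
        \<open>Y\<close> with a nonzero element.\<close>
      then have "2 \<le> n" by (simp add: one_enat_def)
      then have "flag (subsp k) {\<zero>} (Suc (Suc 0)) T"
        using flag_decrease[OF \<open>flag (subsp k) {\<zero>} n T\<close>] by (simp add: numeral_2_eq_2)
      then obtain Y where Y: "flag (subsp k) {\<zero>} (Suc 0) Y" "Y \<subset> T" by (rule flag_SucE)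
      from Y(1) obtain Z where Z: "flag (subsp k) {\<zero>} 0 Z" "Z \<subset> Y" by (rule flag_SucE)
      then obtain z where z: "z \<in> Y" "z \<noteq> \<zero>" using flagD(2)[OF Z(1)] by blast
      have zk: "z \<in> k" using z Y(2) \<open>T \<subseteq> k\<close> by blast
      then have iz: "inv z \<in> k" "inv z \<otimes> z = \<one>" using subfield_m_inv[OF k] z by auto
      have "k \<subseteq> Y"
      proof
        fix a assume a: "a \<in> k"
        have "a \<otimes> inv z \<in> k" using a iz subringE(6)[OF kr] by blast
        then have "(a \<otimes> inv z) \<otimes> z \<in> Y" using subspD(5)[OF flagD(1)[OF Y(1)]] z by blast
        moreover have "(a \<otimes> inv z) \<otimes> z = a" using a iz zk kc by (simp add: m_assoc subset_iff)
        ultimately show "a \<in> Y" by simp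
      qed
      then show False using Y(2) \<open>T \<subseteq> k\<close> by blast
    qed
  qed
  moreover have "len (subsp k) A (dilate x k <+>\<^bsub>R\<^esub> A) \<le> len (subsp k) {\<zero>} k"
    using subring_subsp[OF kr] A kc x subringE(2)[OF kr] subspD(2)[OF A]
    by (intro len_dilate_add_le) (auto simp: dilate_def)
  ultimately show ?thesis by (rule order_trans[rotated])
qed

lemma line_props:
  assumes k: "subring k R" and A: "A \<in> subsp k" and x: "x \<in> carrier R"
  shows "dilate x k <+>\<^bsub>R\<^esub> A \<in> subsp k" and "A \<subseteq> dilate x k <+>\<^bsub>R\<^esub> A" and "x \<in> dilate x k <+>\<^bsub>R\<^esub> A"
proof -
  have kc: "k \<subseteq> carrier R" using subringE(1)[OF k] .
  have d: "dilate x k \<in> subsp k" using dilate_subsp[OF subring_subsp[OF k] x kc] .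
  show "dilate x k <+>\<^bsub>R\<^esub> A \<in> subsp k" "A \<subseteq> dilate x k <+>\<^bsub>R\<^esub> A"
    using subsp_add[OF d A kc] set_add_upper[OF d A] by auto
  have "x \<in> dilate x k" using x subringE(3)[OF k] by (auto simp: dilate_def image_iff intro!: bexI[of _ \<one>])
  then show "x \<in> dilate x k <+>\<^bsub>R\<^esub> A" using set_add_upper[OF d A] by auto
qed

lemma line_least:
  assumes "Y \<in> subsp k" and "x \<in> Y" and "A \<subseteq> Y" and k: "k \<subseteq> carrier R" and "x \<in> carrier R"
  shows "dilate x k <+>\<^bsub>R\<^esub> A \<subseteq> Y"
proof -
  have "x \<otimes> a \<in> Y" if "a \<in> k" for a
    using that assms subspD(5)[OF assms(1) that assms(2)] m_comm[of x a] by auto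
  then have "dilate x k \<subseteq> Y" by (auto simp: dilate_def)
  then show ?thesis using assms(3) by (rule set_add_least[OF assms(1)])
qed

text \<open>The last assumption expresses that \<open>V\<close> is generated by \<open>A\<close> and
  \<open>G\<close>, in a form that survives when \<open>A\<close> is enlarged. The elements of
  \<open>G\<close> are adjoined one at a time, each raising the length by at most 1.\<close>

lemma len_le_card:
  assumes k: "subfield k R" and "finite G" and "A \<in> subsp k" and V: "V \<in> subsp k" and "A \<subseteq> V" and "G \<subseteq> V"
    and "\<And>Y. Y \<in> subsp k \<Longrightarrow> A \<union> G \<subseteq> Y \<Longrightarrow> V \<subseteq> Y"
  shows "len (subsp k) A V \<le> enat (card G)"
  using assms(2,3,5-7)
proof (induction G arbitrary: A)
  case empty
  then have "V \<subseteq> A" by auto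
  then show ?case by (simp add: len_trivial)
next
  case (insert g G)
  have kr: "subring k R" and kc: "k \<subseteq> carrier R" using subfieldE[OF k] by auto
  have g: "g \<in> carrier R" using insert.prems(3) subspD(1)[OF V] by blast
  let ?A = "dilate g k <+>\<^bsub>R\<^esub> A"
  note A = line_props[OF kr insert.prems(1) g]
  have AV: "?A \<subseteq> V" using line_least[OF V _ _ kc g] insert.prems(2,3) by simp
  have "len (subsp k) ?A V \<le> enat (card G)"
  proof (rule insert.IH[OF A(1) AV])
    show "G \<subseteq> V" using insert.prems(3) by simp
    show "V \<subseteq> Y" if "Y \<in> subsp k" "?A \<union> G \<subseteq> Y" for Y
      using that A by (intro insert.prems(4)) auto
  qed
  moreover have "len (subsp k) A ?A \<le> 1" using len_line_le[OF k insert.prems(1) g] .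
  ultimately have "len (subsp k) A V \<le> 1 + enat (card G)"
    using len_add[OF insert.prems(1) A(1) V A(2) AV kc] by (simp add: add_mono)
  then show ?case using insert by (simp add: one_enat_def)
qed

text \<open>Vectors that generate \<open>V\<close> modulo \<open>W\<close> over \<open>k\<close>
  also generate the spans over \<open>k'\<close>. The induction adjoins one vector \<open>x\<close>
  of \<open>V\<close> outside \<open>W\<close>: this uses up at least 1 of the length over
  \<open>k\<close>, and at most 1 of the length over \<open>k'\<close>.\<close>

lemma len_kspan_le_aux:
  assumes k: "subfield k R" "subfield k' R" "k \<subseteq> k'" and V: "V \<in> subsp k"
  shows "W \<in> subsp k \<Longrightarrow> W \<subseteq> V \<Longrightarrow> len (subsp k) W V \<le> enat n \<Longrightarrow>
    len (subsp k') (kspan k' W) (kspan k' V) \<le> enat n"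
proof (induction n arbitrary: W)
  case (0 W)
  then have "W = V" using len_pos[OF 0(1) V] by (auto simp: zero_enat_def[symmetric])
  then show ?case by (simp add: len_trivial)
next
  case (Suc n)
  have kr: "subring k R" "k \<subseteq> carrier R" "subring k' R" "k' \<subseteq> carrier R" using subfieldE k by auto
  note Vc = subspD(1)[OF V] and Wc = subspD(1)[OF Suc.prems(1)]
  show ?case
  proof (cases "W = V")
    case False
    then obtain x where x: "x \<in> V" "x \<notin> W" using Suc.prems by blast
    then have xc: "x \<in> carrier R" using Vc by blast
    let ?W = "dilate x k <+>\<^bsub>R\<^esub> W"
    note W = line_props[OF kr(1) Suc.prems(1) xc]
    have WV: "?W \<subseteq> V" using line_least[OF V x(1) Suc.prems(2) kr(2) xc] .
    have "1 \<le> len (subsp k) W ?W" using len_pos[OF Suc.prems(1) W(1)] W x by blast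
    moreover have "len (subsp k) W V = len (subsp k) W ?W + len (subsp k) ?W V"
      using len_add[OF Suc.prems(1) W(1) V W(2) WV kr(2)] .
    ultimately have "1 + len (subsp k) ?W V \<le> enat (Suc n)"
      using Suc.prems(3) add_right_mono order_trans by metis
    then have "len (subsp k) ?W V \<le> enat n" by (cases "len (subsp k) ?W V") (auto simp: one_enat_def)
    then have IH: "len (subsp k') (kspan k' ?W) (kspan k' V) \<le> enat n"
      using Suc.IH W(1) WV by blast
    let ?S = "kspan k' W" and ?S' = "dilate x k' <+>\<^bsub>R\<^esub> kspan k' W"
    have S: "?S \<in> subsp k'" "kspan k' V \<in> subsp k'" using kspan_subsp kr Wc Vc by auto
    note L = line_props[OF kr(3) S(1) xc]
    have "?W \<subseteq> ?S'"
    proof (rule line_least[OF _ L(3) _ kr(2) xc])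
      show "?S' \<in> subsp k" using L(1) subsp_antimono k(3) by blast
      show "W \<subseteq> ?S'" using kspan_superset[of k' W] subringE(3)[OF kr(3)] Wc L(2) by blast
    qed
    then have sub: "kspan k' ?W \<subseteq> ?S'" by (rule kspan_least[OF L(1)])
    have SV: "?S' \<subseteq> kspan k' V"
      using kspan_superset[of k' V] subringE(3)[OF kr(3)] Vc x kspan_mono Suc.prems(2)
      by (intro line_least[OF S(2) _ _ kr(4) xc]) auto
    have "len (subsp k') ?S (kspan k' V) = len (subsp k') ?S ?S' + len (subsp k') ?S' (kspan k' V)"
      using len_add[OF S(1) L(1) S(2) L(2) SV kr(4)] .
    also have "\<dots> \<le> 1 + enat n"
      using len_line_le[OF k(2) S(1) xc] len_mono[OF sub order_refl order_refl] IH
      by (meson add_mono order_trans)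
    finally show ?thesis by (simp add: one_enat_def)
  qed (simp add: len_trivial)
qed

lemma len_kspan_le:
  assumes "subfield k R" and "subfield k' R" and "k \<subseteq> k'" and "V \<in> subsp k" and "W \<in> subsp k"
    and "W \<subseteq> V"
  shows "len (subsp k') (kspan k' W) (kspan k' V) \<le> len (subsp k) W V"
  using len_kspan_le_aux[OF assms] by (cases "len (subsp k) W V") auto

text \<open>The assumption \<open>disj\<close> is linear disjointness: a subspace \<open>T\<close>
  of \<open>V\<close> is recovered as the part of its span that lies in \<open>V\<close>. So forming
  spans is strictly monotone.\<close>

lemma len_le_kspan:
  assumes "subring k' R" and V: "V \<in> subsp k"
    and disj: "\<And>T x. T \<in> subsp k \<Longrightarrow> T \<subseteq> V \<Longrightarrow> x \<in> V \<Longrightarrow> x \<in> kspan k' T \<Longrightarrow> x \<in> T"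
  shows "len (subsp k) W V \<le> len (subsp k') (kspan k' W) (kspan k' V)"
proof (rule len_transfer[where h = "kspan k'"])
  note Vc = subspD(1)[OF V]
  show "kspan k' T \<in> subsp k' \<and> kspan k' W \<subseteq> kspan k' T \<and> kspan k' T \<subseteq> kspan k' V"
    if "T \<in> subsp k" "W \<subseteq> T" "T \<subseteq> V" for T
    using that kspan_subsp[OF assms(1)] kspan_mono Vc by (metis subset_trans)
  show "kspan k' T \<subset> kspan k' Y"
    if T: "T \<in> subsp k" "Y \<in> subsp k" "W \<subseteq> T" "T \<subset> Y" "Y \<subseteq> V" for T Y
  proof -
    obtain y where y: "y \<in> Y" "y \<notin> T" using T by blast
    then have "y \<notin> kspan k' T" using disj[OF T(1), of y] T by blast
    moreover have "y \<in> kspan k' Y"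
      using kspan_superset[of k' Y] subringE(3)[OF assms(1)] y T(5) Vc by blast
    ultimately show ?thesis using kspan_mono[of T Y k'] T by blast
  qed
qed

end

section \<open>Lengths under injective semilinear maps\<close>

context ring_hom_ring
begin

lemma image_subsp:
  assumes V: "V \<in> R.subsp k" and k: "k \<subseteq> carrier R"
  shows "h ` V \<in> S.subsp (h ` k)"
proof (rule S.subspI)
  note D = R.subspD[OF V]
  note C = subsetD[OF D(1)] subsetD[OF k]
  show "h ` V \<subseteq> carrier S" using C by auto
  show "\<zero>\<^bsub>S\<^esub> \<in> h ` V" using D(2) by (metis hom_zero imageI)
  show "u \<oplus>\<^bsub>S\<^esub> v \<in> h ` V" if uv: "u \<in> h ` V" "v \<in> h ` V" for u v
  proof -
    obtain a b where "a \<in> V" "b \<in> V" "u = h a" "v = h b" using uv by auto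
    moreover from this have "u \<oplus>\<^bsub>S\<^esub> v = h (a \<oplus> b)" using C by simp
    ultimately show ?thesis using D(3) by auto
  qed
  show "\<ominus>\<^bsub>S\<^esub> u \<in> h ` V" if u: "u \<in> h ` V" for u
  proof -
    obtain a where "a \<in> V" "u = h a" using u by auto
    moreover from this have "\<ominus>\<^bsub>S\<^esub> u = h (\<ominus> a)" using C by simp
    ultimately show ?thesis using D(4) by auto
  qed
  show "b \<otimes>\<^bsub>S\<^esub> u \<in> h ` V" if u: "u \<in> h ` V" "b \<in> h ` k" for u b
  proof -
    obtain a c where "a \<in> V" "u = h a" "c \<in> k" "b = h c" using u by auto
    moreover from this have "b \<otimes>\<^bsub>S\<^esub> u = h (c \<otimes> a)" using C by simp
    ultimately show ?thesis using D(5) by auto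
  qed
qed

lemma vimage_subsp:
  assumes V: "V \<in> R.subsp k" and k: "k \<subseteq> carrier R" and T: "T \<in> S.subsp (h ` k)"
  shows "{v \<in> V. h v \<in> T} \<in> R.subsp k"
  using R.subspD[OF V] S.subspD[OF T] k by (intro R.subspI) (auto simp: subset_iff)

text \<open>The scalars are moved together with the vectors. This covers the Frobenius, which is not
  linear over a fixed field, as well as the embedding \<open>nu\<close> of fields of
  fractions.\<close>

lemma len_image:
  assumes inj: "inj_on h (carrier R)" and V: "V \<in> R.subsp k" and k: "k \<subseteq> carrier R" and W: "W \<subseteq> V"
  shows "len (S.subsp (h ` k)) (h ` W) (h ` V) = len (R.subsp k) W V"
proof (rule antisym)
  note Vc = R.subspD(1)[OF V]
  show "len (R.subsp k) W V \<le> len (S.subsp (h ` k)) (h ` W) (h ` V)"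
  proof (rule len_transfer[where h = "image h"])
    show "h ` T \<subset> h ` Y" if "T \<in> R.subsp k" "Y \<in> R.subsp k" "T \<subset> Y" "Y \<subseteq> V" for T Y
      using that Vc inj by (meson image_strict_mono inj_on_subset subset_trans)
  qed (use image_subsp k in auto)
  show "len (S.subsp (h ` k)) (h ` W) (h ` V) \<le> len (R.subsp k) W V"
  proof (rule len_transfer[where h = "\<lambda>T. {v \<in> V. h v \<in> T}"])
    show "{v \<in> V. h v \<in> T} \<in> R.subsp k \<and> W \<subseteq> {v \<in> V. h v \<in> T} \<and> {v \<in> V. h v \<in> T} \<subseteq> V"
      if "T \<in> S.subsp (h ` k)" "h ` W \<subseteq> T" "T \<subseteq> h ` V" for T
      using vimage_subsp[OF V k that(1)] that W by auto
    show "{v \<in> V. h v \<in> T} \<subset> {v \<in> V. h v \<in> Y}"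
      if T: "T \<in> S.subsp (h ` k)" "Y \<in> S.subsp (h ` k)" "T \<subset> Y" "Y \<subseteq> h ` V" for T Y
      using T(3,4) by blast
  qed
qed

end

section \<open>The inequality inside a fixed field\<close>

context cring
begin

text \<open>For \<open>C\<close> a ring this is the module \<open>U + C y_1 + ... + C y_n\<close>.
  The recursion over the list lets lengths be estimated one generator at a time.\<close>

fun comb :: "'a set \<Rightarrow> 'a set \<Rightarrow> 'a list \<Rightarrow> 'a set" where
  "comb C U [] = U"
| "comb C U (y # ys) = dilate y C <+>\<^bsub>R\<^esub> comb C U ys"

lemma comb_subsp:
  assumes "C \<in> subsp k" and "U \<in> subsp k" and "k \<subseteq> carrier R" and "set ys \<subseteq> carrier R"
  shows "comb C U ys \<in> subsp k" and "U \<subseteq> comb C U ys"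
proof -
  have "comb C U ys \<in> subsp k \<and> U \<subseteq> comb C U ys"
    using assms(4)
  proof (induction ys)
    case (Cons y ys)
    have "dilate y C \<in> subsp k" using Cons.prems dilate_subsp[OF assms(1) _ assms(3)] by simp
    moreover have "comb C U ys \<in> subsp k" and *: "U \<subseteq> comb C U ys" using Cons by auto
    ultimately have "comb C U (y # ys) \<in> subsp k" "comb C U ys \<subseteq> comb C U (y # ys)"
      using subsp_add[OF _ _ assms(3)] set_add_upper(2) unfolding comb.simps by blast+
    then show ?case using * by (blast intro: subset_trans)
  qed (use assms in auto)
  then show "comb C U ys \<in> subsp k" and "U \<subseteq> comb C U ys" by auto
qed

lemma comb_mono:
  assumes "C \<subseteq> C'" and "U \<subseteq> U'"
  shows "comb C U ys \<subseteq> comb C' U' ys"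
proof (induction ys)
  case (Cons y ys)
  then show ?case using set_add_monotone[OF dilate_mono[OF assms(1)] Cons] by simp
qed (use assms in simp)

lemma comb_least:
  assumes Y: "Y \<in> subsp C" and C: "C \<subseteq> carrier R" and "U \<subseteq> Y" and "set ys \<subseteq> Y"
  shows "comb C U ys \<subseteq> Y"
  using assms(4)
proof (induction ys)
  case (Cons y ys)
  then have y: "y \<in> Y" by simp
  have "y \<otimes> c \<in> Y" if c: "c \<in> C" for c
    using subspD(5)[OF Y c y] m_comm[of y c] subsetD[OF C c] subsetD[OF subspD(1)[OF Y] y] by simp
  then have "dilate y C \<subseteq> Y" by (auto simp: dilate_def)
  then show ?case using Cons set_add_least[OF Y] by simp
qed (use assms in simp)

lemma comb_generator:
  assumes C: "subring C R" and "U \<in> subsp C" and "set ys \<subseteq> carrier R" and "y \<in> set ys"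
  shows "y \<in> comb C U ys"
  using assms(3,4)
proof (induction ys)
  case (Cons z ys)
  note Cc = subringE(1)[OF C]
  have d: "dilate z C \<in> subsp C" "comb C U ys \<in> subsp C"
    using Cons.prems dilate_subsp[OF subring_subsp[OF C]] comb_subsp[OF subring_subsp[OF C] assms(2)] Cc by auto
  have "z \<in> dilate z C"
    using Cons.prems subringE(3)[OF C] by (auto simp: dilate_def image_iff intro!: bexI[of _ \<one>])
  then show ?case using set_add_upper[OF d] Cons by auto
qed simp

lemma dilate_set_add:
  assumes "V \<subseteq> carrier R" and "W \<subseteq> carrier R" and "c \<in> carrier R"
  shows "dilate c (V <+>\<^bsub>R\<^esub> W) \<subseteq> dilate c V <+>\<^bsub>R\<^esub> dilate c W"
proof
  fix x assume "x \<in> dilate c (V <+>\<^bsub>R\<^esub> W)"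
  then obtain v w where "v \<in> V" "w \<in> W" "x = c \<otimes> (v \<oplus> w)"
    by (auto simp: dilate_def mem_set_add)
  moreover from this have "x = c \<otimes> v \<oplus> c \<otimes> w" using assms by (auto simp: r_distr subset_iff)
  ultimately show "x \<in> dilate c V <+>\<^bsub>R\<^esub> dilate c W" unfolding dilate_def mem_set_add by blast
qed

text \<open>The summands \<open>y C\<close> absorb the factor \<open>c\<close> because
  \<open>c\<close> belongs to \<open>C\<close>; only \<open>U\<close> shrinks. Iteration therefore
  improves the error term while keeping the generators.\<close>

lemma dilate_comb:
  assumes C: "subring C R" and U: "U \<in> subsp C" and "set ys \<subseteq> carrier R" and c: "c \<in> C"
  shows "dilate c (comb C U ys) \<subseteq> comb C (dilate c U) ys"
  using assms(3)
proof (induction ys)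
  case (Cons y ys)
  note Cc = subringE(1)[OF C] and CC = subring_subsp[OF C]
  have y: "y \<in> carrier R" and c': "c \<in> carrier R" using Cons c Cc by auto
  have "dilate c (dilate y C) \<subseteq> dilate y C"
  proof -
    have "c \<otimes> (y \<otimes> a) = y \<otimes> (c \<otimes> a)" if "a \<in> C" for a using y c' that Cc by (simp add: m_lcomm subset_iff)
    then show ?thesis using subringE(6)[OF C c] by (auto simp: dilate_def)
  qed
  moreover have "dilate c (comb C U (y # ys)) \<subseteq> dilate c (dilate y C) <+>\<^bsub>R\<^esub> dilate c (comb C U ys)"
    using subspD(1)[OF dilate_subsp[OF CC y Cc]] subspD(1)[OF comb_subsp(1)[OF CC U Cc]] Cons.prems c'
    by (simp add: dilate_set_add)
  moreover have "dilate c (comb C U ys) \<subseteq> comb C (dilate c U) ys" using Cons by simp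
  ultimately have "dilate c (comb C U (y # ys)) \<subseteq> dilate y C <+>\<^bsub>R\<^esub> comb C (dilate c U) ys"
    by (meson order_trans set_add_monotone)
  then show ?case by simp
qed simp

text \<open>Since \<open>y I\<close> is contained in \<open>U\<close>, multiplication by
  \<open>y\<close> factors through \<open>C / I\<close>, so each generator contributes at most the
  length of \<open>C / I\<close>.\<close>

lemma len_comb_le:
  assumes C: "C \<in> subsp k" and U: "U \<in> subsp k" and k: "k \<subseteq> carrier R" and "set ys \<subseteq> carrier R"
    and I: "I \<subseteq> C" and "\<And>y. y \<in> set ys \<Longrightarrow> dilate y I \<subseteq> U"
  shows "len (subsp k) U (comb C U ys) \<le> enat (length ys) * len (subsp k) I C"
  using assms(4,6)
proof (induction ys)
  case Nil
  then show ?case by (simp add: len_trivial zero_enat_def[symmetric])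
next
  case (Cons y ys)
  let ?N = "comb C U ys" and ?N' = "comb C U (y # ys)"
  have N: "?N \<in> subsp k" "U \<subseteq> ?N" using comb_subsp[OF C U k] Cons.prems by auto
  have N': "?N' \<in> subsp k" using comb_subsp[OF C U k Cons.prems(1)] by auto
  have y: "y \<in> carrier R" "dilate y I \<subseteq> ?N" using Cons.prems N by auto
  have sub: "?N \<subseteq> ?N'" using set_add_upper(2)[OF dilate_subsp[OF C y(1) k] N(1)] by simp
  have "len (subsp k) U ?N' = len (subsp k) U ?N + len (subsp k) ?N ?N'"
    by (rule len_add[OF U N(1) N' N(2) sub k])
  also have "\<dots> \<le> enat (length ys) * len (subsp k) I C + len (subsp k) I C"
    using Cons len_dilate_add_le[OF C N(1) k y(1) I y(2)] by (intro add_mono) auto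
  also have "\<dots> = (enat (length ys) + 1) * len (subsp k) I C" by (simp only: distrib_right mult_1)
  finally show ?case by (simp add: one_enat_def)
qed

lemma kspan_dilate:
  assumes k: "subring k R" and V: "V \<subseteq> carrier R" and x: "x \<in> carrier R"
  shows "kspan k (dilate x V) = dilate x (kspan k V)"
proof
  note kc = subringE(1)[OF k]
  have "V \<subseteq> kspan k V" using kspan_superset V subringE(3)[OF k] by blast
  then show "kspan k (dilate x V) \<subseteq> dilate x (kspan k V)"
    using dilate_subsp[OF kspan_subsp[OF k V] x kc] dilate_mono by (intro kspan_least) auto
  have "x \<otimes> y \<in> kspan k (dilate x V)" if "y \<in> kspan k V" for y
    using that
  proof induction
    case kspan_zero
    then show ?case using x kspan.kspan_zero by simp
  next
    case (kspan_add y a v)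
    have "y \<in> carrier R" "a \<in> carrier R" "v \<in> carrier R"
      using kspan_add kspan_closed[OF kc V] V kc by auto
    then have "x \<otimes> (y \<oplus> a \<otimes> v) = x \<otimes> y \<oplus> a \<otimes> (x \<otimes> v)"
      using x by (simp add: r_distr m_lcomm)
    then show ?case using kspan_add kspan.kspan_add[of _ k "dilate x V" a "x \<otimes> v"] by (simp add: dilate_def)
  qed
  then show "dilate x (kspan k V) \<subseteq> kspan k (dilate x V)" by (auto simp: dilate_def)
qed

lemma dilate_unit:
  assumes C: "subring C R" and "y \<in> carrier R" and "r \<in> C" and "r' \<in> C" and "r \<otimes> r' = \<one>"
  shows "dilate (y \<otimes> r) C = dilate y C"
proof -
  note Cc = subsetD[OF subringE(1)[OF C]]
  have e: "y \<otimes> r \<otimes> c = y \<otimes> (r \<otimes> c)" "y \<otimes> c = y \<otimes> r \<otimes> (r' \<otimes> c)" if "c \<in> C" for c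
  proof -
    have c: "y \<in> carrier R" "r \<in> carrier R" "r' \<in> carrier R" "c \<in> carrier R" using assms Cc that by auto
    then show "y \<otimes> r \<otimes> c = y \<otimes> (r \<otimes> c)" by (simp add: m_assoc)
    have "y \<otimes> r \<otimes> (r' \<otimes> c) = y \<otimes> (r \<otimes> r') \<otimes> c" using c by (simp add: m_assoc)
    then show "y \<otimes> c = y \<otimes> r \<otimes> (r' \<otimes> c)" using c assms(5) by simp
  qed
  have m: "r \<otimes> c \<in> C" "r' \<otimes> c \<in> C" if "c \<in> C" for c
    using subringE(6)[OF C] assms(3,4) that by auto
  show ?thesis
  proof
    show "dilate (y \<otimes> r) C \<subseteq> dilate y C"
      unfolding dilate_def
    proof (rule image_subsetI)
      show "y \<otimes> r \<otimes> c \<in> (\<otimes>) y ` C" if "c \<in> C" for c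
        using m(1)[OF that] e(1)[OF that] by (rule rev_image_eqI)
    qed
    show "dilate y C \<subseteq> dilate (y \<otimes> r) C"
      unfolding dilate_def
    proof (rule image_subsetI)
      show "y \<otimes> c \<in> (\<otimes>) (y \<otimes> r) ` C" if "c \<in> C" for c
        using m(2)[OF that] e(2)[OF that] by (rule rev_image_eqI)
    qed
  qed
qed

end

lemma (in domain) pow_nonzero:
  "x \<in> carrier R \<Longrightarrow> x \<noteq> \<zero> \<Longrightarrow> x [^] (n::nat) \<noteq> \<zero>"
  by (induction n) (auto dest: integral)

text \<open>In the application \<open>F\<close> is the field of fractions of $R \otimes_K K^{1/p^2}$, \<open>A\<close> is the image of \<open>R\<close>,
  \<open>k0\<close> and \<open>k1\<close> are those of \<open>K\<close> and $K^{1/p}$, \<open>O1\<close> is that of \<open>R(1)\<close>, and \<open>O2\<close> consists of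
  the \<open>p\<close>-th powers of the elements of \<open>R(2)\<close>.\<close>

locale frobenius_tower = field F for F (structure) +
  fixes p M :: nat and A k0 k1 O1 O2 :: "'a set" and t :: 'a
  assumes p_pos: "0 < p"
    and frobenius: "ring_hom_ring F F (\<lambda>x. x [^] p)"
    and A: "subring A F"
    and t: "t \<in> A" "t \<noteq> \<zero>" "\<And>x. x \<in> A \<Longrightarrow> t \<otimes> x \<noteq> \<one>"
    and factor: "\<And>x. x \<in> A \<Longrightarrow> x \<noteq> \<zero> \<Longrightarrow> \<exists>n u w. u \<in> A \<and> w \<in> A \<and> u \<otimes> w = \<one> \<and> x = u \<otimes> t [^] (n::nat)"
    and k0: "subfield k0 F" "k0 = (\<lambda>x. x [^] p) ` k1" "k0 \<subseteq> k1" "k0 \<subseteq> A"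
    and k1: "subfield k1 F" "k1 \<subseteq> O1"
    and O1: "subring O1 F" "A \<subseteq> O1" "(\<lambda>x. x [^] p) ` O1 \<subseteq> A"
    and division: "\<And>c s x. c \<in> (\<lambda>x. x [^] p) ` O1 \<Longrightarrow> s \<in> (\<lambda>x. x [^] p) ` O1 \<Longrightarrow> s \<noteq> \<zero> \<Longrightarrow>
        x \<in> A \<Longrightarrow> c = s \<otimes> x \<Longrightarrow> x \<in> (\<lambda>x. x [^] p) ` O1"
    and disjoint: "\<And>T x. T \<in> subsp k0 \<Longrightarrow> T \<subseteq> A \<Longrightarrow> x \<in> A \<Longrightarrow> x \<in> kspan k1 T \<Longrightarrow> x \<in> T"
    and O2: "O2 \<in> subsp k1" "(\<lambda>x. x [^] p) ` O1 \<subseteq> O2" "O2 \<subseteq> O1" "dilate (t [^] p) O2 \<subseteq> O2"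
      "dilate ((t [^] p) [^] M) O2 \<subseteq> kspan k1 ((\<lambda>x. x [^] p) ` O1)"
    and finite_residue: "len (subsp k0) (dilate t A) A \<noteq> \<infinity>"
begin

definition "\<phi> x = x [^] p"
definition "P = \<phi> ` O1"
definition "q = t [^] p"
definition "d = len (subsp k0) (dilate t A) A"

text \<open>The \<open>t\<close>-adic valuation is kept as a relation, so that exponents can be read
  off from \<open>factor\<close> directly.\<close>

definition val :: "'a \<Rightarrow> nat \<Rightarrow> bool" where
  "val x n \<longleftrightarrow> (\<exists>u w. u \<in> A \<and> w \<in> A \<and> u \<otimes> w = \<one> \<and> x = u \<otimes> t [^] n)"

lemma phi_hom: "ring_hom_ring F F \<phi>"
  using frobenius by (simp add: \<phi>_def[abs_def])

lemma closed:
  shows "A \<subseteq> carrier F" "O1 \<subseteq> carrier F" "O2 \<subseteq> carrier F" "k0 \<subseteq> carrier F" "k1 \<subseteq> carrier F"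
    "P \<subseteq> carrier F" "t \<in> carrier F" "q \<in> carrier F" "q \<noteq> \<zero>"
proof -
  show *: "A \<subseteq> carrier F" "O1 \<subseteq> carrier F" "k0 \<subseteq> carrier F" "k1 \<subseteq> carrier F"
    using subringE(1)[OF A] subringE(1)[OF O1(1)] subfieldE(3)[OF k0(1)] subfieldE(3)[OF k1(1)] by auto
  show "O2 \<subseteq> carrier F" using O2 * by blast
  show "P \<subseteq> carrier F" using * by (auto simp: P_def \<phi>_def)
  show "t \<in> carrier F" using t * by auto
  then show "q \<in> carrier F" "q \<noteq> \<zero>" using t nat_pow_closed by (auto simp: q_def pow_nonzero)
qed

lemma P: "subring P F" "P \<subseteq> A" "k0 \<subseteq> P" "q \<in> P" "P \<subseteq> O2"
    "\<And>c s x. c \<in> P \<Longrightarrow> s \<in> P \<Longrightarrow> s \<noteq> \<zero> \<Longrightarrow> x \<in> A \<Longrightarrow> c = s \<otimes> x \<Longrightarrow> x \<in> P"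
proof -
  have \<phi>: "\<phi> = (\<lambda>x. x [^] p)" by (auto simp: \<phi>_def)
  show "subring P F" unfolding P_def by (rule ring_hom_ring.img_is_subring[OF phi_hom O1(1)])
  show "P \<subseteq> A" using O1(3) by (simp add: P_def \<phi>)
  show "k0 \<subseteq> P" unfolding P_def \<phi> using k0(2) k1(2) by (metis image_mono)
  show "q \<in> P" unfolding P_def \<phi> q_def using t(1) O1(2) by blast
  show "P \<subseteq> O2" using O2(2) by (simp add: P_def \<phi>)
  show "x \<in> P" if "c \<in> P" "s \<in> P" "s \<noteq> \<zero>" "x \<in> A" "c = s \<otimes> x" for c s x
    using division that unfolding P_def \<phi> by blast
qed

lemma valI: "u \<in> A \<Longrightarrow> w \<in> A \<Longrightarrow> u \<otimes> w = \<one> \<Longrightarrow> val (u \<otimes> t [^] n) n"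
  unfolding val_def by blast

lemma valD:
  assumes "val x n"
  shows "x \<in> A" and "x \<noteq> \<zero>" and "n = 0 \<Longrightarrow> \<exists>w\<in>A. x \<otimes> w = \<one>"
proof -
  obtain u w where u: "u \<in> A" "w \<in> A" "u \<otimes> w = \<one>" "x = u \<otimes> t [^] n" using assms by (auto simp: val_def)
  have c: "u \<in> carrier F" "w \<in> carrier F" "t \<in> carrier F" using u(1,2) closed by auto
  have "t [^] m \<in> A" for m :: nat using t(1) subringE(3,6)[OF A] by (induction m) auto
  then show "x \<in> A" using u subringE(6)[OF A] by simp
  have "u \<noteq> \<zero>" using u c by auto
  then show "x \<noteq> \<zero>" using u c t(2) by (simp add: integral_iff pow_nonzero)
  show "\<exists>w\<in>A. x \<otimes> w = \<one>" if "n = 0" using u c that by auto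
qed

lemma val_pow: "val x n \<Longrightarrow> val (x [^] m) (m * n)"
proof (induction m)
  case 0
  then show ?case using subringE(3)[OF A] closed by (auto simp: val_def intro!: exI[of _ \<one>])
next
  case (Suc m)
  then obtain u w u' w' where u: "u \<in> A" "w \<in> A" "u \<otimes> w = \<one>" "x = u \<otimes> t [^] n"
    and u': "u' \<in> A" "w' \<in> A" "u' \<otimes> w' = \<one>" "x [^] m = u' \<otimes> t [^] (m * n)" by (auto simp: val_def)
  have c: "u \<in> carrier F" "w \<in> carrier F" "u' \<in> carrier F" "w' \<in> carrier F" "t \<in> carrier F"
    using u u' closed by auto
  have "(u' \<otimes> u) \<otimes> (w' \<otimes> w) = (u' \<otimes> w') \<otimes> (u \<otimes> w)" using c by (simp add: m_ac)
  then have "(u' \<otimes> u) \<otimes> (w' \<otimes> w) = \<one>" using u u' by simp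
  moreover have "u' \<otimes> u \<in> A" "w' \<otimes> w \<in> A" using u u' subringE(6)[OF A] by auto
  ultimately have "val ((u' \<otimes> u) \<otimes> t [^] (Suc m * n)) (Suc m * n)" by (intro valI)
  moreover have "x [^] Suc m = (u' \<otimes> u) \<otimes> (t [^] (m * n) \<otimes> t [^] n)"
    using u(4) u'(4) c by (simp add: m_ac)
  moreover have "t [^] (m * n) \<otimes> t [^] n = t [^] (Suc m * n)"
    using c by (simp add: nat_pow_mult add.commute)
  ultimately show ?case by simp
qed

lemma val_t: "val t 1"
  using subringE(3)[OF A] closed unfolding val_def by (intro exI[of _ \<one>]) auto

lemma val_divide:
  assumes "val c n" and "val s m" and "m \<le> n"
  obtains x where "val x (n - m)" and "c = s \<otimes> x"
proof -
  obtain u w u' w' where u: "u \<in> A" "w \<in> A" "u \<otimes> w = \<one>" "c = u \<otimes> t [^] n"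
    and u': "u' \<in> A" "w' \<in> A" "u' \<otimes> w' = \<one>" "s = u' \<otimes> t [^] m" using assms by (auto simp: val_def)
  have c: "u \<in> carrier F" "w \<in> carrier F" "u' \<in> carrier F" "w' \<in> carrier F" "t \<in> carrier F"
    using u u' closed by auto
  have "(u \<otimes> w') \<otimes> (w \<otimes> u') = (u \<otimes> w) \<otimes> (u' \<otimes> w')" using c by (simp add: m_ac)
  then have "(u \<otimes> w') \<otimes> (w \<otimes> u') = \<one>" using u u' by simp
  moreover have "u \<otimes> w' \<in> A" "w \<otimes> u' \<in> A" using u u' subringE(6)[OF A] by auto
  ultimately have 1: "val (u \<otimes> w' \<otimes> t [^] (n - m)) (n - m)" by (intro valI)
  have "s \<otimes> (u \<otimes> w' \<otimes> t [^] (n - m)) = (u' \<otimes> w') \<otimes> (u \<otimes> (t [^] m \<otimes> t [^] (n - m)))"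
    unfolding u'(4) using c by (simp add: m_ac)
  also have "\<dots> = c" using c u u' assms(3) by (simp add: nat_pow_mult)
  finally show thesis using that 1 by metis
qed

lemma val_exists: "x \<in> A \<Longrightarrow> x \<noteq> \<zero> \<Longrightarrow> \<exists>n. val x n"
  using factor[of x] unfolding val_def by metis

lemma val_not_unit:
  assumes "val x n" and "n \<noteq> 0" and "w \<in> A"
  shows "x \<otimes> w \<noteq> \<one>"
proof
  assume x: "x \<otimes> w = \<one>"
  obtain y where y: "val y (n - 1)" "x = t \<otimes> y" using val_divide[OF assms(1) val_t] assms(2) by auto
  have "y \<otimes> w \<in> A" using valD(1)[OF y(1)] assms subringE(6)[OF A] by auto
  then show False using t(3)[of "y \<otimes> w"] x y(2) valD(1)[OF y(1)] assms closed by (auto simp: m_assoc subset_iff)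
qed

text \<open>\<open>P\<close> is a discrete valuation ring: the uniformizer \<open>s\<close> is an element of \<open>P\<close> of least positive
  valuation \<open>v\<close> in \<open>A\<close>, and \<open>v\<close> divides \<open>p\<close>, the valuation of \<open>q\<close>.\<close>

lemma uniformizer:
  obtains s v m where "s \<in> P" and "s \<noteq> \<zero>" and "0 < v" and "0 < m" and "m * v = p"
    and "dilate s A = dilate (t [^] v) A" and "dilate q P = dilate (s [^] m) P"
    and "dilate q A = dilate (s [^] m) A"
    and "\<And>c. c \<in> P \<Longrightarrow> c \<notin> dilate s P \<Longrightarrow> \<exists>w\<in>P. c \<otimes> w = \<one>"
    and "dilate s P \<noteq> P"
proof -
  let ?Q = "\<lambda>v. 0 < v \<and> (\<exists>s\<in>P. val s v)"
  have vq: "val q p" using val_pow[OF val_t, of p] by (simp add: q_def)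
  then have "?Q p" using P(4) p_pos by auto
  define v where "v = (LEAST v. ?Q v)"
  have v: "?Q v" "v \<le> p" using LeastI[of ?Q, OF \<open>?Q p\<close>] Least_le[of ?Q, OF \<open>?Q p\<close>] by (auto simp: v_def)
  have small: "n = 0" if "c \<in> P" "val c n" "n < v" for c n
    using that not_less_Least[of n ?Q] by (auto simp: v_def)
  obtain s where s: "s \<in> P" "val s v" using v by auto
  have s0: "s \<noteq> \<zero>" "s \<in> A" "s \<in> carrier F" using valD[OF s(2)] closed by auto
  \<comment> \<open>The inverse exists in \<open>A\<close>, and \<open>division\<close> applied to
    \<open>\<one> = c \<otimes> w\<close> puts it into \<open>P\<close>.\<close>
  have inP: "\<exists>w\<in>P. c \<otimes> w = \<one>" if c: "c \<in> P" "val c 0" for c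
  proof -
    obtain w where w: "w \<in> A" "c \<otimes> w = \<one>" using valD(3)[OF c(2)] by auto
    then have "w \<in> P" using P(6)[OF subringE(3)[OF P(1)] c(1) valD(2)[OF c(2)], of w] by simp
    then show ?thesis using w by auto
  qed
  define m where "m = p div v"
  have m0: "0 < m" using v by (simp add: m_def div_greater_zero_iff)
  have mv: "m * v \<le> p" by (simp add: m_def)
  have vs: "val (s [^] m) (m * v)" by (rule val_pow[OF s(2)])
  obtain r where r: "val r (p - m * v)" "q = s [^] m \<otimes> r" using val_divide[OF vq vs mv] .
  have sm: "s [^] m \<in> P" using s(1) subringE(3,6)[OF P(1)] by (induction m) auto
  have rP: "r \<in> P" using P(6)[OF P(4) sm valD(2)[OF vs] valD(1)[OF r(1)] r(2)] .
  \<comment> \<open>The quotient \<open>r\<close> of \<open>q\<close> by \<open>s^m\<close> lies in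
    \<open>P\<close> and has the remainder of \<open>p\<close> modulo \<open>v\<close> as its
    valuation. Minimality of \<open>v\<close> forces this remainder to be 0, so \<open>v\<close>
    divides \<open>p\<close> and \<open>r\<close> is a unit of \<open>P\<close>.\<close>
  have "p - m * v < v" using v by (simp add: m_def minus_div_mult_eq_mod)
  then have r0: "p - m * v = 0" using small[OF rP r(1)] by simp
  obtain w where w: "w \<in> P" "r \<otimes> w = \<one>" using inP[OF rP] r r0 by auto
  show thesis
  proof (rule that[OF s(1) s0(1) _ m0])
    show "0 < v" "m * v = p" using v r0 mv by auto
    obtain u u' where u: "u \<in> A" "u' \<in> A" "u \<otimes> u' = \<one>" "s = u \<otimes> t [^] v"
      using s(2) by (auto simp: val_def)
    have "s = t [^] v \<otimes> u" using u closed by (simp add: m_comm subset_iff)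
    then show "dilate s A = dilate (t [^] v) A"
      using dilate_unit[OF A _ u(1-3), of "t [^] v"] closed by simp
    show "dilate q P = dilate (s [^] m) P"
      using dilate_unit[OF P(1) _ rP w] s0 r(2) by simp
    show "dilate q A = dilate (s [^] m) A"
      using dilate_unit[OF A, of "s [^] m" r w] s0 r(2) w rP P(2) by auto
    show "\<exists>w\<in>P. c \<otimes> w = \<one>" if c: "c \<in> P" "c \<notin> dilate s P" for c
    proof -
      have "\<zero> = s \<otimes> \<zero>" using s0 by simp
      then have "c \<noteq> \<zero>" using c(2) subringE(2)[OF P(1)] by (auto simp: dilate_def)
      then obtain n where n: "val c n" using val_exists c P(2) by blast
      \<comment> \<open>Otherwise \<open>c\<close> divided by \<open>s\<close> would be in
        \<open>A\<close>, hence in \<open>P\<close> by \<open>division\<close>, and \<open>c\<close>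
        would belong to \<open>s P\<close>.\<close>
      have "\<not> v \<le> n"
      proof
        assume "v \<le> n"
        then obtain x where x: "val x (n - v)" "c = s \<otimes> x" using val_divide[OF n s(2)] by blast
        then have "x \<in> P" using P(6)[OF c(1) s(1) s0(1)] valD(1) by blast
        then show False using x c by (auto simp: dilate_def)
      qed
      then show ?thesis using small[OF c(1) n] inP[OF c(1)] n by auto
    qed
    show "dilate s P \<noteq> P"
    proof
      assume "dilate s P = P"
      then have "\<one> \<in> dilate s P" using subringE(3)[OF P(1)] by simp
      then obtain x where "x \<in> P" "s \<otimes> x = \<one>" by (auto simp: dilate_def)
      then show False using val_not_unit[OF s(2)] v P(2) by blast
    qed
  qed
qed

end

section \<open>Counting lengths along the tower\<close>

context frobenius_tower
begin

abbreviation "len0 \<equiv> len (subsp k0)"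
abbreviation "len1 \<equiv> len (subsp k1)"
abbreviation "C \<equiv> kspan k1 P"
abbreviation "D \<equiv> kspan k1 A"

lemma subrings: "subring k0 F" "subring k1 F"
  using subfieldE(1)[OF k0(1)] subfieldE(1)[OF k1(1)] by auto

lemma subsp0: "A \<in> subsp k0" "P \<in> subsp k0"
  using subsp_antimono[OF k0(4)] subring_subsp[OF A] subsp_antimono[OF P(3)] subring_subsp[OF P(1)]
  by auto

lemma subsp1: "O1 \<in> subsp k1" "C \<in> subsp k1" "D \<in> subsp k1"
proof -
  show "O1 \<in> subsp k1" using subsp_antimono[OF k1(2)] subring_subsp[OF O1(1)] by auto
  show "C \<in> subsp k1" "D \<in> subsp k1" using kspan_subsp[OF subrings(2)] closed by auto
qed

lemma spans: "C \<subseteq> O2" "D \<subseteq> O1" "C \<subseteq> D" "P \<subseteq> C" "A \<subseteq> D"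
proof -
  show "C \<subseteq> O2" using kspan_least[OF O2(1) P(5)] .
  show "D \<subseteq> O1" using kspan_least[OF subsp1(1) O1(2)] .
  show "C \<subseteq> D" using kspan_mono[OF P(2)] .
  show "P \<subseteq> C" "A \<subseteq> D" using kspan_superset subringE(3)[OF subrings(2)] closed by auto
qed

lemma dilate_closed:
  "x \<in> O1 \<Longrightarrow> dilate x O1 \<subseteq> O1" "x \<in> A \<Longrightarrow> dilate x A \<subseteq> A" "x \<in> P \<Longrightarrow> dilate x P \<subseteq> P"
  "x \<in> A \<Longrightarrow> dilate x D \<subseteq> D" "x \<in> P \<Longrightarrow> dilate x C \<subseteq> C"
proof -
  show O: "dilate x O1 \<subseteq> O1" if "x \<in> O1" using subringE(6)[OF O1(1) that] by (auto simp: dilate_def)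
  show A': "dilate x A \<subseteq> A" if "x \<in> A" using subringE(6)[OF A that] by (auto simp: dilate_def)
  show P': "dilate x P \<subseteq> P" if "x \<in> P" using subringE(6)[OF P(1) that] by (auto simp: dilate_def)
  show "dilate x D \<subseteq> D" if "x \<in> A"
    using kspan_dilate[OF subrings(2) closed(1) subsetD[OF closed(1) that]]
      kspan_mono[OF A'[OF that], of k1] by simp
  show "dilate x C \<subseteq> C" if "x \<in> P"
    using kspan_dilate[OF subrings(2) closed(6) subsetD[OF closed(6) that]]
      kspan_mono[OF P'[OF that], of k1] by simp
qed

text \<open>Three comparisons are combined. \<open>D\<close> has finite index in \<open>O1\<close>,
  so both have the same length modulo \<open>t\<close>. By linear disjointness the length of
  \<open>D / t D\<close> over \<open>k1\<close> is that of \<open>A / t A\<close> over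
  \<open>k0\<close>. Finally the Frobenius carries \<open>O1\<close>, \<open>t\<close> and
  \<open>k1\<close> to \<open>P\<close>, \<open>q\<close> and \<open>k0\<close>.\<close>

lemma dilate_t_O1:
  assumes fin: "len1 D O1 \<noteq> \<infinity>"
  shows "len1 (dilate t O1) O1 = d" and "len0 (dilate q P) P = d"
proof -
  have t1: "t \<in> O1" using t O1 by auto
  have eq: "len1 (dilate t D) D = len1 (dilate t O1) O1"
    using len_dilate_index[OF subsp1(1,3) spans(2) closed(7) t(2) closed(5)] dilate_closed(1)[OF t1]
      dilate_closed(4)[OF t(1)] fin by simp
  have "len1 (dilate t D) D = d"
  proof (rule antisym)
    have sub: "dilate t A \<in> subsp k0" "dilate t A \<subseteq> A"
      using dilate_subsp subsp0 closed dilate_closed(2)[OF t(1)] by auto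
    note k = kspan_dilate[OF subrings(2) closed(1) closed(7)]
    show "len1 (dilate t D) D \<le> d"
      using len_kspan_le[OF k0(1) k1(1) k0(3) subsp0(1) sub] unfolding d_def k .
    show "d \<le> len1 (dilate t D) D"
      using len_le_kspan[OF subrings(2) subsp0(1) disjoint, of "dilate t A"] unfolding d_def k by simp
  qed
  then show 1: "len1 (dilate t O1) O1 = d" using eq by simp
  interpret phi: ring_hom_ring F F \<phi> by (rule phi_hom)
  have inj: "inj_on \<phi> (carrier F)"
  proof (rule inj_onI)
    fix x y assume xy: "x \<in> carrier F" "y \<in> carrier F" "\<phi> x = \<phi> y"
    then have "\<phi> (x \<ominus> y) = \<zero>" by (simp add: a_minus_def r_neg)
    then have "x \<ominus> y = \<zero>" using pow_nonzero[of "x \<ominus> y" p] xy by (auto simp: \<phi>_def)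
    then show "x = y" using xy by simp
  qed
  have "\<phi> ` dilate t O1 = dilate q P"
  proof -
    have "\<phi> (t \<otimes> x) = q \<otimes> \<phi> x" if "x \<in> O1" for x
      using that closed by (simp add: q_def \<phi>_def nat_pow_distrib subset_iff)
    then show ?thesis by (simp add: dilate_def P_def image_image)
  qed
  moreover have "\<phi> ` k1 = k0" using k0(2) by (simp add: \<phi>_def)
  ultimately show "len0 (dilate q P) P = d"
    using phi.len_image[OF inj subsp1(1) closed(5) dilate_closed(1)[OF t1]] 1 by (simp add: P_def)
qed

text \<open>Modulo \<open>N\<close> the vector \<open>y\<close> is killed by \<open>s P\<close> and
  by nothing else in \<open>P\<close>, as every other element of \<open>P\<close> is a unit. So
  \<open>y P + N\<close> over \<open>N\<close> is at least as long as \<open>P / s P\<close>; the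
  map on subspaces is \<open>T\<close> to \<open>y T + N\<close>.\<close>

lemma comb_step:
  assumes s: "s \<in> P" and inP: "\<And>c. c \<in> P \<Longrightarrow> c \<notin> dilate s P \<Longrightarrow> \<exists>w\<in>P. c \<otimes> w = \<one>"
    and N: "N \<in> subsp P" and y: "y \<in> carrier F" "y \<notin> N" and sN: "dilate s (dilate y P) \<subseteq> N"
  shows "len0 (dilate s P) P \<le> len0 N (dilate y P <+>\<^bsub>F\<^esub> N)"
proof (rule len_transfer[where h = "\<lambda>T. dilate y T <+>\<^bsub>F\<^esub> N"])
  have N0: "N \<in> subsp k0" using N subsp_antimono[OF P(3)] by blast
  show "dilate y T <+>\<^bsub>F\<^esub> N \<in> subsp k0 \<and> N \<subseteq> dilate y T <+>\<^bsub>F\<^esub> N \<and>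
      dilate y T <+>\<^bsub>F\<^esub> N \<subseteq> dilate y P <+>\<^bsub>F\<^esub> N" if T: "T \<in> subsp k0" "T \<subseteq> P" for T
  proof -
    have d: "dilate y T \<in> subsp k0" by (rule dilate_subsp[OF T(1) y(1) closed(4)])
    show ?thesis using subsp_add[OF d N0 closed(4)] set_add_upper(2)[OF d N0]
        set_add_monotone[OF dilate_mono[OF T(2)] order_refl] by blast
  qed
  show "dilate y T <+>\<^bsub>F\<^esub> N \<subset> dilate y Y <+>\<^bsub>F\<^esub> N"
    if T: "T \<in> subsp k0" "Y \<in> subsp k0" "dilate s P \<subseteq> T" "T \<subset> Y" "Y \<subseteq> P" for T Y
  proof -
    obtain z where z: "z \<in> Y" "z \<notin> T" using T by blast
    have zP: "z \<in> P" using z T by blast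
    have "y \<otimes> z \<notin> dilate y T <+>\<^bsub>F\<^esub> N"
    proof
      assume "y \<otimes> z \<in> dilate y T <+>\<^bsub>F\<^esub> N"
      then obtain x n where xn: "x \<in> T" "n \<in> N" "y \<otimes> z = y \<otimes> x \<oplus> n"
        by (auto simp: mem_set_add dilate_def)
      have xP: "x \<in> P" using xn T by blast
      have c: "x \<in> carrier F" "z \<in> carrier F" "n \<in> carrier F"
        using xP zP closed xn subspD(1)[OF N] by auto
      have "y \<otimes> (z \<ominus> x) = y \<otimes> z \<ominus> y \<otimes> x" using c y by algebra
      also have "\<dots> = n" unfolding xn(3) using c y by algebra
      finally have yc: "y \<otimes> (z \<ominus> x) \<in> N" using xn by simp
      have cP: "z \<ominus> x \<in> P" using subspD(6)[OF subsp0(2) zP xP] .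
      \<comment> \<open>Either \<open>z - x\<close> lies in \<open>s P\<close>, hence in
        \<open>T\<close>, and then \<open>z\<close> does too, or it is a unit of \<open>P\<close>
        and \<open>y\<close> would be in \<open>N\<close>.\<close>
      show False
      proof (cases "z \<ominus> x \<in> dilate s P")
        case True
        then have "z \<ominus> x \<in> T" using T by blast
        then have "(z \<ominus> x) \<oplus> x \<in> T" using subspD(3)[OF T(1)] xn by blast
        moreover have "(z \<ominus> x) \<oplus> x = z" using c by algebra
        ultimately show False using z by simp
      next
        case False
        then obtain w where w: "w \<in> P" "(z \<ominus> x) \<otimes> w = \<one>" using inP[OF cP] by blast
        have wc: "w \<in> carrier F" using w closed by auto
        have "w \<otimes> (y \<otimes> (z \<ominus> x)) \<in> N" using subspD(5)[OF N w(1) yc] .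
        moreover have "w \<otimes> (y \<otimes> (z \<ominus> x)) = y \<otimes> ((z \<ominus> x) \<otimes> w)" using wc c y by (simp add: m_ac)
        ultimately show False using w y by simp
      qed
    qed
    moreover have "y \<otimes> z \<in> dilate y Y <+>\<^bsub>F\<^esub> N"
      using set_add_upper(1)[OF dilate_subsp[OF T(2) y(1) closed(4)] N0] z by (auto simp: dilate_def)
    moreover have "dilate y T <+>\<^bsub>F\<^esub> N \<subseteq> dilate y Y <+>\<^bsub>F\<^esub> N"
      using T by (intro set_add_monotone dilate_mono) auto
    ultimately show ?thesis by blast
  qed
qed

text \<open>This is the iteration behind Nakayama's lemma: multiplying the given inclusion by
  \<open>c^j\<close> yields \<open>c^j A\<close> inside \<open>c^(j+1) A\<close> plus the same
  generated module, which is substituted into the previous stage.\<close>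

lemma comb_pow:
  assumes c: "c \<in> P" and ys: "set ys \<subseteq> A" and sub: "A \<subseteq> comb P (dilate c A) ys"
  shows "A \<subseteq> comb P (dilate (c [^] (j::nat)) A) ys"
proof (induction j)
  case 0
  have "P \<in> subsp P" "A \<in> subsp P" "set ys \<subseteq> carrier F"
    using subring_subsp[OF P(1)] subsp_antimono[OF P(2)] subring_subsp[OF A] ys closed by auto
  from comb_subsp(2)[OF this(1,2) closed(6) this(3)] show ?case using closed by (simp add: dilate_one)
next
  case (Suc j)
  have PP: "P \<in> subsp P" "A \<in> subsp P"
    using subring_subsp[OF P(1)] subsp_antimono[OF P(2)] subring_subsp[OF A] by auto
  have cc: "c \<in> carrier F" using c closed by blast
  have cA: "dilate c A \<in> subsp P" using dilate_subsp[OF PP(2) cc closed(6)] .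
  have cj: "c [^] j \<in> P" using c subringE(3,6)[OF P(1)] by (induction j) auto
  have yc: "set ys \<subseteq> carrier F" using ys closed by blast
  have U: "dilate (c [^] Suc j) A \<in> subsp P"
    using dilate_subsp[OF PP(2) _ closed(6)] cc nat_pow_closed by blast
  have "dilate (c [^] j) A \<subseteq> dilate (c [^] j) (comb P (dilate c A) ys)"
    using dilate_mono sub by blast
  also have "\<dots> \<subseteq> comb P (dilate (c [^] j) (dilate c A)) ys"
    using dilate_comb[OF P(1) cA yc cj] .
  also have "dilate (c [^] j) (dilate c A) = dilate (c [^] Suc j) A"
    using cc closed by (simp add: dilate_mult)
  finally have "comb P (dilate (c [^] j) A) ys \<subseteq> comb P (dilate (c [^] Suc j) A) ys"
    using comb_generator[OF P(1) U yc]
    by (intro comb_least[OF comb_subsp(1)[OF PP(1) U closed(6) yc] closed(6)]) blast+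
  with Suc show ?case by blast
qed

text \<open>The length of \<open>A / s A\<close> is \<open>v d\<close> and that of \<open>P / s P\<close> is \<open>d / m\<close>, so \<open>A / s A\<close> has dimension
  at most \<open>v m = p\<close> over the residue field of \<open>P\<close>.\<close>

lemma generators:
  assumes fin: "len1 D O1 \<noteq> \<infinity>"
  obtains ys where "length ys \<le> p" and "set ys \<subseteq> A" and "A \<subseteq> comb P (dilate q A) ys"
proof -
  obtain s v m where s: "s \<in> P" "s \<noteq> \<zero>" and vm: "0 < v" "0 < m" "m * v = p"
    and sA: "dilate s A = dilate (t [^] v) A" and qP: "dilate q P = dilate (s [^] m) P"
    and qA: "dilate q A = dilate (s [^] m) A"
    and inP: "\<And>c. c \<in> P \<Longrightarrow> c \<notin> dilate s P \<Longrightarrow> \<exists>w\<in>P. c \<otimes> w = \<one>"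
    and sP: "dilate s P \<noteq> P"
    by (rule uniformizer, rule that)
  have sc: "s \<in> carrier F" "s \<in> A" using s P(2) closed by auto
  define d1 where "d1 = len0 (dilate s P) P"
  have "len0 (dilate s A) A = enat v * d"
    unfolding sA d_def using len_dilate_pow[OF subsp0(1) closed(7) t(2) closed(4) dilate_closed(2)[OF t(1)]] by simp
  \<comment> \<open>By Frobenius \<open>P / q P\<close> has length \<open>d\<close>. Up to a unit of
    \<open>P\<close> the element \<open>q\<close> is \<open>s^m\<close>, so there are
    \<open>m\<close> layers, each as long as \<open>P / s P\<close>.\<close>
  moreover have md: "d = enat m * d1"
    using dilate_t_O1(2)[OF fin] len_dilate_pow(2)[OF subsp0(2) sc(1) s(2) closed(4) dilate_closed(3)[OF s(1)], of m]
    by (simp add: qP d1_def)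
  ultimately have "len0 (dilate s A) A = (enat v * enat m) * d1" by (simp only: mult.assoc)
  also have "enat v * enat m = enat p" using vm(3) by (simp add: mult.commute)
  finally have lenA: "len0 (dilate s A) A = enat p * d1" .
  \<comment> \<open>Later \<open>(p + 1) d1 \<le> p d1\<close> has to be absurd, which needs
    \<open>d1\<close> to be nonzero and finite. The latter is inherited from
    \<open>d\<close>.\<close>
  have d1: "1 \<le> d1" "d1 \<noteq> \<infinity>"
  proof -
    have "dilate s P \<subset> P" using dilate_closed(3)[OF s(1)] sP by blast
    then show "1 \<le> d1" unfolding d1_def using subsp0(2) sc closed by (intro len_pos dilate_subsp) auto
    show "d1 \<noteq> \<infinity>"
    proof
      assume "d1 = \<infinity>"
      then have "d = \<infinity>" using md vm(2) by (simp add: times_enat_def zero_enat_def)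
      then show False using finite_residue by (simp add: d_def)
    qed
  qed
  have PP: "P \<in> subsp P" "A \<in> subsp P" "A \<in> subsp A"
    using subring_subsp[OF P(1)] subsp_antimono[OF P(2)] subring_subsp[OF A] by auto
  have sAP: "dilate s A \<in> subsp P" using dilate_subsp[OF PP(2) sc(1) closed(6)] .
  note kP = subsp_antimono[OF P(3)]
  have combP: "comb P (dilate s A) ys \<in> subsp P" "dilate s A \<subseteq> comb P (dilate s A) ys"
      "comb P (dilate s A) ys \<subseteq> A" if "set ys \<subseteq> A" for ys
  proof -
    have c: "set ys \<subseteq> carrier F" using that closed by blast
    show "comb P (dilate s A) ys \<in> subsp P" "dilate s A \<subseteq> comb P (dilate s A) ys"
      using comb_subsp[OF PP(1) sAP closed(6) c] by auto
    show "comb P (dilate s A) ys \<subseteq> A"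
      using comb_least[OF PP(2) closed(6) dilate_closed(2)[OF sc(2)] that] .
  qed
  \<comment> \<open>Greedy choice of generators: as long as the module is not all of
    \<open>A\<close>, a further element of \<open>A\<close> adds at least \<open>d1\<close> to the
    length. The first alternative records that the process has stopped.\<close>
  have "(\<exists>ys. set ys \<subseteq> A \<and> length ys < n \<and> A \<subseteq> comb P (dilate s A) ys) \<or>
    (\<exists>ys. set ys \<subseteq> A \<and> length ys = n \<and> enat n * d1 \<le> len0 (dilate s A) (comb P (dilate s A) ys))" for n
  proof (induction n)
    case 0
    show ?case by (auto simp: zero_enat_def[symmetric] intro!: exI[of _ "[]"])
  next
    case (Suc n)
    show ?case
    proof (cases "\<exists>ys. set ys \<subseteq> A \<and> length ys < Suc n \<and> A \<subseteq> comb P (dilate s A) ys")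
      case False
      then obtain ys where ys: "set ys \<subseteq> A" "length ys = n"
        "enat n * d1 \<le> len0 (dilate s A) (comb P (dilate s A) ys)"
        using Suc by (metis less_Suc_eq)
      let ?N = "comb P (dilate s A) ys"
      have "\<not> A \<subseteq> ?N" using False ys by (metis lessI)
      then obtain y where y: "y \<in> A" "y \<notin> ?N" by blast
      have yc: "y \<in> carrier F" using y closed by blast
      let ?N' = "comb P (dilate s A) (y # ys)"
      note N = combP[OF ys(1)]
      have ys': "set (y # ys) \<subseteq> A" using ys y by simp
      \<comment> \<open>As \<open>y\<close> is in \<open>A\<close>, multiplying by \<open>s\<close>
        sends \<open>y P\<close> into \<open>s A\<close>, the bottom of the interval; this is what
        makes \<open>comb_step\<close> applicable.\<close>
      have "dilate s (dilate y P) \<subseteq> dilate s A"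
        using subringE(6)[OF A] y P(2) by (intro dilate_mono) (auto simp: dilate_def)
      then have "d1 \<le> len0 ?N ?N'"
        unfolding d1_def comb.simps using N yc y by (intro comb_step[OF s(1) inP]) auto
      moreover have "?N \<subseteq> ?N'"
        using set_add_upper(2)[OF dilate_subsp[OF PP(1) yc closed(6)] N(1)] by simp
      then have "len0 (dilate s A) ?N' = len0 (dilate s A) ?N + len0 ?N ?N'"
        using kP sAP N(1,2) combP(1)[OF ys'] closed(4) by (intro len_add) blast+
      ultimately have "enat n * d1 + d1 \<le> len0 (dilate s A) ?N'"
        using ys(3) by (simp add: add_mono)
      moreover have "enat (Suc n) = enat n + 1" by (simp add: one_enat_def)
      then have "enat (Suc n) * d1 = enat n * d1 + d1" by (simp only: distrib_right mult_1)
      ultimately show ?thesis using ys' ys(2) by (metis length_Cons)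
    qed blast
  qed
  \<comment> \<open>At \<open>p + 1\<close> the process must have stopped, because the whole
    interval has length \<open>p d1\<close> only.\<close>
  from this[of "Suc p"] obtain ys where ys: "set ys \<subseteq> A" "length ys \<le> p" "A \<subseteq> comb P (dilate s A) ys"
  proof
    assume "\<exists>ys. set ys \<subseteq> A \<and> length ys = Suc p \<and>
      enat (Suc p) * d1 \<le> len0 (dilate s A) (comb P (dilate s A) ys)"
    then obtain ys where ys: "set ys \<subseteq> A"
      "enat (Suc p) * d1 \<le> len0 (dilate s A) (comb P (dilate s A) ys)" by blast
    have "len0 (dilate s A) (comb P (dilate s A) ys) \<le> len0 (dilate s A) A"
      using combP(3)[OF ys(1)] by (intro len_mono) auto
    then have "enat (Suc p) * d1 \<le> enat p * d1" using ys(2) lenA by simp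
    then have False using d1 by (cases d1) (auto simp: one_enat_def)
    then show thesis ..
  qed (auto simp: less_Suc_eq_le)
  \<comment> \<open>The generators were found modulo \<open>s\<close>; passing to \<open>s^m\<close>
    gives them modulo \<open>q\<close>, which generates the same multiple of
    \<open>A\<close>.\<close>
  have "A \<subseteq> comb P (dilate (s [^] m) A) ys" using comb_pow[OF s(1) ys(1,3)] .
  then show thesis using that ys qA by metis
qed

text \<open>Finiteness of the first genus enters through \<open>dilate_t_O1\<close> and
  \<open>generators\<close>; an infinite one makes the inequality trivial.\<close>

lemma frobenius_genus_aux:
  assumes fin: "len1 D O1 \<noteq> \<infinity>"
  shows "enat p * len1 C O2 \<le> len1 D O1"
proof -
  define I where "I = dilate (q [^] M) O2"
  define U where "U = dilate (q [^] M) O1"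
  define a2 where "a2 = len1 (dilate q O2) O2"
  have qM: "q [^] i \<in> carrier F" "q [^] i \<noteq> \<zero>" "q [^] i \<in> P" for i :: nat
  proof -
    show "q [^] i \<in> carrier F" "q [^] i \<noteq> \<zero>" using closed pow_nonzero by auto
    show "q [^] i \<in> P" using P(4) subringE(3,6)[OF P(1)] by (induction i) auto
  qed
  have IC: "I \<subseteq> C" using O2(5) by (simp add: I_def q_def P_def \<phi>_def)
  have I1: "I \<in> subsp k1" "I \<subseteq> O2"
    using dilate_subsp[OF O2(1) _ closed(5)] qM IC spans(1) by (auto simp: I_def)
  have U1: "U \<in> subsp k1" "U \<subseteq> O1"
    using dilate_subsp[OF subsp1(1) _ closed(5)] qM dilate_closed(1) P(2) O1(2)
    unfolding U_def by blast+
  have qO2: "dilate q O2 \<subseteq> O2" using O2(4) by (simp add: q_def)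
  have d: "d \<noteq> \<infinity>" using finite_residue by (simp add: d_def)
  have qC: "len1 (dilate q C) C \<le> d"
  proof -
    have "dilate q P \<in> subsp k0" using dilate_subsp subsp0 closed by auto
    then have "len1 (kspan k1 (dilate q P)) C \<le> len0 (dilate q P) P"
      using len_kspan_le[OF k0(1) k1(1) k0(3) subsp0(2)] dilate_closed(3)[OF P(4)] by blast
    then show ?thesis using kspan_dilate[OF subrings(2) closed(6,8)] dilate_t_O1(2)[OF fin] by simp
  qed
  \<comment> \<open>A first, crude bound shows only that \<open>a2\<close> is finite. Multiplied by
    \<open>q^M\<close>, the layer from \<open>q O2\<close> to \<open>O2\<close> becomes part of the
    interval from \<open>q^(M+1) C\<close> to \<open>C\<close>, of length at most
    \<open>(M+1) d\<close>.\<close>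
  have "a2 = len1 (dilate (q [^] M) (dilate q O2)) I"
    unfolding a2_def I_def using len_dilate[OF qM(1,2) _ closed(3,5)] qO2 closed(3) by simp
  also have "dilate (q [^] M) (dilate q O2) = dilate (q [^] Suc M) O2"
    using closed qM by (simp add: dilate_mult)
  also have "len1 (dilate (q [^] Suc M) O2) I \<le> len1 (dilate (q [^] Suc M) C) C"
    using dilate_mono[OF spans(1)] IC by (intro len_mono) auto
  also have "\<dots> = enat (Suc M) * len1 (dilate q C) C"
    using len_dilate_pow(2)[OF subsp1(2) closed(8,9,5) dilate_closed(5)[OF P(4)]] .
  also have "\<dots> \<le> enat (Suc M) * d" by (rule mult_left_mono[OF qC]) simp
  finally have "a2 \<noteq> \<infinity>" using d by (cases a2) (auto simp: times_enat_def)
  have IO2: "len1 I O2 = enat M * a2"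
    unfolding I_def a2_def using len_dilate_pow(2)[OF O2(1) closed(8,9,5) qO2] .
  have split2: "len1 I O2 = len1 I C + len1 C O2"
    using len_add[OF I1(1) subsp1(2) O2(1) IC spans(1) closed(5)] .
  have finI: "len1 I O2 \<noteq> \<infinity>" using IO2 \<open>a2 \<noteq> \<infinity>\<close> by (auto simp: times_enat_def split: enat.splits)
  then have finC: "len1 C O2 \<noteq> \<infinity>" "len1 I C \<noteq> \<infinity>"
    using split2 by (metis plus_eq_infty_iff_enat)+
  \<comment> \<open>The crude bound made the index of \<open>C\<close> in \<open>O2\<close> finite.
    Now \<open>O2\<close> and \<open>C\<close> have the same length modulo \<open>q\<close>, and
    that of \<open>C\<close> is at most \<open>d\<close>.\<close>
  have "a2 \<le> d"
    using len_dilate_index[OF O2(1) subsp1(2) spans(1) closed(8,9,5) qO2 dilate_closed(5)[OF P(4)] finC(1)]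
      qC by (simp add: a2_def)
  have UO1: "len1 U O1 = enat (p * M) * d"
  proof -
    have t1: "t \<in> O1" using t O1 by auto
    \<comment> \<open>This identity makes \<open>O1 / U\<close> consist of \<open>p M\<close> layers
      of length \<open>d\<close>, against \<open>M\<close> layers of \<open>O2 / I\<close>.\<close>
    have "q [^] M = t [^] (p * M)" using closed by (simp add: q_def nat_pow_pow)
    then show ?thesis unfolding U_def dilate_t_O1(1)[OF fin, symmetric]
      using len_dilate_pow(2)[OF subsp1(1) closed(7) t(2) closed(5) dilate_closed(1)[OF t1]] by simp
  qed
  obtain ys where ys: "length ys \<le> p" "set ys \<subseteq> A" "A \<subseteq> comb P (dilate q A) ys"
    using generators[OF fin] by blast
  have yc: "set ys \<subseteq> carrier F" using ys closed by blast
  let ?W = "comb C U ys"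
  have W: "?W \<in> subsp k1" "U \<subseteq> ?W" using comb_subsp[OF subsp1(2) U1(1) closed(5) yc] by auto
  \<comment> \<open>The generators modulo \<open>q\<close> also work modulo \<open>q^M\<close>.
    Enlarging \<open>P\<close> to \<open>C\<close> and \<open>A\<close> to \<open>O1\<close> then
    places \<open>A\<close>, and with it \<open>D\<close>, in \<open>?W\<close>.\<close>
  have "A \<subseteq> comb P (dilate (q [^] M) A) ys" using comb_pow[OF P(4) ys(2,3)] .
  also have "\<dots> \<subseteq> ?W" using comb_mono[OF spans(4) dilate_mono[OF O1(2)]] by (simp add: U_def)
  finally have DW: "D \<subseteq> ?W" using kspan_least[OF W(1)] by blast
  have WO: "?W \<subseteq> O1"
  proof (rule comb_least[of O1 C U ys])
    show "O1 \<in> subsp C" using subsp_antimono[of C O1] subring_subsp[OF O1(1)] spans O2(3) by blast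
    show "C \<subseteq> carrier F" using spans(1) closed(3) by blast
    show "set ys \<subseteq> O1" using ys O1 by blast
  qed (fact U1)
  have "len1 U ?W \<le> enat (length ys) * len1 I C"
  proof (rule len_comb_le[OF subsp1(2) U1(1) closed(5) yc IC])
    fix y assume "y \<in> set ys"
    then have y: "y \<in> O1" using ys O1 by blast
    \<comment> \<open>Since \<open>y\<close> and \<open>O2\<close> lie in the ring
      \<open>O1\<close>, multiplying \<open>I\<close> by \<open>y\<close> lands in
      \<open>q^M O1\<close>, which is \<open>U\<close>.\<close>
    have "y \<otimes> (q [^] M \<otimes> x) = q [^] M \<otimes> (y \<otimes> x)" if "x \<in> O1" for x
      using that y qM closed(2) by (simp add: m_lcomm subset_iff)
    moreover have "y \<otimes> x \<in> O1" if "x \<in> O1" for x using subringE(6)[OF O1(1) y that] .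
    ultimately show "dilate y I \<subseteq> U" using O2(3) unfolding I_def U_def dilate_def by fastforce
  qed
  also have "\<dots> \<le> enat p * len1 I C" using ys(1) by (intro mult_right_mono) auto
  finally have 1: "len1 U ?W \<le> enat p * len1 I C" .
  have "len1 U O1 = len1 U ?W + len1 ?W O1"
    using len_add[OF U1(1) W(1) subsp1(1) W(2) WO closed(5)] .
  also have "\<dots> \<le> enat p * len1 I C + len1 D O1"
    using 1 len_mono[OF DW order_refl order_refl] by (intro add_mono) auto
  finally have 2: "enat (p * M) * d \<le> enat p * len1 I C + len1 D O1" using UO1 by simp
  have "enat p * len1 I C + enat p * len1 C O2 = enat p * (enat M * a2)"
    using split2 IO2 by (simp add: distrib_left)
  also have "\<dots> = enat (p * M) * a2" by (simp add: mult.assoc[symmetric])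
  also have "\<dots> \<le> enat (p * M) * d" by (rule mult_left_mono[OF \<open>a2 \<le> d\<close>]) simp
  also note 2
  \<comment> \<open>The common term \<open>p\<close> times the length of \<open>C / I\<close> is
    finite and is cancelled.\<close>
  finally show ?thesis using finC(2) by (auto simp: times_enat_def split: enat.splits)
qed

theorem frobenius_genus: "enat p * len1 C O2 \<le> len1 D O1"
  using frobenius_genus_aux by (cases "len1 D O1 = \<infinity>") auto

end

section \<open>Tensor products\<close>

text \<open>Keys may cancel in the sum. All three sums are therefore extended to the union of both
  key sets, where a missing key has coefficient 0.\<close>

lemma (in abelian_group) finsum_frag_add:
  fixes \<phi> \<psi> :: "'c \<Rightarrow>\<^sub>0 int"
  assumes "Poly_Mapping.keys \<phi> \<subseteq> W" and "Poly_Mapping.keys \<psi> \<subseteq> W" and v: "v \<in> W \<rightarrow> carrier G"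
  shows "(\<Oplus>z\<in>Poly_Mapping.keys (\<phi> + \<psi>). add_pow G (Poly_Mapping.lookup (\<phi> + \<psi>) z) (v z)) =
    (\<Oplus>z\<in>Poly_Mapping.keys \<phi>. add_pow G (Poly_Mapping.lookup \<phi> z) (v z)) \<oplus>
    (\<Oplus>z\<in>Poly_Mapping.keys \<psi>. add_pow G (Poly_Mapping.lookup \<psi> z) (v z))"
proof -
  let ?K = "Poly_Mapping.keys \<phi> \<union> Poly_Mapping.keys \<psi>"
  have vK: "v z \<in> carrier G" if "z \<in> ?K" for z using assms that by auto
  have zero: "add_pow G (0::int) x = \<zero>" for x by (simp add: add_pow_def)
  have ext: "(\<Oplus>z\<in>Poly_Mapping.keys \<theta>. add_pow G (Poly_Mapping.lookup \<theta> z) (v z)) =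
      (\<Oplus>z\<in>?K. add_pow G (Poly_Mapping.lookup \<theta> z) (v z))" if "Poly_Mapping.keys \<theta> \<subseteq> ?K" for \<theta> :: "'c \<Rightarrow>\<^sub>0 int"
    using that vK zero by (intro add.finprod_mono_neutral_cong_left) (auto simp: in_keys_iff)
  have "Poly_Mapping.keys (\<phi> + \<psi>) \<subseteq> ?K" by (rule Poly_Mapping.keys_add)
  then have "(\<Oplus>z\<in>Poly_Mapping.keys (\<phi> + \<psi>). add_pow G (Poly_Mapping.lookup (\<phi> + \<psi>) z) (v z)) =
      (\<Oplus>z\<in>?K. add_pow G (Poly_Mapping.lookup (\<phi> + \<psi>) z) (v z))" by (rule ext)
  also have "\<dots> = (\<Oplus>z\<in>?K. add_pow G (Poly_Mapping.lookup \<phi> z) (v z) \<oplus> add_pow G (Poly_Mapping.lookup \<psi> z) (v z))"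
    using vK by (intro add.finprod_cong) (auto simp: lookup_add add.int_pow_mult)
  also have "\<dots> = (\<Oplus>z\<in>?K. add_pow G (Poly_Mapping.lookup \<phi> z) (v z)) \<oplus>
      (\<Oplus>z\<in>?K. add_pow G (Poly_Mapping.lookup \<psi> z) (v z))"
    using vK by (intro finsum_addf) auto
  finally show ?thesis using ext[of \<phi>] ext[of \<psi>] by simp
qed

locale tensor_product = A: cring A + S: cring S for A :: "'a ring" and S :: "'s ring" +
  fixes K :: "'k ring" and \<alpha> :: "'k \<Rightarrow> 'a" and \<sigma> :: "'k \<Rightarrow> 's"
  assumes alpha: "\<alpha> \<in> ring_hom K A" and sigma: "\<sigma> \<in> ring_hom K S"
begin

abbreviation "PR \<equiv> pair_ring A S"
abbreviation "T \<equiv> tensor K A \<alpha> S \<sigma>"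
abbreviation "I \<equiv> tensor_ideal K A \<alpha> S \<sigma>"
abbreviation "tp \<equiv> pure_tensor K A \<alpha> S \<sigma>"

definition pmult :: "'a \<times> 's \<Rightarrow> 'a \<times> 's \<Rightarrow> 'a \<times> 's" where
  "pmult z w = (fst z \<otimes>\<^bsub>A\<^esub> fst w, snd z \<otimes>\<^bsub>S\<^esub> snd w)"

text \<open>The product of \<open>pair_ring\<close>, rewritten with projections in place of case
  distinctions so that additivity of \<open>frag_extend\<close> applies in each argument.\<close>

definition fmult :: "('a \<times> 's \<Rightarrow>\<^sub>0 int) \<Rightarrow> ('a \<times> 's \<Rightarrow>\<^sub>0 int) \<Rightarrow> ('a \<times> 's \<Rightarrow>\<^sub>0 int)" where
  "fmult f g = frag_extend (\<lambda>z. frag_extend (\<lambda>w. frag_of (pmult z w)) g) f"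

lemma PR_simps [simp]:
  "carrier PR = {f. Poly_Mapping.keys f \<subseteq> carrier A \<times> carrier S}"
  "f \<otimes>\<^bsub>PR\<^esub> g = fmult f g" "\<one>\<^bsub>PR\<^esub> = frag_of (\<one>\<^bsub>A\<^esub>, \<one>\<^bsub>S\<^esub>)" "\<zero>\<^bsub>PR\<^esub> = 0" "f \<oplus>\<^bsub>PR\<^esub> g = f + g"
  by (auto simp: pair_ring_def fmult_def pmult_def case_prod_beta')

lemma fmult_simps [simp]:
  "fmult 0 g = 0" "fmult f 0 = 0" "fmult (f + f') g = fmult f g + fmult f' g"
  "fmult (f - f') g = fmult f g - fmult f' g"
  "fmult (frag_of z) g = frag_extend (\<lambda>w. frag_of (pmult z w)) g"
  by (auto simp: fmult_def frag_extend_add frag_extend_diff intro: frag_extend_eq_0)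

lemma frag_extend_distrib:
  fixes h h' :: "'c \<Rightarrow> ('d \<Rightarrow>\<^sub>0 int)"
  shows
  "frag_extend (\<lambda>z. h z + h' z) f = frag_extend h f + frag_extend h' f"
  "frag_extend (\<lambda>z. h z - h' z) f = frag_extend h f - frag_extend h' f"
proof -
  have "frag_cmul c (a - b) = frag_cmul c a - frag_cmul c b" for c and a b :: "'d \<Rightarrow>\<^sub>0 int"
    by (rule poly_mapping_eqI) (simp add: lookup_minus right_diff_distrib)
  then show "frag_extend (\<lambda>z. h z - h' z) f = frag_extend h f - frag_extend h' f"
    by (simp add: frag_extend_def sum_subtractf)
  show "frag_extend (\<lambda>z. h z + h' z) f = frag_extend h f + frag_extend h' f"
    by (simp add: frag_extend_def frag_cmul_distrib2 sum.distrib)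
qed

lemma fmult_simps2 [simp]:
  "fmult f (g + g') = fmult f g + fmult f g'" "fmult f (g - g') = fmult f g - fmult f g'"
  by (simp_all add: fmult_def frag_extend_add frag_extend_diff frag_extend_distrib)

lemma pmult_closed: "z \<in> carrier A \<times> carrier S \<Longrightarrow> w \<in> carrier A \<times> carrier S \<Longrightarrow> pmult z w \<in> carrier A \<times> carrier S"
  by (auto simp: pmult_def)

lemma fmult_closed:
  assumes "Poly_Mapping.keys f \<subseteq> carrier A \<times> carrier S" and "Poly_Mapping.keys g \<subseteq> carrier A \<times> carrier S"
  shows "Poly_Mapping.keys (fmult f g) \<subseteq> carrier A \<times> carrier S"
  using assms(1)
proof (induction f rule: frag_induction)
  case (one z)
  show ?case using assms(2)
  proof (induction g rule: frag_induction)
    case (one w)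
    then show ?case using pmult_closed[OF \<open>z \<in> carrier A \<times> carrier S\<close>] by simp
  next
    case (diff a b)
    then show ?case using keys_diff[of "fmult (frag_of z) a" "fmult (frag_of z) b"]
      unfolding fmult_simps2 by blast
  qed simp
next
  case (diff a b)
  then show ?case using keys_diff[of "fmult a g" "fmult b g"] unfolding fmult_simps by blast
qed simp

lemma fmult_comm:
  assumes "Poly_Mapping.keys f \<subseteq> carrier A \<times> carrier S" and "Poly_Mapping.keys g \<subseteq> carrier A \<times> carrier S"
  shows "fmult f g = fmult g f"
  using assms(1)
proof (induction f rule: frag_induction)
  case (one z)
  show ?case using assms(2)
  proof (induction g rule: frag_induction)
    case (one w)
    then show ?case using \<open>z \<in> carrier A \<times> carrier S\<close> by (auto simp: pmult_def A.m_comm S.m_comm)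
  next
    case (diff a b)
    then show ?case by (simp del: fmult_simps(5))
  qed (simp del: fmult_simps(5))
qed (simp_all del: fmult_simps(5))

lemma fmult_assoc:
  assumes f: "Poly_Mapping.keys f \<subseteq> carrier A \<times> carrier S" and g: "Poly_Mapping.keys g \<subseteq> carrier A \<times> carrier S"
    and h: "Poly_Mapping.keys h \<subseteq> carrier A \<times> carrier S"
  shows "fmult (fmult f g) h = fmult f (fmult g h)"
  using f
proof (induction f rule: frag_induction)
  case (one z)
  note z = one
  show ?case using g
  proof (induction g rule: frag_induction)
    case (one w)
    note w = one
    show ?case using h
    proof (induction h rule: frag_induction)
      case (one u)
      then show ?case using z w by (auto simp: pmult_def A.m_assoc S.m_assoc)
    next
      case (diff a b)
      then show ?case by (simp del: fmult_simps(5))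
    qed (simp del: fmult_simps(5))
  next
    case (diff a b)
    then show ?case by (simp del: fmult_simps(5))
  qed (simp del: fmult_simps(5))
qed (simp_all del: fmult_simps(5))

lemma fmult_one:
  assumes "Poly_Mapping.keys f \<subseteq> carrier A \<times> carrier S"
  shows "fmult (frag_of (\<one>\<^bsub>A\<^esub>, \<one>\<^bsub>S\<^esub>)) f = f"
  using assms
proof (induction f rule: frag_induction)
  case (one z)
  then show ?case by (auto simp: pmult_def)
next
  case (diff a b)
  then show ?case by (simp del: fmult_simps(5))
qed simp

lemma pair_ring_cring: "cring PR"
proof (rule cringI)
  show "abelian_group PR"
  proof (rule abelian_groupI)
    show "x \<oplus>\<^bsub>PR\<^esub> y \<in> carrier PR" if "x \<in> carrier PR" "y \<in> carrier PR" for x y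
      using that Poly_Mapping.keys_add[of x y] unfolding PR_simps by blast
    show "\<exists>y\<in>carrier PR. y \<oplus>\<^bsub>PR\<^esub> x = \<zero>\<^bsub>PR\<^esub>" if "x \<in> carrier PR" for x
      using that by (intro bexI[of _ "- x"]) auto
  qed (simp_all add: add_ac)
  show "Group.comm_monoid PR"
  proof (rule comm_monoidI)
    fix f g h assume c: "f \<in> carrier PR" "g \<in> carrier PR"
    then show "f \<otimes>\<^bsub>PR\<^esub> g \<in> carrier PR" "f \<otimes>\<^bsub>PR\<^esub> g = g \<otimes>\<^bsub>PR\<^esub> f"
      using fmult_closed[of f g] fmult_comm[of f g] by (simp_all del: fmult_simps)
    assume "h \<in> carrier PR"
    then show "f \<otimes>\<^bsub>PR\<^esub> g \<otimes>\<^bsub>PR\<^esub> h = f \<otimes>\<^bsub>PR\<^esub> (g \<otimes>\<^bsub>PR\<^esub> h)"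
      using c fmult_assoc[of f g h] by (simp del: fmult_simps)
  next
    fix f assume "f \<in> carrier PR"
    then show "\<one>\<^bsub>PR\<^esub> \<otimes>\<^bsub>PR\<^esub> f = f" using fmult_one[of f] by (simp del: fmult_simps)
  qed simp
qed simp_all

lemma PR_minus: "f \<in> carrier PR \<Longrightarrow> g \<in> carrier PR \<Longrightarrow> f \<ominus>\<^bsub>PR\<^esub> g = f - g"
proof -
  interpret PR: cring PR by (rule pair_ring_cring)
  assume fg: "f \<in> carrier PR" "g \<in> carrier PR"
  then have "- g \<in> carrier PR" "g \<oplus>\<^bsub>PR\<^esub> - g = \<zero>\<^bsub>PR\<^esub>" by auto
  then have "\<ominus>\<^bsub>PR\<^esub> g = - g" using PR.minus_equality fg by (metis PR.a_comm)
  then show "f \<ominus>\<^bsub>PR\<^esub> g = f - g" by (simp add: a_minus_def)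
qed

lemma relations_carrier: "tensor_relations K A \<alpha> S \<sigma> \<subseteq> carrier PR"
proof -
  have d3: "Poly_Mapping.keys (frag_of x - frag_of y - frag_of z) \<subseteq> {x, y, z}" for x y z :: "'a \<times> 's"
    using keys_diff[of "frag_of x - frag_of y" "frag_of z"] keys_diff[of "frag_of x" "frag_of y"] by auto
  have d2: "Poly_Mapping.keys (frag_of x - frag_of y) \<subseteq> {x, y}" for x y :: "'a \<times> 's"
    using keys_diff[of "frag_of x" "frag_of y"] by auto
  have h: "\<alpha> k \<in> carrier A" "\<sigma> k \<in> carrier S" if "k \<in> carrier K" for k
    using that alpha sigma by (auto dest: ring_hom_closed)
  show ?thesis
    unfolding tensor_relations_def PR_simps
    by (auto dest!: subsetD[OF d3] subsetD[OF d2] simp: h)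
qed

lemma ideal_I: "ideal I PR"
  unfolding tensor_ideal_def
  by (rule ring.genideal_ideal[OF cring.axioms(1)[OF pair_ring_cring] relations_carrier])

lemma tensor_cring: "cring T"
  unfolding tensor_def by (rule ideal.quotient_is_cring[OF ideal_I pair_ring_cring])

lemma proj_hom: "ring_hom_ring PR T (\<lambda>f. I +>\<^bsub>PR\<^esub> f)"
  unfolding tensor_def by (rule ideal.rcos_ring_hom_ring[OF ideal_I])

lemma proj:
  shows "f \<in> carrier PR \<Longrightarrow> I +>\<^bsub>PR\<^esub> f \<in> carrier T"
    and "f \<in> carrier PR \<Longrightarrow> g \<in> carrier PR \<Longrightarrow> I +>\<^bsub>PR\<^esub> (f + g) = (I +>\<^bsub>PR\<^esub> f) \<oplus>\<^bsub>T\<^esub> (I +>\<^bsub>PR\<^esub> g)"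
    and "f \<in> carrier PR \<Longrightarrow> g \<in> carrier PR \<Longrightarrow> I +>\<^bsub>PR\<^esub> (fmult f g) = (I +>\<^bsub>PR\<^esub> f) \<otimes>\<^bsub>T\<^esub> (I +>\<^bsub>PR\<^esub> g)"
    and "I +>\<^bsub>PR\<^esub> frag_of (\<one>\<^bsub>A\<^esub>, \<one>\<^bsub>S\<^esub>) = \<one>\<^bsub>T\<^esub>"
    and "I +>\<^bsub>PR\<^esub> 0 = \<zero>\<^bsub>T\<^esub>"
proof -
  interpret h: ring_hom_ring PR T "\<lambda>f. I +>\<^bsub>PR\<^esub> f" by (rule proj_hom)
  show "f \<in> carrier PR \<Longrightarrow> I +>\<^bsub>PR\<^esub> f \<in> carrier T" by (rule h.hom_closed)
  show "f \<in> carrier PR \<Longrightarrow> g \<in> carrier PR \<Longrightarrow> I +>\<^bsub>PR\<^esub> (f + g) = (I +>\<^bsub>PR\<^esub> f) \<oplus>\<^bsub>T\<^esub> (I +>\<^bsub>PR\<^esub> g)"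
    using h.hom_add[of f g] by simp
  show "f \<in> carrier PR \<Longrightarrow> g \<in> carrier PR \<Longrightarrow> I +>\<^bsub>PR\<^esub> (fmult f g) = (I +>\<^bsub>PR\<^esub> f) \<otimes>\<^bsub>T\<^esub> (I +>\<^bsub>PR\<^esub> g)"
    using h.hom_mult[of f g] by simp
  show "I +>\<^bsub>PR\<^esub> frag_of (\<one>\<^bsub>A\<^esub>, \<one>\<^bsub>S\<^esub>) = \<one>\<^bsub>T\<^esub>" using h.hom_one by simp
  show "I +>\<^bsub>PR\<^esub> 0 = \<zero>\<^bsub>T\<^esub>" using h.hom_zero by simp
qed

lemma proj_surj:
  assumes "x \<in> carrier T"
  obtains f where "f \<in> carrier PR" and "x = I +>\<^bsub>PR\<^esub> f"
  using assms unfolding tensor_def FactRing_def A_RCOSETS_def' by auto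

lemma tp_closed: "a \<in> carrier A \<Longrightarrow> s \<in> carrier S \<Longrightarrow> tp a s \<in> carrier T"
  using proj(1)[of "frag_of (a, s)"] by (simp add: pure_tensor_def)

lemma tp_mult:
  assumes "a \<in> carrier A" "s \<in> carrier S" "b \<in> carrier A" "t \<in> carrier S"
  shows "tp a s \<otimes>\<^bsub>T\<^esub> tp b t = tp (a \<otimes>\<^bsub>A\<^esub> b) (s \<otimes>\<^bsub>S\<^esub> t)"
proof -
  have "frag_of (a, s) \<in> carrier PR" "frag_of (b, t) \<in> carrier PR" using assms by auto
  from proj(3)[OF this] show ?thesis
    by (simp add: pure_tensor_def pmult_def)
qed

lemma tp_one: "tp \<one>\<^bsub>A\<^esub> \<one>\<^bsub>S\<^esub> = \<one>\<^bsub>T\<^esub>"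
  using proj(4) by (simp add: pure_tensor_def)

lemma proj_relation:
  assumes "f \<in> tensor_relations K A \<alpha> S \<sigma>"
  shows "I +>\<^bsub>PR\<^esub> f = \<zero>\<^bsub>T\<^esub>"
proof -
  interpret ideal I PR by (rule ideal_I)
  have "f \<in> I" using ring.genideal_self[OF cring.axioms(1)[OF pair_ring_cring] relations_carrier] assms
    by (auto simp: tensor_ideal_def)
  then show ?thesis by (simp add: tensor_def FactRing_def a_rcos_const)
qed

lemma proj_diff:
  assumes "f \<in> carrier PR" "g \<in> carrier PR"
  shows "I +>\<^bsub>PR\<^esub> (f - g) = (I +>\<^bsub>PR\<^esub> f) \<ominus>\<^bsub>T\<^esub> (I +>\<^bsub>PR\<^esub> g)"
proof -
  interpret h: ring_hom_ring PR T "\<lambda>f. I +>\<^bsub>PR\<^esub> f" by (rule proj_hom)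
  have "I +>\<^bsub>PR\<^esub> (f \<ominus>\<^bsub>PR\<^esub> g) = (I +>\<^bsub>PR\<^esub> f) \<ominus>\<^bsub>T\<^esub> (I +>\<^bsub>PR\<^esub> g)"
    using assms unfolding a_minus_def by (simp del: PR_simps)
  then show ?thesis using PR_minus[OF assms] by simp
qed

lemma tp_add_left:
  assumes "a \<in> carrier A" "b \<in> carrier A" "s \<in> carrier S"
  shows "tp (a \<oplus>\<^bsub>A\<^esub> b) s = tp a s \<oplus>\<^bsub>T\<^esub> tp b s"
proof -
  interpret T: cring T by (rule tensor_cring)
  let ?f = "frag_of (a \<oplus>\<^bsub>A\<^esub> b, s)" and ?g = "frag_of (a, s)" and ?h = "frag_of (b, s)"
  have c: "?f \<in> carrier PR" "?g \<in> carrier PR" "?h \<in> carrier PR" using assms by auto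
  have "?f - ?g - ?h \<in> tensor_relations K A \<alpha> S \<sigma>" using assms unfolding tensor_relations_def by blast
  from proj_relation[OF this] have "I +>\<^bsub>PR\<^esub> (?f - (?g + ?h)) = \<zero>\<^bsub>T\<^esub>" by (simp add: diff_diff_eq)
  moreover have "?g + ?h \<in> carrier PR" using c Poly_Mapping.keys_add[of ?g ?h] by auto
  ultimately have "tp (a \<oplus>\<^bsub>A\<^esub> b) s \<ominus>\<^bsub>T\<^esub> (I +>\<^bsub>PR\<^esub> (?g + ?h)) = \<zero>\<^bsub>T\<^esub>"
    using proj_diff[OF c(1)] by (simp add: pure_tensor_def)
  moreover have "I +>\<^bsub>PR\<^esub> (?g + ?h) = tp a s \<oplus>\<^bsub>T\<^esub> tp b s"
    using proj(2)[OF c(2,3)] by (simp add: pure_tensor_def)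
  ultimately show ?thesis using tp_closed assms by (simp add: T.r_right_minus_eq)
qed

lemma tp_add_right:
  assumes "a \<in> carrier A" "s \<in> carrier S" "t \<in> carrier S"
  shows "tp a (s \<oplus>\<^bsub>S\<^esub> t) = tp a s \<oplus>\<^bsub>T\<^esub> tp a t"
proof -
  interpret T: cring T by (rule tensor_cring)
  let ?f = "frag_of (a, s \<oplus>\<^bsub>S\<^esub> t)" and ?g = "frag_of (a, s)" and ?h = "frag_of (a, t)"
  have c: "?f \<in> carrier PR" "?g \<in> carrier PR" "?h \<in> carrier PR" using assms by auto
  have "?f - ?g - ?h \<in> tensor_relations K A \<alpha> S \<sigma>" using assms unfolding tensor_relations_def by blast
  from proj_relation[OF this] have "I +>\<^bsub>PR\<^esub> (?f - (?g + ?h)) = \<zero>\<^bsub>T\<^esub>" by (simp add: diff_diff_eq)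
  moreover have "?g + ?h \<in> carrier PR" using c Poly_Mapping.keys_add[of ?g ?h] by auto
  ultimately have "tp a (s \<oplus>\<^bsub>S\<^esub> t) \<ominus>\<^bsub>T\<^esub> (I +>\<^bsub>PR\<^esub> (?g + ?h)) = \<zero>\<^bsub>T\<^esub>"
    using proj_diff[OF c(1)] by (simp add: pure_tensor_def)
  moreover have "I +>\<^bsub>PR\<^esub> (?g + ?h) = tp a s \<oplus>\<^bsub>T\<^esub> tp a t"
    using proj(2)[OF c(2,3)] by (simp add: pure_tensor_def)
  ultimately show ?thesis using tp_closed assms by (simp add: T.r_right_minus_eq)
qed

lemma tp_balanced:
  assumes "k \<in> carrier K" "a \<in> carrier A" "s \<in> carrier S"
  shows "tp (\<alpha> k \<otimes>\<^bsub>A\<^esub> a) s = tp a (\<sigma> k \<otimes>\<^bsub>S\<^esub> s)"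
proof -
  interpret T: cring T by (rule tensor_cring)
  let ?f = "frag_of (\<alpha> k \<otimes>\<^bsub>A\<^esub> a, s)" and ?g = "frag_of (a, \<sigma> k \<otimes>\<^bsub>S\<^esub> s)"
  have h: "\<alpha> k \<in> carrier A" "\<sigma> k \<in> carrier S"
    using assms alpha sigma by (auto dest: ring_hom_closed)
  have c: "?f \<in> carrier PR" "?g \<in> carrier PR" using assms h by auto
  have "?f - ?g \<in> tensor_relations K A \<alpha> S \<sigma>" using assms unfolding tensor_relations_def by blast
  from proj_relation[OF this] have "tp (\<alpha> k \<otimes>\<^bsub>A\<^esub> a) s \<ominus>\<^bsub>T\<^esub> tp a (\<sigma> k \<otimes>\<^bsub>S\<^esub> s) = \<zero>\<^bsub>T\<^esub>"
    using proj_diff[OF c] by (simp add: pure_tensor_def)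
  then show ?thesis using tp_closed assms h by (simp add: T.r_right_minus_eq)
qed

text \<open>Closure under differences covers sums and negatives at once and matches the induction on
  the free abelian group; zero is obtained as \<open>1 - 1\<close>.\<close>

lemma tensor_induct [consumes 1, case_names pure diff]:
  assumes "x \<in> carrier T"
    and pure: "\<And>a s. a \<in> carrier A \<Longrightarrow> s \<in> carrier S \<Longrightarrow> Q (tp a s)"
    and diff: "\<And>x y. x \<in> carrier T \<Longrightarrow> y \<in> carrier T \<Longrightarrow> Q x \<Longrightarrow> Q y \<Longrightarrow> Q (x \<ominus>\<^bsub>T\<^esub> y)"
  shows "Q x"
proof -
  interpret T: cring T by (rule tensor_cring)
  have zero: "Q \<zero>\<^bsub>T\<^esub>"
  proof -
    have "\<one>\<^bsub>T\<^esub> \<ominus>\<^bsub>T\<^esub> \<one>\<^bsub>T\<^esub> = \<zero>\<^bsub>T\<^esub>" by (simp add: a_minus_def T.r_neg)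
    moreover have "Q (\<one>\<^bsub>T\<^esub> \<ominus>\<^bsub>T\<^esub> \<one>\<^bsub>T\<^esub>)"
      using diff[of "\<one>\<^bsub>T\<^esub>" "\<one>\<^bsub>T\<^esub>"] pure[of "\<one>\<^bsub>A\<^esub>" "\<one>\<^bsub>S\<^esub>"] by (simp add: tp_one)
    ultimately show ?thesis by (simp only:)
  qed
  obtain f where f: "f \<in> carrier PR" "x = I +>\<^bsub>PR\<^esub> f" using proj_surj[OF assms(1)] .
  then have "Poly_Mapping.keys f \<subseteq> carrier A \<times> carrier S" by simp
  then have "f \<in> carrier PR \<and> Q (I +>\<^bsub>PR\<^esub> f)"
  proof (induction f rule: frag_induction)
    case zero
    have "I +>\<^bsub>PR\<^esub> 0 = \<zero>\<^bsub>T\<^esub>" by (rule proj(5))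
    then show ?case using \<open>Q \<zero>\<^bsub>T\<^esub>\<close> by simp
  next
    case (one z)
    then show ?case using pure[of "fst z" "snd z"] by (auto simp: pure_tensor_def)
  next
    case (diff f g)
    have c: "f - g \<in> carrier PR" using diff keys_diff[of f g] by auto
    have "I +>\<^bsub>PR\<^esub> f \<in> carrier T" "I +>\<^bsub>PR\<^esub> g \<in> carrier T"
      using proj(1) diff by blast+
    then show ?case using c diff assms(3) proj_diff by simp
  qed
  then show ?thesis using f by simp
qed

end

text \<open>The maps are asked to be additive and balanced, not multiplicative. So the same lift
  serves for a linear functional in \<open>T_disjoint\<close> and for the ring homomorphisms behind
  \<open>bc_map\<close> and \<open>norm_base_change_map\<close>.\<close>

locale tensor_pairing = tensor_product A S K \<alpha> \<sigma> + C: cring C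
  for A :: "'a ring" and S :: "'s ring" and K :: "'k ring" and \<alpha> \<sigma> and C :: "'c ring" +
  fixes f :: "'a \<Rightarrow> 'c" and g :: "'s \<Rightarrow> 'c"
  assumes f_closed: "\<And>a. a \<in> carrier A \<Longrightarrow> f a \<in> carrier C"
    and g_closed: "\<And>s. s \<in> carrier S \<Longrightarrow> g s \<in> carrier C"
    and f_add: "\<And>a b. a \<in> carrier A \<Longrightarrow> b \<in> carrier A \<Longrightarrow> f (a \<oplus>\<^bsub>A\<^esub> b) = f a \<oplus>\<^bsub>C\<^esub> f b"
    and g_add: "\<And>s t. s \<in> carrier S \<Longrightarrow> t \<in> carrier S \<Longrightarrow> g (s \<oplus>\<^bsub>S\<^esub> t) = g s \<oplus>\<^bsub>C\<^esub> g t"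
    and balanced: "\<And>k a s. k \<in> carrier K \<Longrightarrow> a \<in> carrier A \<Longrightarrow> s \<in> carrier S \<Longrightarrow>
        f (\<alpha> k \<otimes>\<^bsub>A\<^esub> a) \<otimes>\<^bsub>C\<^esub> g s = f a \<otimes>\<^bsub>C\<^esub> g (\<sigma> k \<otimes>\<^bsub>S\<^esub> s)"
begin

abbreviation "L \<equiv> tensor_lift C f g"

definition plift :: "('a \<times> 's \<Rightarrow>\<^sub>0 int) \<Rightarrow> 'c" where
  "plift \<phi> = (\<Oplus>\<^bsub>C\<^esub>z\<in>Poly_Mapping.keys \<phi>.
     add_pow C (Poly_Mapping.lookup \<phi> z) (f (fst z) \<otimes>\<^bsub>C\<^esub> g (snd z)))"

lemma plift_add:
  assumes "\<phi> \<in> carrier PR" and "\<psi> \<in> carrier PR"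
  shows "plift (\<phi> + \<psi>) = plift \<phi> \<oplus>\<^bsub>C\<^esub> plift \<psi>"
  unfolding plift_def
  using assms f_closed g_closed by (intro C.finsum_frag_add[of _ "carrier A \<times> carrier S"]) auto

lemma plift_closed: "\<phi> \<in> carrier PR \<Longrightarrow> plift \<phi> \<in> carrier C"
  unfolding plift_def using f_closed g_closed by (intro C.finsum_closed) auto

lemma plift_of: "a \<in> carrier A \<Longrightarrow> s \<in> carrier S \<Longrightarrow> plift (frag_of (a, s)) = f a \<otimes>\<^bsub>C\<^esub> g s"
proof -
  assume "a \<in> carrier A" "s \<in> carrier S"
  then have c: "f a \<otimes>\<^bsub>C\<^esub> g s \<in> carrier C" using f_closed g_closed by simp
  have one: "add_pow C (1::int) x = x" if "x \<in> carrier C" for x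
    using that C.add.int_pow_1 by (simp add: add_pow_def)
  have "plift (frag_of (a, s)) = (\<Oplus>\<^bsub>C\<^esub>z\<in>insert (a, s) {}. add_pow C (1::int) (f a \<otimes>\<^bsub>C\<^esub> g s))"
    unfolding plift_def using c by (intro C.add.finprod_cong) (auto simp: simp_implies_def)
  also have "\<dots> = f a \<otimes>\<^bsub>C\<^esub> g s" using c by (subst C.finsum_insert) (auto simp: one)
  finally show ?thesis .
qed

lemma plift_zero: "plift 0 = \<zero>\<^bsub>C\<^esub>"
  by (simp add: plift_def)

lemma PR_diff_closed: "\<phi> \<in> carrier PR \<Longrightarrow> \<psi> \<in> carrier PR \<Longrightarrow> \<phi> - \<psi> \<in> carrier PR"
  using keys_diff[of \<phi> \<psi>] by auto

lemma plift_diff: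
  assumes "\<phi> \<in> carrier PR" and "\<psi> \<in> carrier PR"
  shows "plift (\<phi> - \<psi>) = plift \<phi> \<ominus>\<^bsub>C\<^esub> plift \<psi>"
proof -
  have c: "\<phi> - \<psi> \<in> carrier PR" by (rule PR_diff_closed[OF assms])
  have "plift \<phi> = plift (\<phi> - \<psi>) \<oplus>\<^bsub>C\<^esub> plift \<psi>" using plift_add[OF c assms(2)] by simp
  then show ?thesis using plift_closed[OF c] plift_closed[OF assms(2)] C.minus_eq C.r_neg C.a_assoc by simp
qed

text \<open>The relation is multiplied by a generator because \<open>tensor_ideal\<close> is
  generated as an ideal, while without multiplicativity of \<open>f\<close> and \<open>g\<close> the
  kernel of \<open>plift\<close> is only known to be a subgroup.\<close>

lemma plift_relation:
  assumes "\<rho> \<in> tensor_relations K A \<alpha> S \<sigma>" and "c \<in> carrier A" and "t \<in> carrier S"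
  shows "plift (fmult \<rho> (frag_of (c, t))) = \<zero>\<^bsub>C\<^esub>"
proof -
  have fr: "frag_of (a, s) \<in> carrier PR" if "a \<in> carrier A" "s \<in> carrier S" for a s using that by simp
  from assms(1) consider
    (left) a b s where "\<rho> = frag_of (a \<oplus>\<^bsub>A\<^esub> b, s) - frag_of (a, s) - frag_of (b, s)"
      "a \<in> carrier A" "b \<in> carrier A" "s \<in> carrier S"
  | (right) a s u where "\<rho> = frag_of (a, s \<oplus>\<^bsub>S\<^esub> u) - frag_of (a, s) - frag_of (a, u)"
      "a \<in> carrier A" "s \<in> carrier S" "u \<in> carrier S"
  | (mid) k a s where "\<rho> = frag_of (\<alpha> k \<otimes>\<^bsub>A\<^esub> a, s) - frag_of (a, \<sigma> k \<otimes>\<^bsub>S\<^esub> s)"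
      "k \<in> carrier K" "a \<in> carrier A" "s \<in> carrier S"
    unfolding tensor_relations_def by blast
  then show ?thesis
  proof cases
    case left
    let ?x = "f (a \<otimes>\<^bsub>A\<^esub> c)" and ?y = "f (b \<otimes>\<^bsub>A\<^esub> c)" and ?z = "g (s \<otimes>\<^bsub>S\<^esub> t)"
    have c: "?x \<in> carrier C" "?y \<in> carrier C" "?z \<in> carrier C" using left assms f_closed g_closed by auto
    have "plift (fmult \<rho> (frag_of (c, t)))
      = (?x \<oplus>\<^bsub>C\<^esub> ?y) \<otimes>\<^bsub>C\<^esub> ?z \<ominus>\<^bsub>C\<^esub> ?x \<otimes>\<^bsub>C\<^esub> ?z \<ominus>\<^bsub>C\<^esub> ?y \<otimes>\<^bsub>C\<^esub> ?z"
      using left assms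
      by (simp add: pmult_def plift_diff[OF PR_diff_closed[OF fr fr] fr] plift_diff[OF fr fr] plift_of
          A.l_distr f_add del: PR_simps(1))
    also have "\<dots> = \<zero>\<^bsub>C\<^esub>" using c by algebra
    finally show ?thesis .
  next
    case right
    let ?x = "f (a \<otimes>\<^bsub>A\<^esub> c)" and ?y = "g (s \<otimes>\<^bsub>S\<^esub> t)" and ?z = "g (u \<otimes>\<^bsub>S\<^esub> t)"
    have c: "?x \<in> carrier C" "?y \<in> carrier C" "?z \<in> carrier C" using right assms f_closed g_closed by auto
    have "plift (fmult \<rho> (frag_of (c, t)))
      = ?x \<otimes>\<^bsub>C\<^esub> (?y \<oplus>\<^bsub>C\<^esub> ?z) \<ominus>\<^bsub>C\<^esub> ?x \<otimes>\<^bsub>C\<^esub> ?y \<ominus>\<^bsub>C\<^esub> ?x \<otimes>\<^bsub>C\<^esub> ?z"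
      using right assms
      by (simp add: pmult_def plift_diff[OF PR_diff_closed[OF fr fr] fr] plift_diff[OF fr fr] plift_of
          S.l_distr g_add del: PR_simps(1))
    also have "\<dots> = \<zero>\<^bsub>C\<^esub>" using c by algebra
    finally show ?thesis .
  next
    case mid
    have h: "\<alpha> k \<in> carrier A" "\<sigma> k \<in> carrier S" using mid alpha sigma by (auto dest: ring_hom_closed)
    have "f (a \<otimes>\<^bsub>A\<^esub> c) \<otimes>\<^bsub>C\<^esub> g (\<sigma> k \<otimes>\<^bsub>S\<^esub> (s \<otimes>\<^bsub>S\<^esub> t)) \<in> carrier C"
      using mid h assms f_closed g_closed by simp
    moreover have "plift (fmult \<rho> (frag_of (c, t)))
      = f (\<alpha> k \<otimes>\<^bsub>A\<^esub> (a \<otimes>\<^bsub>A\<^esub> c)) \<otimes>\<^bsub>C\<^esub> g (s \<otimes>\<^bsub>S\<^esub> t)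
        \<ominus>\<^bsub>C\<^esub> f (a \<otimes>\<^bsub>A\<^esub> c) \<otimes>\<^bsub>C\<^esub> g (\<sigma> k \<otimes>\<^bsub>S\<^esub> (s \<otimes>\<^bsub>S\<^esub> t))"
      using mid h assms
      by (simp add: pmult_def plift_diff[OF fr fr] plift_of A.m_assoc S.m_assoc del: PR_simps(1))
    ultimately show ?thesis using balanced mid assms by (simp add: C.minus_eq C.r_neg)
  qed
qed

text \<open>The elements annihilated by \<open>plift\<close> together with all their multiples form an ideal.\<close>

lemma plift_ideal:
  assumes "\<phi> \<in> I"
  shows "plift \<phi> = \<zero>\<^bsub>C\<^esub>"
proof -
  interpret PR: cring PR by (rule pair_ring_cring)
  define J where "J = {\<phi> \<in> carrier PR. \<forall>\<psi>\<in>carrier PR. plift (fmult \<phi> \<psi>) = \<zero>\<^bsub>C\<^esub>}"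
  have mc: "fmult \<phi> \<psi> \<in> carrier PR" if "\<phi> \<in> carrier PR" "\<psi> \<in> carrier PR" for \<phi> \<psi>
    using PR.m_closed[OF that] by (simp only: PR_simps)
  have JI: "ideal J PR"
  proof (rule idealI)
    show "ring PR" by (rule PR.ring_axioms)
    show "subgroup J (add_monoid PR)"
    proof (rule PR.add.subgroupI)
      show "J \<subseteq> carrier PR" by (auto simp: J_def)
      show "J \<noteq> {}" using plift_zero by (auto simp: J_def intro!: exI[of _ 0])
      fix \<phi> assume \<phi>: "\<phi> \<in> J"
      then have \<phi>c: "\<phi> \<in> carrier PR" by (simp add: J_def)
      have "plift (fmult (0 - \<phi>) \<psi>) = \<zero>\<^bsub>C\<^esub>" if \<psi>: "\<psi> \<in> carrier PR" for \<psi>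
      proof -
        have "plift (fmult (0 - \<phi>) \<psi>) = plift (fmult 0 \<psi>) \<ominus>\<^bsub>C\<^esub> plift (fmult \<phi> \<psi>)"
          unfolding fmult_simps(4) using mc[OF \<phi>c \<psi>] PR.zero_closed by (intro plift_diff) auto
        then show ?thesis using \<phi> \<psi> by (simp add: J_def plift_zero C.minus_eq)
      qed
      moreover have "\<ominus>\<^bsub>PR\<^esub> \<phi> = \<zero>\<^bsub>PR\<^esub> \<ominus>\<^bsub>PR\<^esub> \<phi>"
        using \<phi>c by (simp only: PR.minus_eq PR.l_zero PR.a_inv_closed)
      then have "\<ominus>\<^bsub>PR\<^esub> \<phi> = 0 - \<phi>" using PR_minus[OF PR.zero_closed \<phi>c] by (simp only: PR_simps(4))
      moreover have "0 - \<phi> \<in> carrier PR" using \<phi>c by simp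
      ultimately show "\<ominus>\<^bsub>PR\<^esub> \<phi> \<in> J" by (simp add: J_def)
      fix \<phi>' assume \<phi>': "\<phi>' \<in> J"
      have "plift (fmult (\<phi> + \<phi>') \<psi>) = \<zero>\<^bsub>C\<^esub>" if "\<psi> \<in> carrier PR" for \<psi>
        using plift_add[OF mc mc, of \<phi> \<psi> \<phi>' \<psi>] \<phi> \<phi>' that by (simp add: J_def)
      then show "\<phi> \<oplus>\<^bsub>PR\<^esub> \<phi>' \<in> J" using PR.a_closed[of \<phi> \<phi>'] \<phi> \<phi>' by (simp add: J_def)
    qed
    fix \<phi> \<psi> assume \<phi>: "\<phi> \<in> J" and \<psi>: "\<psi> \<in> carrier PR"
    have "plift (fmult (fmult \<phi> \<psi>) \<theta>) = \<zero>\<^bsub>C\<^esub>" if "\<theta> \<in> carrier PR" for \<theta>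
      using fmult_assoc[of \<phi> \<psi> \<theta>] \<phi> \<psi> that mc[OF \<psi> that] by (simp add: J_def)
    then show 1: "\<phi> \<otimes>\<^bsub>PR\<^esub> \<psi> \<in> J" using mc[OF _ \<psi>] \<phi> by (simp add: J_def)
    show "\<psi> \<otimes>\<^bsub>PR\<^esub> \<phi> \<in> J" using 1 PR.m_comm[of \<phi> \<psi>] \<phi> \<psi> by (simp add: J_def)
  qed
  have "tensor_relations K A \<alpha> S \<sigma> \<subseteq> J"
  proof
    fix \<rho> assume \<rho>: "\<rho> \<in> tensor_relations K A \<alpha> S \<sigma>"
    have \<rho>c: "\<rho> \<in> carrier PR" using relations_carrier \<rho> by blast
    have "\<psi> \<in> carrier PR \<and> plift (fmult \<rho> \<psi>) = \<zero>\<^bsub>C\<^esub>" if "Poly_Mapping.keys \<psi> \<subseteq> carrier A \<times> carrier S" for \<psi>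
      using that
    proof (induction \<psi> rule: frag_induction)
      case zero
      then show ?case by (simp add: plift_zero)
    next
      case (one z)
      then show ?case using plift_relation[OF \<rho>, of "fst z" "snd z"] by auto
    next
      case (diff \<phi> \<psi>)
      then have "plift (fmult \<rho> (\<phi> - \<psi>)) = plift (fmult \<rho> \<phi>) \<ominus>\<^bsub>C\<^esub> plift (fmult \<rho> \<psi>)"
        unfolding fmult_simps2 by (intro plift_diff mc \<rho>c) auto
      then show ?case using diff PR_diff_closed by (simp add: C.minus_eq del: PR_simps(1))
    qed
    then show "\<rho> \<in> J" using \<rho>c by (simp add: J_def)
  qed
  then have "I \<subseteq> J" unfolding tensor_ideal_def by (rule PR.genideal_minimal[OF JI])
  then have \<phi>: "\<phi> \<in> J" using assms by blast
  have eq: "fmult \<phi> (frag_of (\<one>\<^bsub>A\<^esub>, \<one>\<^bsub>S\<^esub>)) = \<phi>"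
    using PR.r_one[of \<phi>] \<phi> unfolding PR_simps J_def by simp
  have "\<forall>\<psi>\<in>carrier PR. plift (fmult \<phi> \<psi>) = \<zero>\<^bsub>C\<^esub>" using \<phi> unfolding J_def by blast
  from bspec[OF this PR.one_closed] show ?thesis unfolding PR_simps(3) eq .
qed

lemma lift_coset:
  assumes \<phi>: "\<phi> \<in> carrier PR"
  shows "L (I +>\<^bsub>PR\<^esub> \<phi>) = plift \<phi>"
proof -
  interpret I: ideal I PR by (rule ideal_I)
  have i: "plift (i + \<phi>) = plift \<phi>" if "i \<in> I" for i
  proof -
    have "i \<in> carrier PR" using I.a_subset that by blast
    then have "plift (i + \<phi>) = \<zero>\<^bsub>C\<^esub> \<oplus>\<^bsub>C\<^esub> plift \<phi>"
      using plift_add[OF _ \<phi>] plift_ideal[OF that] by metis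
    then show ?thesis using plift_closed[OF \<phi>] by simp
  qed
  have "plift ` (I +>\<^bsub>PR\<^esub> \<phi>) = {plift \<phi>}"
  proof
    show "plift ` (I +>\<^bsub>PR\<^esub> \<phi>) \<subseteq> {plift \<phi>}"
    proof (rule image_subsetI)
      fix x assume "x \<in> I +>\<^bsub>PR\<^esub> \<phi>"
      then obtain j where "j \<in> I" "x = j + \<phi>"
        unfolding a_r_coset_def' PR_simps(5) by (elim UN_E singletonE)
      then show "plift x \<in> {plift \<phi>}" using i by simp
    qed
    have "\<zero>\<^bsub>PR\<^esub> \<in> I" by (rule additive_subgroup.zero_closed[OF ideal.axioms(1)[OF ideal_I]])
    then have "0 + \<phi> \<in> I +>\<^bsub>PR\<^esub> \<phi>"
      unfolding a_r_coset_def' PR_simps(4,5) by (rule UN_I) simp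
    then show "{plift \<phi>} \<subseteq> plift ` (I +>\<^bsub>PR\<^esub> \<phi>)" by simp
  qed
  then show ?thesis by (simp add: tensor_lift_def plift_def[abs_def])
qed

lemma lift_tp: "a \<in> carrier A \<Longrightarrow> s \<in> carrier S \<Longrightarrow> L (tp a s) = f a \<otimes>\<^bsub>C\<^esub> g s"
  using lift_coset[of "frag_of (a, s)"] plift_of by (simp add: pure_tensor_def)

lemma lift_closed: "x \<in> carrier T \<Longrightarrow> L x \<in> carrier C"
  using lift_coset plift_closed by (metis proj_surj)

lemma lift_add:
  assumes "x \<in> carrier T" and "y \<in> carrier T"
  shows "L (x \<oplus>\<^bsub>T\<^esub> y) = L x \<oplus>\<^bsub>C\<^esub> L y"
proof -
  interpret PR: cring PR by (rule pair_ring_cring)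
  obtain \<phi> \<psi> where c: "\<phi> \<in> carrier PR" "x = I +>\<^bsub>PR\<^esub> \<phi>" "\<psi> \<in> carrier PR" "y = I +>\<^bsub>PR\<^esub> \<psi>"
    using assms proj_surj by metis
  have "\<phi> + \<psi> \<in> carrier PR" using PR.a_closed[OF c(1,3)] by simp
  then show ?thesis using lift_coset c proj(2) plift_add by metis
qed

lemma lift_diff:
  assumes "x \<in> carrier T" and "y \<in> carrier T"
  shows "L (x \<ominus>\<^bsub>T\<^esub> y) = L x \<ominus>\<^bsub>C\<^esub> L y"
proof -
  obtain \<phi> \<psi> where c: "\<phi> \<in> carrier PR" "x = I +>\<^bsub>PR\<^esub> \<phi>" "\<psi> \<in> carrier PR" "y = I +>\<^bsub>PR\<^esub> \<psi>"
    using assms proj_surj by metis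
  then show ?thesis using lift_coset proj_diff plift_diff PR_diff_closed by metis
qed

lemma lift_hom:
  assumes "f \<in> ring_hom A C" and "g \<in> ring_hom S C"
  shows "L \<in> ring_hom T C"
proof (rule ring_hom_memI)
  interpret T: cring T by (rule tensor_cring)
  show "L x \<in> carrier C" if "x \<in> carrier T" for x by (rule lift_closed[OF that])
  show "L (x \<oplus>\<^bsub>T\<^esub> y) = L x \<oplus>\<^bsub>C\<^esub> L y" if "x \<in> carrier T" "y \<in> carrier T" for x y by (rule lift_add[OF that])
  show "L \<one>\<^bsub>T\<^esub> = \<one>\<^bsub>C\<^esub>"
    using lift_tp[of "\<one>\<^bsub>A\<^esub>" "\<one>\<^bsub>S\<^esub>"] assms by (simp add: tp_one ring_hom_one)
  show "L (x \<otimes>\<^bsub>T\<^esub> y) = L x \<otimes>\<^bsub>C\<^esub> L y" if x: "x \<in> carrier T" and y: "y \<in> carrier T" for x y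
    using x
  proof (induction x rule: tensor_induct)
    case (pure a s)
    note as = pure
    show ?case using y
    proof (induction y rule: tensor_induct)
      case (pure b t)
      have "f a \<in> carrier C" "f b \<in> carrier C" "g s \<in> carrier C" "g t \<in> carrier C"
        using pure as f_closed g_closed by auto
      then show ?case using pure as ring_hom_mult[OF assms(1)] ring_hom_mult[OF assms(2)]
        by (simp add: tp_mult lift_tp C.m_ac)
    next
      case (diff y z)
      have "tp a s \<otimes>\<^bsub>T\<^esub> (y \<ominus>\<^bsub>T\<^esub> z) = tp a s \<otimes>\<^bsub>T\<^esub> y \<ominus>\<^bsub>T\<^esub> tp a s \<otimes>\<^bsub>T\<^esub> z"
        using diff tp_closed[OF as] by algebra
      moreover have "L (tp a s) \<otimes>\<^bsub>C\<^esub> (L y \<ominus>\<^bsub>C\<^esub> L z) = L (tp a s) \<otimes>\<^bsub>C\<^esub> L y \<ominus>\<^bsub>C\<^esub> L (tp a s) \<otimes>\<^bsub>C\<^esub> L z"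
        using lift_closed diff tp_closed[OF as] by algebra
      ultimately show ?case using diff tp_closed[OF as] by (simp add: lift_diff)
    qed
  next
    case (diff x z)
    have "(x \<ominus>\<^bsub>T\<^esub> z) \<otimes>\<^bsub>T\<^esub> y = x \<otimes>\<^bsub>T\<^esub> y \<ominus>\<^bsub>T\<^esub> z \<otimes>\<^bsub>T\<^esub> y" using diff y by algebra
    moreover have "(L x \<ominus>\<^bsub>C\<^esub> L z) \<otimes>\<^bsub>C\<^esub> L y = L x \<otimes>\<^bsub>C\<^esub> L y \<ominus>\<^bsub>C\<^esub> L z \<otimes>\<^bsub>C\<^esub> L y"
      using lift_closed diff y by algebra
    ultimately show ?case using diff y by (simp add: lift_diff)
  qed
qed

end

section \<open>The Frobenius endomorphism\<close>

context cring
begin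

text \<open>Multiplication by \<open>x\<close> shifts the first exponent and multiplication by
  \<open>y\<close> the second. After splitting off the term of index 0, Pascal's rule adds the two
  sums termwise.\<close>

lemma binomial:
  assumes x: "x \<in> carrier R" and y: "y \<in> carrier R"
  shows "(x \<oplus> y) [^] n = (\<Oplus>k\<in>{..n}. add_pow R (n choose k) (x [^] k \<otimes> y [^] (n - k)))"
proof (induction n)
  case 0
  show ?case using x y by (simp add: add_pow_def)
next
  case (Suc n)
  define m where "m j k = x [^] (j::nat) \<otimes> y [^] (k::nat)" for j k
  have m: "m j k \<in> carrier R" for j k using x y by (simp add: m_def)
  have xm: "x \<otimes> m j k = m (Suc j) k" and ym: "y \<otimes> m j k = m j (Suc k)" for j k
    using x y by (simp_all add: m_def m_ac nat_pow_comm)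
  have one: "add_pow R (Suc 0) z = z" if "z \<in> carrier R" for z using that by (simp add: add_pow_def)
  have zero: "add_pow R (0::nat) z = \<zero>" for z by (simp add: add_pow_def)
  let ?S = "\<Oplus>k\<in>{..n}. add_pow R (n choose k) (m k (n - k))"
  have S: "?S \<in> carrier R" using m by (intro finsum_closed) auto
  have xS: "x \<otimes> ?S = (\<Oplus>k\<in>{..n}. add_pow R (n choose k) (m (Suc k) (n - k)))"
    using x m by (subst finsum_rdistr) (auto intro!: add.finprod_cong simp: add_pow_rdistr xm simp_implies_def)
  \<comment> \<open>The index \<open>Suc n\<close> may be included because
    \<open>n choose Suc n\<close> is 0.\<close>
  have yS: "y \<otimes> ?S = (\<Oplus>k\<in>{..Suc n}. add_pow R (n choose k) (m k (Suc n - k)))"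
  proof -
    have "y \<otimes> ?S = (\<Oplus>k\<in>{..n}. add_pow R (n choose k) (m k (Suc n - k)))"
      using y m by (subst finsum_rdistr)
        (auto intro!: add.finprod_cong simp: add_pow_rdistr ym Suc_diff_le simp_implies_def)
    moreover have "(\<Oplus>k\<in>{..n}. add_pow R (n choose k) (m k (Suc n - k))) \<in> carrier R"
      using m by (intro finsum_closed) auto
    ultimately show ?thesis using m by (subst finsum_Suc) (auto simp: zero binomial_eq_0)
  qed
  have yS2: "y \<otimes> ?S = (\<Oplus>k\<in>{..n}. add_pow R (n choose Suc k) (m (Suc k) (n - k))) \<oplus> m 0 (Suc n)"
    unfolding yS using m by (subst finsum_Suc2) (auto simp: one)
  have c: "(\<Oplus>k\<in>{..n}. add_pow R (n choose k) (m (Suc k) (n - k))) \<in> carrier R"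
      "(\<Oplus>k\<in>{..n}. add_pow R (n choose Suc k) (m (Suc k) (n - k))) \<in> carrier R"
    using m by (auto intro!: finsum_closed)
  have "(\<Oplus>k\<in>{..Suc n}. add_pow R (Suc n choose k) (m k (Suc n - k))) =
      (\<Oplus>k\<in>{..n}. add_pow R (Suc n choose Suc k) (m (Suc k) (n - k))) \<oplus> m 0 (Suc n)"
    using m by (subst finsum_Suc2) (auto simp: one)
  also have "(\<Oplus>k\<in>{..n}. add_pow R (Suc n choose Suc k) (m (Suc k) (n - k))) =
      (\<Oplus>k\<in>{..n}. add_pow R (n choose k) (m (Suc k) (n - k)) \<oplus> add_pow R (n choose Suc k) (m (Suc k) (n - k)))"
    using m by (intro add.finprod_cong) (auto simp: add.nat_pow_mult simp_implies_def)
  also have "\<dots> = (\<Oplus>k\<in>{..n}. add_pow R (n choose k) (m (Suc k) (n - k))) \<oplus>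
      (\<Oplus>k\<in>{..n}. add_pow R (n choose Suc k) (m (Suc k) (n - k)))"
    using m by (intro finsum_addf) auto
  finally have "(\<Oplus>k\<in>{..Suc n}. add_pow R (Suc n choose k) (m k (Suc n - k))) = x \<otimes> ?S \<oplus> y \<otimes> ?S"
    unfolding xS yS2 using c m by (simp add: a_assoc)
  also have "\<dots> = (x \<oplus> y) [^] Suc n"
    using Suc x y S unfolding m_def[symmetric] by (simp add: l_distr[symmetric] m_comm)
  finally show ?case by (simp add: m_def)
qed

lemma add_pow_multiple_zero:
  assumes "add_pow R (p::nat) \<one> = \<zero>" and "p dvd n" and "z \<in> carrier R"
  shows "add_pow R n z = \<zero>"
proof -
  obtain m where n: "n = p * m" using assms(2) by blast
  have p: "add_pow R p z = \<zero>"
    using add_pow_ldistr[of \<one> z p] assms by simp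
  have "add_pow R (p * m) z = add_pow R m (add_pow R p z)"
    using add.nat_pow_pow[OF assms(3), of m p] by (simp add: add_pow_def mult.commute)
  also have "\<dots> = \<zero>" unfolding p by simp
  finally show ?thesis using n by simp
qed

lemma frobenius_add:
  assumes "Factorial_Ring.prime p" and "add_pow R (p::nat) \<one> = \<zero>" and x: "x \<in> carrier R" and y: "y \<in> carrier R"
  shows "(x \<oplus> y) [^] p = x [^] p \<oplus> y [^] p"
proof -
  have p: "0 < p" using assms(1) prime_gt_0_nat by blast
  have z: "add_pow R (p choose k) (x [^] k \<otimes> y [^] (p - k)) = \<zero>" if "k \<in> {..p} - {0, p}" for k
  proof -
    have k: "0 < k" "k < p" using that by auto
    \<comment> \<open>From \<open>k (p choose k) = p ((p-1) choose (k-1))\<close>; since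
      \<open>p\<close> does not divide \<open>k\<close>, it divides the binomial
      coefficient.\<close>
    have "p dvd k * (p choose k)" using times_binomial_minus1_eq[OF k(1), of p] by simp
    then have "p dvd k \<or> p dvd p choose k" by (rule prime_dvd_multD[OF assms(1)])
    moreover have "\<not> p dvd k" using k by (simp add: nat_dvd_not_less)
    ultimately have "p dvd p choose k" by blast
    then show ?thesis using x y by (intro add_pow_multiple_zero[OF assms(2)]) simp_all
  qed
  have one: "add_pow R (Suc 0) z = z" if "z \<in> carrier R" for z using that by (simp add: add_pow_def)
  have "(x \<oplus> y) [^] p = (\<Oplus>k\<in>{..p}. add_pow R (p choose k) (x [^] k \<otimes> y [^] (p - k)))"
    by (rule binomial[OF x y])
  also have "\<dots> = (\<Oplus>k\<in>insert p {0}. add_pow R (p choose k) (x [^] k \<otimes> y [^] (p - k)))"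
    using x y z by (intro add.finprod_mono_neutral_cong_left[symmetric]) auto
  also have "\<dots> = x [^] p \<oplus> y [^] p"
    using x y p by (subst finsum_insert) (auto simp: one)
  finally show ?thesis .
qed

lemma frobenius_hom:
  assumes "Factorial_Ring.prime p" and "add_pow R (p::nat) \<one> = \<zero>"
  shows "(\<lambda>x. x [^] (p ^ n)) \<in> ring_hom R R"
proof (rule ring_hom_memI)
  show "(x \<oplus> y) [^] (p ^ n) = x [^] (p ^ n) \<oplus> y [^] (p ^ n)"
    if "x \<in> carrier R" "y \<in> carrier R" for x y
  proof (induction n)
    case (Suc n)
    have pow: "z [^] (p ^ Suc n) = (z [^] (p ^ n)) [^] p" if "z \<in> carrier R" for z
      using that by (simp add: nat_pow_pow mult.commute)
    show ?case using that Suc frobenius_add[OF assms] by (simp only: pow a_closed nat_pow_closed)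
  qed (use that in simp)
qed (auto simp: nat_pow_distrib)

end

lemma ring_hom_add_pow:
  assumes "ring R" and "ring S" and h: "h \<in> ring_hom R S" and x: "x \<in> carrier R"
  shows "h (add_pow R (n::nat) x) = add_pow S n (h x)"
proof -
  interpret ring_hom_ring R S h
    using assms by (intro ring_hom_ringI2)
  have "add_pow R m x \<in> carrier R" for m :: nat using x by simp
  then show ?thesis using x by (induction n) (simp_all add: add_pow_def)
qed

text \<open>In \<open>K\<close> the multiples \<open>m 1\<close> and \<open>n 1\<close> have the
  product \<open>(m n) 1\<close>. If \<open>p\<close> divides \<open>m n\<close>, one factor
  vanishes because \<open>K\<close> is a domain, which is primality in Euclid's form.\<close>

lemma has_char_prime:
  assumes "field K" and "has_char K p" and "p > 0"
  shows "Factorial_Ring.prime p" and "add_pow K p \<one>\<^bsub>K\<^esub> = \<zero>\<^bsub>K\<^esub>"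
proof -
  interpret field K by fact
  have char: "add_pow K n \<one>\<^bsub>K\<^esub> = \<zero>\<^bsub>K\<^esub> \<longleftrightarrow> p dvd n" for n :: nat
    using assms(2) by (simp add: has_char_def)
  then show "add_pow K p \<one>\<^bsub>K\<^esub> = \<zero>\<^bsub>K\<^esub>" by simp
  have "p \<noteq> 1"
  proof
    assume "p = 1"
    then have "add_pow K (Suc 0) \<one>\<^bsub>K\<^esub> = \<zero>\<^bsub>K\<^esub>" using char[of 1] by simp
    then show False by (simp add: add_pow_def)
  qed
  moreover have "p dvd m \<or> p dvd n" if "p dvd m * n" for m n
  proof -
    have "add_pow K n \<one>\<^bsub>K\<^esub> \<in> carrier K" by simp
    then have "add_pow K m \<one>\<^bsub>K\<^esub> \<otimes>\<^bsub>K\<^esub> add_pow K n \<one>\<^bsub>K\<^esub> = add_pow K (m * n) \<one>\<^bsub>K\<^esub>"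
      using add_pow_ldistr[of "\<one>\<^bsub>K\<^esub>" "add_pow K n \<one>\<^bsub>K\<^esub>" m] add.nat_pow_pow[of "\<one>\<^bsub>K\<^esub>" m n]
      by (simp add: add_pow_def mult.commute)
    also have "\<dots> = \<zero>\<^bsub>K\<^esub>" using char that by blast
    finally show ?thesis using char integral[of "add_pow K m \<one>\<^bsub>K\<^esub>" "add_pow K n \<one>\<^bsub>K\<^esub>"] by auto
  qed
  ultimately have "prime_elem p"
    using assms(3) by (intro Factorial_Ring.prime_elemI) auto
  then show "Factorial_Ring.prime p" by (intro Factorial_Ring.primeI) auto
qed

section \<open>Fields of fractions\<close>

context domain
begin

abbreviation "Q \<equiv> frac_field R"

lemma mem_fraction:
  assumes "a \<in> carrier R" and "b \<in> carrier R" and "b \<noteq> \<zero>"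
  shows "(c, d) \<in> fraction R a b \<longleftrightarrow> c \<in> carrier R \<and> d \<in> carrier R \<and> d \<noteq> \<zero> \<and> a \<otimes> d = c \<otimes> b"
  using assms by (auto simp: fraction_def frac_rel_def)

lemma frac_trans:
  assumes "a \<in> carrier R" "b \<in> carrier R" "c \<in> carrier R" "d \<in> carrier R" "e \<in> carrier R" "f \<in> carrier R"
    and "d \<noteq> \<zero>" and "a \<otimes> d = c \<otimes> b" and "c \<otimes> f = e \<otimes> d"
  shows "a \<otimes> f = e \<otimes> b"
proof -
  have "d \<otimes> (a \<otimes> f) = (a \<otimes> d) \<otimes> f" using assms(1-6) by algebra
  also have "\<dots> = (c \<otimes> f) \<otimes> b" using assms(1-6,8) by algebra
  also have "\<dots> = d \<otimes> (e \<otimes> b)" using assms(1-6,9) by algebra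
  finally show ?thesis using assms by (simp add: m_lcancel)
qed

lemma fraction_eq:
  assumes "a \<in> carrier R" "b \<in> carrier R" "b \<noteq> \<zero>" "c \<in> carrier R" "d \<in> carrier R" "d \<noteq> \<zero>"
  shows "fraction R a b = fraction R c d \<longleftrightarrow> a \<otimes> d = c \<otimes> b"
proof
  assume "fraction R a b = fraction R c d"
  moreover have "(c, d) \<in> fraction R c d" using assms by (simp add: mem_fraction)
  ultimately show "a \<otimes> d = c \<otimes> b" using mem_fraction assms by metis
next
  assume eq: "a \<otimes> d = c \<otimes> b"
  have "(x, y) \<in> fraction R a b \<longleftrightarrow> (x, y) \<in> fraction R c d" for x y
    unfolding mem_fraction[OF assms(1-3)] mem_fraction[OF assms(4-6)]
    using frac_trans[of c d a b x y] frac_trans[of a b c d x y] assms eq eq[symmetric] by blast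
  then show "fraction R a b = fraction R c d" by auto
qed

lemma fraction_closed:
  "a \<in> carrier R \<Longrightarrow> b \<in> carrier R \<Longrightarrow> b \<noteq> \<zero> \<Longrightarrow> fraction R a b \<in> carrier Q"
  by (auto simp: frac_field_def fraction_def intro!: quotientI)

lemma frac_cases:
  assumes "x \<in> carrier Q"
  obtains a b where "a \<in> carrier R" and "b \<in> carrier R" and "b \<noteq> \<zero>" and "x = fraction R a b"
  using assms by (auto simp: frac_field_def fraction_def elim!: quotientE)

text \<open>The operations of \<open>frac_field\<close> are unions over all representatives; such a
  union collapses to one class once the result is independent of them.\<close>

lemma UN_constant:
  assumes "U \<noteq> {}" and "\<And>x. x \<in> U \<Longrightarrow> F x = c"
  shows "(\<Union>x\<in>U. F x) = c"
  using assms by auto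

lemma fraction_nonempty: "a \<in> carrier R \<Longrightarrow> b \<in> carrier R \<Longrightarrow> b \<noteq> \<zero> \<Longrightarrow> fraction R a b \<noteq> {}"
  using mem_fraction[of a b a b] by auto

lemma fraction_mult:
  assumes ab: "a \<in> carrier R" "b \<in> carrier R" "b \<noteq> \<zero>" and cd: "c \<in> carrier R" "d \<in> carrier R" "d \<noteq> \<zero>"
  shows "fraction R a b \<otimes>\<^bsub>Q\<^esub> fraction R c d = fraction R (a \<otimes> c) (b \<otimes> d)"
proof -
  have "fraction R (a' \<otimes> c') (b' \<otimes> d') = fraction R (a \<otimes> c) (b \<otimes> d)"
    if "(a', b') \<in> fraction R a b" "(c', d') \<in> fraction R c d" for a' b' c' d'
  proof -
    have *: "a' \<in> carrier R" "b' \<in> carrier R" "b' \<noteq> \<zero>" "a \<otimes> b' = a' \<otimes> b"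
      "c' \<in> carrier R" "d' \<in> carrier R" "d' \<noteq> \<zero>" "c \<otimes> d' = c' \<otimes> d"
      using that mem_fraction[OF ab] mem_fraction[OF cd] by auto
    have "(a \<otimes> c) \<otimes> (b' \<otimes> d') = (a \<otimes> b') \<otimes> (c \<otimes> d')" using *(1,2,5,6) ab cd by (simp add: m_ac)
    also have "\<dots> = (a' \<otimes> b) \<otimes> (c' \<otimes> d)" by (simp only: *(4,8))
    also have "\<dots> = (a' \<otimes> c') \<otimes> (b \<otimes> d)" using *(1,2,5,6) ab cd by (simp add: m_ac)
    finally show ?thesis using * ab cd by (subst fraction_eq) (auto dest: integral)
  qed
  then show ?thesis
    using fraction_nonempty[OF ab] fraction_nonempty[OF cd]
    by (simp add: frac_field_def) (intro UN_constant, auto)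
qed

lemma fraction_add:
  assumes ab: "a \<in> carrier R" "b \<in> carrier R" "b \<noteq> \<zero>" and cd: "c \<in> carrier R" "d \<in> carrier R" "d \<noteq> \<zero>"
  shows "fraction R a b \<oplus>\<^bsub>Q\<^esub> fraction R c d = fraction R (a \<otimes> d \<oplus> c \<otimes> b) (b \<otimes> d)"
proof -
  have "fraction R (a' \<otimes> d' \<oplus> c' \<otimes> b') (b' \<otimes> d') = fraction R (a \<otimes> d \<oplus> c \<otimes> b) (b \<otimes> d)"
    if "(a', b') \<in> fraction R a b" "(c', d') \<in> fraction R c d" for a' b' c' d'
  proof -
    have *: "a' \<in> carrier R" "b' \<in> carrier R" "b' \<noteq> \<zero>" "a \<otimes> b' = a' \<otimes> b"
      "c' \<in> carrier R" "d' \<in> carrier R" "d' \<noteq> \<zero>" "c \<otimes> d' = c' \<otimes> d"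
      using that mem_fraction[OF ab] mem_fraction[OF cd] by auto
    have "(a \<otimes> d \<oplus> c \<otimes> b) \<otimes> (b' \<otimes> d') = (a \<otimes> b') \<otimes> (d \<otimes> d') \<oplus> (c \<otimes> d') \<otimes> (b \<otimes> b')"
      using *(1,2,5,6) ab cd by algebra
    also have "\<dots> = (a' \<otimes> d' \<oplus> c' \<otimes> b') \<otimes> (b \<otimes> d)"
      unfolding *(4,8) using *(1,2,5,6) ab cd by algebra
    finally show ?thesis using * ab cd by (subst fraction_eq) (auto dest: integral)
  qed
  then show ?thesis
    using fraction_nonempty[OF ab] fraction_nonempty[OF cd]
    by (simp add: frac_field_def) (intro UN_constant, auto)
qed

lemma frac_one: "\<one>\<^bsub>Q\<^esub> = fraction R \<one> \<one>" and frac_zero: "\<zero>\<^bsub>Q\<^esub> = fraction R \<zero> \<one>"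
  by (simp_all add: frac_field_def)

lemma frac_cring: "cring Q"
proof (rule cringI)
  have nz: "b \<in> carrier R \<Longrightarrow> d \<in> carrier R \<Longrightarrow> b \<noteq> \<zero> \<Longrightarrow> d \<noteq> \<zero> \<Longrightarrow> b \<otimes> d \<noteq> \<zero>" for b d
    using integral by blast
  show "abelian_group Q"
  proof (rule abelian_groupI)
    fix x y z assume "x \<in> carrier Q" "y \<in> carrier Q" "z \<in> carrier Q"
    obtain a b c d e f where *: "a \<in> carrier R" "b \<in> carrier R" "b \<noteq> \<zero>" "x = fraction R a b"
      "c \<in> carrier R" "d \<in> carrier R" "d \<noteq> \<zero>" "y = fraction R c d"
      "e \<in> carrier R" "f \<in> carrier R" "f \<noteq> \<zero>" "z = fraction R e f"
        using \<open>x \<in> carrier Q\<close> \<open>y \<in> carrier Q\<close> \<open>z \<in> carrier Q\<close> by (elim frac_cases) blast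
    show "x \<oplus>\<^bsub>Q\<^esub> y \<oplus>\<^bsub>Q\<^esub> z = x \<oplus>\<^bsub>Q\<^esub> (y \<oplus>\<^bsub>Q\<^esub> z)"
    proof -
      have "((a \<otimes> d \<oplus> c \<otimes> b) \<otimes> f \<oplus> e \<otimes> (b \<otimes> d)) \<otimes> (b \<otimes> (d \<otimes> f))
        = (a \<otimes> (d \<otimes> f) \<oplus> (c \<otimes> f \<oplus> e \<otimes> d) \<otimes> b) \<otimes> (b \<otimes> d \<otimes> f)" using * by algebra
      then show ?thesis using * nz by (simp add: fraction_add fraction_eq)
    qed
  next
    fix x y assume "x \<in> carrier Q" "y \<in> carrier Q"
    obtain a b c d where *: "a \<in> carrier R" "b \<in> carrier R" "b \<noteq> \<zero>" "x = fraction R a b"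
      "c \<in> carrier R" "d \<in> carrier R" "d \<noteq> \<zero>" "y = fraction R c d"
        using \<open>x \<in> carrier Q\<close> \<open>y \<in> carrier Q\<close> by (elim frac_cases) blast
    show "x \<oplus>\<^bsub>Q\<^esub> y \<in> carrier Q" using * nz by (simp add: fraction_add fraction_closed)
    have "(a \<otimes> d \<oplus> c \<otimes> b) \<otimes> (d \<otimes> b) = (c \<otimes> b \<oplus> a \<otimes> d) \<otimes> (b \<otimes> d)" using * by algebra
    then show "x \<oplus>\<^bsub>Q\<^esub> y = y \<oplus>\<^bsub>Q\<^esub> x" using * nz by (simp add: fraction_add fraction_eq)
  next
    fix x assume "x \<in> carrier Q"
    then obtain a b where *: "a \<in> carrier R" "b \<in> carrier R" "b \<noteq> \<zero>" "x = fraction R a b"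
      by (metis frac_cases)
    have "(\<zero> \<otimes> b \<oplus> a \<otimes> \<one>) \<otimes> b = a \<otimes> (\<one> \<otimes> b)" using * by algebra
    then show "\<zero>\<^bsub>Q\<^esub> \<oplus>\<^bsub>Q\<^esub> x = x" using * nz by (simp add: fraction_add fraction_eq frac_zero)
    have "(\<ominus> a \<otimes> b \<oplus> a \<otimes> b) \<otimes> \<one> = \<zero> \<otimes> (b \<otimes> b)" using * by algebra
    then have "fraction R (\<ominus> a) b \<oplus>\<^bsub>Q\<^esub> x = \<zero>\<^bsub>Q\<^esub>"
      using *(1-3) nz[OF *(2,2,3,3)] unfolding *(4) by (simp add: fraction_add fraction_eq frac_zero)
    moreover have "fraction R (\<ominus> a) b \<in> carrier Q" using *(1-3) by (simp add: fraction_closed)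
    ultimately show "\<exists>y\<in>carrier Q. y \<oplus>\<^bsub>Q\<^esub> x = \<zero>\<^bsub>Q\<^esub>" by blast
  qed (simp add: frac_zero fraction_closed)
  show "Group.comm_monoid Q"
  proof (rule comm_monoidI)
    fix x y z assume "x \<in> carrier Q" "y \<in> carrier Q" "z \<in> carrier Q"
    obtain a b c d e f where *: "a \<in> carrier R" "b \<in> carrier R" "b \<noteq> \<zero>" "x = fraction R a b"
      "c \<in> carrier R" "d \<in> carrier R" "d \<noteq> \<zero>" "y = fraction R c d"
      "e \<in> carrier R" "f \<in> carrier R" "f \<noteq> \<zero>" "z = fraction R e f"
        using \<open>x \<in> carrier Q\<close> \<open>y \<in> carrier Q\<close> \<open>z \<in> carrier Q\<close> by (elim frac_cases) blast
    show "x \<otimes>\<^bsub>Q\<^esub> y \<otimes>\<^bsub>Q\<^esub> z = x \<otimes>\<^bsub>Q\<^esub> (y \<otimes>\<^bsub>Q\<^esub> z)" using * nz by (simp add: fraction_mult m_assoc)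
  next
    fix x y assume "x \<in> carrier Q" "y \<in> carrier Q"
    obtain a b c d where *: "a \<in> carrier R" "b \<in> carrier R" "b \<noteq> \<zero>" "x = fraction R a b"
      "c \<in> carrier R" "d \<in> carrier R" "d \<noteq> \<zero>" "y = fraction R c d"
        using \<open>x \<in> carrier Q\<close> \<open>y \<in> carrier Q\<close> by (elim frac_cases) blast
    show "x \<otimes>\<^bsub>Q\<^esub> y \<in> carrier Q" using * nz by (simp add: fraction_mult fraction_closed)
    show "x \<otimes>\<^bsub>Q\<^esub> y = y \<otimes>\<^bsub>Q\<^esub> x" using * by (simp add: fraction_mult m_comm)
  next
    fix x assume "x \<in> carrier Q"
    then obtain a b where *: "a \<in> carrier R" "b \<in> carrier R" "b \<noteq> \<zero>" "x = fraction R a b"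
      by (metis frac_cases)
    then show "\<one>\<^bsub>Q\<^esub> \<otimes>\<^bsub>Q\<^esub> x = x" by (simp add: fraction_mult frac_one)
  qed (simp add: frac_one fraction_closed)
  fix x y z assume "x \<in> carrier Q" "y \<in> carrier Q" "z \<in> carrier Q"
  obtain a b c d e f where *: "a \<in> carrier R" "b \<in> carrier R" "b \<noteq> \<zero>" "x = fraction R a b"
    "c \<in> carrier R" "d \<in> carrier R" "d \<noteq> \<zero>" "y = fraction R c d"
    "e \<in> carrier R" "f \<in> carrier R" "f \<noteq> \<zero>" "z = fraction R e f"
      using \<open>x \<in> carrier Q\<close> \<open>y \<in> carrier Q\<close> \<open>z \<in> carrier Q\<close> by (elim frac_cases) blast
  have "(a \<otimes> d \<oplus> c \<otimes> b) \<otimes> e \<otimes> (b \<otimes> f \<otimes> (d \<otimes> f)) =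
    (a \<otimes> e \<otimes> (d \<otimes> f) \<oplus> c \<otimes> e \<otimes> (b \<otimes> f)) \<otimes> (b \<otimes> d \<otimes> f)" using * by algebra
  then show "(x \<oplus>\<^bsub>Q\<^esub> y) \<otimes>\<^bsub>Q\<^esub> z = x \<otimes>\<^bsub>Q\<^esub> z \<oplus>\<^bsub>Q\<^esub> y \<otimes>\<^bsub>Q\<^esub> z"
    using * nz by (simp add: fraction_add fraction_mult fraction_eq)
qed

lemma frac_is_field: "field Q"
proof (rule cring.cring_fieldI2[OF frac_cring])
  show "\<zero>\<^bsub>Q\<^esub> \<noteq> \<one>\<^bsub>Q\<^esub>" by (simp add: frac_zero frac_one fraction_eq)
  fix x assume x: "x \<in> carrier Q" "x \<noteq> \<zero>\<^bsub>Q\<^esub>"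
  then obtain a b where *: "a \<in> carrier R" "b \<in> carrier R" "b \<noteq> \<zero>" "x = fraction R a b"
    by (metis frac_cases)
  then have a: "a \<noteq> \<zero>" using x by (auto simp: frac_zero fraction_eq)
  moreover have "a \<otimes> b \<noteq> \<zero>" using a * integral by blast
  ultimately have "x \<otimes>\<^bsub>Q\<^esub> fraction R b a = \<one>\<^bsub>Q\<^esub>"
    using * by (simp add: fraction_mult frac_one fraction_eq m_comm)
  moreover have "fraction R b a \<in> carrier Q" using *(1,2) a by (simp add: fraction_closed)
  ultimately show "\<exists>y\<in>carrier Q. x \<otimes>\<^bsub>Q\<^esub> y = \<one>\<^bsub>Q\<^esub>" by blast
qed

lemma frac_emb_hom: "frac_emb R \<in> ring_hom R Q"
  by (rule ring_hom_memI) (auto simp: frac_emb_def fraction_closed fraction_mult fraction_add frac_one)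

lemma frac_emb_inj: "inj_on (frac_emb R) (carrier R)"
  by (rule inj_onI) (simp add: frac_emb_def fraction_eq)

lemma frac_emb_nonzero: "a \<in> carrier R \<Longrightarrow> a \<noteq> \<zero> \<Longrightarrow> frac_emb R a \<noteq> \<zero>\<^bsub>Q\<^esub>"
  by (simp add: frac_emb_def frac_zero fraction_eq)

lemma frac_quotient:
  assumes "x \<in> carrier Q"
  obtains a b where "a \<in> carrier R" and "b \<in> carrier R" and "b \<noteq> \<zero>"
    and "x \<otimes>\<^bsub>Q\<^esub> frac_emb R b = frac_emb R a"
proof -
  obtain a b where *: "a \<in> carrier R" "b \<in> carrier R" "b \<noteq> \<zero>" "x = fraction R a b"
    using assms by (metis frac_cases)
  then have "x \<otimes>\<^bsub>Q\<^esub> frac_emb R b = frac_emb R a"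
    by (simp add: frac_emb_def fraction_mult fraction_eq)
  then show thesis using that * by blast
qed

lemma frac_lift_fraction:
  assumes C: "field C" and h: "h \<in> ring_hom R C" and inj: "\<And>a. a \<in> carrier R \<Longrightarrow> h a = \<zero>\<^bsub>C\<^esub> \<Longrightarrow> a = \<zero>"
    and ab: "a \<in> carrier R" "b \<in> carrier R" "b \<noteq> \<zero>"
  shows "frac_lift C h (fraction R a b) = h a \<otimes>\<^bsub>C\<^esub> inv\<^bsub>C\<^esub> (h b)"
proof -
  interpret C: field C by fact
  have c: "h c \<in> carrier C" if "c \<in> carrier R" for c using h that by (rule ring_hom_closed)
  have i: "inv\<^bsub>C\<^esub> (h c) \<in> carrier C" "h c \<otimes>\<^bsub>C\<^esub> inv\<^bsub>C\<^esub> (h c) = \<one>\<^bsub>C\<^esub>"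
    if "c \<in> carrier R" "c \<noteq> \<zero>" for c
  proof -
    have "h c \<in> Units C" using inj that c C.field_Units by auto
    then show "inv\<^bsub>C\<^esub> (h c) \<in> carrier C" "h c \<otimes>\<^bsub>C\<^esub> inv\<^bsub>C\<^esub> (h c) = \<one>\<^bsub>C\<^esub>" by auto
  qed
  have "h c \<otimes>\<^bsub>C\<^esub> inv\<^bsub>C\<^esub> (h d) = h a \<otimes>\<^bsub>C\<^esub> inv\<^bsub>C\<^esub> (h b)" if "(c, d) \<in> fraction R a b" for c d
  proof -
    have *: "c \<in> carrier R" "d \<in> carrier R" "d \<noteq> \<zero>" "a \<otimes> d = c \<otimes> b"
      using that mem_fraction[OF ab] by auto
    have eq: "h a \<otimes>\<^bsub>C\<^esub> h d = h c \<otimes>\<^bsub>C\<^esub> h b"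
      using ring_hom_mult[OF h] *(1,2,4) ab by metis
    note cc = c[OF *(1)] c[OF *(2)] c[OF ab(1)] c[OF ab(2)] i[OF *(2,3)] i[OF ab(2,3)]
    have "h c \<otimes>\<^bsub>C\<^esub> inv\<^bsub>C\<^esub> (h d) = h c \<otimes>\<^bsub>C\<^esub> (h b \<otimes>\<^bsub>C\<^esub> inv\<^bsub>C\<^esub> (h b)) \<otimes>\<^bsub>C\<^esub> inv\<^bsub>C\<^esub> (h d)"
      using cc by simp
    also have "\<dots> = (h c \<otimes>\<^bsub>C\<^esub> h b) \<otimes>\<^bsub>C\<^esub> (inv\<^bsub>C\<^esub> (h b) \<otimes>\<^bsub>C\<^esub> inv\<^bsub>C\<^esub> (h d))"
      using cc(1-5,7) by (simp add: C.m_assoc)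
    also have "\<dots> = h a \<otimes>\<^bsub>C\<^esub> inv\<^bsub>C\<^esub> (h b) \<otimes>\<^bsub>C\<^esub> (h d \<otimes>\<^bsub>C\<^esub> inv\<^bsub>C\<^esub> (h d))"
      unfolding eq[symmetric] using cc(1-5,7) by (simp add: C.m_ac)
    finally show ?thesis using cc by simp
  qed
  then have "(case z of (c, d) \<Rightarrow> h c \<otimes>\<^bsub>C\<^esub> inv\<^bsub>C\<^esub> (h d)) = h a \<otimes>\<^bsub>C\<^esub> inv\<^bsub>C\<^esub> (h b)"
    if "z \<in> fraction R a b" for z using that by (cases z) simp
  then have "(\<lambda>(a, b). h a \<otimes>\<^bsub>C\<^esub> inv\<^bsub>C\<^esub> (h b)) ` fraction R a b =
      (\<lambda>z. h a \<otimes>\<^bsub>C\<^esub> inv\<^bsub>C\<^esub> (h b)) ` fraction R a b" by (rule image_cong[OF refl])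
  also have "\<dots> = {h a \<otimes>\<^bsub>C\<^esub> inv\<^bsub>C\<^esub> (h b)}" using fraction_nonempty[OF ab] by (simp only: image_constant_conv if_False)
  finally have "(\<lambda>(a, b). h a \<otimes>\<^bsub>C\<^esub> inv\<^bsub>C\<^esub> (h b)) ` fraction R a b = {h a \<otimes>\<^bsub>C\<^esub> inv\<^bsub>C\<^esub> (h b)}" .
  then show ?thesis by (simp add: frac_lift_def)
qed

lemma frac_lift_emb:
  assumes C: "field C" and h: "h \<in> ring_hom R C" and inj: "\<And>a. a \<in> carrier R \<Longrightarrow> h a = \<zero>\<^bsub>C\<^esub> \<Longrightarrow> a = \<zero>"
    and a: "a \<in> carrier R"
  shows "frac_lift C h (frac_emb R a) = h a"
proof -
  interpret C: field C by fact
  have inj': "\<And>a. a \<in> carrier R \<Longrightarrow> h a = \<zero>\<^bsub>C\<^esub> \<Longrightarrow> a = \<zero>" by (rule inj)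
  have "frac_lift C h (frac_emb R a) = h a \<otimes>\<^bsub>C\<^esub> inv\<^bsub>C\<^esub> (h \<one>)"
    unfolding frac_emb_def by (rule frac_lift_fraction[OF C h inj' a one_closed one_not_zero])
  also have "\<dots> = h a \<otimes>\<^bsub>C\<^esub> \<one>\<^bsub>C\<^esub>" unfolding ring_hom_one[OF h] by simp
  also have "\<dots> = h a" using ring_hom_closed[OF h a] by (rule C.r_one)
  finally show ?thesis .
qed

lemma frac_lift_hom:
  assumes C: "field C" and h: "h \<in> ring_hom R C" and inj: "\<And>a. a \<in> carrier R \<Longrightarrow> h a = \<zero>\<^bsub>C\<^esub> \<Longrightarrow> a = \<zero>"
  shows "frac_lift C h \<in> ring_hom Q C"
proof (rule ring_hom_memI)
  interpret C: field C by fact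
  note fl = frac_lift_fraction[OF C h inj]
  have c: "h c \<in> carrier C" if "c \<in> carrier R" for c using h that by (rule ring_hom_closed)
  have i: "inv\<^bsub>C\<^esub> (h c) \<in> carrier C" "h c \<otimes>\<^bsub>C\<^esub> inv\<^bsub>C\<^esub> (h c) = \<one>\<^bsub>C\<^esub>"
    if "c \<in> carrier R" "c \<noteq> \<zero>" for c
  proof -
    have "h c \<in> Units C" using inj that c C.field_Units by auto
    then show "inv\<^bsub>C\<^esub> (h c) \<in> carrier C" "h c \<otimes>\<^bsub>C\<^esub> inv\<^bsub>C\<^esub> (h c) = \<one>\<^bsub>C\<^esub>" by auto
  qed
  have nz: "b \<otimes> d \<noteq> \<zero>" if "b \<in> carrier R" "d \<in> carrier R" "b \<noteq> \<zero>" "d \<noteq> \<zero>" for b d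
    using integral that by blast
  have im: "inv\<^bsub>C\<^esub> (h (b \<otimes> d)) = inv\<^bsub>C\<^esub> (h b) \<otimes>\<^bsub>C\<^esub> inv\<^bsub>C\<^esub> (h d)"
    if bd: "b \<in> carrier R" "b \<noteq> \<zero>" "d \<in> carrier R" "d \<noteq> \<zero>" for b d
  proof -
    have "h (b \<otimes> d) \<otimes>\<^bsub>C\<^esub> (inv\<^bsub>C\<^esub> (h b) \<otimes>\<^bsub>C\<^esub> inv\<^bsub>C\<^esub> (h d)) =
      (h b \<otimes>\<^bsub>C\<^esub> inv\<^bsub>C\<^esub> (h b)) \<otimes>\<^bsub>C\<^esub> (h d \<otimes>\<^bsub>C\<^esub> inv\<^bsub>C\<^esub> (h d))"
      using bd c i(1) by (simp add: ring_hom_mult[OF h] C.m_ac)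
    also have "\<dots> = \<one>\<^bsub>C\<^esub>" using bd i(2) by simp
    finally show ?thesis using bd c i(1) by (intro C.comm_inv_char) auto
  qed
  show "frac_lift C h x \<in> carrier C" if "x \<in> carrier Q" for x
    using that c i(1) by (elim frac_cases) (simp add: fl)
  show "frac_lift C h \<one>\<^bsub>Q\<^esub> = \<one>\<^bsub>C\<^esub>"
    using frac_lift_emb[OF C h inj one_closed] ring_hom_one[OF h] by (simp add: frac_one frac_emb_def)
  fix x y assume "x \<in> carrier Q" "y \<in> carrier Q"
  obtain a b c' d where *: "a \<in> carrier R" "b \<in> carrier R" "b \<noteq> \<zero>" "x = fraction R a b"
    "c' \<in> carrier R" "d \<in> carrier R" "d \<noteq> \<zero>" "y = fraction R c' d"
      using \<open>x \<in> carrier Q\<close> \<open>y \<in> carrier Q\<close> by (elim frac_cases) blast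
  note cc = c[OF *(1)] c[OF *(2)] c[OF *(5)] c[OF *(6)] i[OF *(2,3)] i[OF *(6,7)]
  show "frac_lift C h (x \<otimes>\<^bsub>Q\<^esub> y) = frac_lift C h x \<otimes>\<^bsub>C\<^esub> frac_lift C h y"
    using *(1-8) nz cc(1-5,7) by (simp add: fraction_mult fl im ring_hom_mult[OF h *(1) *(5)] C.m_ac)
  have "(h a \<otimes>\<^bsub>C\<^esub> h d \<oplus>\<^bsub>C\<^esub> h c' \<otimes>\<^bsub>C\<^esub> h b) \<otimes>\<^bsub>C\<^esub> (inv\<^bsub>C\<^esub> (h b) \<otimes>\<^bsub>C\<^esub> inv\<^bsub>C\<^esub> (h d)) =
    h a \<otimes>\<^bsub>C\<^esub> inv\<^bsub>C\<^esub> (h b) \<otimes>\<^bsub>C\<^esub> (h d \<otimes>\<^bsub>C\<^esub> inv\<^bsub>C\<^esub> (h d)) \<oplus>\<^bsub>C\<^esub>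
    h c' \<otimes>\<^bsub>C\<^esub> inv\<^bsub>C\<^esub> (h d) \<otimes>\<^bsub>C\<^esub> (h b \<otimes>\<^bsub>C\<^esub> inv\<^bsub>C\<^esub> (h b))"
    using cc(1-5,7) by algebra
  also have "\<dots> = h a \<otimes>\<^bsub>C\<^esub> inv\<^bsub>C\<^esub> (h b) \<oplus>\<^bsub>C\<^esub> h c' \<otimes>\<^bsub>C\<^esub> inv\<^bsub>C\<^esub> (h d)"
    using cc by simp
  finally show "frac_lift C h (x \<oplus>\<^bsub>Q\<^esub> y) = frac_lift C h x \<oplus>\<^bsub>C\<^esub> frac_lift C h y"
    using * nz by (simp add: fraction_add fl im ring_hom_mult[OF h *(1) *(6)] ring_hom_mult[OF h *(5) *(2)] ring_hom_add[OF h])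
qed

end

section \<open>Purely inseparable roots\<close>

text \<open>Both structures share their additive part, so sums in the module can be computed in the
  ring.\<close>

lemma finsum_ring_module: "finsum (ring_module C \<sigma>) f S = finsum C f S"
  by (simp add: finsum_def finprod_def ring_module_def)

text \<open>The list is \<open>X^n - y\<close> with the leading coefficient first, which accounts
  for the \<open>n - 1\<close> zeros.\<close>

lemma (in ring) eval_pure_polynomial:
  assumes "x \<in> carrier R" and "y \<in> carrier R" and "0 < n"
  shows "eval (\<one> # replicate (n - 1) \<zero> @ [\<ominus> y]) x = x [^] n \<ominus> y"
proof -
  have rep: "eval (replicate m \<zero> @ [\<ominus> y]) x = \<ominus> y" for m
    using assms(1,2) by (induction m) auto
  have "eval (\<one> # replicate (n - 1) \<zero> @ [\<ominus> y]) x = \<one> \<otimes> x [^] n \<oplus> eval (replicate (n - 1) \<zero> @ [\<ominus> y]) x"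
    using assms(3) by simp
  then show ?thesis using assms(1) by (simp only: rep l_one nat_pow_closed a_minus_def)
qed

lemma (in algebraically_closed) root_exists:
  assumes y: "y \<in> carrier L" and n: "0 < n"
  obtains x where "x \<in> carrier L" and "x [^] (n::nat) = y"
proof -
  let ?P = "\<one> # replicate (n - 1) \<zero> @ [\<ominus> y]"
  have P: "?P \<in> carrier (poly_ring L)"
    using y by (auto simp: univ_poly_carrier[symmetric] polynomial_def)
  have "degree ?P = n" using n by simp
  then have "size (roots ?P) = n" using roots_over_carrier[OF P] by (simp add: splitted_def)
  then obtain x where "x \<in># roots ?P" using n by (metis multiset_nonemptyE size_empty less_irrefl)
  then have "is_root ?P x" using roots_mem_iff_is_root[OF P] by blast
  then have x: "x \<in> carrier L" "eval ?P x = \<zero>" by (auto simp: is_root_def)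
  have "x [^] n \<oplus> \<ominus> y = \<zero>"
    using eval_pure_polynomial[OF x(1) y n] x(2) unfolding a_minus_def by (simp only:)
  then have "x [^] n = y" using x y minus_equality[of "x [^] n" "\<ominus> y"] by simp
  then show thesis using that x by blast
qed

locale root_tower = K: field K for K :: "'k ring" +
  fixes p :: nat
  assumes prime: "Factorial_Ring.prime p" and char: "add_pow K p \<one>\<^bsub>K\<^esub> = \<zero>\<^bsub>K\<^esub>"
begin

abbreviation "Om \<equiv> ac K"
abbreviation "em \<equiv> ac_emb K"
abbreviation "KK \<equiv> carrier K"

lemma p_pos: "0 < p"
  using prime prime_gt_0_nat by blast

lemma Om_closed: "algebraically_closed Om" and em_hom: "em \<in> ring_hom K Om"
proof -
  have "algebraic_closure Om (em ` KK)" unfolding ac_def ac_emb_def by (rule K.alg_closureE(1))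
  then interpret algebraic_closure Om "em ` KK" .
  show "algebraically_closed Om" by (rule algebraically_closed_axioms)
  show "em \<in> ring_hom K Om" unfolding ac_def ac_emb_def by (rule K.alg_closureE(2))
qed

end

sublocale root_tower \<subseteq> Om: algebraically_closed "ac K"
  by (rule Om_closed)

context root_tower
begin

lemma em_closed: "c \<in> KK \<Longrightarrow> em c \<in> carrier Om"
  using em_hom by (rule ring_hom_closed)

lemma em_subfield: "subfield (em ` KK) Om"
proof -
  interpret h: ring_hom_ring K Om em
    by (rule ring_hom_ringI2[OF K.ring_axioms Om.ring_axioms em_hom])
  show ?thesis using h.img_is_subfield(2)[OF K.carrier_is_subfield] by simp
qed

lemma Om_char: "add_pow Om p \<one>\<^bsub>Om\<^esub> = \<zero>\<^bsub>Om\<^esub>"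
proof -
  have "em (add_pow K p \<one>\<^bsub>K\<^esub>) = add_pow Om p (em \<one>\<^bsub>K\<^esub>)"
    by (rule ring_hom_add_pow[OF K.ring_axioms Om.ring_axioms em_hom K.one_closed])
  moreover have "em \<zero>\<^bsub>K\<^esub> = \<zero>\<^bsub>Om\<^esub>"
    using ring_hom_zero[OF em_hom K.ring_axioms Om.ring_axioms] .
  ultimately show ?thesis using char ring_hom_one[OF em_hom] by simp
qed

lemma Om_frob: "ring_hom_ring Om Om (\<lambda>x. x [^]\<^bsub>Om\<^esub> (p ^ n))"
  by (rule ring_hom_ringI2[OF Om.ring_axioms Om.ring_axioms Om.frobenius_hom[OF prime Om_char]])

lemma Om_frob_inj:
  assumes "x \<in> carrier Om" "y \<in> carrier Om" "x [^]\<^bsub>Om\<^esub> (p ^ n) = y [^]\<^bsub>Om\<^esub> (p ^ n)"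
  shows "x = y"
proof -
  interpret f: ring_hom_ring Om Om "\<lambda>x. x [^]\<^bsub>Om\<^esub> (p ^ n)" by (rule Om_frob)
  have "(x \<ominus>\<^bsub>Om\<^esub> y) [^]\<^bsub>Om\<^esub> (p ^ n) = \<zero>\<^bsub>Om\<^esub>"
    using assms f.hom_add[of x "\<ominus>\<^bsub>Om\<^esub> y"] f.hom_a_inv[of y] by (simp add: Om.minus_eq Om.r_neg)
  then have "x \<ominus>\<^bsub>Om\<^esub> y = \<zero>\<^bsub>Om\<^esub>" using Om.pow_nonzero[of "x \<ominus>\<^bsub>Om\<^esub> y" "p ^ n"] assms by auto
  then show ?thesis using assms by simp
qed

lemma em_pow: "c \<in> KK \<Longrightarrow> em (c [^]\<^bsub>K\<^esub> (n::nat)) = em c [^]\<^bsub>Om\<^esub> n"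
proof (induction n)
  case (Suc n)
  then show ?case using ring_hom_mult[OF em_hom, of "c [^]\<^bsub>K\<^esub> n" c] by simp
qed (use ring_hom_one[OF em_hom] in simp)

definition "E n = p_roots K p n KK"

lemma mem_E: "x \<in> E n \<longleftrightarrow> x \<in> carrier Om \<and> x [^]\<^bsub>Om\<^esub> (p ^ n) \<in> em ` KK"
  by (simp add: E_def p_roots_def)

lemma root_field_eq: "root_field K p n = Om\<lparr>carrier := E n\<rparr>"
  by (simp add: root_field_def E_def)

lemma E_subfield: "subfield (E n) Om"
proof (rule Om.subfieldI')
  interpret f: ring_hom_ring Om Om "\<lambda>x. x [^]\<^bsub>Om\<^esub> (p ^ n)" by (rule Om_frob)
  note s = subfieldE[OF em_subfield]
  have sr: "subring (em ` KK) Om" using s by blast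
  show "subring (E n) Om"
  proof (rule Om.subringI)
    show "E n \<subseteq> carrier Om" by (auto simp: mem_E)
    show "\<one>\<^bsub>Om\<^esub> \<in> E n" using subringE(3)[OF sr] by (simp add: mem_E)
    fix x y assume x: "x \<in> E n" and y: "y \<in> E n"
    then show "x \<otimes>\<^bsub>Om\<^esub> y \<in> E n"
      using f.hom_mult[of x y] subringE(6)[OF sr] by (simp add: mem_E)
    show "x \<oplus>\<^bsub>Om\<^esub> y \<in> E n"
      using x y f.hom_add[of x y] subringE(7)[OF sr] by (simp add: mem_E)
    show "\<ominus>\<^bsub>Om\<^esub> x \<in> E n"
      using x f.hom_a_inv[of x] subringE(5)[OF sr] by (simp add: mem_E)
  qed
  fix x assume x: "x \<in> E n - {\<zero>\<^bsub>Om\<^esub>}"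
  then have xc: "x \<in> carrier Om" "x \<noteq> \<zero>\<^bsub>Om\<^esub>" "x [^]\<^bsub>Om\<^esub> (p ^ n) \<in> em ` KK" by (auto simp: mem_E)
  have xu: "x \<in> Units Om" using xc Om.field_Units by simp
  have pn: "x [^]\<^bsub>Om\<^esub> (p ^ n) \<noteq> \<zero>\<^bsub>Om\<^esub>" using xc Om.pow_nonzero by blast
  then have "inv\<^bsub>Om\<^esub> (x [^]\<^bsub>Om\<^esub> (p ^ n)) \<in> em ` KK"
    using Om.subfield_m_inv(1)[OF em_subfield] xc(3) by blast
  moreover have "(inv\<^bsub>Om\<^esub> x) [^]\<^bsub>Om\<^esub> (p ^ n) = inv\<^bsub>Om\<^esub> (x [^]\<^bsub>Om\<^esub> (p ^ n))"
  proof (rule Om.comm_inv_char[symmetric])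
    show "x [^]\<^bsub>Om\<^esub> (p ^ n) \<otimes>\<^bsub>Om\<^esub> (inv\<^bsub>Om\<^esub> x) [^]\<^bsub>Om\<^esub> (p ^ n) = \<one>\<^bsub>Om\<^esub>"
      using f.hom_mult[of x "inv\<^bsub>Om\<^esub> x"] xu xc by simp
  qed (use xc xu in auto)
  ultimately show "inv\<^bsub>Om\<^esub> x \<in> E n" using xu by (simp add: mem_E)
qed

lemma root_field_field: "field (root_field K p n)"
  unfolding root_field_eq by (rule Om.subfield_iff(2)[OF E_subfield])

lemma em_root_hom: "em \<in> ring_hom K (root_field K p n)"
proof -
  have "em c \<in> E n" if "c \<in> KK" for c
    using that em_pow[OF that, of "p ^ n"] em_closed by (auto simp: mem_E simp flip: em_pow)
  then show ?thesis using em_hom by (simp add: ring_hom_def root_field_eq Pi_iff)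
qed

lemma E_Suc: "x \<in> carrier Om \<Longrightarrow> x [^]\<^bsub>Om\<^esub> p \<in> E n \<longleftrightarrow> x \<in> E (Suc n)"
  by (simp add: mem_E Om.nat_pow_pow)

lemma E_mono: "E n \<subseteq> E (Suc n)"
proof
  fix x assume x: "x \<in> E n"
  have sr: "subring (E n) Om" using subfieldE(1)[OF E_subfield] .
  have "x [^]\<^bsub>Om\<^esub> (m::nat) \<in> E n" for m
    using x subringE(3,6)[OF sr] by (induction m) auto
  then show "x \<in> E (Suc n)" using E_Suc[of x n] x by (simp add: mem_E)
qed

lemma p_root_exists:
  assumes "y \<in> E n"
  obtains x where "x \<in> E (Suc n)" and "x [^]\<^bsub>Om\<^esub> p = y"
proof -
  obtain x where x: "x \<in> carrier Om" "x [^]\<^bsub>Om\<^esub> p = y"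
    using Om.root_exists[OF _ p_pos] assms by (metis mem_E)
  then show thesis using that E_Suc assms by blast
qed

lemma E_0: "E 0 = em ` KK"
  using em_closed by (auto simp: mem_E)

lemma subring_finprod_closed:
  assumes "subring H K" and "finite S" and "\<And>i. i \<in> S \<Longrightarrow> f i \<in> H"
  shows "finprod K f S \<in> H"
  using assms(2,3)
proof (induction S rule: finite_induct)
  case (insert i S)
  have "f \<in> S \<rightarrow> KK" "f i \<in> KK" using insert subringE(1)[OF assms(1)] by auto
  then show ?case using insert subringE(6)[OF assms(1)] by (simp add: K.finprod_insert)
qed (use subringE(3)[OF assms(1)] in simp)

lemma subring_finsum_closed:
  assumes "subring H K" and "finite S" and "\<And>i. i \<in> S \<Longrightarrow> f i \<in> H"
  shows "finsum K f S \<in> H"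
  using assms(2,3)
proof (induction S rule: finite_induct)
  case (insert i S)
  have "f \<in> S \<rightarrow> KK" "f i \<in> KK" using insert subringE(1)[OF assms(1)] by auto
  then show ?case using insert subringE(7)[OF assms(1)] by (simp add: K.finsum_insert)
qed (use subringE(2)[OF assms(1)] in simp)

text \<open>Every element is a sum of reduced monomials in \<open>B\<close> with coefficients that
  are \<open>p\<close>-th powers; \<open>H\<close> contains both kinds of factors and is closed
  under the operations.\<close>

lemma p_basis_generates:
  assumes "p_basis K p B" and "subring H K" and "B \<subseteq> H" and "\<And>d. d \<in> KK \<Longrightarrow> d [^]\<^bsub>K\<^esub> p \<in> H"
  shows "KK \<subseteq> H"
proof
  fix c assume c: "c \<in> KK"
  have sp: "spanning (K\<lparr>carrier := (\<lambda>x. x [^]\<^bsub>K\<^esub> p) ` KK\<rparr>) (ring_module K (\<lambda>c. c)) (p_exponents p B) (monomial K)"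
    using assms(1) by (simp add: p_basis_def Let_def)
  moreover have "c \<in> carrier (ring_module K (\<lambda>c. c))" using c by (simp add: ring_module_def)
  ultimately have "\<exists>S a. finite S \<and> S \<subseteq> p_exponents p B \<and> a \<in> S \<rightarrow> (\<lambda>x. x [^]\<^bsub>K\<^esub> p) ` KK \<and>
    c = (\<Oplus>\<^bsub>ring_module K (\<lambda>c. c)\<^esub>i\<in>S. a i \<odot>\<^bsub>ring_module K (\<lambda>c. c)\<^esub> monomial K i)"
    unfolding spanning_def by simp
  then obtain S a where S: "finite S" "S \<subseteq> p_exponents p B" "a \<in> S \<rightarrow> (\<lambda>x. x [^]\<^bsub>K\<^esub> p) ` KK"
    and "c = (\<Oplus>\<^bsub>ring_module K (\<lambda>c. c)\<^esub>i\<in>S. a i \<odot>\<^bsub>ring_module K (\<lambda>c. c)\<^esub> monomial K i)" by blast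
  then have ceq: "c = (\<Oplus>\<^bsub>K\<^esub>i\<in>S. a i \<otimes>\<^bsub>K\<^esub> monomial K i)"
    unfolding finsum_ring_module by (simp add: ring_module_def)
  have pow: "b [^]\<^bsub>K\<^esub> (m::nat) \<in> H" if "b \<in> B" for b m
    using that assms(3) subringE(3,6)[OF assms(2)] by (induction m) auto
  have "a e \<otimes>\<^bsub>K\<^esub> monomial K e \<in> H" if "e \<in> S" for e
  proof -
    have e: "finite {b. e b \<noteq> 0}" "{b. e b \<noteq> 0} \<subseteq> B" using S(2) that by (auto simp: p_exponents_def)
    have "monomial K e \<in> H"
      unfolding monomial_def
    proof (rule subring_finprod_closed[OF assms(2) e(1)])
      show "b [^]\<^bsub>K\<^esub> e b \<in> H" if "b \<in> {b. e b \<noteq> 0}" for b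
        using pow[OF subsetD[OF e(2) that]] .
    qed
    moreover have "a e \<in> H"
    proof -
      have "a e \<in> (\<lambda>x. x [^]\<^bsub>K\<^esub> p) ` KK" using S(3) that by (rule funcset_mem)
      then show ?thesis using assms(4) by (elim imageE) simp
    qed
    ultimately show ?thesis by (intro subringE(6)[OF assms(2)])
  qed
  then show "c \<in> H" unfolding ceq by (intro subring_finsum_closed[OF assms(2) S(1)])
qed

text \<open>Induction on \<open>n\<close>. The elements of \<open>K\<close> whose root of order
  \<open>p^(n+1)\<close> lies in the generated field form a subring. It contains \<open>B\<close> by
  construction and the \<open>p\<close>-th powers by the induction hypothesis, hence all of
  \<open>K\<close>.\<close>

lemma E_adjoin:
  assumes B: "p_basis K p B"
  shows "E n = generate_field Om (em ` KK \<union> p_roots K p n B)" (is "_ = ?G n")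
proof -
  have BK: "B \<subseteq> KK" using B by (simp add: p_basis_def)
  have in_carrier: "em ` KK \<union> p_roots K p n B \<subseteq> carrier Om" for n
    using em_closed by (auto simp: p_roots_def)
  have G: "subfield (?G n) Om" for n by (rule Om.generate_field_is_subfield[OF in_carrier])
  have incl: "em ` KK \<subseteq> ?G n" "p_roots K p n B \<subseteq> ?G n" for n
    by (auto intro: generate_field.incl)
  have step: "?G n \<subseteq> ?G (Suc n)" for n
  proof (rule Om.generate_field_min_subfield1[OF in_carrier G])
    have "y \<in> ?G (Suc n)" if y: "y \<in> p_roots K p n B" for y
    proof -
      \<comment> \<open>A root of order \<open>p^n\<close> of an element of \<open>B\<close> is the
        \<open>p\<close>-th power of one of order \<open>p^(n+1)\<close>, so the generated fields
        increase with \<open>n\<close>.\<close>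
      obtain w where w: "w \<in> carrier Om" "w [^]\<^bsub>Om\<^esub> p = y"
        using Om.root_exists[OF _ p_pos] y by (metis (no_types, lifting) mem_Collect_eq p_roots_def)
      then have "w \<in> p_roots K p (Suc n) B" using y by (simp add: p_roots_def Om.nat_pow_pow flip: w(2))
      then have wG: "w \<in> ?G (Suc n)" using incl by blast
      have "w [^]\<^bsub>Om\<^esub> (m::nat) \<in> ?G (Suc n)" for m
        using wG subringE(3,6)[OF subfieldE(1)[OF G]] by (induction m) auto
      then show ?thesis using w by blast
    qed
    then show "em ` KK \<union> p_roots K p n B \<subseteq> ?G (Suc n)" using incl(1) by blast
  qed
  have sub: "E n \<subseteq> ?G n" for n
  proof (induction n)
    case 0
    show ?case using E_0 incl(1) by simp
  next
    case (Suc n)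
    define H where "H = {c \<in> KK. \<exists>x\<in>?G (Suc n). x [^]\<^bsub>Om\<^esub> (p ^ Suc n) = em c}"
    interpret f: ring_hom_ring Om Om "\<lambda>x. x [^]\<^bsub>Om\<^esub> (p ^ Suc n)" by (rule Om_frob)
    note GG = subringE[OF subfieldE(1)[OF G[of "Suc n"]]]
    have Gc: "x \<in> carrier Om" if "x \<in> ?G (Suc n)" for x using GG(1) that by blast
    have "subring H K"
    proof (rule K.subringI)
      show "H \<subseteq> KK" by (auto simp: H_def)
      show "\<one>\<^bsub>K\<^esub> \<in> H" using GG(3) ring_hom_one[OF em_hom]
        by (auto simp: H_def intro!: bexI[of _ "\<one>\<^bsub>Om\<^esub>"])
      fix c d assume "c \<in> H" "d \<in> H"
      then obtain x y where xy: "c \<in> KK" "d \<in> KK" "x \<in> ?G (Suc n)" "y \<in> ?G (Suc n)"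
        "x [^]\<^bsub>Om\<^esub> (p ^ Suc n) = em c" "y [^]\<^bsub>Om\<^esub> (p ^ Suc n) = em d" unfolding H_def by blast
      note xyc = Gc[OF xy(3)] Gc[OF xy(4)]
      have "(x \<otimes>\<^bsub>Om\<^esub> y) [^]\<^bsub>Om\<^esub> (p ^ Suc n) = em (c \<otimes>\<^bsub>K\<^esub> d)"
        using f.hom_mult[OF xyc] xy(5,6) ring_hom_mult[OF em_hom xy(1,2)] by (simp only:)
      then show "c \<otimes>\<^bsub>K\<^esub> d \<in> H" using GG(6)[OF xy(3,4)] xy(1,2) unfolding H_def by blast
      have "(x \<oplus>\<^bsub>Om\<^esub> y) [^]\<^bsub>Om\<^esub> (p ^ Suc n) = em (c \<oplus>\<^bsub>K\<^esub> d)"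
        using f.hom_add[OF xyc] xy(5,6) ring_hom_add[OF em_hom xy(1,2)] by (simp only:)
      then show "c \<oplus>\<^bsub>K\<^esub> d \<in> H" using GG(7)[OF xy(3,4)] xy(1,2) unfolding H_def by blast
      interpret h: ring_hom_ring K Om em
        by (rule ring_hom_ringI2[OF K.ring_axioms Om.ring_axioms em_hom])
      have "(\<ominus>\<^bsub>Om\<^esub> x) [^]\<^bsub>Om\<^esub> (p ^ Suc n) = em (\<ominus>\<^bsub>K\<^esub> c)"
        using f.hom_a_inv[OF xyc(1)] xy(5) h.hom_a_inv[OF xy(1)] by (simp only:)
      then show "\<ominus>\<^bsub>K\<^esub> c \<in> H" using GG(5)[OF xy(3)] xy(1) unfolding H_def by blast
    qed
    moreover have "B \<subseteq> H"
    proof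
      fix b assume b: "b \<in> B"
      then have "em b \<in> carrier Om" using BK em_closed by blast
      then obtain x where x: "x \<in> carrier Om" "x [^]\<^bsub>Om\<^esub> (p ^ Suc n) = em b"
        using Om.root_exists[of "em b" "p ^ Suc n"] p_pos by auto
      then have "x \<in> p_roots K p (Suc n) B" using b unfolding p_roots_def by blast
      then show "b \<in> H" using x b BK incl(2) unfolding H_def by blast
    qed
    moreover have "d [^]\<^bsub>K\<^esub> p \<in> H" if d: "d \<in> KK" for d
    proof -
      obtain x where x: "x \<in> carrier Om" "x [^]\<^bsub>Om\<^esub> (p ^ n) = em d"
        using Om.root_exists[of "em d" "p ^ n"] p_pos em_closed[OF d] by auto
      then have "x \<in> E n" using d by (simp add: mem_E)
      then have "x \<in> ?G (Suc n)" using Suc step by blast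
      moreover have "x [^]\<^bsub>Om\<^esub> (p ^ Suc n) = (x [^]\<^bsub>Om\<^esub> (p ^ n)) [^]\<^bsub>Om\<^esub> p"
        using x(1) by (simp add: Om.nat_pow_pow mult.commute)
      then have "x [^]\<^bsub>Om\<^esub> (p ^ Suc n) = em (d [^]\<^bsub>K\<^esub> p)" using x(2) em_pow[OF d] by simp
      ultimately show ?thesis using d unfolding H_def by blast
    qed
    ultimately have KH: "KK \<subseteq> H" using p_basis_generates[OF B] by blast
    show ?case
    proof
      fix x assume x: "x \<in> E (Suc n)"
      then obtain c where c: "c \<in> KK" "x [^]\<^bsub>Om\<^esub> (p ^ Suc n) = em c" unfolding mem_E by blast
      then obtain y where y: "y \<in> ?G (Suc n)" "y [^]\<^bsub>Om\<^esub> (p ^ Suc n) = em c"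
        using KH unfolding H_def by blast
      \<comment> \<open>Roots of order \<open>p^(n+1)\<close> are unique in characteristic
        \<open>p\<close>, so the root found in the generated field is the given one.\<close>
      have "x = y" using Om_frob_inj[of x y "Suc n"] x y c(2) Gc[OF y(1)] mem_E by metis
      then show "x \<in> ?G (Suc n)" using y by blast
    qed
  qed
  have "em ` KK \<subseteq> E n" using ring_hom_closed[OF em_root_hom] by (auto simp: root_field_eq)
  moreover have "p_roots K p n B \<subseteq> E n" using BK by (auto simp: p_roots_def mem_E)
  ultimately have "?G n \<subseteq> E n" by (intro Om.generate_field_min_subfield1[OF in_carrier E_subfield]) auto
  then show ?thesis using sub by blast
qed

lemma adjoin_roots_eq: "p_basis K p B \<Longrightarrow> adjoin_roots K p B n = root_field K p n"
  using E_adjoin by (simp add: adjoin_roots_def root_field_eq)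

end

section \<open>Discrete valuation rings and linear functionals\<close>

text \<open>In a principal ideal domain an irreducible element generates a maximal ideal. There is
  only one, so all irreducibles are associated to its generator \<open>t\<close>, and a
  factorization into irreducibles becomes a unit times a power of \<open>t\<close>.\<close>

lemma dvr_factorization:
  fixes R :: "'r ring" (structure)
  assumes "dvr R"
  obtains t where "t \<in> carrier R" and "t \<noteq> \<zero>\<^bsub>R\<^esub>" and "max_ideal R = genideal R {t}"
    and "\<And>x. x \<in> carrier R \<Longrightarrow> t \<otimes>\<^bsub>R\<^esub> x \<noteq> \<one>\<^bsub>R\<^esub>"
    and "\<And>x. x \<in> carrier R \<Longrightarrow> x \<noteq> \<zero>\<^bsub>R\<^esub> \<Longrightarrow>
      \<exists>n u w. u \<in> carrier R \<and> w \<in> carrier R \<and> u \<otimes>\<^bsub>R\<^esub> w = \<one>\<^bsub>R\<^esub> \<and> x = u \<otimes>\<^bsub>R\<^esub> t [^]\<^bsub>R\<^esub> (n::nat)"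
proof -
  interpret principal_domain R using assms by (simp add: dvr_def)
  have ex1: "\<exists>!M. maximalideal M R" and nf: "\<not> field R" using assms by (auto simp: dvr_def)
  have M: "maximalideal (max_ideal R) R" unfolding max_ideal_def using ex1 by (rule theI')
  have uniq: "N = max_ideal R" if "maximalideal N R" for N using ex1 M that by blast
  obtain t where t: "t \<in> carrier R" "max_ideal R = cgenideal R t"
    using exists_gen[OF maximalideal.axioms(1)[OF M]] by blast
  have t0: "t \<noteq> \<zero>"
  proof
    assume "t = \<zero>"
    then have "max_ideal R = {\<zero>}" using t(2) cgenideal_eq_genideal[OF zero_closed] genideal_zero by simp
    then show False using M zeromaximalideal_fieldI nf by simp
  qed
  have tn: "t \<otimes> x \<noteq> \<one>" if x: "x \<in> carrier R" for x
  proof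
    assume tx: "t \<otimes> x = \<one>"
    then have "x \<otimes> t = \<one>" using x t m_comm by simp
    then have "t \<in> Units R" using tx t x unfolding Units_def by blast
    then have "carrier R = max_ideal R" using ideal_eq_carrier_iff[OF t(1)] t(2) by simp
    then show False using maximalideal.I_notcarr[OF M] by simp
  qed
  \<comment> \<open>The induction over the factors works with \<open>Units\<close>;
    \<open>good\<close> spells out the inverse, which is the form used after transport to subrings
    of a field.\<close>
  define good where "good x \<longleftrightarrow> (\<exists>n u w. u \<in> carrier R \<and> w \<in> carrier R \<and> u \<otimes> w = \<one> \<and> x = u \<otimes> t [^] (n::nat))" for x
  have irr: "\<exists>u\<in>Units R. q = u \<otimes> t" if q: "q \<in> carrier R" "q \<noteq> \<zero>" "irreducible (mult_of R) q" for q
  proof -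
    have "ring_irreducible q" using q by (intro ring_irreducibleI') auto
    then have "maximalideal (cgenideal R q) R" by (rule irreducible_imp_maximalideal[OF q(1)])
    then have "cgenideal R q = cgenideal R t" using uniq t(2) by simp
    then have "q \<sim> t" using associated_iff_same_ideal[OF q(1) t(1)] by simp
    then show ?thesis using ring_associated_iff[OF q(1) t(1)] by simp
  qed
  have unit_good: "good (v \<otimes> t [^] (n::nat))" if v: "v \<in> Units R" for v n
    unfolding good_def using Units_closed[OF v] Units_inv_closed[OF v] Units_r_inv[OF v] by blast
  have good_unit: "\<exists>v\<in>Units R. \<exists>n. x = v \<otimes> t [^] (n::nat)" if gx: "good x" for x
  proof -
    obtain n u w where u: "u \<in> carrier R" "w \<in> carrier R" "u \<otimes> w = \<one>" "x = u \<otimes> t [^] (n::nat)"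
      using gx unfolding good_def by blast
    have "w \<otimes> u = \<one>" using u m_comm by simp
    then have "u \<in> Units R" using u unfolding Units_def by blast
    then show ?thesis using u by blast
  qed
  have all_good: "good x" if x: "x \<in> carrier R" "x \<noteq> \<zero>" for x
  proof (cases "x \<in> Units R")
    case True
    then show ?thesis using unit_good[of x 0] x by simp
  next
    case False
    then obtain fs where fs: "set fs \<subseteq> carrier (mult_of R)" "wfactors (mult_of R) fs x"
      using factorization_property[of x] x by blast
    have irrfs: "\<forall>q\<in>set fs. irreducible (mult_of R) q" and
      as: "foldr (\<otimes>) fs \<one> \<sim>\<^bsub>mult_of R\<^esub> x" using fs(2) unfolding wfactors_def by auto
    have "good (foldr (\<otimes>) fs \<one>) \<and> foldr (\<otimes>) fs \<one> \<in> carrier R"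
      using fs(1) irrfs
    proof (induction fs)
      case Nil
      show ?case using unit_good[of \<one> 0] by simp
    next
      case (Cons q fs)
      then have q: "q \<in> carrier R" "q \<noteq> \<zero>" by auto
      obtain u where u: "u \<in> Units R" "q = u \<otimes> t" using irr[OF q] Cons.prems by auto
      obtain v n where v: "v \<in> Units R" "foldr (\<otimes>) fs \<one> = v \<otimes> t [^] (n::nat)"
        using good_unit[of "foldr (\<otimes>) fs \<one>"] Cons by auto
      have c: "u \<in> carrier R" "v \<in> carrier R" using u v by auto
      have "q \<otimes> foldr (\<otimes>) fs \<one> = (u \<otimes> v) \<otimes> t [^] Suc n"
        unfolding u(2) v(2) using c t(1) by (simp add: m_ac)
      then show ?case using unit_good[OF Units_m_closed[OF u(1) v(1)], of "Suc n"] q Cons c t(1) by simp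
    qed
    \<comment> \<open>\<open>wfactors\<close> speaks about the monoid of nonzero elements;
      association there has to be carried back to the ring.\<close>
    moreover have "foldr (\<otimes>) fs \<one> \<sim> x"
    proof -
      have "foldr (\<otimes>) fs \<one> \<in> carrier (mult_of R)"
        using fs(1) by (induction fs) (auto simp: integral_iff)
      then show ?thesis using assoc_iff_assoc_mult[of "foldr (\<otimes>) fs \<one>" x] as x by simp
    qed
    ultimately have "\<exists>u\<in>Units R. x = u \<otimes> foldr (\<otimes>) fs \<one>"
      using ring_associated_iff[OF x(1)] associated_sym by blast
    then obtain u where u: "u \<in> Units R" "x = u \<otimes> foldr (\<otimes>) fs \<one>" by blast
    obtain v n where v: "v \<in> Units R" "foldr (\<otimes>) fs \<one> = v \<otimes> t [^] (n::nat)"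
      using good_unit \<open>good (foldr (\<otimes>) fs \<one>) \<and> _\<close> by blast
    have "x = (u \<otimes> v) \<otimes> t [^] n" unfolding u(2) v(2)
      using Units_closed[OF u(1)] Units_closed[OF v(1)] t(1) by (simp add: m_assoc)
    then show ?thesis using unit_good[OF Units_m_closed[OF u(1) v(1)]] by simp
  qed
  show thesis
  proof (rule that[OF t(1) t0])
    show "max_ideal R = genideal R {t}" using t(2) cgenideal_eq_genideal[OF t(1)] by simp
  qed (use tn all_good in \<open>auto simp: good_def\<close>)
qed

text \<open>A functional killing \<open>V\<close> but not \<open>x\<close>, obtained from a maximal subspace that contains \<open>V\<close>
  and avoids \<open>x\<close>.\<close>

lemma linear_functional:
  fixes K :: "'k ring" and R :: "'r ring"
  assumes K: "field K" and R: "cring R" and iota: "\<iota> \<in> ring_hom K R"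
    and V: "V \<in> ring.subsp R (\<iota> ` carrier K)" and x: "x \<in> carrier R" "x \<notin> V"
  obtains l where "\<And>y. y \<in> carrier R \<Longrightarrow> l y \<in> carrier K"
    and "\<And>y z. y \<in> carrier R \<Longrightarrow> z \<in> carrier R \<Longrightarrow> l (y \<oplus>\<^bsub>R\<^esub> z) = l y \<oplus>\<^bsub>K\<^esub> l z"
    and "\<And>c y. c \<in> carrier K \<Longrightarrow> y \<in> carrier R \<Longrightarrow> l (\<iota> c \<otimes>\<^bsub>R\<^esub> y) = c \<otimes>\<^bsub>K\<^esub> l y"
    and "\<And>v. v \<in> V \<Longrightarrow> l v = \<zero>\<^bsub>K\<^esub>" and "l x = \<one>\<^bsub>K\<^esub>"
proof -
  interpret K: field K by fact
  interpret R: cring R by fact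
  interpret h: ring_hom_ring K R \<iota> by (rule ring_hom_ringI2[OF K.ring_axioms R.ring_axioms iota])
  let ?k = "\<iota> ` carrier K"
  have kR: "?k \<subseteq> carrier R" by auto
  have ksub: "subring ?k R" using h.img_is_subring[OF K.carrier_is_subring] .
  define A where "A = {H \<in> R.subsp ?k. V \<subseteq> H \<and> x \<notin> H}"
  have "\<exists>H\<in>A. \<forall>Y\<in>A. H \<subseteq> Y \<longrightarrow> Y = H"
  proof (rule subset_Zorn_nonempty)
    show "A \<noteq> {}" using V x by (auto simp: A_def)
    fix C assume C: "C \<noteq> {}" "subset.chain A C"
    then have CA: "C \<subseteq> A" and lin: "\<And>X' Y. X' \<in> C \<Longrightarrow> Y \<in> C \<Longrightarrow> X' \<subseteq> Y \<or> Y \<subseteq> X'"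
      by (auto simp: subset.chain_def)
    have mem: "\<And>Z. Z \<in> C \<Longrightarrow> Z \<in> R.subsp ?k" using CA by (auto simp: A_def)
    have "\<Union>C \<in> R.subsp ?k"
    proof (rule R.subspI)
      show "\<Union>C \<subseteq> carrier R" using R.subspD(1) mem by blast
      show "\<zero>\<^bsub>R\<^esub> \<in> \<Union>C" using R.subspD(2) mem C(1) by blast
      show "u \<oplus>\<^bsub>R\<^esub> v \<in> \<Union>C" if uv: "u \<in> \<Union>C" "v \<in> \<Union>C" for u v
      proof -
        obtain Y Z where YZ: "Y \<in> C" "u \<in> Y" "Z \<in> C" "v \<in> Z" using uv by blast
        then obtain W where W: "W \<in> C" "u \<in> W" "v \<in> W" using lin[OF YZ(1,3)] by blast
        show ?thesis using R.subspD(3)[OF mem[OF W(1)] W(2,3)] W(1) by blast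
      qed
      show "\<ominus>\<^bsub>R\<^esub> v \<in> \<Union>C" if v: "v \<in> \<Union>C" for v
      proof -
        obtain Y where Y: "Y \<in> C" "v \<in> Y" using v by blast
        show ?thesis using R.subspD(4)[OF mem[OF Y(1)] Y(2)] Y(1) by blast
      qed
      show "a \<otimes>\<^bsub>R\<^esub> v \<in> \<Union>C" if a: "a \<in> ?k" and v: "v \<in> \<Union>C" for a v
      proof -
        obtain Y where Y: "Y \<in> C" "v \<in> Y" using v by blast
        show ?thesis using R.subspD(5)[OF mem[OF Y(1)] a Y(2)] Y(1) by blast
      qed
    qed
    moreover have "V \<subseteq> \<Union>C" "x \<notin> \<Union>C" using C(1) CA by (auto simp: A_def)
    ultimately show "\<Union>C \<in> A" by (simp add: A_def)
  qed
  then obtain H where HA: "H \<in> A" and "\<forall>Y\<in>A. H \<subseteq> Y \<longrightarrow> Y = H" by (rule bexE)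
  then have max: "Y = H" if "Y \<in> A" "H \<subseteq> Y" for Y using that by blast
  have H: "H \<in> R.subsp ?k" "V \<subseteq> H" "x \<notin> H" using HA by (simp_all add: A_def)
  note Hc = subsetD[OF R.subspD(1)[OF H(1)]]
  \<comment> \<open>Otherwise multiplying by the inverse of \<open>c\<close> would put
    \<open>x\<close> itself into \<open>H\<close>.\<close>
  have uniq0: "c = \<zero>\<^bsub>K\<^esub>" if c: "c \<in> carrier K" "\<iota> c \<otimes>\<^bsub>R\<^esub> x \<in> H" for c
  proof (rule ccontr)
    assume "c \<noteq> \<zero>\<^bsub>K\<^esub>"
    then have cu: "c \<in> Units K" using c K.field_Units by simp
    have "\<iota> (inv\<^bsub>K\<^esub> c) \<otimes>\<^bsub>R\<^esub> (\<iota> c \<otimes>\<^bsub>R\<^esub> x) \<in> H"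
      using R.subspD(5)[OF H(1) imageI c(2)] cu by simp
    moreover have "\<iota> (inv\<^bsub>K\<^esub> c) \<otimes>\<^bsub>R\<^esub> (\<iota> c \<otimes>\<^bsub>R\<^esub> x) = \<iota> (inv\<^bsub>K\<^esub> c \<otimes>\<^bsub>K\<^esub> c) \<otimes>\<^bsub>R\<^esub> x"
      using cu c(1) x(1) by (simp add: R.m_assoc del: K.Units_l_inv)
    ultimately show False using cu x H(3) by simp
  qed
  \<comment> \<open>By maximality, adjoining \<open>y\<close> to \<open>H\<close> captures
    \<open>x\<close>. The coefficient of \<open>y\<close> in the resulting equation is nonzero
    because \<open>x\<close> is not in \<open>H\<close>, so the equation can be solved for
    \<open>y\<close>.\<close>
  have ex: "\<exists>c\<in>carrier K. y \<ominus>\<^bsub>R\<^esub> \<iota> c \<otimes>\<^bsub>R\<^esub> x \<in> H" if y: "y \<in> carrier R" for y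
  proof (cases "y \<in> H")
    case True
    then show ?thesis using x y by (intro bexI[of _ "\<zero>\<^bsub>K\<^esub>"]) (auto simp: R.minus_eq)
  next
    case False
    let ?D = "R.dilate y ?k"
    have D: "?D \<in> R.subsp ?k" using R.dilate_subsp[OF R.subring_subsp[OF ksub] y kR] .
    have DH: "?D <+>\<^bsub>R\<^esub> H \<in> R.subsp ?k" "H \<subseteq> ?D <+>\<^bsub>R\<^esub> H" "?D \<subseteq> ?D <+>\<^bsub>R\<^esub> H"
      using R.subsp_add[OF D H(1) kR] R.set_add_upper[OF D H(1)] by auto
    have "y \<otimes>\<^bsub>R\<^esub> \<iota> \<one>\<^bsub>K\<^esub> \<in> ?D" unfolding R.dilate_def by blast
    then have yD: "y \<in> ?D <+>\<^bsub>R\<^esub> H" using DH(3) y by auto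
    have "x \<in> ?D <+>\<^bsub>R\<^esub> H"
    proof (rule ccontr)
      assume "x \<notin> ?D <+>\<^bsub>R\<^esub> H"
      then have "?D <+>\<^bsub>R\<^esub> H \<in> A" using DH H(2) unfolding A_def by blast
      then show False using max[OF _ DH(2)] yD False by blast
    qed
    then obtain d z where "d \<in> ?D" "z \<in> H" "x = d \<oplus>\<^bsub>R\<^esub> z" unfolding mem_set_add by blast
    then obtain c where c: "c \<in> carrier K" "x = y \<otimes>\<^bsub>R\<^esub> \<iota> c \<oplus>\<^bsub>R\<^esub> z" and z: "z \<in> H"
      unfolding R.dilate_def by blast
    have "c \<noteq> \<zero>\<^bsub>K\<^esub>" using c z H(3) y Hc[OF z] by auto
    then have cu: "c \<in> Units K" using c K.field_Units by simp
    let ?e = "\<iota> (inv\<^bsub>K\<^esub> c)"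
    have e: "?e \<in> carrier R" using cu by simp
    have ce: "\<iota> c \<otimes>\<^bsub>R\<^esub> ?e = \<one>\<^bsub>R\<^esub>"
      using cu c h.hom_mult[of c "inv\<^bsub>K\<^esub> c"] by simp
    have cc: "\<iota> c \<in> carrier R" using c by simp
    have "?e \<otimes>\<^bsub>R\<^esub> x = y \<otimes>\<^bsub>R\<^esub> (\<iota> c \<otimes>\<^bsub>R\<^esub> ?e) \<oplus>\<^bsub>R\<^esub> ?e \<otimes>\<^bsub>R\<^esub> z"
      unfolding c(2) using e cc y Hc[OF z] by algebra
    then have "y \<ominus>\<^bsub>R\<^esub> ?e \<otimes>\<^bsub>R\<^esub> x = y \<ominus>\<^bsub>R\<^esub> (y \<oplus>\<^bsub>R\<^esub> ?e \<otimes>\<^bsub>R\<^esub> z)" using ce y by simp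
    also have "\<dots> = \<ominus>\<^bsub>R\<^esub> (?e \<otimes>\<^bsub>R\<^esub> z)" using y e Hc[OF z] by algebra
    also have "\<dots> \<in> H"
    proof -
      have "?e \<in> ?k" using cu by blast
      from R.subspD(4)[OF H(1) R.subspD(5)[OF H(1) this z]] show ?thesis .
    qed
    finally show ?thesis using cu by blast
  qed
  \<comment> \<open>\<open>H\<close> is a hyperplane complementary to the line through
    \<open>x\<close>, and \<open>l\<close> is the coordinate along \<open>x\<close>. Its linearity
    follows from uniqueness of that coordinate.\<close>
  define l where "l y = (SOME c. c \<in> carrier K \<and> y \<ominus>\<^bsub>R\<^esub> \<iota> c \<otimes>\<^bsub>R\<^esub> x \<in> H)" for y
  have lam: "l y \<in> carrier K" "y \<ominus>\<^bsub>R\<^esub> \<iota> (l y) \<otimes>\<^bsub>R\<^esub> x \<in> H" if "y \<in> carrier R" for y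
  proof -
    have "\<exists>c. c \<in> carrier K \<and> y \<ominus>\<^bsub>R\<^esub> \<iota> c \<otimes>\<^bsub>R\<^esub> x \<in> H" using ex[OF that] by blast
    then have "l y \<in> carrier K \<and> y \<ominus>\<^bsub>R\<^esub> \<iota> (l y) \<otimes>\<^bsub>R\<^esub> x \<in> H" unfolding l_def by (rule someI_ex)
    then show "l y \<in> carrier K" "y \<ominus>\<^bsub>R\<^esub> \<iota> (l y) \<otimes>\<^bsub>R\<^esub> x \<in> H" by auto
  qed
  have lam_eq: "l y = c" if y: "y \<in> carrier R" and c: "c \<in> carrier K" "y \<ominus>\<^bsub>R\<^esub> \<iota> c \<otimes>\<^bsub>R\<^esub> x \<in> H" for y c
  proof -
    note ll = lam[OF y]
    have cc: "\<iota> c \<in> carrier R" "\<iota> (l y) \<in> carrier R" using c ll by auto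
    have "(y \<ominus>\<^bsub>R\<^esub> \<iota> c \<otimes>\<^bsub>R\<^esub> x) \<ominus>\<^bsub>R\<^esub> (y \<ominus>\<^bsub>R\<^esub> \<iota> (l y) \<otimes>\<^bsub>R\<^esub> x) \<in> H"
      using R.subspD(6)[OF H(1) c(2) ll(2)] .
    moreover have "(y \<ominus>\<^bsub>R\<^esub> \<iota> c \<otimes>\<^bsub>R\<^esub> x) \<ominus>\<^bsub>R\<^esub> (y \<ominus>\<^bsub>R\<^esub> \<iota> (l y) \<otimes>\<^bsub>R\<^esub> x) = (\<iota> (l y) \<ominus>\<^bsub>R\<^esub> \<iota> c) \<otimes>\<^bsub>R\<^esub> x"
      using y cc x(1) by algebra
    moreover have "\<iota> (l y) \<ominus>\<^bsub>R\<^esub> \<iota> c = \<iota> (l y \<ominus>\<^bsub>K\<^esub> c)" using c ll by (simp add: R.minus_eq K.minus_eq)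
    ultimately have "l y \<ominus>\<^bsub>K\<^esub> c = \<zero>\<^bsub>K\<^esub>" using uniq0[of "l y \<ominus>\<^bsub>K\<^esub> c"] c ll by simp
    then show ?thesis using c ll by simp
  qed
  show thesis
  proof (rule that)
    show "l y \<in> carrier K" if "y \<in> carrier R" for y using lam(1)[OF that] .
    show "l (y \<oplus>\<^bsub>R\<^esub> z) = l y \<oplus>\<^bsub>K\<^esub> l z" if yz: "y \<in> carrier R" "z \<in> carrier R" for y z
    proof (rule lam_eq)
      have cc: "\<iota> (l y) \<in> carrier R" "\<iota> (l z) \<in> carrier R" using lam yz by auto
      have "(y \<oplus>\<^bsub>R\<^esub> z) \<ominus>\<^bsub>R\<^esub> (\<iota> (l y) \<oplus>\<^bsub>R\<^esub> \<iota> (l z)) \<otimes>\<^bsub>R\<^esub> x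
        = (y \<ominus>\<^bsub>R\<^esub> \<iota> (l y) \<otimes>\<^bsub>R\<^esub> x) \<oplus>\<^bsub>R\<^esub> (z \<ominus>\<^bsub>R\<^esub> \<iota> (l z) \<otimes>\<^bsub>R\<^esub> x)"
        using yz cc x(1) by algebra
      also have "\<dots> \<in> H" using R.subspD(3)[OF H(1) lam(2)[OF yz(1)] lam(2)[OF yz(2)]] .
      finally show "(y \<oplus>\<^bsub>R\<^esub> z) \<ominus>\<^bsub>R\<^esub> \<iota> (l y \<oplus>\<^bsub>K\<^esub> l z) \<otimes>\<^bsub>R\<^esub> x \<in> H" using lam(1) yz by simp
    qed (use yz lam(1) in auto)
    show "l (\<iota> c \<otimes>\<^bsub>R\<^esub> y) = c \<otimes>\<^bsub>K\<^esub> l y" if c: "c \<in> carrier K" and y: "y \<in> carrier R" for c y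
    proof (rule lam_eq)
      have cc: "\<iota> (l y) \<in> carrier R" "\<iota> c \<in> carrier R" using lam y c by auto
      have "\<iota> c \<otimes>\<^bsub>R\<^esub> y \<ominus>\<^bsub>R\<^esub> (\<iota> c \<otimes>\<^bsub>R\<^esub> \<iota> (l y)) \<otimes>\<^bsub>R\<^esub> x
        = \<iota> c \<otimes>\<^bsub>R\<^esub> (y \<ominus>\<^bsub>R\<^esub> \<iota> (l y) \<otimes>\<^bsub>R\<^esub> x)"
        using y cc x(1) by algebra
      also have "\<dots> \<in> H" using R.subspD(5)[OF H(1) _ lam(2)[OF y]] c by blast
      finally show "\<iota> c \<otimes>\<^bsub>R\<^esub> y \<ominus>\<^bsub>R\<^esub> \<iota> (c \<otimes>\<^bsub>K\<^esub> l y) \<otimes>\<^bsub>R\<^esub> x \<in> H" using lam(1) y c by simp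
    qed (use y c lam(1) in auto)
    show "l v = \<zero>\<^bsub>K\<^esub>" if v: "v \<in> V" for v
    proof (rule lam_eq)
      show vc: "v \<in> carrier R" using v H(2) Hc by blast
      show "v \<ominus>\<^bsub>R\<^esub> \<iota> \<zero>\<^bsub>K\<^esub> \<otimes>\<^bsub>R\<^esub> x \<in> H" using v H(2) vc x(1) by (auto simp: R.minus_eq)
    qed simp
    show "l x = \<one>\<^bsub>K\<^esub>"
    proof (rule lam_eq)
      show "x \<ominus>\<^bsub>R\<^esub> \<iota> \<one>\<^bsub>K\<^esub> \<otimes>\<^bsub>R\<^esub> x \<in> H" using x R.subspD(2)[OF H(1)] by (simp add: R.minus_eq R.r_neg)
    qed (use x in auto)
  qed
qed

section \<open>The base changes of a discrete valuation ring\<close>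

locale dvr_setting = root_tower K p for K :: "'k ring" and p +
  fixes R :: "'r ring" and \<iota> :: "'k \<Rightarrow> 'r"
  assumes dvr: "dvr R" and iota: "\<iota> \<in> ring_hom K R" and geom: "geometrically_integral K R \<iota>"

sublocale dvr_setting \<subseteq> R: principal_domain R
  using dvr by (simp add: dvr_def)

context dvr_setting
begin

abbreviation "BC n \<equiv> base_change K R \<iota> p n"
abbreviation "bt n \<equiv> bc_tensor K R \<iota> p n"
abbreviation "RR \<equiv> carrier R"

definition "\<rho> n r = bt n r \<one>\<^bsub>Om\<^esub>"
definition "\<sigma> n s = bt n \<one>\<^bsub>R\<^esub> s"

lemma E_simps [simp]:
  "carrier (root_field K p n) = E n" "x \<otimes>\<^bsub>root_field K p n\<^esub> y = x \<otimes>\<^bsub>Om\<^esub> y"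
  "x \<oplus>\<^bsub>root_field K p n\<^esub> y = x \<oplus>\<^bsub>Om\<^esub> y" "\<one>\<^bsub>root_field K p n\<^esub> = \<one>\<^bsub>Om\<^esub>" "\<zero>\<^bsub>root_field K p n\<^esub> = \<zero>\<^bsub>Om\<^esub>"
  by (simp_all add: root_field_eq)

lemma E_carrier: "s \<in> E n \<Longrightarrow> s \<in> carrier Om"
  by (simp add: mem_E)

lemma E_one: "\<one>\<^bsub>Om\<^esub> \<in> E n"
  and E_mult: "s \<in> E n \<Longrightarrow> u \<in> E n \<Longrightarrow> s \<otimes>\<^bsub>Om\<^esub> u \<in> E n"
  using subringE[OF subfieldE(1)[OF E_subfield]] by auto

lemma E_pow: "s \<in> E n \<Longrightarrow> s [^]\<^bsub>Om\<^esub> (m::nat) \<in> E n"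
  by (induction m) (auto simp: E_one E_mult)

lemma em_E: "c \<in> KK \<Longrightarrow> em c \<in> E n"
  using ring_hom_closed[OF em_root_hom[of n]] by simp

lemma tp_locale: "tensor_product R (root_field K p n) K \<iota> em"
proof -
  interpret E: field "root_field K p n" by (rule root_field_field)
  show ?thesis using iota em_root_hom by unfold_locales
qed

text \<open>The field K^(1/p^n) lives on a subset of the type \<open>'k ac\<close>, so it is among
  the extensions over which \<open>geometrically_integral\<close> quantifies.\<close>

lemma T_domain: "domain (BC n)"
  unfolding base_change_def
  using geom root_field_field em_root_hom unfolding geometrically_integral_def by blast

lemma T_cring: "cring (BC n)"
  using T_domain domain.axioms(1) by blast

lemma tp_closed: "r \<in> RR \<Longrightarrow> s \<in> E n \<Longrightarrow> bt n r s \<in> carrier (BC n)"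
  using tensor_product.tp_closed[OF tp_locale] by (simp add: base_change_def bc_tensor_def)

lemma tp_mult: "r \<in> RR \<Longrightarrow> s \<in> E n \<Longrightarrow> r' \<in> RR \<Longrightarrow> s' \<in> E n \<Longrightarrow>
    bt n r s \<otimes>\<^bsub>BC n\<^esub> bt n r' s' = bt n (r \<otimes>\<^bsub>R\<^esub> r') (s \<otimes>\<^bsub>Om\<^esub> s')"
  using tensor_product.tp_mult[OF tp_locale] by (simp add: base_change_def bc_tensor_def)

lemma tp_one: "bt n \<one>\<^bsub>R\<^esub> \<one>\<^bsub>Om\<^esub> = \<one>\<^bsub>BC n\<^esub>"
  using tensor_product.tp_one[OF tp_locale] by (simp add: base_change_def bc_tensor_def)

lemma tp_add_left: "r \<in> RR \<Longrightarrow> r' \<in> RR \<Longrightarrow> s \<in> E n \<Longrightarrow>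
    bt n (r \<oplus>\<^bsub>R\<^esub> r') s = bt n r s \<oplus>\<^bsub>BC n\<^esub> bt n r' s"
  using tensor_product.tp_add_left[OF tp_locale] by (simp add: base_change_def bc_tensor_def)

lemma tp_add_right: "r \<in> RR \<Longrightarrow> s \<in> E n \<Longrightarrow> s' \<in> E n \<Longrightarrow>
    bt n r (s \<oplus>\<^bsub>Om\<^esub> s') = bt n r s \<oplus>\<^bsub>BC n\<^esub> bt n r s'"
  using tensor_product.tp_add_right[OF tp_locale] by (simp add: base_change_def bc_tensor_def)

lemma tp_balanced: "c \<in> KK \<Longrightarrow> r \<in> RR \<Longrightarrow> s \<in> E n \<Longrightarrow>
    bt n (\<iota> c \<otimes>\<^bsub>R\<^esub> r) s = bt n r (em c \<otimes>\<^bsub>Om\<^esub> s)"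
  using tensor_product.tp_balanced[OF tp_locale] by (simp add: base_change_def bc_tensor_def)

lemma T_induct [consumes 1, case_names pure diff]:
  assumes "x \<in> carrier (BC n)" and "\<And>r s. r \<in> RR \<Longrightarrow> s \<in> E n \<Longrightarrow> Q (bt n r s)"
    and "\<And>x y. x \<in> carrier (BC n) \<Longrightarrow> y \<in> carrier (BC n) \<Longrightarrow> Q x \<Longrightarrow> Q y \<Longrightarrow> Q (x \<ominus>\<^bsub>BC n\<^esub> y)"
  shows "Q x"
  using tensor_product.tensor_induct[OF tp_locale, of x n Q] assms
  by (simp add: base_change_def bc_tensor_def)

lemma rho_hom: "\<rho> n \<in> ring_hom R (BC n)"
  unfolding \<rho>_def by (rule ring_hom_memI)
    (simp_all add: tp_closed tp_mult tp_one tp_add_left E_one E_carrier Om.l_one)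

lemma sigma_hom: "\<sigma> n \<in> ring_hom (root_field K p n) (BC n)"
  unfolding \<sigma>_def by (rule ring_hom_memI)
    (simp_all add: tp_closed tp_mult tp_one tp_add_right E_carrier)

lemma tp_rho_sigma: "r \<in> RR \<Longrightarrow> s \<in> E n \<Longrightarrow> bt n r s = \<rho> n r \<otimes>\<^bsub>BC n\<^esub> \<sigma> n s"
  by (simp add: \<rho>_def \<sigma>_def tp_mult E_one E_carrier)

lemma iota_closed: "c \<in> KK \<Longrightarrow> \<iota> c \<in> RR"
  using iota by (rule ring_hom_closed)

lemma sigma_em: "c \<in> KK \<Longrightarrow> \<sigma> n (em c) = \<rho> n (\<iota> c)"
  using tp_balanced[of c "\<one>\<^bsub>R\<^esub>" "\<one>\<^bsub>Om\<^esub>" n]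
  by (simp add: \<rho>_def \<sigma>_def E_one iota_closed em_closed)

lemma R_char: "add_pow R p \<one>\<^bsub>R\<^esub> = \<zero>\<^bsub>R\<^esub>"
  using ring_hom_add_pow[OF K.ring_axioms R.ring_axioms iota K.one_closed, of p] char
    ring_hom_one[OF iota] ring_hom_zero[OF iota K.ring_axioms R.ring_axioms] by simp

lemma T_ring: "ring (BC n)"
  using T_cring cring.axioms(1) by blast

lemma T_char: "add_pow (BC n) p \<one>\<^bsub>BC n\<^esub> = \<zero>\<^bsub>BC n\<^esub>"
  using ring_hom_add_pow[OF R.ring_axioms T_ring rho_hom R.one_closed, of n p] R_char
    ring_hom_one[OF rho_hom] ring_hom_zero[OF rho_hom R.ring_axioms T_ring] by simp

lemma T_frob: "ring_hom_ring (BC n) (BC n) (\<lambda>x. x [^]\<^bsub>BC n\<^esub> (p ^ m))"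
  by (rule ring_hom_ringI2[OF T_ring T_ring cring.frobenius_hom[OF T_cring prime T_char]])

lemma tp_pow:
  assumes "r \<in> RR" and "s \<in> E n"
  shows "bt n r s [^]\<^bsub>BC n\<^esub> (m::nat) = bt n (r [^]\<^bsub>R\<^esub> m) (s [^]\<^bsub>Om\<^esub> m)"
proof (induction m)
  case (Suc m)
  then show ?case using assms by (simp add: tp_mult E_pow)
qed (simp add: tp_one)

text \<open>For a pure tensor, the power of the second factor lies in \<open>K\<close> and moves to
  the left; additivity of the Frobenius extends this to all elements.\<close>

lemma T_pow_in_R:
  assumes "x \<in> carrier (BC n)"
  shows "\<exists>r\<in>RR. x [^]\<^bsub>BC n\<^esub> (p ^ n) = \<rho> n r"
  using assms
proof (induction x rule: T_induct)
  case (pure r s)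
  obtain c where c: "c \<in> KK" "s [^]\<^bsub>Om\<^esub> (p ^ n) = em c" using pure(2) by (auto simp: mem_E)
  have "bt n r s [^]\<^bsub>BC n\<^esub> (p ^ n) = bt n (r [^]\<^bsub>R\<^esub> (p ^ n)) (em c \<otimes>\<^bsub>Om\<^esub> \<one>\<^bsub>Om\<^esub>)"
    using pure c em_closed by (simp add: tp_pow)
  also have "\<dots> = \<rho> n (\<iota> c \<otimes>\<^bsub>R\<^esub> r [^]\<^bsub>R\<^esub> (p ^ n))"
    using tp_balanced[OF c(1) _ E_one] pure by (simp add: \<rho>_def)
  finally show ?case using pure c iota_closed by blast
next
  case (diff x y)
  interpret f: ring_hom_ring "BC n" "BC n" "\<lambda>x. x [^]\<^bsub>BC n\<^esub> (p ^ n)" by (rule T_frob)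
  interpret g: ring_hom_ring R "BC n" "\<rho> n" by (rule ring_hom_ringI2[OF R.ring_axioms T_ring rho_hom])
  obtain r r' where r: "r \<in> RR" "r' \<in> RR" "x [^]\<^bsub>BC n\<^esub> (p ^ n) = \<rho> n r" "y [^]\<^bsub>BC n\<^esub> (p ^ n) = \<rho> n r'"
    using diff by blast
  have "(x \<ominus>\<^bsub>BC n\<^esub> y) [^]\<^bsub>BC n\<^esub> (p ^ n) = x [^]\<^bsub>BC n\<^esub> (p ^ n) \<ominus>\<^bsub>BC n\<^esub> y [^]\<^bsub>BC n\<^esub> (p ^ n)"
    using diff(1,2) f.hom_add[of x "\<ominus>\<^bsub>BC n\<^esub> y"] f.hom_a_inv[of y] by (simp add: a_minus_def)
  also have "\<dots> = \<rho> n (r \<ominus>\<^bsub>R\<^esub> r')" using r by (simp add: a_minus_def)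
  finally show ?case using r by blast
qed

text \<open>Were \<open>x\<close> outside \<open>V\<close>, a functional \<open>l\<close> on
  \<open>R\<close> would kill \<open>V\<close> and take the value 1 at \<open>x\<close>. Its
  extension \<open>l \<otimes> id\<close> kills the K^(1/p^n)-span of \<open>V\<close> but not the
  image of \<open>x\<close>.\<close>

lemma T_disjoint:
  assumes V: "V \<in> R.subsp (\<iota> ` KK)" and x: "x \<in> RR"
    and span: "\<rho> n x \<in> ring.kspan (BC n) (\<sigma> n ` E n) (\<rho> n ` V)"
  shows "x \<in> V"
proof (rule ccontr)
  assume xV: "x \<notin> V"
  obtain l where l: "\<And>y. y \<in> RR \<Longrightarrow> l y \<in> KK"
    "\<And>y z. y \<in> RR \<Longrightarrow> z \<in> RR \<Longrightarrow> l (y \<oplus>\<^bsub>R\<^esub> z) = l y \<oplus>\<^bsub>K\<^esub> l z"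
    "\<And>c y. c \<in> KK \<Longrightarrow> y \<in> RR \<Longrightarrow> l (\<iota> c \<otimes>\<^bsub>R\<^esub> y) = c \<otimes>\<^bsub>K\<^esub> l y"
    "\<And>v. v \<in> V \<Longrightarrow> l v = \<zero>\<^bsub>K\<^esub>" "l x = \<one>\<^bsub>K\<^esub>"
    by (rule linear_functional[OF K.field_axioms R.is_cring iota V x xV], rule that)
  interpret T: cring "BC n" by (rule T_cring)
  interpret Ef: field "root_field K p n" by (rule root_field_field)
  interpret P: tensor_pairing R "root_field K p n" K \<iota> em "root_field K p n" "\<lambda>y. em (l y)" "\<lambda>s. s"
  proof (intro tensor_pairing.intro tp_locale tensor_pairing_axioms.intro)
    show "cring (root_field K p n)" by (rule Ef.is_cring)
    show "em (l y) \<in> carrier (root_field K p n)" if "y \<in> RR" for y using l(1)[OF that] em_E by simp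
    show "em (l (y \<oplus>\<^bsub>R\<^esub> z)) = em (l y) \<oplus>\<^bsub>root_field K p n\<^esub> em (l z)" if "y \<in> RR" "z \<in> RR" for y z
      using l(1,2) that ring_hom_add[OF em_hom] by simp
    show "em (l (\<iota> c \<otimes>\<^bsub>R\<^esub> y)) \<otimes>\<^bsub>root_field K p n\<^esub> s =
        em (l y) \<otimes>\<^bsub>root_field K p n\<^esub> (em c \<otimes>\<^bsub>root_field K p n\<^esub> s)"
      if "c \<in> KK" "y \<in> RR" "s \<in> carrier (root_field K p n)" for c y s
      using l(1,3) that ring_hom_mult[OF em_hom] em_closed E_carrier by (simp add: Om.m_ac)
  qed auto
  let ?L = "tensor_lift (root_field K p n) (\<lambda>y. em (l y)) (\<lambda>s. s)"
  have Ltp: "?L (bt n r s) = em (l r) \<otimes>\<^bsub>Om\<^esub> s" if "r \<in> RR" "s \<in> E n" for r s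
    using P.lift_tp[of r s] that by (simp add: bc_tensor_def)
  have Ladd: "?L (y \<oplus>\<^bsub>BC n\<^esub> z) = ?L y \<oplus>\<^bsub>Om\<^esub> ?L z" if "y \<in> carrier (BC n)" "z \<in> carrier (BC n)" for y z
    using P.lift_add[of y z] that by (simp add: base_change_def)
  have em0: "em \<zero>\<^bsub>K\<^esub> = \<zero>\<^bsub>Om\<^esub>" using ring_hom_zero[OF em_hom K.ring_axioms Om.ring_axioms] .
  have em1: "em \<one>\<^bsub>K\<^esub> = \<one>\<^bsub>Om\<^esub>" using ring_hom_one[OF em_hom] .
  have VR: "V \<subseteq> RR" using R.subspD(1)[OF V] .
  have pure0: "?L (\<sigma> n s \<otimes>\<^bsub>BC n\<^esub> \<rho> n v) = \<zero>\<^bsub>Om\<^esub>" "\<sigma> n s \<otimes>\<^bsub>BC n\<^esub> \<rho> n v \<in> carrier (BC n)"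
    if "s \<in> E n" "v \<in> V" for s v
  proof -
    have v: "v \<in> RR" using that VR by blast
    have eq: "\<sigma> n s \<otimes>\<^bsub>BC n\<^esub> \<rho> n v = bt n v s"
      using that v by (simp add: \<rho>_def \<sigma>_def tp_mult E_one E_carrier)
    show "?L (\<sigma> n s \<otimes>\<^bsub>BC n\<^esub> \<rho> n v) = \<zero>\<^bsub>Om\<^esub>"
      unfolding eq using Ltp[OF v that(1)] l(4)[OF that(2)] em0 E_carrier[OF that(1)] by simp
    show "\<sigma> n s \<otimes>\<^bsub>BC n\<^esub> \<rho> n v \<in> carrier (BC n)" unfolding eq by (rule tp_closed[OF v that(1)])
  qed
  have "y \<in> carrier (BC n) \<and> ?L y = \<zero>\<^bsub>Om\<^esub>" if "y \<in> T.kspan (\<sigma> n ` E n) (\<rho> n ` V)" for y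
    using that
  proof induction
    case kspan_zero
    have "?L (\<zero>\<^bsub>BC n\<^esub> \<oplus>\<^bsub>BC n\<^esub> \<zero>\<^bsub>BC n\<^esub>) = ?L \<zero>\<^bsub>BC n\<^esub> \<oplus>\<^bsub>Om\<^esub> ?L \<zero>\<^bsub>BC n\<^esub>" by (rule Ladd) auto
    moreover have "?L \<zero>\<^bsub>BC n\<^esub> \<in> carrier Om"
      using P.lift_closed[of "\<zero>\<^bsub>BC n\<^esub>"] E_carrier T.zero_closed by (simp add: base_change_def)
    ultimately have "?L \<zero>\<^bsub>BC n\<^esub> = \<zero>\<^bsub>Om\<^esub>" by simp
    then show ?case by simp
  next
    case (kspan_add y a v)
    then obtain s w where sw: "s \<in> E n" "w \<in> V" "a = \<sigma> n s" "v = \<rho> n w" by blast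
    then show ?case using kspan_add pure0[OF sw(1,2)] Ladd[of y "\<sigma> n s \<otimes>\<^bsub>BC n\<^esub> \<rho> n w"] by simp
  qed
  then have "?L (\<rho> n x) = \<zero>\<^bsub>Om\<^esub>" using span by blast
  moreover have "?L (\<rho> n x) = \<one>\<^bsub>Om\<^esub>" unfolding \<rho>_def using Ltp[OF x E_one] l(5) em1 by simp
  ultimately show False by simp
qed

text \<open>This is \<open>T_disjoint\<close> for the zero subspace.\<close>

lemma rho_inj:
  assumes "r \<in> RR" and "\<rho> n r = \<zero>\<^bsub>BC n\<^esub>"
  shows "r = \<zero>\<^bsub>R\<^esub>"
proof -
  interpret T: cring "BC n" by (rule T_cring)
  have "{\<zero>\<^bsub>R\<^esub>} \<in> R.subsp (\<iota> ` KK)" using iota_closed by (intro R.subspI) auto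
  moreover have "\<rho> n r \<in> T.kspan (\<sigma> n ` E n) (\<rho> n ` {\<zero>\<^bsub>R\<^esub>})" using assms(2) T.kspan_zero by simp
  ultimately show ?thesis using T_disjoint assms(1) by blast
qed

abbreviation "bc \<equiv> bc_map K R \<iota> p 1 2"

lemma E12: "s \<in> E 1 \<Longrightarrow> s \<in> E 2"
  using E_mono[of 1] by (simp add: numeral_2_eq_2 subset_iff)

lemma bc_facts:
  shows "bc \<in> ring_hom (BC 1) (BC 2)" and "\<And>r s. r \<in> RR \<Longrightarrow> s \<in> E 1 \<Longrightarrow> bc (bt 1 r s) = bt 2 r s"
proof -
  interpret T: cring "BC 2" by (rule T_cring)
  have eq1: "(\<lambda>a. bc_tensor K R \<iota> p 2 a \<one>\<^bsub>root_field K p 2\<^esub>) = \<rho> 2"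
    and eq2: "(\<lambda>s. bc_tensor K R \<iota> p 2 \<one>\<^bsub>R\<^esub> s) = \<sigma> 2" by (auto simp: \<rho>_def \<sigma>_def)
  have bc: "bc = tensor_lift (BC 2) (\<rho> 2) (\<sigma> 2)" unfolding bc_map_def eq1 eq2 ..
  have sig: "\<sigma> 2 \<in> ring_hom (root_field K p 1) (BC 2)"
    using sigma_hom[of 2] E12 by (auto simp: ring_hom_def)
  interpret P: tensor_pairing R "root_field K p 1" K \<iota> em "BC 2" "\<rho> 2" "\<sigma> 2"
  proof (intro tensor_pairing.intro tp_locale tensor_pairing_axioms.intro)
    show "cring (BC 2)" by (rule T_cring)
    show "\<rho> 2 r \<in> carrier (BC 2)" if "r \<in> RR" for r using ring_hom_closed[OF rho_hom that] .
    show "\<sigma> 2 s \<in> carrier (BC 2)" if "s \<in> carrier (root_field K p 1)" for s using ring_hom_closed[OF sig that] .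
    show "\<rho> 2 (r \<oplus>\<^bsub>R\<^esub> r') = \<rho> 2 r \<oplus>\<^bsub>BC 2\<^esub> \<rho> 2 r'" if "r \<in> RR" "r' \<in> RR" for r r'
      using ring_hom_add[OF rho_hom that] .
    show "\<sigma> 2 (s \<oplus>\<^bsub>root_field K p 1\<^esub> u) = \<sigma> 2 s \<oplus>\<^bsub>BC 2\<^esub> \<sigma> 2 u"
      if "s \<in> carrier (root_field K p 1)" "u \<in> carrier (root_field K p 1)" for s u
      using ring_hom_add[OF sig that] .
    show "\<rho> 2 (\<iota> c \<otimes>\<^bsub>R\<^esub> r) \<otimes>\<^bsub>BC 2\<^esub> \<sigma> 2 s = \<rho> 2 r \<otimes>\<^bsub>BC 2\<^esub> \<sigma> 2 (em c \<otimes>\<^bsub>root_field K p 1\<^esub> s)"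
      if "c \<in> KK" "r \<in> RR" "s \<in> carrier (root_field K p 1)" for c r s
    proof -
      have s: "s \<in> E 2" "em c \<otimes>\<^bsub>Om\<^esub> s \<in> E 2" using that E12 em_E E_mult by auto
      have "\<rho> 2 (\<iota> c \<otimes>\<^bsub>R\<^esub> r) \<otimes>\<^bsub>BC 2\<^esub> \<sigma> 2 s = bt 2 (\<iota> c \<otimes>\<^bsub>R\<^esub> r) s"
        using tp_rho_sigma[of "\<iota> c \<otimes>\<^bsub>R\<^esub> r" s 2] that s iota_closed by simp
      also have "\<dots> = bt 2 r (em c \<otimes>\<^bsub>Om\<^esub> s)" by (rule tp_balanced[OF that(1,2) s(1)])
      finally show ?thesis using tp_rho_sigma[OF that(2) s(2)] by simp
    qed
  qed
  show "bc \<in> ring_hom (BC 1) (BC 2)"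
    using P.lift_hom[OF rho_hom sig] unfolding bc base_change_def[of K R \<iota> p 1] .
  show "bc (bt 1 r s) = bt 2 r s" if "r \<in> RR" "s \<in> E 1" for r s
    using P.lift_tp[of r s] that E12 tp_rho_sigma[of r s 2] unfolding bc bc_tensor_def[of K R \<iota> p 1] by simp
qed

lemma bc_rho: "r \<in> RR \<Longrightarrow> bc (\<rho> 1 r) = \<rho> 2 r"
  unfolding \<rho>_def by (rule bc_facts(2)[OF _ E_one])

lemma bc_sigma: "s \<in> E 1 \<Longrightarrow> bc (\<sigma> 1 s) = \<sigma> 2 s"
  unfolding \<sigma>_def by (rule bc_facts(2)[OF R.one_closed])

text \<open>Injectivity is known on \<open>R\<close>, and the \<open>p\<close>-th power of
  \<open>x\<close> already lies there; \<open>BC 1\<close> has no nilpotents.\<close>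

lemma bc_inj:
  assumes x: "x \<in> carrier (BC 1)" and "bc x = \<zero>\<^bsub>BC 2\<^esub>"
  shows "x = \<zero>\<^bsub>BC 1\<^esub>"
proof -
  interpret h: ring_hom_ring "BC 1" "BC 2" bc by (rule ring_hom_ringI2[OF T_ring T_ring bc_facts(1)])
  interpret T1: domain "BC 1" by (rule T_domain)
  obtain r where r: "r \<in> RR" "x [^]\<^bsub>BC 1\<^esub> p = \<rho> 1 r" using T_pow_in_R[OF x] by auto
  have "\<rho> 2 r = bc x [^]\<^bsub>BC 2\<^esub> p" using bc_rho[OF r(1)] r(2) x h.hom_nat_pow[of x p] by simp
  also have "\<dots> = \<zero>\<^bsub>BC 2\<^esub>" using assms(2) p_pos h.S.nat_pow_zero by simp
  finally have "r = \<zero>\<^bsub>R\<^esub>" using rho_inj r by blast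
  then have "x [^]\<^bsub>BC 1\<^esub> p = \<zero>\<^bsub>BC 1\<^esub>"
    using r(2) ring_hom_zero[OF rho_hom R.ring_axioms T_ring] by simp
  then show ?thesis using T1.pow_nonzero[OF x] by blast
qed

end

section \<open>Dimensions of quotient modules\<close>

lemma lin_indep_subset:
  assumes "lin_indep F M I v" and "J \<subseteq> I"
  shows "lin_indep F M J v"
  unfolding lin_indep_def
proof (intro conjI allI impI)
  show "v \<in> J \<rightarrow> carrier M" using assms by (auto simp: lin_indep_def)
  fix S c assume "finite S \<and> S \<subseteq> J \<and> c \<in> S \<rightarrow> carrier F \<and> (\<Oplus>\<^bsub>M\<^esub>i\<in>S. c i \<odot>\<^bsub>M\<^esub> v i) = \<zero>\<^bsub>M\<^esub>"
  then have "finite S \<and> S \<subseteq> I \<and> c \<in> S \<rightarrow> carrier F \<and> (\<Oplus>\<^bsub>M\<^esub>i\<in>S. c i \<odot>\<^bsub>M\<^esub> v i) = \<zero>\<^bsub>M\<^esub>"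
    using assms(2) by (simp add: subset_trans[of S J I])
  then show "\<forall>i\<in>S. c i = \<zero>\<^bsub>F\<^esub>" using assms(1) unfolding lin_indep_def by blast
qed

locale quotient_dimension = Q: field Q + S: field S for Q :: "'c ring" and S :: "'s ring" +
  fixes \<sigma> :: "'s \<Rightarrow> 'c" and N W :: "'c set"
  assumes sigma: "\<sigma> \<in> ring_hom S Q"
    and N: "N \<in> Q.subsp (\<sigma> ` carrier S)" and W: "W \<in> Q.subsp (\<sigma> ` carrier S)" and WN: "W \<subseteq> N"
begin

abbreviation "k \<equiv> \<sigma> ` carrier S"
abbreviation "M \<equiv> quot_module (ring_module (Q\<lparr>carrier := N\<rparr>) \<sigma>) W"

definition coset :: "'c \<Rightarrow> 'c set" where
  "coset x = (\<lambda>w. w \<oplus>\<^bsub>Q\<^esub> x) ` W"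

lemma Nc: "x \<in> N \<Longrightarrow> x \<in> carrier Q" and Wc: "x \<in> W \<Longrightarrow> x \<in> carrier Q"
  using Q.subspD(1)[OF N] WN by auto

lemma sc: "a \<in> carrier S \<Longrightarrow> \<sigma> a \<in> carrier Q"
  using sigma by (rule ring_hom_closed)

lemma sN: "a \<in> carrier S \<Longrightarrow> x \<in> N \<Longrightarrow> \<sigma> a \<otimes>\<^bsub>Q\<^esub> x \<in> N"
  using Q.subspD(5)[OF N] by blast

lemma k_subring: "subring k Q"
  by (rule ring_hom_ring.img_is_subring[OF ring_hom_ringI2[OF S.ring_axioms Q.ring_axioms sigma] S.carrier_is_subring])

lemma coset_eq_iff:
  assumes x: "x \<in> carrier Q" and y: "y \<in> carrier Q"
  shows "coset x = coset y \<longleftrightarrow> x \<ominus>\<^bsub>Q\<^esub> y \<in> W"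
proof
  assume "coset x = coset y"
  moreover have "\<zero>\<^bsub>Q\<^esub> \<oplus>\<^bsub>Q\<^esub> x \<in> coset x" unfolding coset_def using Q.subspD(2)[OF W] by blast
  ultimately obtain w where w: "w \<in> W" "\<zero>\<^bsub>Q\<^esub> \<oplus>\<^bsub>Q\<^esub> x = w \<oplus>\<^bsub>Q\<^esub> y" unfolding coset_def by blast
  then have "x = w \<oplus>\<^bsub>Q\<^esub> y" using x by simp
  then have "x \<ominus>\<^bsub>Q\<^esub> y = w" using Wc[OF w(1)] y by (simp add: Q.minus_eq Q.a_assoc Q.r_neg)
  then show "x \<ominus>\<^bsub>Q\<^esub> y \<in> W" using w by simp
next
  assume d: "x \<ominus>\<^bsub>Q\<^esub> y \<in> W"
  have sub: "coset u \<subseteq> coset v" if u: "u \<in> carrier Q" and v: "v \<in> carrier Q" and d: "u \<ominus>\<^bsub>Q\<^esub> v \<in> W" for u v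
  proof
    fix z assume "z \<in> coset u"
    then obtain w where w: "w \<in> W" "z = w \<oplus>\<^bsub>Q\<^esub> u" unfolding coset_def by blast
    then have "z = (w \<oplus>\<^bsub>Q\<^esub> (u \<ominus>\<^bsub>Q\<^esub> v)) \<oplus>\<^bsub>Q\<^esub> v"
      using Wc[OF w(1)] u v by (simp add: Q.minus_eq Q.a_assoc Q.l_neg)
    then show "z \<in> coset v" using Q.subspD(3)[OF W w(1) d] unfolding coset_def by blast
  qed
  have "y \<ominus>\<^bsub>Q\<^esub> x = \<ominus>\<^bsub>Q\<^esub> (x \<ominus>\<^bsub>Q\<^esub> y)" using x y by (simp add: Q.minus_eq Q.minus_add Q.a_comm)
  then have "y \<ominus>\<^bsub>Q\<^esub> x \<in> W" using Q.subspD(4)[OF W d] by simp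
  then show "coset x = coset y" using sub[OF x y d] sub[OF y x] by blast
qed

lemma coset_zero: "coset \<zero>\<^bsub>Q\<^esub> = W"
proof -
  have "w \<oplus>\<^bsub>Q\<^esub> \<zero>\<^bsub>Q\<^esub> = w" if "w \<in> W" for w using Wc[OF that] by simp
  then show ?thesis unfolding coset_def by (simp add: image_def)
qed

lemma rcoset: "W +>\<^bsub>ring_module (Q\<lparr>carrier := N\<rparr>) \<sigma>\<^esub> x = coset x"
  by (auto simp: a_r_coset_def' ring_module_def coset_def)

lemma M_carrier: "carrier M = coset ` N"
  unfolding quot_module_def A_RCOSETS_def' by (auto simp: rcoset) (auto simp: ring_module_def)

lemma M_zero: "\<zero>\<^bsub>M\<^esub> = coset \<zero>\<^bsub>Q\<^esub>"
  by (simp add: quot_module_def coset_zero)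

lemma M_add:
  assumes "x \<in> N" and "y \<in> N"
  shows "coset x \<oplus>\<^bsub>M\<^esub> coset y = coset (x \<oplus>\<^bsub>Q\<^esub> y)"
proof -
  have "coset x \<oplus>\<^bsub>M\<^esub> coset y = (\<Union>u\<in>coset x. \<Union>v\<in>coset y. {u \<oplus>\<^bsub>Q\<^esub> v})"
    by (simp add: quot_module_def set_add_def' ring_module_def)
  also have "\<dots> = coset (x \<oplus>\<^bsub>Q\<^esub> y)"
  proof
    show "(\<Union>u\<in>coset x. \<Union>v\<in>coset y. {u \<oplus>\<^bsub>Q\<^esub> v}) \<subseteq> coset (x \<oplus>\<^bsub>Q\<^esub> y)"
    proof
      fix z assume "z \<in> (\<Union>u\<in>coset x. \<Union>v\<in>coset y. {u \<oplus>\<^bsub>Q\<^esub> v})"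
      then obtain w w' where w: "w \<in> W" "w' \<in> W" "z = (w \<oplus>\<^bsub>Q\<^esub> x) \<oplus>\<^bsub>Q\<^esub> (w' \<oplus>\<^bsub>Q\<^esub> y)"
        unfolding coset_def by blast
      then have "z = (w \<oplus>\<^bsub>Q\<^esub> w') \<oplus>\<^bsub>Q\<^esub> (x \<oplus>\<^bsub>Q\<^esub> y)"
        using Wc Nc[OF assms(1)] Nc[OF assms(2)] by (simp add: Q.a_ac)
      then show "z \<in> coset (x \<oplus>\<^bsub>Q\<^esub> y)"
        using Q.subspD(3)[OF W w(1,2)] unfolding coset_def by blast
    qed
    show "coset (x \<oplus>\<^bsub>Q\<^esub> y) \<subseteq> (\<Union>u\<in>coset x. \<Union>v\<in>coset y. {u \<oplus>\<^bsub>Q\<^esub> v})"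
    proof
      fix z assume "z \<in> coset (x \<oplus>\<^bsub>Q\<^esub> y)"
      then obtain w where w: "w \<in> W" "z = w \<oplus>\<^bsub>Q\<^esub> (x \<oplus>\<^bsub>Q\<^esub> y)" unfolding coset_def by blast
      then have "z = (w \<oplus>\<^bsub>Q\<^esub> x) \<oplus>\<^bsub>Q\<^esub> (\<zero>\<^bsub>Q\<^esub> \<oplus>\<^bsub>Q\<^esub> y)"
        using Wc[OF w(1)] Nc[OF assms(1)] Nc[OF assms(2)] by (simp add: Q.a_assoc)
      moreover have "w \<oplus>\<^bsub>Q\<^esub> x \<in> coset x" "\<zero>\<^bsub>Q\<^esub> \<oplus>\<^bsub>Q\<^esub> y \<in> coset y"
        using w(1) Q.subspD(2)[OF W] unfolding coset_def by blast+
      ultimately show "z \<in> (\<Union>u\<in>coset x. \<Union>v\<in>coset y. {u \<oplus>\<^bsub>Q\<^esub> v})" by blast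
    qed
  qed
  finally show ?thesis .
qed

lemma M_smult:
  assumes "a \<in> carrier S" and "x \<in> N"
  shows "a \<odot>\<^bsub>M\<^esub> coset x = coset (\<sigma> a \<otimes>\<^bsub>Q\<^esub> x)"
proof -
  have sm: "a \<odot>\<^bsub>M\<^esub> coset x = (\<Union>u\<in>coset x. coset (\<sigma> a \<otimes>\<^bsub>Q\<^esub> u))"
    by (simp add: quot_module_def rcoset) (simp add: ring_module_def)
  have eq: "coset (\<sigma> a \<otimes>\<^bsub>Q\<^esub> u) = coset (\<sigma> a \<otimes>\<^bsub>Q\<^esub> x)" if u: "u \<in> coset x" for u
  proof -
    obtain w where w: "w \<in> W" "u = w \<oplus>\<^bsub>Q\<^esub> x" using u unfolding coset_def by blast
    note c = sc[OF assms(1)] Wc[OF w(1)] Nc[OF assms(2)]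
    have "\<sigma> a \<otimes>\<^bsub>Q\<^esub> u \<ominus>\<^bsub>Q\<^esub> \<sigma> a \<otimes>\<^bsub>Q\<^esub> x = \<sigma> a \<otimes>\<^bsub>Q\<^esub> w" unfolding w(2) using c by algebra
    moreover have "\<sigma> a \<otimes>\<^bsub>Q\<^esub> w \<in> W" using Q.subspD(5)[OF W imageI[OF assms(1)] w(1)] .
    ultimately show ?thesis using c w(2) by (subst coset_eq_iff) auto
  qed
  have "coset x \<noteq> {}" using Q.subspD(2)[OF W] unfolding coset_def by blast
  then show ?thesis unfolding sm using eq by auto
qed

lemma M_abelian_monoid: "abelian_monoid M"
proof (rule abelian_monoidI)
  fix U V Y assume "U \<in> carrier M" "V \<in> carrier M" "Y \<in> carrier M"
  then obtain x y z where *: "x \<in> N" "y \<in> N" "z \<in> N" "U = coset x" "V = coset y" "Y = coset z"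
    unfolding M_carrier by blast
  note c = Nc[OF *(1)] Nc[OF *(2)] Nc[OF *(3)] Q.subspD(3)[OF N *(1,2)] Q.subspD(3)[OF N *(2,3)]
  show "U \<oplus>\<^bsub>M\<^esub> V \<oplus>\<^bsub>M\<^esub> Y = U \<oplus>\<^bsub>M\<^esub> (V \<oplus>\<^bsub>M\<^esub> Y)"
    unfolding *(4-6) using * c by (simp add: M_add Q.a_assoc)
next
  fix U V assume "U \<in> carrier M" "V \<in> carrier M"
  then obtain x y where *: "x \<in> N" "y \<in> N" "U = coset x" "V = coset y"
    unfolding M_carrier by blast
  note c = Nc[OF *(1)] Nc[OF *(2)] Q.subspD(3)[OF N *(1,2)]
  show "U \<oplus>\<^bsub>M\<^esub> V \<in> carrier M" unfolding *(3,4) M_add[OF *(1,2)] M_carrier using c by blast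
  show "U \<oplus>\<^bsub>M\<^esub> V = V \<oplus>\<^bsub>M\<^esub> U" unfolding *(3,4) using * c by (simp add: M_add Q.a_comm)
next
  show "\<zero>\<^bsub>M\<^esub> \<in> carrier M" unfolding M_zero M_carrier using Q.subspD(2)[OF N] by blast
  fix U assume "U \<in> carrier M"
  then obtain x where *: "x \<in> N" "U = coset x" unfolding M_carrier by blast
  show "\<zero>\<^bsub>M\<^esub> \<oplus>\<^bsub>M\<^esub> U = U"
    unfolding M_zero *(2) M_add[OF Q.subspD(2)[OF N] *(1)] using Nc[OF *(1)] by simp
qed

lemma M_smult_closed: "a \<in> carrier S \<Longrightarrow> U \<in> carrier M \<Longrightarrow> a \<odot>\<^bsub>M\<^esub> U \<in> carrier M"
  unfolding M_carrier using M_smult sN by auto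

lemma M_smult_family:
  assumes "a \<in> J \<rightarrow> carrier S" and "J \<subseteq> carrier M"
  shows "(\<lambda>i. a i \<odot>\<^bsub>M\<^esub> i) \<in> J \<rightarrow> carrier M"
  using assms by (intro Pi_I M_smult_closed) (auto simp only: Pi_iff subset_iff)

lemma M_smult_zero: "U \<in> carrier M \<Longrightarrow> \<zero>\<^bsub>S\<^esub> \<odot>\<^bsub>M\<^esub> U = \<zero>\<^bsub>M\<^esub>"
  unfolding M_carrier M_zero
  using M_smult[OF S.zero_closed] Nc ring_hom_zero[OF sigma S.ring_axioms Q.ring_axioms] by auto

lemma comb_in:
  assumes Y: "Y \<in> Q.subsp k" "Y \<subseteq> N" and "finite J" and "J \<subseteq> coset ` Y" and a: "a \<in> J \<rightarrow> carrier S"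
  shows "(\<Oplus>\<^bsub>M\<^esub>i\<in>J. a i \<odot>\<^bsub>M\<^esub> i) \<in> coset ` Y"
  using assms(3-5)
proof (induction J rule: finite_induct)
  interpret M: abelian_monoid M by (rule M_abelian_monoid)
  case empty
  then show ?case unfolding M.finsum_empty M_zero using Q.subspD(2)[OF Y(1)] by blast
next
  interpret M: abelian_monoid M by (rule M_abelian_monoid)
  case (insert i J)
  have sub: "insert i J \<subseteq> carrier M" using insert.prems(1) Y(2) unfolding M_carrier by blast
  have f: "(\<lambda>i. a i \<odot>\<^bsub>M\<^esub> i) \<in> J \<rightarrow> carrier M" "a i \<odot>\<^bsub>M\<^esub> i \<in> carrier M"
    using M_smult_family[of a J] M_smult_closed insert.prems(2) sub by (simp, simp)
  obtain x where x: "x \<in> Y" "i = coset x" using insert.prems(1) by blast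
  obtain y where y: "y \<in> Y" "(\<Oplus>\<^bsub>M\<^esub>i\<in>J. a i \<odot>\<^bsub>M\<^esub> i) = coset y" using insert by auto
  have ai: "a i \<in> carrier S" using insert.prems(2) by simp
  have sx: "\<sigma> (a i) \<otimes>\<^bsub>Q\<^esub> x \<in> Y" using Q.subspD(5)[OF Y(1) imageI[OF ai] x(1)] .
  have "(\<Oplus>\<^bsub>M\<^esub>i\<in>insert i J. a i \<odot>\<^bsub>M\<^esub> i) = a i \<odot>\<^bsub>M\<^esub> i \<oplus>\<^bsub>M\<^esub> coset y"
    using M.finsum_insert[OF insert.hyps(1,2) f] y(2) by simp
  also have "a i \<odot>\<^bsub>M\<^esub> i = coset (\<sigma> (a i) \<otimes>\<^bsub>Q\<^esub> x)"
    unfolding x(2) by (rule M_smult) (use ai x Y in auto)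
  also have "coset (\<sigma> (a i) \<otimes>\<^bsub>Q\<^esub> x) \<oplus>\<^bsub>M\<^esub> coset y = coset (\<sigma> (a i) \<otimes>\<^bsub>Q\<^esub> x \<oplus>\<^bsub>Q\<^esub> y)"
    by (rule M_add) (use sx y Y in auto)
  finally show ?case using Q.subspD(3)[OF Y(1) sx y(1)] by blast
qed

lemma coset_mem:
  assumes "Y \<in> Q.subsp k" and "W \<subseteq> Y" and "x \<in> carrier Q" and "coset x \<in> coset ` Y"
  shows "x \<in> Y"
proof -
  obtain y where y: "y \<in> Y" "coset x = coset y" using assms(4) by blast
  have yc: "y \<in> carrier Q" using Q.subspD(1)[OF assms(1)] y by blast
  then have "x \<ominus>\<^bsub>Q\<^esub> y \<in> Y" using coset_eq_iff[OF assms(3)] y assms(2) by blast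
  then have "(x \<ominus>\<^bsub>Q\<^esub> y) \<oplus>\<^bsub>Q\<^esub> y \<in> Y" using Q.subspD(3)[OF assms(1)] y by blast
  moreover have "(x \<ominus>\<^bsub>Q\<^esub> y) \<oplus>\<^bsub>Q\<^esub> y = x" using assms(3) yc by (simp add: Q.minus_eq Q.a_assoc Q.l_neg)
  ultimately show ?thesis by simp
qed

text \<open>From each strict step choose a vector \<open>z\<close> of the larger space outside the
  smaller one. A relation with nonzero coefficient at the coset of \<open>z\<close> would put
  \<open>z\<close> into the smaller space.\<close>

lemma flag_independent:
  assumes "flag (Q.subsp k) W n Y" and "Y \<subseteq> N"
  shows "\<exists>J. finite J \<and> card J = n \<and> J \<subseteq> coset ` Y \<and> lin_indep S M J (\<lambda>x. x)"
  using assms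
proof (induction)
  case (flag_0 Y)
  show ?case by (intro exI[of _ "{}"]) (simp add: lin_indep_def)
next
  case (flag_Suc n Y Z)
  interpret M: abelian_monoid M by (rule M_abelian_monoid)
  have YN: "Y \<subseteq> N" using flag_Suc by blast
  then obtain J where J: "finite J" "card J = n" "J \<subseteq> coset ` Y" "lin_indep S M J (\<lambda>x. x)"
    using flag_Suc.IH by blast
  have Y: "Y \<in> Q.subsp k" "W \<subseteq> Y" using flagD[OF flag_Suc.hyps(1)] by auto
  obtain z where z: "z \<in> Z" "z \<notin> Y" using flag_Suc.hyps(2) by blast
  have zN: "z \<in> N" using z flag_Suc.prems by blast
  have zJ: "coset z \<notin> J" using coset_mem[OF Y Nc[OF zN]] J(3) z(2) by blast
  have carr: "insert (coset z) J \<subseteq> carrier M" using J(3) YN zN unfolding M_carrier by blast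
  have "lin_indep S M (insert (coset z) J) (\<lambda>x. x)"
    unfolding lin_indep_def
  proof (intro conjI allI impI)
    show "(\<lambda>x. x) \<in> insert (coset z) J \<rightarrow> carrier M" using carr by auto
    fix I c assume "finite I \<and> I \<subseteq> insert (coset z) J \<and> c \<in> I \<rightarrow> carrier S \<and>
      (\<Oplus>\<^bsub>M\<^esub>i\<in>I. c i \<odot>\<^bsub>M\<^esub> i) = \<zero>\<^bsub>M\<^esub>"
    then have I: "finite I" "I \<subseteq> insert (coset z) J" "c \<in> I \<rightarrow> carrier S"
      "(\<Oplus>\<^bsub>M\<^esub>i\<in>I. c i \<odot>\<^bsub>M\<^esub> i) = \<zero>\<^bsub>M\<^esub>" by auto
    have J': "\<forall>i\<in>I'. c i = \<zero>\<^bsub>S\<^esub>" if "finite I'" "I' \<subseteq> J" "c \<in> I' \<rightarrow> carrier S"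
      "(\<Oplus>\<^bsub>M\<^esub>i\<in>I'. c i \<odot>\<^bsub>M\<^esub> i) = \<zero>\<^bsub>M\<^esub>" for I'
      using J(4) that unfolding lin_indep_def by blast
    show "\<forall>i\<in>I. c i = \<zero>\<^bsub>S\<^esub>"
    proof (cases "coset z \<in> I")
      case False
      then show ?thesis using J' I by blast
    next
      case True
      define I' where "I' = I - {coset z}"
      have I': "finite I'" "I' \<subseteq> J" "I = insert (coset z) I'" "coset z \<notin> I'" "c \<in> I' \<rightarrow> carrier S"
        using I True by (auto simp: I'_def)
      have cz: "c (coset z) \<in> carrier S" using I(3) True by blast
      have f: "(\<lambda>i. c i \<odot>\<^bsub>M\<^esub> i) \<in> I' \<rightarrow> carrier M" "c (coset z) \<odot>\<^bsub>M\<^esub> coset z \<in> carrier M"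
        using M_smult_family[OF I'(5)] M_smult_closed[OF cz] carr I'(2) by (blast, simp)
      have I'Y: "I' \<subseteq> coset ` Y" using I'(2) J(3) by blast
      then obtain y where y: "y \<in> Y" "(\<Oplus>\<^bsub>M\<^esub>i\<in>I'. c i \<odot>\<^bsub>M\<^esub> i) = coset y"
        using comb_in[OF Y(1) YN I'(1) _ I'(5)] by blast
      have yN: "y \<in> N" using y YN by blast
      have "\<zero>\<^bsub>M\<^esub> = c (coset z) \<odot>\<^bsub>M\<^esub> coset z \<oplus>\<^bsub>M\<^esub> coset y"
        using M.finsum_insert[OF I'(1,4) f] I(4) y(2) unfolding I'(3) by simp
      also have "\<dots> = coset (\<sigma> (c (coset z)) \<otimes>\<^bsub>Q\<^esub> z \<oplus>\<^bsub>Q\<^esub> y)"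
        unfolding M_smult[OF cz zN] by (rule M_add[OF sN[OF cz zN] yN])
      finally have "coset (\<sigma> (c (coset z)) \<otimes>\<^bsub>Q\<^esub> z \<oplus>\<^bsub>Q\<^esub> y) = coset \<zero>\<^bsub>Q\<^esub>" unfolding M_zero ..
      then have "\<sigma> (c (coset z)) \<otimes>\<^bsub>Q\<^esub> z \<oplus>\<^bsub>Q\<^esub> y \<in> Y"
        using coset_mem[OF Y] Q.subspD(2)[OF Y(1)] Q.a_closed[OF Nc[OF sN[OF cz zN]] Nc[OF yN]] by blast
      then have "(\<sigma> (c (coset z)) \<otimes>\<^bsub>Q\<^esub> z \<oplus>\<^bsub>Q\<^esub> y) \<ominus>\<^bsub>Q\<^esub> y \<in> Y" using Q.subspD(6)[OF Y(1)] y(1) by blast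
      moreover have "(\<sigma> (c (coset z)) \<otimes>\<^bsub>Q\<^esub> z \<oplus>\<^bsub>Q\<^esub> y) \<ominus>\<^bsub>Q\<^esub> y = \<sigma> (c (coset z)) \<otimes>\<^bsub>Q\<^esub> z"
        using Nc[OF sN[OF cz zN]] Nc[OF yN] by (simp add: Q.minus_eq Q.a_assoc Q.r_neg)
      ultimately have cY: "\<sigma> (c (coset z)) \<otimes>\<^bsub>Q\<^esub> z \<in> Y" by simp
      \<comment> \<open>The multiple of \<open>z\<close> by this coefficient lies in
        \<open>Y\<close>; a nonzero coefficient could be inverted, giving \<open>z\<close> in
        \<open>Y\<close>.\<close>
      have c0: "c (coset z) = \<zero>\<^bsub>S\<^esub>"
      proof (rule ccontr)
        assume "c (coset z) \<noteq> \<zero>\<^bsub>S\<^esub>"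
        then have u: "c (coset z) \<in> Units S" using cz S.field_Units by simp
        have "\<sigma> (inv\<^bsub>S\<^esub> (c (coset z))) \<otimes>\<^bsub>Q\<^esub> (\<sigma> (c (coset z)) \<otimes>\<^bsub>Q\<^esub> z) \<in> Y"
          using Q.subspD(5)[OF Y(1) imageI cY] u by blast
        moreover have "\<sigma> (inv\<^bsub>S\<^esub> (c (coset z))) \<otimes>\<^bsub>Q\<^esub> \<sigma> (c (coset z)) = \<one>\<^bsub>Q\<^esub>"
          using ring_hom_mult[OF sigma S.Units_inv_closed[OF u] cz] S.Units_l_inv[OF u] ring_hom_one[OF sigma] by simp
        then have "\<sigma> (inv\<^bsub>S\<^esub> (c (coset z))) \<otimes>\<^bsub>Q\<^esub> (\<sigma> (c (coset z)) \<otimes>\<^bsub>Q\<^esub> z) = z"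
          using Q.m_assoc[OF sc[OF S.Units_inv_closed[OF u]] sc[OF cz] Nc[OF zN]] Nc[OF zN] by simp
        ultimately show False using z(2) by simp
      qed
      have "(\<Oplus>\<^bsub>M\<^esub>i\<in>I'. c i \<odot>\<^bsub>M\<^esub> i) = \<zero>\<^bsub>M\<^esub>"
      proof -
        have "\<zero>\<^bsub>M\<^esub> = c (coset z) \<odot>\<^bsub>M\<^esub> coset z \<oplus>\<^bsub>M\<^esub> (\<Oplus>\<^bsub>M\<^esub>i\<in>I'. c i \<odot>\<^bsub>M\<^esub> i)"
          using M.finsum_insert[OF I'(1,4) f] I(4) unfolding I'(3) by simp
        also have "c (coset z) \<odot>\<^bsub>M\<^esub> coset z = \<zero>\<^bsub>M\<^esub>"
          unfolding c0 by (rule M_smult_zero) (use carr in blast)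
        also have "\<zero>\<^bsub>M\<^esub> \<oplus>\<^bsub>M\<^esub> (\<Oplus>\<^bsub>M\<^esub>i\<in>I'. c i \<odot>\<^bsub>M\<^esub> i) = (\<Oplus>\<^bsub>M\<^esub>i\<in>I'. c i \<odot>\<^bsub>M\<^esub> i)"
          by (rule M.l_zero[OF M.finsum_closed[OF f(1)]])
        finally show ?thesis ..
      qed
      then show ?thesis using J'[OF I'(1,2,5)] c0 I'(3) by blast
    qed
  qed
  moreover have "insert (coset z) J \<subseteq> coset ` Z" using J(3) z(1) flag_Suc.hyps(2) by blast
  ultimately show ?case using J zJ by (intro exI[of _ "insert (coset z) J"]) simp
qed

text \<open>Representatives of the independent cosets are adjoined one by one. The coordinates are
  carried through the induction: they say that the space reached so far is spanned modulo
  \<open>W\<close> by the cosets used, so a new independent coset has its representative outside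
  it.\<close>

lemma independent_flag:
  assumes "finite J" and "J \<subseteq> carrier M" and "lin_indep S M J (\<lambda>x. x)"
  shows "\<exists>Y. flag (Q.subsp k) W (card J) Y \<and> Y \<subseteq> N \<and>
    (\<forall>x\<in>Y. \<exists>a\<in>J \<rightarrow> carrier S. coset x = (\<Oplus>\<^bsub>M\<^esub>i\<in>J. a i \<odot>\<^bsub>M\<^esub> i))"
  using assms
proof (induction J rule: finite_induct)
  interpret M: abelian_monoid M by (rule M_abelian_monoid)
  case empty
  have "coset x = \<zero>\<^bsub>M\<^esub>" if "x \<in> W" for x
    unfolding M_zero using Wc[OF that] that by (simp add: coset_eq_iff Q.minus_eq)
  then show ?case using WN W by (intro exI[of _ W]) (auto intro: flag.flag_0)
next
  interpret M: abelian_monoid M by (rule M_abelian_monoid)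
  case (insert s J)
  have ind: "lin_indep S M J (\<lambda>x. x)"
    by (rule lin_indep_subset[OF insert.prems(2) subset_insertI])
  then obtain Y where Y: "flag (Q.subsp k) W (card J) Y" "Y \<subseteq> N"
    and coord: "\<forall>x\<in>Y. \<exists>a\<in>J \<rightarrow> carrier S. coset x = (\<Oplus>\<^bsub>M\<^esub>i\<in>J. a i \<odot>\<^bsub>M\<^esub> i)" using insert by auto
  have Ys: "Y \<in> Q.subsp k" using flagD[OF Y(1)] by auto
  obtain y where y: "y \<in> N" "s = coset y" using insert.prems(1) unfolding M_carrier by blast
  have JM: "J \<subseteq> carrier M" "s \<in> carrier M" using insert.prems(1) by auto
  \<comment> \<open>Updating a coefficient family at the new index \<open>s\<close> leaves the sum
    over \<open>J\<close> unchanged.\<close>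
  have fin_insert: "(\<Oplus>\<^bsub>M\<^esub>i\<in>insert s J. (a(s := b)) i \<odot>\<^bsub>M\<^esub> i) = b \<odot>\<^bsub>M\<^esub> s \<oplus>\<^bsub>M\<^esub> (\<Oplus>\<^bsub>M\<^esub>i\<in>J. a i \<odot>\<^bsub>M\<^esub> i)"
    if a: "a \<in> J \<rightarrow> carrier S" and b: "b \<in> carrier S" for a b
  proof -
    have eq: "(a(s := b)) i = a i" if "i \<in> J" for i using that insert.hyps(2) by auto
    have "a(s := b) \<in> J \<rightarrow> carrier S" using a b by auto
    then have f: "(\<lambda>i. (a(s := b)) i \<odot>\<^bsub>M\<^esub> i) \<in> J \<rightarrow> carrier M" using JM(1) by (rule M_smult_family)
    have fs: "(a(s := b)) s \<odot>\<^bsub>M\<^esub> s \<in> carrier M" using M_smult_closed JM(2) b by simp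
    have "(\<Oplus>\<^bsub>M\<^esub>i\<in>J. (a(s := b)) i \<odot>\<^bsub>M\<^esub> i) = (\<Oplus>\<^bsub>M\<^esub>i\<in>J. a i \<odot>\<^bsub>M\<^esub> i)"
      by (rule M.add.finprod_cong'[OF refl]) (use M_smult_family[OF a JM(1)] eq in auto)
    then show ?thesis using M.finsum_insert[OF insert.hyps(1,2) f fs] by simp
  qed
  have yY: "y \<notin> Y"
  proof
    assume "y \<in> Y"
    then obtain a where a: "a \<in> J \<rightarrow> carrier S" "coset y = (\<Oplus>\<^bsub>M\<^esub>i\<in>J. a i \<odot>\<^bsub>M\<^esub> i)" using coord by blast
    \<comment> \<open>If \<open>y\<close> were already in the space, coefficient -1 at
      \<open>s\<close> together with the coordinates of \<open>y\<close> would be a nontrivial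
      relation.\<close>
    let ?b = "\<ominus>\<^bsub>S\<^esub> \<one>\<^bsub>S\<^esub>"
    interpret h: ring_hom_ring S Q \<sigma> by (rule ring_hom_ringI2[OF S.ring_axioms Q.ring_axioms sigma])
    have "\<sigma> ?b \<otimes>\<^bsub>Q\<^esub> y \<oplus>\<^bsub>Q\<^esub> y = \<zero>\<^bsub>Q\<^esub>" using Nc[OF y(1)] by (simp add: Q.l_minus Q.l_neg)
    then have "?b \<odot>\<^bsub>M\<^esub> s \<oplus>\<^bsub>M\<^esub> coset y = \<zero>\<^bsub>M\<^esub>"
      unfolding y(2) M_zero using M_smult[OF _ y(1), of ?b] M_add[OF sN[OF _ y(1)] y(1), of ?b] by simp
    then have "(\<Oplus>\<^bsub>M\<^esub>i\<in>insert s J. (a(s := ?b)) i \<odot>\<^bsub>M\<^esub> i) = \<zero>\<^bsub>M\<^esub>"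
      using fin_insert[OF a(1), of ?b] a(2) by simp
    moreover have "a(s := ?b) \<in> insert s J \<rightarrow> carrier S" using a(1) by auto
    ultimately have "\<forall>i\<in>insert s J. (a(s := ?b)) i = \<zero>\<^bsub>S\<^esub>"
      using insert.prems(2) insert.hyps(1) unfolding lin_indep_def by blast
    then have "?b = \<zero>\<^bsub>S\<^esub>" by simp
    then have "\<one>\<^bsub>S\<^esub> = \<zero>\<^bsub>S\<^esub>" using S.minus_minus[OF S.one_closed] S.minus_zero by metis
    then show False by simp
  qed
  let ?Z = "Q.dilate y k <+>\<^bsub>Q\<^esub> Y"
  note Z = Q.line_props[OF k_subring Ys Nc[OF y(1)]]
  have kQ: "k \<subseteq> carrier Q" using subringE(1)[OF k_subring] .
  have ZN: "?Z \<subseteq> N" by (rule Q.line_least[OF N y(1) Y(2) kQ Nc[OF y(1)]])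
  have "Y \<subset> ?Z" using Z(2,3) yY by blast
  then have "flag (Q.subsp k) W (Suc (card J)) ?Z" using Y(1) Z(1) by (intro flag.flag_Suc[of _ _ _ Y])
  moreover have "\<exists>a\<in>insert s J \<rightarrow> carrier S. coset z = (\<Oplus>\<^bsub>M\<^esub>i\<in>insert s J. a i \<odot>\<^bsub>M\<^esub> i)" if z: "z \<in> ?Z" for z
  proof -
    obtain b x where b: "b \<in> carrier S" "x \<in> Y" "z = y \<otimes>\<^bsub>Q\<^esub> \<sigma> b \<oplus>\<^bsub>Q\<^esub> x"
      using z unfolding mem_set_add Q.dilate_def by blast
    obtain a where a: "a \<in> J \<rightarrow> carrier S" "coset x = (\<Oplus>\<^bsub>M\<^esub>i\<in>J. a i \<odot>\<^bsub>M\<^esub> i)" using coord b(2) by blast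
    have xN: "x \<in> N" using b(2) Y(2) by blast
    have "z = \<sigma> b \<otimes>\<^bsub>Q\<^esub> y \<oplus>\<^bsub>Q\<^esub> x" unfolding b(3) using Q.m_comm[OF Nc[OF y(1)] sc[OF b(1)]] by simp
    then have "coset z = b \<odot>\<^bsub>M\<^esub> s \<oplus>\<^bsub>M\<^esub> coset x"
      using M_smult[OF b(1) y(1)] M_add[OF sN[OF b(1) y(1)] xN] y(2) by simp
    then have "coset z = (\<Oplus>\<^bsub>M\<^esub>i\<in>insert s J. (a(s := b)) i \<odot>\<^bsub>M\<^esub> i)"
      using fin_insert[OF a(1) b(1)] a(2) by simp
    moreover have "a(s := b) \<in> insert s J \<rightarrow> carrier S" using a(1) b(1) by auto
    ultimately show ?thesis by blast
  qed
  ultimately show ?case using ZN insert.hyps by (intro exI[of _ ?Z]) simp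
qed

text \<open>The link between the genera, which are defined by independent cosets, and the chain
  lengths used in the comparison.\<close>

lemma vdim_eq_len: "vdim S M = len (Q.subsp k) W N"
proof (rule antisym)
  show "vdim S M \<le> len (Q.subsp k) W N"
    unfolding vdim_def
  proof (rule SUP_least)
    fix J assume "J \<in> {J. finite J \<and> J \<subseteq> carrier M \<and> lin_indep S M J (\<lambda>x. x)}"
    then obtain Y where "flag (Q.subsp k) W (card J) Y" "Y \<subseteq> N" using independent_flag[of J] by blast
    then show "enat (card J) \<le> len (Q.subsp k) W N" by (rule flag_le_len)
  qed
  show "len (Q.subsp k) W N \<le> vdim S M"
  proof (rule len_leI)
    fix n Y assume Y: "flag (Q.subsp k) W n Y" "Y \<subseteq> N"
    obtain J where J: "finite J" "card J = n" "J \<subseteq> coset ` Y" "lin_indep S M J (\<lambda>x. x)"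
      using flag_independent[OF Y] by blast
    then have "J \<in> {J. finite J \<and> J \<subseteq> carrier M \<and> lin_indep S M J (\<lambda>x. x)}"
      using Y(2) unfolding M_carrier by blast
    then show "enat n \<le> vdim S M" unfolding vdim_def J(2)[symmetric] by (rule SUP_upper)
  qed
qed

end

section \<open>Normalizations\<close>

text \<open>If \<open>z\<close> is the inverse of \<open>y\<close>, multiplying an equation of degree \<open>m\<close> for \<open>y\<close> by \<open>z\<^sup>m\<close> shows
  that \<open>z\<close> divides its leading coefficient.\<close>

lemma (in cring) eval_inverse_divides:
  assumes A: "subring A R" and z: "z \<in> A" and y: "y \<in> carrier R" and yz: "y \<otimes> z = \<one>" and "set ps \<subseteq> A"
  shows "\<exists>c\<in>A. z [^] length ps \<otimes> eval ps y = z \<otimes> c"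
  using assms(5)
proof (induction ps)
  case Nil
  have "\<zero> \<in> A" "z \<in> carrier R" using subringE(1,2)[OF A] z by auto
  then show ?case by (intro bexI[of _ \<zero>]) auto
next
  case (Cons a ps)
  note Ac = subsetD[OF subringE(1)[OF A]]
  obtain c where c: "c \<in> A" "z [^] length ps \<otimes> eval ps y = z \<otimes> c" using Cons by auto
  have a: "a \<in> A" "a \<in> carrier R" using Cons.prems Ac by auto
  have zc: "z \<in> carrier R" "c \<in> carrier R" using z c Ac by auto
  have e: "eval ps y \<in> carrier R" using Cons.prems Ac y by (intro eval_in_carrier) auto
  have "(y \<otimes> z) [^] length ps = y [^] length ps \<otimes> z [^] length ps" by (rule nat_pow_distrib[OF y zc(1)])
  then have yzn: "y [^] length ps \<otimes> z [^] length ps = \<one>" using yz by simp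
  have "z [^] length (a # ps) \<otimes> eval (a # ps) y
    = z \<otimes> (a \<otimes> (y [^] length ps \<otimes> z [^] length ps)) \<oplus> z \<otimes> (z [^] length ps \<otimes> eval ps y)"
    using a zc e y by (simp add: r_distr m_ac)
  also have "\<dots> = z \<otimes> (a \<oplus> z \<otimes> c)" unfolding yzn c(2) using a zc by (simp add: r_distr)
  finally show ?case using a c z subringE(6,7)[OF A] by blast
qed

text \<open>Up to a unit \<open>y\<close> is a power of \<open>t\<close>. If the exponent were
  negative, the inverse \<open>z\<close> of \<open>y\<close> would be a multiple of
  \<open>t\<close>, and the integral equation multiplied by a power of \<open>z\<close> would make
  \<open>z\<close> a unit of \<open>A\<close>.\<close>

lemma (in field) dvr_integrally_closed:
  assumes A: "subring A R" and t: "t \<in> A" "t \<noteq> \<zero>" "\<And>x. x \<in> A \<Longrightarrow> t \<otimes> x \<noteq> \<one>"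
    and factor: "\<And>x. x \<in> A \<Longrightarrow> x \<noteq> \<zero> \<Longrightarrow> \<exists>n u w. u \<in> A \<and> w \<in> A \<and> u \<otimes> w = \<one> \<and> x = u \<otimes> t [^] (n::nat)"
    and y: "y \<in> carrier R" and frac: "a \<in> A" "b \<in> A" "b \<noteq> \<zero>" "y \<otimes> b = a"
    and ps: "set ps \<subseteq> A" "eval (\<one> # ps) y = \<zero>"
  shows "y \<in> A"
proof (cases "a = \<zero>")
  case True
  have "b \<in> carrier R" using frac subringE(1)[OF A] by blast
  then have "y = \<zero>" using True frac y integral by blast
  then show ?thesis using subringE(2)[OF A] by simp
next
  case False
  note Ac = subsetD[OF subringE(1)[OF A]]
  obtain i u w where u: "u \<in> A" "w \<in> A" "u \<otimes> w = \<one>" "a = u \<otimes> t [^] (i::nat)"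
    using factor[OF frac(1) False] by blast
  obtain j u' w' where u': "u' \<in> A" "w' \<in> A" "u' \<otimes> w' = \<one>" "b = u' \<otimes> t [^] (j::nat)"
    using factor[OF frac(2,3)] by blast
  have c: "t \<in> carrier R" "u \<in> carrier R" "w \<in> carrier R" "u' \<in> carrier R" "w' \<in> carrier R"
    using t u u' Ac by auto
  have tA: "t [^] (n::nat) \<in> A" for n using t(1) subringE(3,6)[OF A] by (induction n) auto
  have tpow: "t [^] (n::nat) \<in> carrier R" "t [^] n \<noteq> \<zero>" for n using pow_nonzero c t by auto
  have cancel: "v = v'" if "v \<otimes> t [^] (n::nat) = v' \<otimes> t [^] n" "v \<in> carrier R" "v' \<in> carrier R" for v v' n
    using that tpow m_rcancel by blast
  show ?thesis
  proof (cases "j \<le> i")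
    case True
    have "t [^] (i - j) \<otimes> t [^] j = t [^] i" using c True by (simp add: nat_pow_mult)
    then have "(y \<otimes> u') \<otimes> t [^] j = (u \<otimes> t [^] (i - j)) \<otimes> t [^] j"
      using frac(4) u(4) u'(4) c y tpow by (simp add: m_assoc)
    then have "y \<otimes> u' = u \<otimes> t [^] (i - j)" using cancel c y tpow by simp
    then have "(y \<otimes> u') \<otimes> w' = u \<otimes> t [^] (i - j) \<otimes> w'" by simp
    moreover have "(y \<otimes> u') \<otimes> w' = y" using c y u'(3) by (simp add: m_assoc)
    ultimately show ?thesis using u u' tA subringE(6)[OF A] by metis
  next
    case False
    \<comment> \<open>Chosen so that \<open>t \<otimes> v\<close> is the inverse of
      \<open>y\<close>. One factor \<open>t\<close> is kept apart, since the contradiction comes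
      from \<open>t\<close> not being a unit.\<close>
    define v where "v = u' \<otimes> w \<otimes> t [^] (j - Suc i)"
    have v: "v \<in> A" "v \<in> carrier R" using u u' tA subringE(6)[OF A] Ac by (auto simp: v_def)
    define z where "z = t \<otimes> v"
    have z: "z \<in> A" "z \<in> carrier R" using v t c subringE(6)[OF A] by (auto simp: z_def)
    have "t \<otimes> t [^] (j - Suc i) \<otimes> t [^] i = t [^] Suc (j - Suc i) \<otimes> t [^] i" using c by (simp add: m_comm)
    also have "\<dots> = t [^] (Suc (j - Suc i) + i)" by (rule nat_pow_mult[OF c(1)])
    also have "Suc (j - Suc i) + i = j" using False by simp
    finally have tj: "t \<otimes> t [^] (j - Suc i) \<otimes> t [^] i = t [^] j" .
    have "(y \<otimes> z) \<otimes> t [^] i = (y \<otimes> u' \<otimes> (t \<otimes> t [^] (j - Suc i) \<otimes> t [^] i)) \<otimes> w"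
      unfolding z_def v_def using c y tpow by (simp add: m_ac)
    also have "\<dots> = u \<otimes> t [^] i \<otimes> w" unfolding tj using frac(4) u(4) u'(4) c y tpow by (simp add: m_assoc)
    also have "\<dots> = (u \<otimes> w) \<otimes> t [^] i" using c tpow by (simp add: m_ac)
    finally have yz: "y \<otimes> z = \<one>" using cancel[of "y \<otimes> z" i \<one>] y z u(3) by simp
    obtain c' where c': "c' \<in> A" "z [^] length ps \<otimes> eval ps y = z \<otimes> c'"
      using eval_inverse_divides[OF A z(1) y yz ps(1)] by blast
    have c'c: "c' \<in> carrier R" using c' Ac by blast
    have e: "eval ps y \<in> carrier R" using ps(1) Ac y by (intro eval_in_carrier) auto
    have "(y \<otimes> z) [^] length ps = y [^] length ps \<otimes> z [^] length ps" by (rule nat_pow_distrib[OF y z(2)])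
    then have yzn: "z [^] length ps \<otimes> y [^] length ps = \<one>" using yz y z by (simp add: m_comm)
    \<comment> \<open>The leading term becomes 1 and all others are divisible by \<open>z\<close>,
      so \<open>z\<close> divides 1.\<close>
    have "\<zero> = z [^] length ps \<otimes> (y [^] length ps \<oplus> eval ps y)" using ps(2) y z e by simp
    also have "\<dots> = \<one> \<oplus> z \<otimes> c'" using y z e by (simp add: r_distr yzn c'(2))
    finally have "\<one> \<oplus> z \<otimes> c' = \<zero>" ..
    then have "z \<otimes> (\<ominus> c') = \<one>"
      using z c'c minus_equality[of \<one> "z \<otimes> c'"] by (simp add: r_minus)
    then have "t \<otimes> (v \<otimes> (\<ominus> c')) = \<one>" using c v c'c by (simp add: z_def m_assoc)
    moreover have "v \<otimes> (\<ominus> c') \<in> A" using v c' subringE(5,6)[OF A] by blast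
    ultimately show ?thesis using t(3) by blast
  qed
qed

section \<open>R(n) as the ring of roots of elements of R\<close>

context dvr_setting
begin

abbreviation "Q n \<equiv> frac_field (BC n)"

definition "rq n r = frac_emb (BC n) (\<rho> n r)"
definition "sq n s = frac_emb (BC n) (\<sigma> n s)"
definition "RQ n = rq n ` RR"
definition "NQ n = {x \<in> carrier (Q n). x [^]\<^bsub>Q n\<^esub> (p ^ n) \<in> RQ n}"

lemma Q_field: "field (Q n)"
  by (rule domain.frac_is_field[OF T_domain])

lemma Q_ring: "ring (Q n)" and Q_cring: "cring (Q n)"
  using field.is_ring[OF Q_field] domain.frac_cring[OF T_domain] by auto

lemma fe_hom: "frac_emb (BC n) \<in> ring_hom (BC n) (Q n)"
  by (rule domain.frac_emb_hom[OF T_domain])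

lemma fe_nonzero: "x \<in> carrier (BC n) \<Longrightarrow> x \<noteq> \<zero>\<^bsub>BC n\<^esub> \<Longrightarrow> frac_emb (BC n) x \<noteq> \<zero>\<^bsub>Q n\<^esub>"
  by (rule domain.frac_emb_nonzero[OF T_domain])

lemma rq_hom: "rq n \<in> ring_hom R (Q n)"
  using ring_hom_trans[OF rho_hom fe_hom, of n] by (simp add: rq_def[abs_def] comp_def)

lemma sq_hom: "sq n \<in> ring_hom (root_field K p n) (Q n)"
  using ring_hom_trans[OF sigma_hom fe_hom, of n] by (simp add: sq_def[abs_def] comp_def)

lemma rq_hom_ring: "ring_hom_ring R (Q n) (rq n)"
  by (rule ring_hom_ringI2[OF R.ring_axioms Q_ring rq_hom])

lemma sq_hom_ring: "ring_hom_ring (root_field K p n) (Q n) (sq n)"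
  by (rule ring_hom_ringI2[OF field.is_ring[OF root_field_field] Q_ring sq_hom])

lemma rq_nonzero: "r \<in> RR \<Longrightarrow> r \<noteq> \<zero>\<^bsub>R\<^esub> \<Longrightarrow> rq n r \<noteq> \<zero>\<^bsub>Q n\<^esub>"
  unfolding rq_def using fe_nonzero rho_inj ring_hom_closed[OF rho_hom] by metis

lemma norm_scalar_eq: "norm_scalar K R \<iota> p n = sq n"
  by (auto simp: norm_scalar_def sq_def \<sigma>_def)

lemma Q_char: "add_pow (Q n) p \<one>\<^bsub>Q n\<^esub> = \<zero>\<^bsub>Q n\<^esub>"
  using ring_hom_add_pow[OF R.ring_axioms Q_ring rq_hom R.one_closed, of n p] R_char
    ring_hom_one[OF rq_hom] ring_hom_zero[OF rq_hom R.ring_axioms Q_ring] by simp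

lemma Q_frob: "ring_hom_ring (Q n) (Q n) (\<lambda>x. x [^]\<^bsub>Q n\<^esub> (p ^ m))"
  by (rule ring_hom_ringI2[OF Q_ring Q_ring cring.frobenius_hom[OF Q_cring prime Q_char]])

lemma fe_pow: "x \<in> carrier (BC n) \<Longrightarrow> frac_emb (BC n) (x [^]\<^bsub>BC n\<^esub> (m::nat)) = frac_emb (BC n) x [^]\<^bsub>Q n\<^esub> m"
  using ring_hom_ring.hom_nat_pow[OF ring_hom_ringI2[OF T_ring Q_ring fe_hom]] by blast

lemma fe_pow_RQ: "x \<in> carrier (BC n) \<Longrightarrow> frac_emb (BC n) x [^]\<^bsub>Q n\<^esub> (p ^ n) \<in> RQ n"
proof -
  assume x: "x \<in> carrier (BC n)"
  then obtain r where r: "r \<in> RR" "x [^]\<^bsub>BC n\<^esub> (p ^ n) = \<rho> n r" using T_pow_in_R by blast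
  have "frac_emb (BC n) x [^]\<^bsub>Q n\<^esub> (p ^ n) = rq n r"
    unfolding fe_pow[OF x, symmetric] r(2) rq_def ..
  then show ?thesis using r(1) unfolding RQ_def by blast
qed

lemma RQ_subring: "subring (RQ n) (Q n)"
  unfolding RQ_def by (rule ring_hom_ring.img_is_subring[OF rq_hom_ring R.carrier_is_subring])

text \<open>One uniformizer is fixed in \<open>R\<close> itself; its images under all
  \<open>rq n\<close> are then available together.\<close>

definition "tt = (SOME t. t \<in> RR \<and> t \<noteq> \<zero>\<^bsub>R\<^esub> \<and> max_ideal R = genideal R {t} \<and>
  (\<forall>x\<in>RR. t \<otimes>\<^bsub>R\<^esub> x \<noteq> \<one>\<^bsub>R\<^esub>) \<and>
  (\<forall>x\<in>RR. x \<noteq> \<zero>\<^bsub>R\<^esub> \<longrightarrow> (\<exists>n u w. u \<in> RR \<and> w \<in> RR \<and> u \<otimes>\<^bsub>R\<^esub> w = \<one>\<^bsub>R\<^esub> \<and> x = u \<otimes>\<^bsub>R\<^esub> t [^]\<^bsub>R\<^esub> (n::nat))))"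

lemma tt: "tt \<in> RR" "tt \<noteq> \<zero>\<^bsub>R\<^esub>" "max_ideal R = genideal R {tt}" "\<And>x. x \<in> RR \<Longrightarrow> tt \<otimes>\<^bsub>R\<^esub> x \<noteq> \<one>\<^bsub>R\<^esub>"
  "\<And>x. x \<in> RR \<Longrightarrow> x \<noteq> \<zero>\<^bsub>R\<^esub> \<Longrightarrow>
    \<exists>n u w. u \<in> RR \<and> w \<in> RR \<and> u \<otimes>\<^bsub>R\<^esub> w = \<one>\<^bsub>R\<^esub> \<and> x = u \<otimes>\<^bsub>R\<^esub> tt [^]\<^bsub>R\<^esub> (n::nat)"
proof -
  let ?P = "\<lambda>t. t \<in> RR \<and> t \<noteq> \<zero>\<^bsub>R\<^esub> \<and> max_ideal R = genideal R {t} \<and>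
    (\<forall>x\<in>RR. t \<otimes>\<^bsub>R\<^esub> x \<noteq> \<one>\<^bsub>R\<^esub>) \<and>
    (\<forall>x\<in>RR. x \<noteq> \<zero>\<^bsub>R\<^esub> \<longrightarrow> (\<exists>n u w. u \<in> RR \<and> w \<in> RR \<and> u \<otimes>\<^bsub>R\<^esub> w = \<one>\<^bsub>R\<^esub> \<and> x = u \<otimes>\<^bsub>R\<^esub> t [^]\<^bsub>R\<^esub> (n::nat)))"
  have "\<exists>t. ?P t" by (rule dvr_factorization[OF dvr]) blast
  then have *: "?P tt" unfolding tt_def by (rule someI_ex)
  show "tt \<in> RR" "tt \<noteq> \<zero>\<^bsub>R\<^esub>" "max_ideal R = genideal R {tt}" using * by auto
  show "tt \<otimes>\<^bsub>R\<^esub> x \<noteq> \<one>\<^bsub>R\<^esub>" if "x \<in> RR" for x using * that by blast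
  show "\<exists>n u w. u \<in> RR \<and> w \<in> RR \<and> u \<otimes>\<^bsub>R\<^esub> w = \<one>\<^bsub>R\<^esub> \<and> x = u \<otimes>\<^bsub>R\<^esub> tt [^]\<^bsub>R\<^esub> (n::nat)"
    if "x \<in> RR" "x \<noteq> \<zero>\<^bsub>R\<^esub>" for x using * that by blast
qed

lemma RQ_unif: "rq n tt \<in> RQ n" "rq n tt \<noteq> \<zero>\<^bsub>Q n\<^esub>" "\<And>x. x \<in> RQ n \<Longrightarrow> rq n tt \<otimes>\<^bsub>Q n\<^esub> x \<noteq> \<one>\<^bsub>Q n\<^esub>"
  "\<And>x. x \<in> RQ n \<Longrightarrow> x \<noteq> \<zero>\<^bsub>Q n\<^esub> \<Longrightarrow>
    \<exists>m u w. u \<in> RQ n \<and> w \<in> RQ n \<and> u \<otimes>\<^bsub>Q n\<^esub> w = \<one>\<^bsub>Q n\<^esub> \<and> x = u \<otimes>\<^bsub>Q n\<^esub> rq n tt [^]\<^bsub>Q n\<^esub> (m::nat)"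
proof -
  interpret h: ring_hom_ring R "Q n" "rq n" by (rule rq_hom_ring)
  show "rq n tt \<in> RQ n" unfolding RQ_def using tt(1) by blast
  show "rq n tt \<noteq> \<zero>\<^bsub>Q n\<^esub>" by (rule rq_nonzero[OF tt(1,2)])
  have inj: "a = b" if ab: "a \<in> RR" "b \<in> RR" "rq n a = rq n b" for a b
  proof (rule ccontr)
    assume "a \<noteq> b"
    then have "rq n (a \<ominus>\<^bsub>R\<^esub> b) \<noteq> \<zero>\<^bsub>Q n\<^esub>" using ab by (intro rq_nonzero) auto
    then show False using ab by (simp add: a_minus_def h.S.r_neg)
  qed
  show "rq n tt \<otimes>\<^bsub>Q n\<^esub> x \<noteq> \<one>\<^bsub>Q n\<^esub>" if "x \<in> RQ n" for x
  proof
    obtain r where r: "r \<in> RR" "x = rq n r" using \<open>x \<in> RQ n\<close> unfolding RQ_def by blast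
    assume "rq n tt \<otimes>\<^bsub>Q n\<^esub> x = \<one>\<^bsub>Q n\<^esub>"
    then have "rq n (tt \<otimes>\<^bsub>R\<^esub> r) = rq n \<one>\<^bsub>R\<^esub>" using r tt(1) by simp
    then show False using inj[of "tt \<otimes>\<^bsub>R\<^esub> r" "\<one>\<^bsub>R\<^esub>"] tt(4)[OF r(1)] r tt(1) by simp
  qed
  show "\<exists>m u w. u \<in> RQ n \<and> w \<in> RQ n \<and> u \<otimes>\<^bsub>Q n\<^esub> w = \<one>\<^bsub>Q n\<^esub> \<and> x = u \<otimes>\<^bsub>Q n\<^esub> rq n tt [^]\<^bsub>Q n\<^esub> (m::nat)"
    if x: "x \<in> RQ n" "x \<noteq> \<zero>\<^bsub>Q n\<^esub>" for x
  proof -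
    obtain r where r: "r \<in> RR" "x = rq n r" using x unfolding RQ_def by blast
    then have "r \<noteq> \<zero>\<^bsub>R\<^esub>" using x(2) by auto
    then obtain m u w where u: "u \<in> RR" "w \<in> RR" "u \<otimes>\<^bsub>R\<^esub> w = \<one>\<^bsub>R\<^esub>" "r = u \<otimes>\<^bsub>R\<^esub> tt [^]\<^bsub>R\<^esub> (m::nat)"
      using tt(5)[OF r(1)] by blast
    have "rq n u \<otimes>\<^bsub>Q n\<^esub> rq n w = \<one>\<^bsub>Q n\<^esub>" using h.hom_mult[OF u(1,2)] u(3) by simp
    moreover have "x = rq n u \<otimes>\<^bsub>Q n\<^esub> rq n tt [^]\<^bsub>Q n\<^esub> m"
      unfolding r(2) u(4) using u(1) tt(1) by (simp add: h.hom_nat_pow)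
    ultimately show ?thesis using u(1,2) unfolding RQ_def by blast
  qed
qed

text \<open>An element of \<open>NQ n\<close> is a root of a pure polynomial
  \<open>X^(p^n) - a\<close> with \<open>a\<close> in \<open>R\<close>. Conversely the Frobenius
  turns an integral equation over the base change into one over \<open>R\<close>, which is
  integrally closed.\<close>

lemma normalization_eq: "norm_bc K R \<iota> p n = (Q n)\<lparr>carrier := NQ n\<rparr>"
proof -
  interpret F: field "Q n" by (rule Q_field)
  interpret f: ring_hom_ring "Q n" "Q n" "\<lambda>x. x [^]\<^bsub>Q n\<^esub> (p ^ n)" by (rule Q_frob)
  have RQe: "RQ n \<subseteq> frac_emb (BC n) ` carrier (BC n)"
    unfolding RQ_def rq_def using ring_hom_closed[OF rho_hom] by blast
  have ec: "frac_emb (BC n) ` carrier (BC n) \<subseteq> carrier (Q n)" using ring_hom_closed[OF fe_hom] by blast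
  have RQc: "RQ n \<subseteq> carrier (Q n)" using RQe ec by blast
  have sub: "subring (frac_emb (BC n) ` carrier (BC n)) (Q n)"
    by (rule ring_hom_ring.img_is_subring[OF ring_hom_ringI2[OF T_ring Q_ring fe_hom] ring.carrier_is_subring[OF T_ring]])
  have "integral_over (Q n) (frac_emb (BC n) ` carrier (BC n)) x \<longleftrightarrow> x \<in> NQ n" if x: "x \<in> carrier (Q n)" for x
  proof
    assume "x \<in> NQ n"
    then have y: "x [^]\<^bsub>Q n\<^esub> (p ^ n) \<in> RQ n" by (simp add: NQ_def)
    let ?q = "\<one>\<^bsub>Q n\<^esub> # replicate (p ^ n - 1) \<zero>\<^bsub>Q n\<^esub> @ [\<ominus>\<^bsub>Q n\<^esub> (x [^]\<^bsub>Q n\<^esub> (p ^ n))]"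
    have e: "F.eval ?q x = \<zero>\<^bsub>Q n\<^esub>"
      using F.eval_pure_polynomial[of x "x [^]\<^bsub>Q n\<^esub> (p ^ n)" "p ^ n"] x p_pos by (simp add: F.minus_eq F.r_neg)
    have "\<ominus>\<^bsub>Q n\<^esub> (x [^]\<^bsub>Q n\<^esub> (p ^ n)) \<in> frac_emb (BC n) ` carrier (BC n)"
      using subringE(5)[OF sub] y RQe by blast
    then have P: "polynomial\<^bsub>Q n\<^esub> (frac_emb (BC n) ` carrier (BC n)) ?q"
      using subringE(2,3)[OF sub] by (auto simp: polynomial_def)
    show "integral_over (Q n) (frac_emb (BC n) ` carrier (BC n)) x"
      unfolding integral_over_def
    proof (intro exI[of _ ?q] conjI)
      show "F.eval ?q x = \<zero>\<^bsub>Q n\<^esub>" by (rule e)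
    qed (use P in simp_all)
  next
    assume "integral_over (Q n) (frac_emb (BC n) ` carrier (BC n)) x"
    then obtain q where q: "polynomial\<^bsub>Q n\<^esub> (frac_emb (BC n) ` carrier (BC n)) q" "q \<noteq> []"
      "lead_coeff q = \<one>\<^bsub>Q n\<^esub>" "F.eval q x = \<zero>\<^bsub>Q n\<^esub>" unfolding integral_over_def by blast
    then obtain ps where ps: "q = \<one>\<^bsub>Q n\<^esub> # ps" by (cases q) auto
    have psc: "set ps \<subseteq> frac_emb (BC n) ` carrier (BC n)" using q(1) ps by (auto simp: polynomial_def)
    let ?f = "\<lambda>x. x [^]\<^bsub>Q n\<^esub> (p ^ n)"
    have "set q \<subseteq> carrier (Q n)" using ps psc ec by auto
    \<comment> \<open>Applying the \<open>p^n\<close>-power map to the coefficients and to the root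
      at once keeps the equation and moves all its coefficients into \<open>R\<close>.\<close>
    then have "F.eval (map ?f q) (?f x) = ?f (F.eval q x)" using f.eval_hom'[OF x] by simp
    also have "\<dots> = \<zero>\<^bsub>Q n\<^esub>" unfolding q(4) by (rule f.hom_zero)
    finally have "F.eval (\<one>\<^bsub>Q n\<^esub> # map ?f ps) (?f x) = \<zero>\<^bsub>Q n\<^esub>" unfolding ps by simp
    moreover have "set (map ?f ps) \<subseteq> RQ n" using psc fe_pow_RQ by auto
    moreover obtain a b where ab: "a \<in> carrier (BC n)" "b \<in> carrier (BC n)" "b \<noteq> \<zero>\<^bsub>BC n\<^esub>"
      "x \<otimes>\<^bsub>Q n\<^esub> frac_emb (BC n) b = frac_emb (BC n) a" by (rule domain.frac_quotient[OF T_domain x])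
    have fb: "frac_emb (BC n) b \<in> carrier (Q n)" "frac_emb (BC n) b \<noteq> \<zero>\<^bsub>Q n\<^esub>"
      using ec ab fe_nonzero by auto
    have "?f x \<otimes>\<^bsub>Q n\<^esub> ?f (frac_emb (BC n) b) = ?f (frac_emb (BC n) a)"
      using f.hom_mult[OF x fb(1)] ab(4) by simp
    moreover have "?f (frac_emb (BC n) b) \<noteq> \<zero>\<^bsub>Q n\<^esub>" using F.pow_nonzero fb by blast
    moreover have "?f x \<in> carrier (Q n)" using x by simp
    ultimately have "?f x \<in> RQ n"
      using F.dvr_integrally_closed[OF RQ_subring RQ_unif] fe_pow_RQ[OF ab(1)] fe_pow_RQ[OF ab(2)] by blast
    then show "x \<in> NQ n" using x by (simp add: NQ_def)
  qed
  then have "{x \<in> carrier (Q n). integral_over (Q n) (frac_emb (BC n) ` carrier (BC n)) x} = NQ n"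
    by (auto simp: NQ_def)
  then show ?thesis by (simp add: norm_bc_def normalization_def)
qed

end

section \<open>The embedding into the largest field of fractions\<close>

lemma (in ring_hom_ring) image_kspan:
  assumes "V \<subseteq> carrier R" and "k \<subseteq> carrier R"
  shows "h ` R.kspan k V = S.kspan (h ` k) (h ` V)"
proof
  have c: "x \<in> carrier R" if "x \<in> R.kspan k V" for x using R.kspan_closed assms that by blast
  have "h x \<in> S.kspan (h ` k) (h ` V)" if "x \<in> R.kspan k V" for x
    using that
  proof induction
    case kspan_zero
    then show ?case using S.kspan.intros(1) by simp
  next
    case (kspan_add x a v)
    have "h (x \<oplus> a \<otimes> v) = h x \<oplus>\<^bsub>S\<^esub> h a \<otimes>\<^bsub>S\<^esub> h v"
      using c[OF kspan_add(1)] kspan_add(2,3) assms by (simp add: subset_iff)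
    then show ?case using S.kspan.intros(2)[OF kspan_add.IH imageI[OF kspan_add(2)] imageI[OF kspan_add(3)]] by simp
  qed
  then show "h ` R.kspan k V \<subseteq> S.kspan (h ` k) (h ` V)" by blast
  show "S.kspan (h ` k) (h ` V) \<subseteq> h ` R.kspan k V"
  proof
    show "y \<in> h ` R.kspan k V" if "y \<in> S.kspan (h ` k) (h ` V)" for y
      using that
    proof induction
      case kspan_zero
      have "h \<zero> = \<zero>\<^bsub>S\<^esub>" by simp
      then show ?case using R.kspan.intros(1) by (metis imageI)
    next
      case (kspan_add y b w)
      obtain x where x: "x \<in> R.kspan k V" "y = h x" using kspan_add.IH by blast
      obtain a where a: "a \<in> k" "b = h a" using kspan_add(2) by blast
      obtain v where v: "v \<in> V" "w = h v" using kspan_add(3) by blast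
      have "y \<oplus>\<^bsub>S\<^esub> b \<otimes>\<^bsub>S\<^esub> w = h (x \<oplus> a \<otimes> v)"
        unfolding x(2) a(2) v(2) using c[OF x(1)] a(1) v(1) assms by (simp add: subset_iff)
      then show ?case using R.kspan.intros(2)[OF x(1) a(1) v(1)] by (rule image_eqI)
    qed
  qed
qed

sublocale dvr_setting \<subseteq> Q1: field "frac_field (base_change K R \<iota> p 1)"
  by (rule Q_field)

sublocale dvr_setting \<subseteq> Q2: field "frac_field (base_change K R \<iota> p 2)"
  by (rule Q_field)

section \<open>Copies of all the rings inside one field\<close>

context dvr_setting
begin

abbreviation "fe n \<equiv> frac_emb (BC n)"
abbreviation "nu \<equiv> norm_map K R \<iota> p 1 2"

lemma fe_hom_ring: "ring_hom_ring (BC n) (Q n) (fe n)"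
  by (rule ring_hom_ringI2[OF T_ring Q_ring fe_hom])

lemma fe_closed: "x \<in> carrier (BC n) \<Longrightarrow> fe n x \<in> carrier (Q n)"
  using ring_hom_closed[OF fe_hom] .

lemma rq_closed: "r \<in> RR \<Longrightarrow> rq n r \<in> carrier (Q n)"
  using ring_hom_closed[OF rq_hom] .

lemma sq_closed: "s \<in> E n \<Longrightarrow> sq n s \<in> carrier (Q n)"
  using ring_hom_closed[OF sq_hom, of s n] by simp

lemma rho_closed: "r \<in> RR \<Longrightarrow> \<rho> n r \<in> carrier (BC n)"
  using ring_hom_closed[OF rho_hom] .

lemma sigma_closed: "s \<in> E n \<Longrightarrow> \<sigma> n s \<in> carrier (BC n)"
  using ring_hom_closed[OF sigma_hom, of s n] by simp

lemma RQ_closed: "RQ n \<subseteq> carrier (Q n)"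
  unfolding RQ_def using rq_closed by blast

lemma fe_inj: "inj_on (fe n) (carrier (BC n))"
  by (rule domain.frac_emb_inj[OF T_domain])

lemma NQ_subring: "subring (NQ n) (Q n)"
proof -
  interpret F: field "Q n" by (rule Q_field)
  interpret f: ring_hom_ring "Q n" "Q n" "\<lambda>x. x [^]\<^bsub>Q n\<^esub> (p ^ n)" by (rule Q_frob)
  note s = subringE[OF RQ_subring[of n]]
  show ?thesis
  proof (rule F.subringI)
    show "NQ n \<subseteq> carrier (Q n)" by (auto simp: NQ_def)
    show "\<one>\<^bsub>Q n\<^esub> \<in> NQ n" using s(3) by (simp add: NQ_def)
    fix x y assume "x \<in> NQ n" "y \<in> NQ n"
    then have *: "x \<in> carrier (Q n)" "y \<in> carrier (Q n)" "x [^]\<^bsub>Q n\<^esub> (p ^ n) \<in> RQ n" "y [^]\<^bsub>Q n\<^esub> (p ^ n) \<in> RQ n"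
      by (auto simp: NQ_def)
    show "x \<otimes>\<^bsub>Q n\<^esub> y \<in> NQ n" using f.hom_mult[OF *(1,2)] s(6)[OF *(3,4)] * by (simp add: NQ_def)
    show "x \<oplus>\<^bsub>Q n\<^esub> y \<in> NQ n" using f.hom_add[OF *(1,2)] s(7)[OF *(3,4)] * by (simp add: NQ_def)
    show "\<ominus>\<^bsub>Q n\<^esub> x \<in> NQ n" using f.hom_a_inv[OF *(1)] s(5)[OF *(3)] * by (simp add: NQ_def)
  qed
qed

lemma fe_NQ: "x \<in> carrier (BC n) \<Longrightarrow> fe n x \<in> NQ n"
  using fe_pow_RQ fe_closed by (simp add: NQ_def)

lemma rq_NQ: "r \<in> RR \<Longrightarrow> rq n r \<in> NQ n" and sq_NQ: "s \<in> E n \<Longrightarrow> sq n s \<in> NQ n"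
  unfolding rq_def sq_def using fe_NQ rho_closed sigma_closed by auto

lemma NQ_closed: "NQ n \<subseteq> carrier (Q n)"
  by (auto simp: NQ_def)

lemma sq_subfield: "subfield (sq n ` E n) (Q n)"
proof -
  interpret h: ring_hom_ring "root_field K p n" "Q n" "sq n" by (rule sq_hom_ring)
  interpret F: field "Q n" by (rule Q_field)
  interpret E: field "root_field K p n" by (rule root_field_field)
  show ?thesis using h.img_is_subfield(2)[OF E.carrier_is_subfield] by simp
qed

lemma NQ_subsp: "NQ n \<in> ring.subsp (Q n) (sq n ` E n)"
proof -
  interpret F: field "Q n" by (rule Q_field)
  have "sq n ` E n \<subseteq> NQ n" using sq_NQ by blast
  then show ?thesis using F.subsp_antimono F.subring_subsp[OF NQ_subring] by blast
qed

text \<open>This replaces the tensor product by a span inside the field of fractions, which is what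
  the length lemmas can handle.\<close>

lemma fe_span: "fe n ` carrier (BC n) = ring.kspan (Q n) (sq n ` E n) (RQ n)"
proof -
  interpret F: field "Q n" by (rule Q_field)
  interpret T: domain "BC n" by (rule T_domain)
  interpret fe: ring_hom_ring "BC n" "Q n" "fe n" by (rule fe_hom_ring)
  have sr: "subring (sq n ` E n) (Q n)" using subfieldE(1)[OF sq_subfield] .
  have K: "F.kspan (sq n ` E n) (RQ n) \<in> F.subsp (sq n ` E n)" by (rule F.kspan_subsp[OF sr RQ_closed])
  have "fe n x \<in> F.kspan (sq n ` E n) (RQ n)" if "x \<in> carrier (BC n)" for x
    using that
  proof (induction x rule: T_induct)
    case (pure r s)
    have "rq n r \<in> F.kspan (sq n ` E n) (RQ n)"
      using F.kspan_superset[OF subringE(3)[OF sr] RQ_closed] pure(1) unfolding RQ_def by blast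
    then have "sq n s \<otimes>\<^bsub>Q n\<^esub> rq n r \<in> F.kspan (sq n ` E n) (RQ n)"
      using F.subspD(5)[OF K] pure(2) by blast
    moreover have "fe n (bt n r s) = sq n s \<otimes>\<^bsub>Q n\<^esub> rq n r"
      using pure rho_closed sigma_closed F.m_comm rq_closed sq_closed
      by (simp add: tp_rho_sigma rq_def sq_def)
    ultimately show ?case by simp
  next
    case (diff x y)
    have "fe n (x \<ominus>\<^bsub>BC n\<^esub> y) = fe n x \<ominus>\<^bsub>Q n\<^esub> fe n y" using diff by (simp add: a_minus_def)
    then show ?case using F.subspD(6)[OF K diff(3,4)] by simp
  qed
  moreover have "F.kspan (sq n ` E n) (RQ n) \<subseteq> fe n ` carrier (BC n)"
  proof (rule F.kspan_least)
    have "subring (fe n ` carrier (BC n)) (Q n)" by (rule fe.img_is_subring[OF T.carrier_is_subring])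
    moreover have "sq n ` E n \<subseteq> fe n ` carrier (BC n)" unfolding sq_def using sigma_closed by blast
    ultimately show "fe n ` carrier (BC n) \<in> F.subsp (sq n ` E n)"
      using F.subring_subsp F.subsp_antimono by blast
    show "RQ n \<subseteq> fe n ` carrier (BC n)" unfolding RQ_def rq_def using rho_closed by blast
  qed
  ultimately show ?thesis by blast
qed

lemma nu_facts:
  shows "nu \<in> ring_hom (Q 1) (Q 2)" and "\<And>x. x \<in> carrier (BC 1) \<Longrightarrow> nu (fe 1 x) = fe 2 (bc x)"
proof -
  let ?h = "\<lambda>x. fe 2 (bc x)"
  have h: "?h \<in> ring_hom (BC 1) (Q 2)" using ring_hom_trans[OF bc_facts(1) fe_hom] by (simp add: comp_def)
  have inj: "x = \<zero>\<^bsub>BC 1\<^esub>" if x: "x \<in> carrier (BC 1)" "?h x = \<zero>\<^bsub>Q 2\<^esub>" for x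
  proof -
    have "bc x = \<zero>\<^bsub>BC 2\<^esub>" using fe_nonzero[OF ring_hom_closed[OF bc_facts(1) x(1)]] x(2) by blast
    then show ?thesis using bc_inj x(1) by blast
  qed
  show "nu \<in> ring_hom (Q 1) (Q 2)"
    unfolding norm_map_def by (rule domain.frac_lift_hom[OF T_domain Q_field h inj])
  show "nu (fe 1 x) = fe 2 (bc x)" if "x \<in> carrier (BC 1)" for x
    unfolding norm_map_def by (rule domain.frac_lift_emb[OF T_domain Q_field h inj that])
qed

lemma nu_hom_ring: "ring_hom_ring (Q 1) (Q 2) nu"
  by (rule ring_hom_ringI2[OF Q_ring Q_ring nu_facts(1)])

lemma nu_closed: "x \<in> carrier (Q 1) \<Longrightarrow> nu x \<in> carrier (Q 2)"
  using ring_hom_closed[OF nu_facts(1)] .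

lemma nu_inj: "inj_on nu (carrier (Q 1))"
proof -
  interpret h: ring_hom_ring "Q 1" "Q 2" nu by (rule nu_hom_ring)
  have "nu \<one>\<^bsub>Q 1\<^esub> \<in> nu ` carrier (Q 1)" by (rule imageI[OF Q1.one_closed])
  then have "nu ` carrier (Q 1) \<noteq> {\<zero>\<^bsub>Q 2\<^esub>}" unfolding h.hom_one using Q2.one_not_zero by blast
  then show ?thesis by (rule h.non_trivial_field_hom_imp_inj[OF Q1.field_axioms])
qed

lemma nu_rq: "r \<in> RR \<Longrightarrow> nu (rq 1 r) = rq 2 r"
  unfolding rq_def using nu_facts(2)[OF rho_closed] bc_rho by simp

lemma nu_sq: "s \<in> E 1 \<Longrightarrow> nu (sq 1 s) = sq 2 s"
  unfolding sq_def using nu_facts(2)[OF sigma_closed] bc_sigma by simp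

lemma nu_pow: "x \<in> carrier (Q 1) \<Longrightarrow> nu (x [^]\<^bsub>Q 1\<^esub> (m::nat)) = nu x [^]\<^bsub>Q 2\<^esub> m"
  using ring_hom_ring.hom_nat_pow[OF nu_hom_ring] by blast

definition "\<phi> x = x [^]\<^bsub>Q 2\<^esub> p"
definition "k1 = sq 2 ` E 1"
text \<open>\<open>K\<close> is embedded through \<open>R\<close> here; by \<open>sq_em\<close> this
  agrees with the embedding through the root fields.\<close>

definition "k0 = rq 2 ` \<iota> ` KK"
definition "N1 = nu ` NQ 1"

lemma phi_hom_ring: "ring_hom_ring (Q 2) (Q 2) \<phi>"
  using Q_frob[of 2 1] by (simp add: \<phi>_def[abs_def])

lemma phi_closed: "x \<in> carrier (Q 2) \<Longrightarrow> \<phi> x \<in> carrier (Q 2)"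
  by (simp add: \<phi>_def)

lemma phi_inj: "inj_on \<phi> (carrier (Q 2))"
proof -
  interpret h: ring_hom_ring "Q 2" "Q 2" \<phi> by (rule phi_hom_ring)
  have "\<phi> \<one>\<^bsub>Q 2\<^esub> \<in> \<phi> ` carrier (Q 2)" by (rule imageI[OF Q2.one_closed])
  then have "\<phi> ` carrier (Q 2) \<noteq> {\<zero>\<^bsub>Q 2\<^esub>}" unfolding h.hom_one using Q2.one_not_zero by blast
  then show ?thesis by (rule h.non_trivial_field_hom_imp_inj[OF Q2.field_axioms])
qed

lemma phi_phi: "x \<in> carrier (Q 2) \<Longrightarrow> \<phi> (\<phi> x) = x [^]\<^bsub>Q 2\<^esub> (p ^ 2)"
  by (simp add: \<phi>_def Q2.nat_pow_pow power2_eq_square)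

lemma NQ1: "x \<in> NQ 1 \<longleftrightarrow> x \<in> carrier (Q 1) \<and> x [^]\<^bsub>Q 1\<^esub> p \<in> RQ 1"
  by (simp add: NQ_def)

lemma nu_RQ: "nu ` RQ 1 = RQ 2"
  unfolding RQ_def image_image by (rule image_cong[OF refl]) (rule nu_rq)

lemma RQ_nuD:
  assumes "x \<in> carrier (Q 1)" and "nu x \<in> RQ 2"
  shows "x \<in> RQ 1"
proof -
  obtain y where "y \<in> RQ 1" "nu x = nu y" using assms(2) nu_RQ by blast
  then show ?thesis using nu_inj assms(1) RQ_closed[of 1] by (auto dest: inj_onD)
qed

text \<open>\<open>nu\<close> is injective, commutes with powers and maps the copy of
  \<open>R\<close> in one field onto that in the other, so membership in R(1) can be tested in the
  larger field.\<close>

lemma NQ1_iff: "x \<in> carrier (Q 1) \<Longrightarrow> x \<in> NQ 1 \<longleftrightarrow> \<phi> (nu x) \<in> RQ 2"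
proof -
  assume x: "x \<in> carrier (Q 1)"
  have "\<phi> (nu x) = nu (x [^]\<^bsub>Q 1\<^esub> p)" unfolding \<phi>_def by (rule nu_pow[OF x, symmetric])
  moreover have "x [^]\<^bsub>Q 1\<^esub> p \<in> carrier (Q 1)" using x by (rule Q1.nat_pow_closed)
  ultimately show ?thesis using RQ_nuD nu_RQ x unfolding NQ1 by (metis imageI)
qed

lemma phi_sq: "s \<in> E 2 \<Longrightarrow> \<phi> (sq 2 s) = sq 2 (s [^]\<^bsub>Om\<^esub> p)"
proof -
  assume s: "s \<in> E 2"
  have "s [^]\<^bsub>root_field K p 2\<^esub> m = s [^]\<^bsub>Om\<^esub> m" for m :: nat by (induction m) simp_all
  then show ?thesis
    using ring_hom_ring.hom_nat_pow[OF sq_hom_ring, of s 2 p] s unfolding \<phi>_def by simp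
qed

text \<open>That all of K^(1/p) is reached is the existence of \<open>p\<close>-th roots in the
  algebraic closure.\<close>

lemma phi_k2: "\<phi> ` sq 2 ` E 2 = k1"
proof
  have "s [^]\<^bsub>Om\<^esub> p \<in> E 1" if "s \<in> E 2" for s
    using E_Suc[of s 1] E_carrier[OF that] that by (simp add: numeral_2_eq_2)
  then show "\<phi> ` sq 2 ` E 2 \<subseteq> k1" unfolding k1_def using phi_sq by auto
  show "k1 \<subseteq> \<phi> ` sq 2 ` E 2"
  proof
    fix x assume "x \<in> k1"
    then obtain u where u: "u \<in> E 1" "x = sq 2 u" unfolding k1_def by blast
    obtain s where s: "s \<in> E (Suc 1)" "s [^]\<^bsub>Om\<^esub> p = u" by (rule p_root_exists[OF u(1)])
    have "s \<in> E 2" using s(1) by (simp add: numeral_2_eq_2)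
    moreover from this have "x = \<phi> (sq 2 s)" using phi_sq s(2) u(2) by simp
    ultimately show "x \<in> \<phi> ` sq 2 ` E 2" by blast
  qed
qed

lemma sq_em: "c \<in> KK \<Longrightarrow> sq 2 (em c) = rq 2 (\<iota> c)"
  unfolding sq_def rq_def using sigma_em by simp

lemma k0_phi: "k0 = \<phi> ` k1"
proof
  show "k0 \<subseteq> \<phi> ` k1"
  proof
    fix x assume "x \<in> k0"
    then obtain c where c: "c \<in> KK" "x = rq 2 (\<iota> c)" unfolding k0_def by blast
    have "em c \<in> E 0" using c(1) E_0 by blast
    then obtain s where s: "s \<in> E (Suc 0)" "s [^]\<^bsub>Om\<^esub> p = em c" by (rule p_root_exists)
    have s1: "s \<in> E 1" using s(1) by simp
    have "\<phi> (sq 2 s) = x" using phi_sq[OF E12[OF s1]] s(2) sq_em[OF c(1)] c(2) by simp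
    then show "x \<in> \<phi> ` k1" unfolding k1_def using s1 by blast
  qed
  show "\<phi> ` k1 \<subseteq> k0"
  proof
    fix x assume "x \<in> \<phi> ` k1"
    then obtain s where s: "s \<in> E 1" "x = \<phi> (sq 2 s)" unfolding k1_def by blast
    have "s [^]\<^bsub>Om\<^esub> p \<in> em ` KK" using s(1) unfolding mem_E by simp
    then obtain c where c: "c \<in> KK" "s [^]\<^bsub>Om\<^esub> p = em c" by blast
    have "x = rq 2 (\<iota> c)" using s(2) phi_sq[OF E12[OF s(1)]] c sq_em by simp
    then show "x \<in> k0" unfolding k0_def using c(1) by blast
  qed
qed

lemma k0_k1: "k0 \<subseteq> k1"
proof
  fix x assume "x \<in> k0"
  then obtain c where c: "c \<in> KK" "x = rq 2 (\<iota> c)" unfolding k0_def by blast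
  then have "x = sq 2 (em c)" using sq_em by simp
  then show "x \<in> k1" unfolding k1_def using em_E[OF c(1)] by blast
qed

lemma k1_subfield: "subfield k1 (Q 2)" and k0_subfield: "subfield k0 (Q 2)"
proof -
  have "sq 2 \<in> ring_hom (root_field K p 1) (Q 2)"
    using sq_hom[of 2] E12 by (auto simp: ring_hom_def)
  then interpret h: ring_hom_ring "root_field K p 1" "Q 2" "sq 2"
    by (rule ring_hom_ringI2[OF field.is_ring[OF root_field_field] Q_ring])
  interpret E: field "root_field K p 1" by (rule root_field_field)
  show k1: "subfield k1 (Q 2)" unfolding k1_def using h.img_is_subfield(2)[OF E.carrier_is_subfield] by simp
  interpret f: ring_hom_ring "Q 2" "Q 2" \<phi> by (rule phi_hom_ring)
  show "subfield k0 (Q 2)" unfolding k0_phi by (rule f.img_is_subfield(2)[OF k1]) simp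
qed

end

section \<open>Inclusions between the copies, disjointness and the conductor\<close>

context dvr_setting
begin

lemma N1_subring: "subring N1 (Q 2)"
  unfolding N1_def by (rule ring_hom_ring.img_is_subring[OF nu_hom_ring NQ_subring])

lemma N1_closed: "N1 \<subseteq> carrier (Q 2)"
  using subringE(1)[OF N1_subring] .

lemma k1_N1: "k1 \<subseteq> N1"
proof
  fix x assume "x \<in> k1"
  then obtain s where s: "s \<in> E 1" "x = sq 2 s" unfolding k1_def by blast
  then have "x = nu (sq 1 s)" using nu_sq by simp
  then show "x \<in> N1" unfolding N1_def using sq_NQ[OF s(1)] by blast
qed

lemma RQ_N1: "RQ 2 \<subseteq> N1"
proof
  fix x assume "x \<in> RQ 2"
  then obtain r where r: "r \<in> RR" "x = rq 2 r" unfolding RQ_def by blast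
  then have "x = nu (rq 1 r)" using nu_rq by simp
  then show "x \<in> N1" unfolding N1_def using rq_NQ[OF r(1)] by blast
qed

lemma phi_N1: "\<phi> ` N1 \<subseteq> RQ 2"
  unfolding N1_def using NQ1_iff NQ_closed[of 1] by blast

text \<open>Dividing the \<open>p\<close>-th roots of \<open>c\<close> and \<open>s\<close> inside
  the field of fractions of the first base change gives an element \<open>w\<close> with
  \<open>p\<close>-th power \<open>x\<close>. As \<open>x\<close> is in \<open>R\<close>,
  \<open>w\<close> belongs to R(1).\<close>

lemma phi_N1_division:
  assumes c: "c \<in> \<phi> ` N1" and s: "s \<in> \<phi> ` N1" "s \<noteq> \<zero>\<^bsub>Q 2\<^esub>" and x: "x \<in> RQ 2" "c = s \<otimes>\<^bsub>Q 2\<^esub> x"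
  shows "x \<in> \<phi> ` N1"
proof -
  interpret f: ring_hom_ring "Q 2" "Q 2" \<phi> by (rule phi_hom_ring)
  interpret nu: ring_hom_ring "Q 1" "Q 2" nu by (rule nu_hom_ring)
  obtain y where y: "y \<in> NQ 1" "c = \<phi> (nu y)" using c unfolding N1_def by blast
  obtain z where z: "z \<in> NQ 1" "s = \<phi> (nu z)" using s(1) unfolding N1_def by blast
  have yc: "y \<in> carrier (Q 1)" and zc: "z \<in> carrier (Q 1)" using y z NQ_closed[of 1] by blast+
  have xc: "x \<in> carrier (Q 2)" using x(1) RQ_closed[of 2] by blast
  have z0: "z \<noteq> \<zero>\<^bsub>Q 1\<^esub>"
  proof
    assume "z = \<zero>\<^bsub>Q 1\<^esub>"
    then have "s = \<zero>\<^bsub>Q 2\<^esub>" using z(2) nu.hom_zero f.hom_zero by (simp only:)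
    then show False using s(2) by simp
  qed
  have zu: "z \<in> Units (Q 1)" using zc z0 Q1.field_Units by blast
  define w where "w = y \<otimes>\<^bsub>Q 1\<^esub> inv\<^bsub>Q 1\<^esub> z"
  have wc: "w \<in> carrier (Q 1)" unfolding w_def using yc Q1.Units_inv_closed[OF zu] by (rule Q1.m_closed)
  have "w \<otimes>\<^bsub>Q 1\<^esub> z = y"
    unfolding w_def using Q1.m_assoc[OF yc Q1.Units_inv_closed[OF zu] zc] Q1.Units_l_inv[OF zu] Q1.r_one[OF yc] by simp
  then have "\<phi> (nu w) \<otimes>\<^bsub>Q 2\<^esub> s = c"
    unfolding y(2) z(2) using nu.hom_mult[OF wc zc] f.hom_mult[OF nu_closed[OF wc] nu_closed[OF zc]] by simp
  moreover have sc: "s \<in> carrier (Q 2)" unfolding z(2) by (rule phi_closed[OF nu_closed[OF zc]])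
  moreover have pc: "\<phi> (nu w) \<in> carrier (Q 2)" by (rule phi_closed[OF nu_closed[OF wc]])
  ultimately have "s \<otimes>\<^bsub>Q 2\<^esub> \<phi> (nu w) = s \<otimes>\<^bsub>Q 2\<^esub> x" using x(2) Q2.m_comm[OF pc sc] by simp
  then have eq: "\<phi> (nu w) = x" using Q2.m_lcancel[OF s(2) sc pc xc] by simp
  then have "w \<in> NQ 1" using NQ1_iff[OF wc] x(1) by simp
  then show ?thesis unfolding N1_def using eq by blast
qed

lemma kspan_RQ:
  assumes V: "V \<subseteq> RR" and "k1 \<subseteq> sq 2 ` E 2"
  shows "Q2.kspan k1 (rq 2 ` V) \<subseteq> fe 2 ` ring.kspan (BC 2) (\<sigma> 2 ` E 2) (\<rho> 2 ` V)"
proof -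
  interpret T: domain "BC 2" by (rule T_domain)
  interpret fe: ring_hom_ring "BC 2" "Q 2" "fe 2" by (rule fe_hom_ring)
  have "\<sigma> 2 ` E 2 \<subseteq> carrier (BC 2)" "\<rho> 2 ` V \<subseteq> carrier (BC 2)"
    using sigma_closed rho_closed V by auto
  then have "fe 2 ` T.kspan (\<sigma> 2 ` E 2) (\<rho> 2 ` V) = Q2.kspan (fe 2 ` \<sigma> 2 ` E 2) (fe 2 ` \<rho> 2 ` V)"
    by (intro fe.image_kspan)
  moreover have "fe 2 ` \<sigma> 2 ` E 2 = sq 2 ` E 2" "fe 2 ` \<rho> 2 ` V = rq 2 ` V"
    by (simp_all add: image_image sq_def rq_def)
  moreover have "Q2.kspan k1 (rq 2 ` V) \<subseteq> Q2.kspan (sq 2 ` E 2) (rq 2 ` V)"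
  proof
    show "x \<in> Q2.kspan (sq 2 ` E 2) (rq 2 ` V)" if "x \<in> Q2.kspan k1 (rq 2 ` V)" for x
      using that
    proof induction
      case kspan_zero
      show ?case by (rule Q2.kspan.intros(1))
    next
      case (kspan_add x a v)
      then show ?case using assms(2) by (intro Q2.kspan.intros(2)) auto
    qed
  qed
  ultimately show ?thesis by simp
qed

lemma k1_k2: "k1 \<subseteq> sq 2 ` E 2"
  unfolding k1_def using E12 by blast

text \<open>\<open>S\<close> is pulled back to \<open>R\<close>, where \<open>T_disjoint\<close>
  applies. The tensor product at hand is over K^(1/p^2), so the span over K^(1/p) is first enlarged
  to this field.\<close>

lemma RQ_disjoint:
  assumes S: "S \<in> Q2.subsp k0" "S \<subseteq> RQ 2" and x: "x \<in> RQ 2" "x \<in> Q2.kspan k1 S"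
  shows "x \<in> S"
proof -
  interpret h: ring_hom_ring R "Q 2" "rq 2" by (rule rq_hom_ring)
  interpret T: domain "BC 2" by (rule T_domain)
  have ik: "\<iota> ` KK \<subseteq> RR" using iota_closed by blast
  have sub: "subring (\<iota> ` KK) R"
    by (rule ring_hom_ring.img_is_subring[OF ring_hom_ringI2[OF K.ring_axioms R.ring_axioms iota] K.carrier_is_subring])
  define V where "V = {r \<in> RR. rq 2 r \<in> S}"
  have RRs: "RR \<in> R.subsp (\<iota> ` KK)"
    using R.subsp_antimono[OF ik] R.subring_subsp[OF R.carrier_is_subring] by blast
  have V: "V \<in> R.subsp (\<iota> ` KK)"
    unfolding V_def by (rule h.vimage_subsp[OF RRs ik]) (use S in \<open>simp add: k0_def\<close>)
  have VR: "V \<subseteq> RR" by (auto simp: V_def)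
  have SV: "S \<subseteq> rq 2 ` V" using S(2) unfolding V_def RQ_def by blast
  obtain r where r: "r \<in> RR" "x = rq 2 r" using x(1) unfolding RQ_def by blast
  have "x \<in> Q2.kspan k1 (rq 2 ` V)" using x(2) Q2.kspan_mono[OF SV] by blast
  then obtain z where z: "z \<in> T.kspan (\<sigma> 2 ` E 2) (\<rho> 2 ` V)" "x = fe 2 z"
    using kspan_RQ[OF VR k1_k2] by blast
  have "\<sigma> 2 ` E 2 \<subseteq> carrier (BC 2)" "\<rho> 2 ` V \<subseteq> carrier (BC 2)"
    using sigma_closed rho_closed VR by auto
  from subsetD[OF T.kspan_closed[OF this] z(1)] have zc: "z \<in> carrier (BC 2)" .
  have "fe 2 z = fe 2 (\<rho> 2 r)" using z(2) r(2) unfolding rq_def by simp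
  then have "z = \<rho> 2 r" by (rule inj_onD[OF fe_inj _ zc rho_closed[OF r(1)]])
  then have "\<rho> 2 r \<in> T.kspan (\<sigma> 2 ` E 2) (\<rho> 2 ` V)" using z(1) by simp
  then have "r \<in> V" by (rule T_disjoint[OF V r(1)])
  then show ?thesis unfolding V_def r(2) by blast
qed

lemma phi_NQ2_subsp: "\<phi> ` NQ 2 \<in> Q2.subsp k1"
proof -
  interpret f: ring_hom_ring "Q 2" "Q 2" \<phi> by (rule phi_hom_ring)
  have "\<phi> ` NQ 2 \<in> Q2.subsp (\<phi> ` sq 2 ` E 2)"
    by (rule f.image_subsp[OF NQ_subsp]) (use sq_closed in blast)
  then show ?thesis unfolding phi_k2 .
qed

lemma N1_NQ2: "N1 \<subseteq> NQ 2"
proof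
  fix x assume "x \<in> N1"
  then have x: "x \<in> carrier (Q 2)" "\<phi> x \<in> RQ 2" using N1_closed phi_N1 by auto
  have "y [^]\<^bsub>Q 2\<^esub> (m::nat) \<in> RQ 2" if "y \<in> RQ 2" for y m
    using that subringE(3,6)[OF RQ_subring[of 2]] by (induction m) auto
  then have "\<phi> (\<phi> x) \<in> RQ 2" using x(2) unfolding \<phi>_def by blast
  then show "x \<in> NQ 2" unfolding NQ_def using x(1) phi_phi by simp
qed

text \<open>For a pure tensor the \<open>p\<close>-th power of the second factor already lies in
  K^(1/p); additivity does the rest.\<close>

lemma phi_fe:
  assumes "x \<in> carrier (BC 2)"
  shows "\<exists>y\<in>carrier (BC 1). x [^]\<^bsub>BC 2\<^esub> p = bc y"
  using assms
proof (induction x rule: T_induct)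
  case (pure r s)
  have "s [^]\<^bsub>Om\<^esub> p \<in> E 1" using E_Suc[of s 1] E_carrier[OF pure(2)] pure(2) by (simp add: numeral_2_eq_2)
  moreover have "r [^]\<^bsub>R\<^esub> p \<in> RR" using pure(1) by simp
  ultimately have "bt 2 r s [^]\<^bsub>BC 2\<^esub> p = bc (bt 1 (r [^]\<^bsub>R\<^esub> p) (s [^]\<^bsub>Om\<^esub> p))"
    "bt 1 (r [^]\<^bsub>R\<^esub> p) (s [^]\<^bsub>Om\<^esub> p) \<in> carrier (BC 1)"
    using bc_facts(2) tp_pow[OF pure] tp_closed by auto
  then show ?case by blast
next
  case (diff x y)
  interpret f: ring_hom_ring "BC 2" "BC 2" "\<lambda>x. x [^]\<^bsub>BC 2\<^esub> p" using T_frob[of 2 1] by simp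
  interpret b: ring_hom_ring "BC 1" "BC 2" bc by (rule ring_hom_ringI2[OF T_ring T_ring bc_facts(1)])
  obtain a c where ac: "a \<in> carrier (BC 1)" "c \<in> carrier (BC 1)" "x [^]\<^bsub>BC 2\<^esub> p = bc a" "y [^]\<^bsub>BC 2\<^esub> p = bc c"
    using diff(3,4) by blast
  have "(x \<ominus>\<^bsub>BC 2\<^esub> y) [^]\<^bsub>BC 2\<^esub> p = x [^]\<^bsub>BC 2\<^esub> p \<ominus>\<^bsub>BC 2\<^esub> y [^]\<^bsub>BC 2\<^esub> p"
    using diff(1,2) f.hom_add[of x "\<ominus>\<^bsub>BC 2\<^esub> y"] f.hom_a_inv[of y] by (simp add: a_minus_def)
  also have "\<dots> = bc a \<ominus>\<^bsub>BC 2\<^esub> bc c" unfolding ac(3,4) ..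
  also have "\<dots> = bc (a \<ominus>\<^bsub>BC 1\<^esub> c)"
    unfolding a_minus_def b.hom_add[OF ac(1) b.R.a_inv_closed[OF ac(2)]] b.hom_a_inv[OF ac(2)] ..
  finally show ?case using ac(1,2) b.R.minus_closed by blast
qed

text \<open>For \<open>y = a / b\<close> the power \<open>y^p = a^p / b^p\<close> comes from the
  field of fractions of the first base change by \<open>phi_fe\<close>. Its own \<open>p\<close>-th
  power lies in \<open>R\<close>, so it belongs to R(1). This is the inclusion of \<open>O2\<close>
  in \<open>O1\<close>.\<close>

lemma phi_NQ2_N1: "\<phi> ` NQ 2 \<subseteq> N1"
proof
  fix x assume "x \<in> \<phi> ` NQ 2"
  then obtain y where y: "y \<in> NQ 2" "x = \<phi> y" by blast
  have yc: "y \<in> carrier (Q 2)" "\<phi> (\<phi> y) \<in> RQ 2" using y(1) phi_phi unfolding NQ_def by auto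
  interpret f: ring_hom_ring "Q 2" "Q 2" \<phi> by (rule phi_hom_ring)
  interpret nu: ring_hom_ring "Q 1" "Q 2" nu by (rule nu_hom_ring)
  obtain a b where ab: "a \<in> carrier (BC 2)" "b \<in> carrier (BC 2)" "b \<noteq> \<zero>\<^bsub>BC 2\<^esub>"
    "y \<otimes>\<^bsub>Q 2\<^esub> fe 2 b = fe 2 a" by (rule domain.frac_quotient[OF T_domain yc(1)])
  obtain a' where a': "a' \<in> carrier (BC 1)" "a [^]\<^bsub>BC 2\<^esub> p = bc a'" using phi_fe[OF ab(1)] ..
  obtain b' where b': "b' \<in> carrier (BC 1)" "b [^]\<^bsub>BC 2\<^esub> p = bc b'" using phi_fe[OF ab(2)] ..
  note ab' = a' b'
  have pa: "\<phi> (fe 2 a) = nu (fe 1 a')"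
    unfolding \<phi>_def using fe_pow[OF ab(1), of p] ab'(2) nu_facts(2)[OF ab'(1)] by simp
  have pb: "\<phi> (fe 2 b) = nu (fe 1 b')"
    unfolding \<phi>_def using fe_pow[OF ab(2), of p] ab'(4) nu_facts(2)[OF ab'(3)] by simp
  have fb: "fe 2 b \<in> carrier (Q 2)" "fe 2 b \<noteq> \<zero>\<^bsub>Q 2\<^esub>" using fe_closed[OF ab(2)] fe_nonzero[OF ab(2,3)] by auto
  have pb0: "\<phi> (fe 2 b) \<noteq> \<zero>\<^bsub>Q 2\<^esub>" unfolding \<phi>_def by (rule Q2.pow_nonzero[OF fb])
  have c1: "fe 1 a' \<in> carrier (Q 1)" "fe 1 b' \<in> carrier (Q 1)" using fe_closed ab'(1,3) by auto
  have "fe 1 b' \<noteq> \<zero>\<^bsub>Q 1\<^esub>"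
  proof
    assume "fe 1 b' = \<zero>\<^bsub>Q 1\<^esub>"
    then have "\<phi> (fe 2 b) = \<zero>\<^bsub>Q 2\<^esub>" using pb nu.hom_zero by (simp only:)
    then show False using pb0 by simp
  qed
  then have bu: "fe 1 b' \<in> Units (Q 1)" using c1 Q1.field_Units by blast
  define z where "z = fe 1 a' \<otimes>\<^bsub>Q 1\<^esub> inv\<^bsub>Q 1\<^esub> (fe 1 b')"
  have zc: "z \<in> carrier (Q 1)" unfolding z_def using c1(1) Q1.Units_inv_closed[OF bu] by (rule Q1.m_closed)
  have "z \<otimes>\<^bsub>Q 1\<^esub> fe 1 b' = fe 1 a'"
    unfolding z_def
    using Q1.m_assoc[OF c1(1) Q1.Units_inv_closed[OF bu] c1(2)] Q1.Units_l_inv[OF bu] Q1.r_one[OF c1(1)] by simp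
  then have "nu z \<otimes>\<^bsub>Q 2\<^esub> \<phi> (fe 2 b) = \<phi> (fe 2 a)" unfolding pa pb using nu.hom_mult[OF zc c1(2)] by simp
  also have "\<dots> = \<phi> y \<otimes>\<^bsub>Q 2\<^esub> \<phi> (fe 2 b)" using f.hom_mult[OF yc(1) fb(1)] ab(4) by simp
  finally have eq: "nu z = \<phi> y"
    using Q2.m_rcancel[OF pb0 phi_closed[OF fb(1)] nu_closed[OF zc] phi_closed[OF yc(1)]] by simp
  then have "z \<in> NQ 1" using NQ1_iff[OF zc] yc(2) by simp
  then show "x \<in> N1" unfolding N1_def y(2) eq[symmetric] by blast
qed

lemma RQ_NQ: "RQ n \<subseteq> NQ n"
  unfolding RQ_def using rq_NQ by blast

lemma phi_NQ2_dilate: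
  assumes x: "x \<in> RQ 2" 
  shows "Q2.dilate (x [^]\<^bsub>Q 2\<^esub> p) (\<phi> ` NQ 2) \<subseteq> \<phi> ` NQ 2"
proof
  interpret f: ring_hom_ring "Q 2" "Q 2" \<phi> by (rule phi_hom_ring)
  fix z assume "z \<in> Q2.dilate (x [^]\<^bsub>Q 2\<^esub> p) (\<phi> ` NQ 2)"
  then obtain y where y: "y \<in> NQ 2" "z = \<phi> x \<otimes>\<^bsub>Q 2\<^esub> \<phi> y" unfolding Q2.dilate_def \<phi>_def by blast
  have x': "x \<in> NQ 2" using x RQ_NQ by blast
  have xy: "x \<in> carrier (Q 2)" "y \<in> carrier (Q 2)" using x' y(1) NQ_closed[of 2] by blast+
  have "z = \<phi> (x \<otimes>\<^bsub>Q 2\<^esub> y)" unfolding y(2) f.hom_mult[OF xy] ..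
  then show "z \<in> \<phi> ` NQ 2" using subringE(6)[OF NQ_subring x' y(1)] by blast
qed

lemma N1_span_phi:
  "\<phi> ` Q2.kspan (sq 2 ` E 2) N1 = Q2.kspan k1 (\<phi> ` N1)"
proof -
  interpret f: ring_hom_ring "Q 2" "Q 2" \<phi> by (rule phi_hom_ring)
  have "sq 2 ` E 2 \<subseteq> carrier (Q 2)" using sq_closed by blast
  then show ?thesis using f.image_kspan[OF N1_closed] phi_k2 by simp
qed

text \<open>The conductor: a common denominator of finitely many generators of the normalization
  divides a power of the uniformizer.\<close>

lemma conductor:
  assumes fin: "finite_module (BC 2) (ring_module (normalization (BC 2)) (fe 2))"
  shows "\<exists>M. Q2.dilate (rq 2 tt [^]\<^bsub>Q 2\<^esub> (M::nat)) (NQ 2) \<subseteq> fe 2 ` carrier (BC 2)"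
proof -
  interpret T: domain "BC 2" by (rule T_domain)
  interpret fe: ring_hom_ring "BC 2" "Q 2" "fe 2" by (rule fe_hom_ring)
  have norm: "normalization (BC 2) = (Q 2)\<lparr>carrier := NQ 2\<rparr>"
    using normalization_eq[of 2] by (simp add: norm_bc_def)
  have sr: "subring (fe 2 ` carrier (BC 2)) (Q 2)" by (rule fe.img_is_subring[OF T.carrier_is_subring])
  let ?D = "fe 2 ` carrier (BC 2)"
  have Dc: "?D \<subseteq> carrier (Q 2)" using subringE(1)[OF sr] .
  let ?M = "ring_module ((Q 2)\<lparr>carrier := NQ 2\<rparr>) (fe 2)"
  obtain G where G: "finite G" "G \<subseteq> carrier ?M" "spanning (BC 2) ?M G (\<lambda>x. x)"
    using fin unfolding norm finite_module_def by blast
  have GN: "G \<subseteq> NQ 2" using G(2) by (simp add: ring_module_def)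
  \<comment> \<open>A common denominator of the generators is built by multiplying their individual
    denominators.\<close>
  have "\<exists>b\<in>carrier (BC 2). b \<noteq> \<zero>\<^bsub>BC 2\<^esub> \<and> (\<forall>g\<in>G. fe 2 b \<otimes>\<^bsub>Q 2\<^esub> g \<in> ?D)"
    using G(1) GN
  proof (induction G rule: finite_induct)
    case empty
    show ?case using T.one_closed T.one_not_zero by blast
  next
    case (insert g G)
    then obtain b where b: "b \<in> carrier (BC 2)" "b \<noteq> \<zero>\<^bsub>BC 2\<^esub>" "\<forall>g\<in>G. fe 2 b \<otimes>\<^bsub>Q 2\<^esub> g \<in> ?D" by blast
    have gc: "g \<in> carrier (Q 2)" using insert.prems NQ_closed[of 2] by blast
    obtain a c where ac: "a \<in> carrier (BC 2)" "c \<in> carrier (BC 2)" "c \<noteq> \<zero>\<^bsub>BC 2\<^esub>"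
      "g \<otimes>\<^bsub>Q 2\<^esub> fe 2 c = fe 2 a" by (rule domain.frac_quotient[OF T_domain gc])
    have bc: "b \<otimes>\<^bsub>BC 2\<^esub> c \<in> carrier (BC 2)" "b \<otimes>\<^bsub>BC 2\<^esub> c \<noteq> \<zero>\<^bsub>BC 2\<^esub>"
      using b(1,2) ac(2,3) T.integral by auto
    have fc: "fe 2 b \<in> ?D" "fe 2 c \<in> ?D" "fe 2 a \<in> ?D" using b(1) ac by auto
    have fcc: "fe 2 b \<in> carrier (Q 2)" "fe 2 c \<in> carrier (Q 2)" using fc Dc by auto
    have "fe 2 (b \<otimes>\<^bsub>BC 2\<^esub> c) \<otimes>\<^bsub>Q 2\<^esub> h \<in> ?D" if h: "h \<in> insert g G" for h
    proof (cases "h = g")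
      case True
      have "fe 2 (b \<otimes>\<^bsub>BC 2\<^esub> c) \<otimes>\<^bsub>Q 2\<^esub> h = fe 2 b \<otimes>\<^bsub>Q 2\<^esub> (g \<otimes>\<^bsub>Q 2\<^esub> fe 2 c)"
        unfolding True fe.hom_mult[OF b(1) ac(2)] using fcc gc by (simp add: Q2.m_ac)
      then show ?thesis unfolding ac(4) using subringE(6)[OF sr fc(1,3)] by simp
    next
      case False
      then have hG: "h \<in> G" using h by blast
      have hc: "h \<in> carrier (Q 2)" using hG insert.prems NQ_closed[of 2] by blast
      have "fe 2 (b \<otimes>\<^bsub>BC 2\<^esub> c) \<otimes>\<^bsub>Q 2\<^esub> h = fe 2 c \<otimes>\<^bsub>Q 2\<^esub> (fe 2 b \<otimes>\<^bsub>Q 2\<^esub> h)"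
        unfolding fe.hom_mult[OF b(1) ac(2)] using fcc hc by (simp add: Q2.m_ac)
      then show ?thesis using subringE(6)[OF sr fc(2)] b(3) hG by simp
    qed
    then show ?case using bc by blast
  qed
  then obtain b where b: "b \<in> carrier (BC 2)" "b \<noteq> \<zero>\<^bsub>BC 2\<^esub>" "\<forall>g\<in>G. fe 2 b \<otimes>\<^bsub>Q 2\<^esub> g \<in> ?D" by blast
  have fb: "fe 2 b \<in> carrier (Q 2)" using fe_closed[OF b(1)] .
  have bN: "fe 2 b \<otimes>\<^bsub>Q 2\<^esub> x \<in> ?D" if x: "x \<in> NQ 2" for x
  proof -
    have xM: "x \<in> carrier ?M" using x by (simp add: ring_module_def)
    from bspec[OF conjunct2[OF G(3)[unfolded spanning_def]] xM]
    obtain S c where S: "finite S" "S \<subseteq> G" "c \<in> S \<rightarrow> carrier (BC 2)"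
      "x = (\<Oplus>\<^bsub>?M\<^esub>i\<in>S. c i \<odot>\<^bsub>?M\<^esub> i)" by (elim exE conjE) (rule that)
    have "x = finsum ((Q 2)\<lparr>carrier := NQ 2\<rparr>) (\<lambda>i. fe 2 (c i) \<otimes>\<^bsub>Q 2\<^esub> i) S"
      using S(4) unfolding finsum_ring_module by (simp add: ring_module_def)
    \<comment> \<open>That the partial sums stay in \<open>NQ 2\<close> is proved along, so that
      they are elements of the field to which distributivity can be applied.\<close>
    moreover have "fe 2 b \<otimes>\<^bsub>Q 2\<^esub> finsum ((Q 2)\<lparr>carrier := NQ 2\<rparr>) (\<lambda>i. fe 2 (c i) \<otimes>\<^bsub>Q 2\<^esub> i) S \<in> ?D \<and>
      finsum ((Q 2)\<lparr>carrier := NQ 2\<rparr>) (\<lambda>i. fe 2 (c i) \<otimes>\<^bsub>Q 2\<^esub> i) S \<in> NQ 2"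
      using S(1-3)
    proof (induction S rule: finite_induct)
      interpret N: ring "(Q 2)\<lparr>carrier := NQ 2\<rparr>" by (rule Q2.subring_is_ring[OF NQ_subring])
      case empty
      have "\<zero>\<^bsub>Q 2\<^esub> \<in> ?D" "\<zero>\<^bsub>Q 2\<^esub> \<in> NQ 2" using subringE(2)[OF sr] subringE(2)[OF NQ_subring] by auto
      then show ?case using N.finsum_empty fb by simp
    next
      interpret N: ring "(Q 2)\<lparr>carrier := NQ 2\<rparr>" by (rule Q2.subring_is_ring[OF NQ_subring])
      case (insert i S)
      let ?g = "\<lambda>i. fe 2 (c i) \<otimes>\<^bsub>Q 2\<^esub> i"
      let ?s = "finsum ((Q 2)\<lparr>carrier := NQ 2\<rparr>) ?g S"
      have g: "?g j \<in> NQ 2" if "j \<in> insert i S" for j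
      proof -
        have "c j \<in> carrier (BC 2)" using insert.prems(2) that by blast
        then have "fe 2 (c j) \<in> NQ 2" by (rule fe_NQ)
        moreover have "j \<in> NQ 2" using that insert.prems(1) GN by blast
        ultimately show ?thesis by (rule subringE(6)[OF NQ_subring])
      qed
      have IH: "fe 2 b \<otimes>\<^bsub>Q 2\<^esub> ?s \<in> ?D" "?s \<in> NQ 2" using insert by auto
      have sum: "finsum ((Q 2)\<lparr>carrier := NQ 2\<rparr>) ?g (insert i S) = ?g i \<oplus>\<^bsub>Q 2\<^esub> ?s"
        using N.finsum_insert[OF insert.hyps(1,2), of ?g] g by simp
      have ci: "c i \<in> carrier (BC 2)" and iG: "i \<in> G" using insert.prems by auto
      have cc: "fe 2 (c i) \<in> carrier (Q 2)" "i \<in> carrier (Q 2)" "?s \<in> carrier (Q 2)"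
        using fe_closed[OF ci] iG GN IH(2) NQ_closed[of 2] by auto
      have "fe 2 b \<otimes>\<^bsub>Q 2\<^esub> (?g i \<oplus>\<^bsub>Q 2\<^esub> ?s) = fe 2 (c i) \<otimes>\<^bsub>Q 2\<^esub> (fe 2 b \<otimes>\<^bsub>Q 2\<^esub> i) \<oplus>\<^bsub>Q 2\<^esub> fe 2 b \<otimes>\<^bsub>Q 2\<^esub> ?s"
        using cc fb by (simp add: Q2.r_distr Q2.m_lcomm)
      moreover have "fe 2 (c i) \<otimes>\<^bsub>Q 2\<^esub> (fe 2 b \<otimes>\<^bsub>Q 2\<^esub> i) \<in> ?D"
        by (rule subringE(6)[OF sr imageI[OF ci] bspec[OF b(3) iG]])
      ultimately have "fe 2 b \<otimes>\<^bsub>Q 2\<^esub> (?g i \<oplus>\<^bsub>Q 2\<^esub> ?s) \<in> ?D" using subringE(7)[OF sr _ IH(1)] by simp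
      moreover have "?g i \<oplus>\<^bsub>Q 2\<^esub> ?s \<in> NQ 2" by (rule subringE(7)[OF NQ_subring g[OF insertI1] IH(2)])
      ultimately show ?case unfolding sum by (rule conjI)
    qed
    ultimately show ?thesis by simp
  qed
  \<comment> \<open>The denominator \<open>b\<close> divides its power of exponent
    \<open>p^2\<close>, which lies in \<open>R\<close> and is a unit times \<open>tt^M\<close>. This
    is the origin of \<open>M\<close>.\<close>
  obtain r where r: "r \<in> RR" "b [^]\<^bsub>BC 2\<^esub> (p ^ 2) = \<rho> 2 r" using T_pow_in_R[OF b(1)] by blast
  have "b [^]\<^bsub>BC 2\<^esub> (p ^ 2) \<noteq> \<zero>\<^bsub>BC 2\<^esub>" by (rule T.pow_nonzero[OF b(1,2)])
  then have "r \<noteq> \<zero>\<^bsub>R\<^esub>" using r(2) ring_hom_zero[OF rho_hom R.ring_axioms T_ring] by metis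
  then obtain M u w where u: "u \<in> RR" "w \<in> RR" "u \<otimes>\<^bsub>R\<^esub> w = \<one>\<^bsub>R\<^esub>" "r = u \<otimes>\<^bsub>R\<^esub> tt [^]\<^bsub>R\<^esub> (M::nat)"
    using tt(5)[OF r(1)] by blast
  interpret h: ring_hom_ring R "Q 2" "rq 2" by (rule rq_hom_ring)
  have pp: "Suc (p ^ 2 - 1) = p ^ 2" using p_pos by simp
  have "b [^]\<^bsub>BC 2\<^esub> (p ^ 2) = b [^]\<^bsub>BC 2\<^esub> (p ^ 2 - 1) \<otimes>\<^bsub>BC 2\<^esub> b" by (rule T.nat_pow_Suc[of b "p ^ 2 - 1", unfolded pp])
  then have rb: "rq 2 r = fe 2 (b [^]\<^bsub>BC 2\<^esub> (p ^ 2 - 1)) \<otimes>\<^bsub>Q 2\<^esub> fe 2 b"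
    unfolding rq_def r(2)[symmetric] using b(1) by simp
  have tM: "rq 2 tt [^]\<^bsub>Q 2\<^esub> M = rq 2 w \<otimes>\<^bsub>Q 2\<^esub> rq 2 r"
  proof -
    have "w \<otimes>\<^bsub>R\<^esub> r = (u \<otimes>\<^bsub>R\<^esub> w) \<otimes>\<^bsub>R\<^esub> tt [^]\<^bsub>R\<^esub> M" unfolding u(4) using u(1,2) tt(1) by (simp add: R.m_ac)
    then have "w \<otimes>\<^bsub>R\<^esub> r = tt [^]\<^bsub>R\<^esub> M" using u(3) tt(1) by simp
    then show ?thesis using h.hom_mult[OF u(2) r(1)] h.hom_nat_pow[OF tt(1), of M] by simp
  qed
  have "rq 2 tt [^]\<^bsub>Q 2\<^esub> M \<otimes>\<^bsub>Q 2\<^esub> x \<in> ?D" if x: "x \<in> NQ 2" for x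
  proof -
    have xc: "x \<in> carrier (Q 2)" using x NQ_closed[of 2] by blast
    have e: "fe 2 (b [^]\<^bsub>BC 2\<^esub> (p ^ 2 - 1)) \<in> ?D" using b(1) by simp
    have w: "rq 2 w \<in> ?D" unfolding rq_def using rho_closed[OF u(2)] by blast
    have "rq 2 tt [^]\<^bsub>Q 2\<^esub> M \<otimes>\<^bsub>Q 2\<^esub> x =
      rq 2 w \<otimes>\<^bsub>Q 2\<^esub> (fe 2 (b [^]\<^bsub>BC 2\<^esub> (p ^ 2 - 1)) \<otimes>\<^bsub>Q 2\<^esub> (fe 2 b \<otimes>\<^bsub>Q 2\<^esub> x))"
      unfolding tM rb using subsetD[OF Dc e] subsetD[OF Dc w] fb xc by (simp add: Q2.m_assoc)
    then show ?thesis using subringE(6)[OF sr w subringE(6)[OF sr e bN[OF x]]] by simp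
  qed
  then show ?thesis unfolding Q2.dilate_def by blast
qed

end

section \<open>The residue field and the assembled tower\<close>

context dvr_setting
begin

text \<open>Generators of the residue field are lifted to \<open>R\<close>. The conclusion is
  phrased with subspaces above the maximal ideal, to match the last assumption of
  \<open>len_le_card\<close>.\<close>

lemma residue_generators:
  assumes "residue_field_finite K R \<iota>"
  shows "\<exists>G. finite G \<and> G \<subseteq> RR \<and> (\<forall>Y\<in>R.subsp (\<iota> ` KK). max_ideal R \<union> G \<subseteq> Y \<longrightarrow> RR \<subseteq> Y)"
proof -
  let ?m = "max_ideal R"
  let ?h = "a_r_coset R ?m"
  let ?M = "ring_module (R Quot ?m) (\<lambda>k. ?h (\<iota> k))"
  interpret m: ideal ?m R unfolding tt(3) by (rule R.genideal_ideal) (use tt(1) in blast)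
  interpret h: ring_hom_ring R "R Quot ?m" ?h by (rule m.rcos_ring_hom_ring)
  from assms[unfolded residue_field_finite_def finite_module_def]
  obtain H where H: "finite H" "H \<subseteq> carrier ?M" "spanning K ?M H (\<lambda>x. x)" by (elim exE conjE) (rule that)
  have "carrier ?M = carrier (R Quot ?m)" unfolding ring_module_def partial_object.simps ..
  also have "\<dots> = a_rcosets\<^bsub>R\<^esub> ?m" unfolding FactRing_def partial_object.simps ..
  finally have cM: "carrier ?M = a_rcosets\<^bsub>R\<^esub> ?m" .
  have HR: "H \<subseteq> ?h ` RR"
  proof
    fix x assume "x \<in> H"
    then have "x \<in> a_rcosets\<^bsub>R\<^esub> ?m" using H(2) unfolding cM by (rule_tac subsetD)
    then show "x \<in> ?h ` RR" unfolding A_RCOSETS_def' by blast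
  qed
  from finite_subset_image[OF H(1) HR]
  obtain G where G: "finite G" "G \<subseteq> RR" "H = ?h ` G" by (elim exE conjE) (rule that)
  have "RR \<subseteq> Y" if Y: "Y \<in> R.subsp (\<iota> ` KK)" "?m \<union> G \<subseteq> Y" for Y
  proof
    fix x assume x: "x \<in> RR"
    note D = R.subspD[OF Y(1)]
    have "?h x \<in> carrier ?M" using x h.hom_closed by (simp add: ring_module_def)
    from bspec[OF conjunct2[OF H(3)[unfolded spanning_def]] this]
    obtain S c where S: "finite S" "S \<subseteq> H" "c \<in> S \<rightarrow> KK" "?h x = (\<Oplus>\<^bsub>?M\<^esub>i\<in>S. c i \<odot>\<^bsub>?M\<^esub> i)"
      by (elim exE conjE) (rule that)
    have "?h x = finsum (R Quot ?m) (\<lambda>i. ?h (\<iota> (c i)) \<otimes>\<^bsub>R Quot ?m\<^esub> i) S"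
      using S(4) unfolding finsum_ring_module by (simp add: ring_module_def)
    moreover have "\<exists>y\<in>Y. finsum (R Quot ?m) (\<lambda>i. ?h (\<iota> (c i)) \<otimes>\<^bsub>R Quot ?m\<^esub> i) S = ?h y"
      using S(1-3)
    proof (induction S rule: finite_induct)
      case empty
      show ?case using D(2) h.hom_zero h.S.finsum_empty by metis
    next
      case (insert i S)
      let ?g = "\<lambda>i. ?h (\<iota> (c i)) \<otimes>\<^bsub>R Quot ?m\<^esub> i"
      obtain y where y: "y \<in> Y" "finsum (R Quot ?m) ?g S = ?h y" using insert by auto
      obtain j where j: "j \<in> G" "i = ?h j" using insert.prems(1) G(3) by blast
      have ci: "c i \<in> KK" using insert.prems(2) by blast
      have cl: "\<iota> (c i) \<in> RR" "j \<in> RR" "y \<in> RR" using iota_closed[OF ci] j(1) G(2) y(1) D(1) by blast+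
      have "?g l \<in> carrier (R Quot ?m)" if "l \<in> insert i S" for l
      proof (rule h.S.m_closed)
        have "c l \<in> KK" using that insert.prems(2) by blast
        then show "?h (\<iota> (c l)) \<in> carrier (R Quot ?m)" by (rule h.hom_closed[OF iota_closed])
        have "l \<in> ?h ` G" using that insert.prems(1) G(3) by blast
        then obtain a where a: "a \<in> G" "l = ?h a" by blast
        show "l \<in> carrier (R Quot ?m)" unfolding a(2) by (rule h.hom_closed[OF subsetD[OF G(2) a(1)]])
      qed
      then have "finsum (R Quot ?m) ?g (insert i S) = ?g i \<oplus>\<^bsub>R Quot ?m\<^esub> ?h y"
        using h.S.finsum_insert[OF insert.hyps(1,2), of ?g] y(2) by simp
      also have "\<dots> = ?h (\<iota> (c i) \<otimes>\<^bsub>R\<^esub> j \<oplus>\<^bsub>R\<^esub> y)"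
        unfolding j(2)[symmetric] using cl j(2) by simp
      finally have "finsum (R Quot ?m) ?g (insert i S) = ?h (\<iota> (c i) \<otimes>\<^bsub>R\<^esub> j \<oplus>\<^bsub>R\<^esub> y)" .
      moreover have "\<iota> (c i) \<otimes>\<^bsub>R\<^esub> j \<oplus>\<^bsub>R\<^esub> y \<in> Y" using D(3,5) y(1) ci j(1) Y(2) by auto
      ultimately show ?case by (rule bexI)
    qed
    ultimately obtain y where y: "y \<in> Y" "?h x = ?h y" by auto
    \<comment> \<open>Equal cosets mean that \<open>x\<close> and \<open>y\<close> differ by an
      element of the maximal ideal, which lies in \<open>Y\<close>.\<close>
    have "x \<in> ?h y" using m.a_rcos_self[OF x] y(2) by simp
    then obtain a where "a \<in> ?m" "x = a \<oplus>\<^bsub>R\<^esub> y" unfolding a_r_coset_def' by blast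
    then show "x \<in> Y" using D(3) y(1) Y(2) by blast
  qed
  then show ?thesis using G(1,2) by blast
qed

text \<open>The maximal ideal is \<open>tt R\<close>, so the quotient is the residue field, and
  \<open>len_le_card\<close> bounds its length by the number of lifted generators.\<close>

lemma residue_len_finite:
  assumes "residue_field_finite K R \<iota>"
  shows "len (Q2.subsp k0) (Q2.dilate (rq 2 tt) (RQ 2)) (RQ 2) \<noteq> \<infinity>"
proof -
  interpret h: ring_hom_ring R "Q 2" "rq 2" by (rule rq_hom_ring)
  from residue_generators[OF assms]
  obtain G where G: "finite G" "G \<subseteq> RR" "\<forall>Y\<in>R.subsp (\<iota> ` KK). max_ideal R \<union> G \<subseteq> Y \<longrightarrow> RR \<subseteq> Y"
    by (elim exE conjE) (rule that)
  have ik: "\<iota> ` KK \<subseteq> RR" using iota_closed by blast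
  have RRs: "RR \<in> R.subsp (\<iota> ` KK)"
    using R.subsp_antimono[OF ik] R.subring_subsp[OF R.carrier_is_subring] by blast
  have k0R: "k0 \<subseteq> RQ 2" unfolding k0_def RQ_def using ik by blast
  have k0c: "k0 \<subseteq> carrier (Q 2)" using k0R RQ_closed[of 2] by (rule subset_trans)
  have V: "RQ 2 \<in> Q2.subsp k0"
    using Q2.subsp_antimono[OF k0R] Q2.subring_subsp[OF RQ_subring] by (rule subsetD)
  have tc: "rq 2 tt \<in> carrier (Q 2)" by (rule rq_closed[OF tt(1)])
  have "len (Q2.subsp k0) (Q2.dilate (rq 2 tt) (RQ 2)) (RQ 2) \<le> enat (card (rq 2 ` G))"
  proof (rule Q2.len_le_card[OF k0_subfield])
    show "finite (rq 2 ` G)" using G(1) by (rule finite_imageI)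
    show "Q2.dilate (rq 2 tt) (RQ 2) \<in> Q2.subsp k0" by (rule Q2.dilate_subsp[OF V tc k0c])
    show "RQ 2 \<in> Q2.subsp k0" by (rule V)
    show "Q2.dilate (rq 2 tt) (RQ 2) \<subseteq> RQ 2"
      unfolding Q2.dilate_def by (rule image_subsetI) (rule subringE(6)[OF RQ_subring RQ_unif(1)])
    show "rq 2 ` G \<subseteq> RQ 2" unfolding RQ_def using G(2) by (rule image_mono)
    fix Y assume Y: "Y \<in> Q2.subsp k0" "Q2.dilate (rq 2 tt) (RQ 2) \<union> rq 2 ` G \<subseteq> Y"
    let ?Y = "{r \<in> RR. rq 2 r \<in> Y}"
    have YR: "?Y \<in> R.subsp (\<iota> ` KK)" by (rule h.vimage_subsp[OF RRs ik Y(1)[unfolded k0_def]])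
    have "max_ideal R \<union> G \<subseteq> ?Y"
    proof (rule Un_least)
      show "max_ideal R \<subseteq> ?Y"
      proof
        fix x assume "x \<in> max_ideal R"
        then have "x \<in> cgenideal R tt" unfolding tt(3) R.cgenideal_eq_genideal[OF tt(1)] .
        then obtain r where r: "r \<in> RR" "x = r \<otimes>\<^bsub>R\<^esub> tt" unfolding cgenideal_def by blast
        have xr: "x = tt \<otimes>\<^bsub>R\<^esub> r" unfolding r(2) by (rule R.m_comm[OF r(1) tt(1)])
        have "rq 2 x = rq 2 tt \<otimes>\<^bsub>Q 2\<^esub> rq 2 r" unfolding xr by (rule h.hom_mult[OF tt(1) r(1)])
        moreover have "rq 2 r \<in> RQ 2" unfolding RQ_def using r(1) by (rule imageI)
        ultimately have "rq 2 x \<in> Q2.dilate (rq 2 tt) (RQ 2)" unfolding Q2.dilate_def by (rule image_eqI)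
        then have "rq 2 x \<in> Y" using Y(2) by blast
        moreover have "x \<in> RR" unfolding xr by (rule R.m_closed[OF tt(1) r(1)])
        ultimately show "x \<in> ?Y" by simp
      qed
      show "G \<subseteq> ?Y" using G(2) Y(2) by blast
    qed
    then have "RR \<subseteq> ?Y" by (rule mp[OF bspec[OF G(3) YR]])
    then show "RQ 2 \<subseteq> Y" unfolding RQ_def by blast
  qed
  moreover have "\<not> \<infinity> \<le> enat (card (rq 2 ` G))" by simp
  ultimately show ?thesis by (rule_tac notI) (simp only:)
qed

lemma tower:
  assumes fin: "finite_module (BC 2) (ring_module (normalization (BC 2)) (fe 2))"
    and res: "residue_field_finite K R \<iota>"
  shows "\<exists>M. frobenius_tower (Q 2) p M (RQ 2) k0 k1 N1 (\<phi> ` NQ 2) (rq 2 tt)"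
proof -
  interpret f: ring_hom_ring "Q 2" "Q 2" \<phi> by (rule phi_hom_ring)
  obtain M where M: "Q2.dilate (rq 2 tt [^]\<^bsub>Q 2\<^esub> (M::nat)) (NQ 2) \<subseteq> fe 2 ` carrier (BC 2)"
    using conductor[OF fin] ..
  have \<phi>: "(\<lambda>x. x [^]\<^bsub>Q 2\<^esub> p) = \<phi>" by (rule ext) (simp add: \<phi>_def)
  have tc: "rq 2 tt \<in> carrier (Q 2)" by (rule rq_closed[OF tt(1)])
  have tMc: "rq 2 tt [^]\<^bsub>Q 2\<^esub> M \<in> carrier (Q 2)" by (rule Q2.nat_pow_closed[OF tc])
  have pow: "(rq 2 tt [^]\<^bsub>Q 2\<^esub> p) [^]\<^bsub>Q 2\<^esub> M = \<phi> (rq 2 tt [^]\<^bsub>Q 2\<^esub> M)"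
    unfolding \<phi>_def Q2.nat_pow_pow[OF tc] by (simp only: mult.commute)
  \<comment> \<open>The conductor bound for R(2) is carried over by the Frobenius:
    \<open>tt^M R(2)\<close> lies in the base change, which is contained in the span of R(1) over
    K^(1/p^2), and the image of that span is \<open>C\<close>.\<close>
  have conduct: "Q2.dilate ((rq 2 tt [^]\<^bsub>Q 2\<^esub> p) [^]\<^bsub>Q 2\<^esub> M) (\<phi> ` NQ 2) \<subseteq> Q2.kspan k1 (\<phi> ` N1)"
  proof
    fix z assume "z \<in> Q2.dilate ((rq 2 tt [^]\<^bsub>Q 2\<^esub> p) [^]\<^bsub>Q 2\<^esub> M) (\<phi> ` NQ 2)"
    then obtain y where y: "y \<in> NQ 2" "z = \<phi> (rq 2 tt [^]\<^bsub>Q 2\<^esub> M) \<otimes>\<^bsub>Q 2\<^esub> \<phi> y"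
      unfolding Q2.dilate_def pow by blast
    have yc: "y \<in> carrier (Q 2)" using y(1) NQ_closed[of 2] by blast
    have z: "z = \<phi> (rq 2 tt [^]\<^bsub>Q 2\<^esub> M \<otimes>\<^bsub>Q 2\<^esub> y)" unfolding y(2) f.hom_mult[OF tMc yc] ..
    have "rq 2 tt [^]\<^bsub>Q 2\<^esub> M \<otimes>\<^bsub>Q 2\<^esub> y \<in> fe 2 ` carrier (BC 2)"
      using M y(1) unfolding Q2.dilate_def by blast
    then have "rq 2 tt [^]\<^bsub>Q 2\<^esub> M \<otimes>\<^bsub>Q 2\<^esub> y \<in> Q2.kspan (sq 2 ` E 2) N1"
      unfolding fe_span using Q2.kspan_mono[OF RQ_N1] by blast
    then show "z \<in> Q2.kspan k1 (\<phi> ` N1)" unfolding z N1_span_phi[symmetric] by (rule imageI)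
  qed
  have k0R: "k0 \<subseteq> RQ 2" unfolding k0_def RQ_def using iota_closed by blast
  have PO2: "\<phi> ` N1 \<subseteq> \<phi> ` NQ 2" using N1_NQ2 by (rule image_mono)
  have "frobenius_tower (Q 2) p M (RQ 2) k0 k1 N1 (\<phi> ` NQ 2) (rq 2 tt)"
  proof (intro frobenius_tower.intro frobenius_tower_axioms.intro; (unfold \<phi>)?)
    show "field (Q 2)" by (rule Q_field)
    show "0 < p" using p_pos .
    show "ring_hom_ring (Q 2) (Q 2) \<phi>" by (rule phi_hom_ring)
    show "subring (RQ 2) (Q 2)" by (rule RQ_subring)
    show "rq 2 tt \<in> RQ 2" "rq 2 tt \<noteq> \<zero>\<^bsub>Q 2\<^esub>" by (rule RQ_unif)+
    show "rq 2 tt \<otimes>\<^bsub>Q 2\<^esub> x \<noteq> \<one>\<^bsub>Q 2\<^esub>" if "x \<in> RQ 2" for x by (rule RQ_unif(3)[OF that])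
    show "\<exists>n u w. u \<in> RQ 2 \<and> w \<in> RQ 2 \<and> u \<otimes>\<^bsub>Q 2\<^esub> w = \<one>\<^bsub>Q 2\<^esub> \<and> x = u \<otimes>\<^bsub>Q 2\<^esub> rq 2 tt [^]\<^bsub>Q 2\<^esub> (n::nat)"
      if "x \<in> RQ 2" "x \<noteq> \<zero>\<^bsub>Q 2\<^esub>" for x by (rule RQ_unif(4)[OF that])
    show "subfield k0 (Q 2)" "subfield k1 (Q 2)" by (rule k0_subfield, rule k1_subfield)
    show "k0 = \<phi> ` k1" by (rule k0_phi)
    show "k0 \<subseteq> k1" by (rule k0_k1)
    show "k0 \<subseteq> RQ 2" by (rule k0R)
    show "k1 \<subseteq> N1" by (rule k1_N1)
    show "subring N1 (Q 2)" by (rule N1_subring)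
    show "RQ 2 \<subseteq> N1" by (rule RQ_N1)
    show "\<phi> ` N1 \<subseteq> RQ 2" by (rule phi_N1)
    show "x \<in> \<phi> ` N1" if "c \<in> \<phi> ` N1" "s \<in> \<phi> ` N1" "s \<noteq> \<zero>\<^bsub>Q 2\<^esub>" "x \<in> RQ 2" "c = s \<otimes>\<^bsub>Q 2\<^esub> x" for c s x
      by (rule phi_N1_division[OF that])
    show "x \<in> T" if "T \<in> Q2.subsp k0" "T \<subseteq> RQ 2" "x \<in> RQ 2" "x \<in> Q2.kspan k1 T" for T x
      by (rule RQ_disjoint[OF that])
    show "\<phi> ` NQ 2 \<in> Q2.subsp k1" by (rule phi_NQ2_subsp)
    show "\<phi> ` N1 \<subseteq> \<phi> ` NQ 2" by (rule PO2)
    show "\<phi> ` NQ 2 \<subseteq> N1" by (rule phi_NQ2_N1)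
    show "Q2.dilate (rq 2 tt [^]\<^bsub>Q 2\<^esub> p) (\<phi> ` NQ 2) \<subseteq> \<phi> ` NQ 2" by (rule phi_NQ2_dilate[OF RQ_unif(1)])
    show "Q2.dilate ((rq 2 tt [^]\<^bsub>Q 2\<^esub> p) [^]\<^bsub>Q 2\<^esub> M) (\<phi> ` NQ 2) \<subseteq> Q2.kspan k1 (\<phi> ` N1)" by (rule conduct)
    show "len (Q2.subsp k0) (Q2.dilate (rq 2 tt) (RQ 2)) (RQ 2) \<noteq> \<infinity>" by (rule residue_len_finite[OF res])
  qed
  then show ?thesis ..
qed

end

lemma carrier_update_ring:
  fixes G :: "('a, 'm) ring_scheme"
  shows "x \<otimes>\<^bsub>G\<lparr>carrier := H\<rparr>\<^esub> y = x \<otimes>\<^bsub>G\<^esub> y" "x \<oplus>\<^bsub>G\<lparr>carrier := H\<rparr>\<^esub> y = x \<oplus>\<^bsub>G\<^esub> y"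
    "\<one>\<^bsub>G\<lparr>carrier := H\<rparr>\<^esub> = \<one>\<^bsub>G\<^esub>" "carrier (G\<lparr>carrier := H\<rparr>) = H"
  by simp_all

section \<open>The two genera as lengths in one field\<close>

context dvr_setting
begin

lemma quot_dim:
  assumes W: "W \<in> ring.subsp (Q n) (sq n ` E n)" "W \<subseteq> NQ n"
  shows "vdim (root_field K p n) (quot_module (ring_module (norm_bc K R \<iota> p n) (norm_scalar K R \<iota> p n)) W) =
    len (ring.subsp (Q n) (sq n ` E n)) W (NQ n)"
proof -
  have "quotient_dimension (Q n) (root_field K p n) (sq n) (NQ n) W"
  proof (intro quotient_dimension.intro quotient_dimension_axioms.intro)
    show "field (Q n)" by (rule Q_field)
    show "field (root_field K p n)" by (rule root_field_field)
    show "sq n \<in> ring_hom (root_field K p n) (Q n)" by (rule sq_hom)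
    show "NQ n \<in> ring.subsp (Q n) (sq n ` carrier (root_field K p n))" unfolding E_simps by (rule NQ_subsp)
    show "W \<in> ring.subsp (Q n) (sq n ` carrier (root_field K p n))" unfolding E_simps by (rule W(1))
    show "W \<subseteq> NQ n" by (rule W(2))
  qed
  from quotient_dimension.vdim_eq_len[OF this] show ?thesis
    unfolding normalization_eq norm_scalar_eq E_simps .
qed

text \<open>The embedding \<open>nu\<close> carries K^(1/p), the first base change and R(1) to
  \<open>k1\<close>, the \<open>k1\<close>-span of \<open>R\<close> and \<open>N1\<close>.\<close>

lemma genus_10:
  "vdim (root_field K p 1) (quot_module (ring_module (norm_bc K R \<iota> p 1) (norm_scalar K R \<iota> p 1))
      (fe 1 ` carrier (BC 1))) = len (Q2.subsp k1) (Q2.kspan k1 (RQ 2)) N1"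
proof -
  interpret nu: ring_hom_ring "Q 1" "Q 2" nu by (rule nu_hom_ring)
  have k: "sq 1 ` E 1 \<subseteq> carrier (Q 1)" using sq_closed by blast
  have W: "fe 1 ` carrier (BC 1) \<in> Q1.subsp (sq 1 ` E 1)"
    unfolding fe_span by (rule Q1.kspan_subsp[OF subfieldE(1)[OF sq_subfield] RQ_closed])
  have WN: "fe 1 ` carrier (BC 1) \<subseteq> NQ 1" using fe_NQ by blast
  have nk: "nu ` sq 1 ` E 1 = k1"
    unfolding k1_def image_image by (rule image_cong[OF refl]) (rule nu_sq)
  have nW: "nu ` fe 1 ` carrier (BC 1) = Q2.kspan k1 (RQ 2)"
    unfolding fe_span nu.image_kspan[OF RQ_closed k] nk nu_RQ ..
  show ?thesis
    using nu.len_image[OF nu_inj NQ_subsp k WN] unfolding quot_dim[OF W WN] nk nW N1_def[symmetric] by (rule sym)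
qed

lemma norm_cring: "cring ((Q n)\<lparr>carrier := NQ n\<rparr>)"
proof -
  interpret F: field "Q n" by (rule Q_field)
  interpret N: domain "(Q n)\<lparr>carrier := NQ n\<rparr>" by (rule F.subring_is_domain[OF NQ_subring])
  show ?thesis by (rule N.is_cring)
qed

lemma nu_NQ: "x \<in> NQ 1 \<Longrightarrow> nu x \<in> NQ 2"
  using N1_NQ2 unfolding N1_def by blast

text \<open>These conditions make \<open>norm_base_change_map\<close> well defined on cosets.
  Balance holds because \<open>nu\<close> restricts to the inclusion of K^(1/p) into
  K^(1/p^2).\<close>

lemma norm_pairing:
  "tensor_pairing (norm_bc K R \<iota> p 1) (root_field K p 2) (root_field K p 1) (norm_scalar K R \<iota> p 1) (\<lambda>s. s)
     (norm_bc K R \<iota> p 2) nu (sq 2)"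
proof -
  interpret h: ring_hom_ring "Q 1" "Q 2" nu by (rule nu_hom_ring)
  interpret E: field "root_field K p 2" by (rule root_field_field)
  have sq1: "sq 1 \<in> ring_hom (root_field K p 1) ((Q 1)\<lparr>carrier := NQ 1\<rparr>)"
  proof (rule ring_hom_memI)
    show "sq 1 x \<in> carrier ((Q 1)\<lparr>carrier := NQ 1\<rparr>)" if "x \<in> carrier (root_field K p 1)" for x
      using that sq_NQ[of x 1] unfolding E_simps by simp
    show "sq 1 (x \<otimes>\<^bsub>root_field K p 1\<^esub> y) = sq 1 x \<otimes>\<^bsub>(Q 1)\<lparr>carrier := NQ 1\<rparr>\<^esub> sq 1 y"
      if "x \<in> carrier (root_field K p 1)" "y \<in> carrier (root_field K p 1)" for x y
      using ring_hom_mult[OF sq_hom that] by (simp only: carrier_update_ring)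
    show "sq 1 (x \<oplus>\<^bsub>root_field K p 1\<^esub> y) = sq 1 x \<oplus>\<^bsub>(Q 1)\<lparr>carrier := NQ 1\<rparr>\<^esub> sq 1 y"
      if "x \<in> carrier (root_field K p 1)" "y \<in> carrier (root_field K p 1)" for x y
      using ring_hom_add[OF sq_hom that] by (simp only: carrier_update_ring)
    show "sq 1 \<one>\<^bsub>root_field K p 1\<^esub> = \<one>\<^bsub>(Q 1)\<lparr>carrier := NQ 1\<rparr>\<^esub>"
      using ring_hom_one[OF sq_hom[of 1]] by (simp only: carrier_update_ring)
  qed
  have id: "(\<lambda>s. s) \<in> ring_hom (root_field K p 1) (root_field K p 2)"
    by (rule ring_hom_memI) (simp_all only: E_simps E12)
  show ?thesis
    unfolding normalization_eq norm_scalar_eq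
  proof (intro tensor_pairing.intro tensor_pairing_axioms.intro tensor_product.intro tensor_product_axioms.intro)
    show "cring ((Q 1)\<lparr>carrier := NQ 1\<rparr>)" "cring ((Q 2)\<lparr>carrier := NQ 2\<rparr>)" by (rule norm_cring)+
    show "cring (root_field K p 2)" by (rule E.is_cring)
    show "sq 1 \<in> ring_hom (root_field K p 1) ((Q 1)\<lparr>carrier := NQ 1\<rparr>)" by (rule sq1)
    show "(\<lambda>s. s) \<in> ring_hom (root_field K p 1) (root_field K p 2)" by (rule id)
    show "nu a \<in> carrier ((Q 2)\<lparr>carrier := NQ 2\<rparr>)" if "a \<in> carrier ((Q 1)\<lparr>carrier := NQ 1\<rparr>)" for a
      using that nu_NQ[of a] by simp
    show "sq 2 s \<in> carrier ((Q 2)\<lparr>carrier := NQ 2\<rparr>)" if "s \<in> carrier (root_field K p 2)" for s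
      using that sq_NQ[of s 2] unfolding E_simps by simp
    show "nu (a \<oplus>\<^bsub>(Q 1)\<lparr>carrier := NQ 1\<rparr>\<^esub> b) = nu a \<oplus>\<^bsub>(Q 2)\<lparr>carrier := NQ 2\<rparr>\<^esub> nu b"
      if "a \<in> carrier ((Q 1)\<lparr>carrier := NQ 1\<rparr>)" "b \<in> carrier ((Q 1)\<lparr>carrier := NQ 1\<rparr>)" for a b
    proof -
      have "a \<in> carrier (Q 1)" "b \<in> carrier (Q 1)" using that NQ_closed[of 1] by (simp_all only: carrier_update_ring) blast+
      from h.hom_add[OF this] show ?thesis by (simp only: carrier_update_ring)
    qed
    show "sq 2 (s \<oplus>\<^bsub>root_field K p 2\<^esub> u) = sq 2 s \<oplus>\<^bsub>(Q 2)\<lparr>carrier := NQ 2\<rparr>\<^esub> sq 2 u"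
      if "s \<in> carrier (root_field K p 2)" "u \<in> carrier (root_field K p 2)" for s u
      using ring_hom_add[OF sq_hom that] by (simp only: carrier_update_ring)
    fix k a s assume c: "k \<in> carrier (root_field K p 1)" "a \<in> carrier ((Q 1)\<lparr>carrier := NQ 1\<rparr>)" "s \<in> carrier (root_field K p 2)"
    have kE: "k \<in> E 1" "k \<in> E 2" and sE: "s \<in> E 2" using c(1,3) E12 unfolding E_simps by auto
    have a: "a \<in> carrier (Q 1)" using c(2) NQ_closed[of 1] by (simp only: carrier_update_ring) blast
    have "nu (sq 1 k \<otimes>\<^bsub>Q 1\<^esub> a) \<otimes>\<^bsub>Q 2\<^esub> sq 2 s = (sq 2 k \<otimes>\<^bsub>Q 2\<^esub> nu a) \<otimes>\<^bsub>Q 2\<^esub> sq 2 s"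
      unfolding h.hom_mult[OF sq_closed[OF kE(1)] a] nu_sq[OF kE(1)] ..
    also have "\<dots> = nu a \<otimes>\<^bsub>Q 2\<^esub> (sq 2 k \<otimes>\<^bsub>Q 2\<^esub> sq 2 s)"
      unfolding Q2.m_comm[OF sq_closed[OF kE(2)] nu_closed[OF a]]
      by (rule Q2.m_assoc[OF nu_closed[OF a] sq_closed[OF kE(2)] sq_closed[OF sE]])
    also have "sq 2 k \<otimes>\<^bsub>Q 2\<^esub> sq 2 s = sq 2 (k \<otimes>\<^bsub>root_field K p 2\<^esub> s)"
      using ring_hom_mult[OF sq_hom[of 2], of k s] kE(2) sE unfolding E_simps by simp
    finally show "nu (sq 1 k \<otimes>\<^bsub>(Q 1)\<lparr>carrier := NQ 1\<rparr>\<^esub> a) \<otimes>\<^bsub>(Q 2)\<lparr>carrier := NQ 2\<rparr>\<^esub> sq 2 s =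
      nu a \<otimes>\<^bsub>(Q 2)\<lparr>carrier := NQ 2\<rparr>\<^esub> sq 2 (k \<otimes>\<^bsub>root_field K p 2\<^esub> s)"
      by (simp only: carrier_update_ring)
  qed
qed

text \<open>Pure tensors are sent to products of an element of \<open>N1\<close> with a scalar from
  K^(1/p^2), and these are exactly the terms from which the span is built.\<close>

lemma norm_base_change_image:
  "norm_base_change_map K R \<iota> p 1 2 ` carrier (norm_base_change K R \<iota> p 1 2) = Q2.kspan (sq 2 ` E 2) N1"
proof -
  interpret nu: ring_hom_ring "Q 1" "Q 2" nu by (rule nu_hom_ring)
  let ?T = "norm_base_change K R \<iota> p 1 2"
  let ?L = "norm_base_change_map K R \<iota> p 1 2"
  let ?k2 = "sq 2 ` E 2"
  let ?tp = "pure_tensor (root_field K p 1) (norm_bc K R \<iota> p 1) (norm_scalar K R \<iota> p 1) (root_field K p 2) (\<lambda>s. s)"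
  note P = norm_pairing
  note tp = tensor_pairing.axioms(1)[OF P]
  have T: "?T = tensor (root_field K p 1) (norm_bc K R \<iota> p 1) (norm_scalar K R \<iota> p 1) (root_field K p 2) (\<lambda>s. s)"
    unfolding norm_base_change_def ..
  have L: "?L = tensor_lift (norm_bc K R \<iota> p 2) nu (sq 2)"
    unfolding norm_base_change_map_def norm_scalar_eq ..
  interpret T: cring ?T unfolding T by (rule tensor_product.tensor_cring[OF tp])
  have add2: "x \<oplus>\<^bsub>norm_bc K R \<iota> p 2\<^esub> y = x \<oplus>\<^bsub>Q 2\<^esub> y" "x \<otimes>\<^bsub>norm_bc K R \<iota> p 2\<^esub> y = x \<otimes>\<^bsub>Q 2\<^esub> y" for x y
    unfolding normalization_eq by (simp_all only: carrier_update_ring)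
  have carr: "carrier (norm_bc K R \<iota> p n) = NQ n" for n
    unfolding normalization_eq by (simp only: carrier_update_ring)
  have Ltp: "?L (?tp a s) = nu a \<otimes>\<^bsub>Q 2\<^esub> sq 2 s" and tpc: "?tp a s \<in> carrier ?T" if "a \<in> NQ 1" "s \<in> E 2" for a s
    using tensor_pairing.lift_tp[OF P, of a s] tensor_product.tp_closed[OF tp, of a s] that
    unfolding carr E_simps L T add2 by simp_all
  have Ladd: "?L (x \<oplus>\<^bsub>?T\<^esub> y) = ?L x \<oplus>\<^bsub>Q 2\<^esub> ?L y" if "x \<in> carrier ?T" "y \<in> carrier ?T" for x y
    using tensor_pairing.lift_add[OF P, of x y] that unfolding L T add2 by simp
  have Lc: "?L x \<in> carrier (Q 2)" if "x \<in> carrier ?T" for x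
    using tensor_pairing.lift_closed[OF P, of x] that NQ_closed[of 2] unfolding L T carr by blast
  have sr: "subring ?k2 (Q 2)" by (rule subfieldE(1)[OF sq_subfield])
  have W: "Q2.kspan ?k2 N1 \<in> Q2.subsp ?k2" by (rule Q2.kspan_subsp[OF sr N1_closed])
  note D = Q2.subspD[OF W]
  have "?L x \<in> Q2.kspan ?k2 N1" if "x \<in> carrier ?T" for x
    using that unfolding T
  proof (induction x rule: tensor_product.tensor_induct[OF tp, consumes 1, case_names pure diff])
    case (pure a s)
    then have as: "a \<in> NQ 1" "s \<in> E 2" unfolding carr E_simps by auto
    have nc: "nu a \<in> carrier (Q 2)" using nu_closed as(1) NQ_closed[of 1] by blast
    have "nu a \<in> Q2.kspan ?k2 N1"
      using Q2.kspan_superset[OF subringE(3)[OF sr] N1_closed] as(1) unfolding N1_def by blast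
    then have "sq 2 s \<otimes>\<^bsub>Q 2\<^esub> nu a \<in> Q2.kspan ?k2 N1" by (rule D(5)[OF imageI[OF as(2)]])
    then show ?case unfolding Ltp[OF as] Q2.m_comm[OF sq_closed[OF as(2)] nc] .
  next
    case (diff x y)
    note d = diff[folded T]
    have xy: "x \<ominus>\<^bsub>?T\<^esub> y \<in> carrier ?T" by (rule T.minus_closed[OF d(1,2)])
    have eq: "(x \<ominus>\<^bsub>?T\<^esub> y) \<oplus>\<^bsub>?T\<^esub> y = x"
      unfolding a_minus_def T.a_assoc[OF d(1) T.a_inv_closed[OF d(2)] d(2)] T.l_neg[OF d(2)]
      by (rule T.r_zero[OF d(1)])
    have "?L x = ?L (x \<ominus>\<^bsub>?T\<^esub> y) \<oplus>\<^bsub>Q 2\<^esub> ?L y" using Ladd[OF xy d(2)] unfolding eq .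
    then have "?L (x \<ominus>\<^bsub>?T\<^esub> y) = ?L x \<ominus>\<^bsub>Q 2\<^esub> ?L y"
      using Lc[OF xy] Lc[OF d(2)] by (simp add: a_minus_def Q2.a_assoc Q2.r_neg)
    then show ?case unfolding T[symmetric] using D(6)[OF d(3,4)] by simp
  qed
  moreover have "y \<in> ?L ` carrier ?T" if "y \<in> Q2.kspan ?k2 N1" for y
    using that
  proof induction
    case kspan_zero
    have z: "\<zero>\<^bsub>Q 1\<^esub> \<in> NQ 1" by (rule subringE(2)[OF NQ_subring])
    have "?L (?tp \<zero>\<^bsub>Q 1\<^esub> \<one>\<^bsub>Om\<^esub>) = \<zero>\<^bsub>Q 2\<^esub>"
      unfolding Ltp[OF z E_one] nu.hom_zero by (rule Q2.l_null[OF sq_closed[OF E_one]])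
    then show ?case using imageI[OF tpc[OF z E_one], of ?L] by simp
  next
    case (kspan_add y a v)
    obtain x where x: "x \<in> carrier ?T" "y = ?L x" using kspan_add.IH by blast
    obtain s where s: "s \<in> E 2" "a = sq 2 s" using kspan_add(2) by blast
    obtain b where b: "b \<in> NQ 1" "v = nu b" using kspan_add(3) unfolding N1_def by blast
    have nb: "nu b \<in> carrier (Q 2)" using nu_closed b(1) NQ_closed[of 1] by blast
    have "y \<oplus>\<^bsub>Q 2\<^esub> a \<otimes>\<^bsub>Q 2\<^esub> v = ?L (x \<oplus>\<^bsub>?T\<^esub> ?tp b s)"
      unfolding Ladd[OF x(1) tpc[OF b(1) s(1)]] Ltp[OF b(1) s(1)] x(2) s(2) b(2)
        Q2.m_comm[OF sq_closed[OF s(1)] nb] ..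
    then show ?case by (rule image_eqI) (rule T.a_closed[OF x(1) tpc[OF b(1) s(1)]])
  qed
  ultimately show ?thesis by blast
qed

text \<open>The Frobenius replaces scalars from K^(1/p^2) by scalars from K^(1/p), without changing
  the length.\<close>

lemma genus_21:
  "vdim (root_field K p 2) (quot_module (ring_module (norm_bc K R \<iota> p 2) (norm_scalar K R \<iota> p 2))
      (norm_base_change_map K R \<iota> p 1 2 ` carrier (norm_base_change K R \<iota> p 1 2))) =
    len (Q2.subsp k1) (Q2.kspan k1 (\<phi> ` N1)) (\<phi> ` NQ 2)"
proof -
  interpret f: ring_hom_ring "Q 2" "Q 2" \<phi> by (rule phi_hom_ring)
  have k: "sq 2 ` E 2 \<subseteq> carrier (Q 2)" using sq_closed by blast
  have W: "Q2.kspan (sq 2 ` E 2) N1 \<in> Q2.subsp (sq 2 ` E 2)"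
    by (rule Q2.kspan_subsp[OF subfieldE(1)[OF sq_subfield] N1_closed])
  have WN: "Q2.kspan (sq 2 ` E 2) N1 \<subseteq> NQ 2" by (rule Q2.kspan_least[OF NQ_subsp N1_NQ2])
  show ?thesis
    using f.len_image[OF phi_inj NQ_subsp k WN]
    unfolding norm_base_change_image quot_dim[OF W WN] phi_k2 N1_span_phi by (rule sym)
qed

end

section \<open>The inequality between the genera\<close>

context dvr_setting
begin

theorem genus_drop:
  assumes B: "p_basis K p B" and jap: "japanese K p B R \<iota>" and res: "residue_field_finite K R \<iota>"
  shows "enat p * vdim (root_field K p 2)
           (quot_module (ring_module (norm_bc K R \<iota> p 2) (norm_scalar K R \<iota> p 2))
             (norm_base_change_map K R \<iota> p 1 2 ` carrier (norm_base_change K R \<iota> p 1 2)))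
    \<le> vdim (root_field K p 1)
           (quot_module (ring_module (norm_bc K R \<iota> p 1) (norm_scalar K R \<iota> p 1))
             (fe 1 ` carrier (BC 1)))"
proof -
  \<comment> \<open>The Japanese condition is used for \<open>n = 2\<close>; it speaks about
    K(B^(1/p^2)), which equals K^(1/p^2) because \<open>B\<close> is a
    \<open>p\<close>-basis.\<close>
  have "finite_module (BC 2) (ring_module (normalization (BC 2)) (fe 2))"
    using jap unfolding japanese_def Let_def adjoin_roots_eq[OF B] base_change_def by (rule spec)
  then obtain M where "frobenius_tower (Q 2) p M (RQ 2) k0 k1 N1 (\<phi> ` NQ 2) (rq 2 tt)"
    using tower res by blast
  then interpret tw: frobenius_tower "Q 2" p M "RQ 2" k0 k1 N1 "\<phi> ` NQ 2" "rq 2 tt" .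
  have "tw.P = \<phi> ` N1" unfolding tw.P_def tw.\<phi>_def \<phi>_def ..
  then show ?thesis using tw.frobenius_genus unfolding genus_10 genus_21 by simp
qed

end

theorem corollary3p7:
  fixes K :: "'k ring" and R :: "'r ring" and \<iota> :: "'k \<Rightarrow> 'r"
    and p :: nat and B :: "'k set" and g10 g21 :: enat
  assumes "field K" and "has_char K p" and "p > 0"
    and "p_basis K p B"
    and "dvr R" and "\<iota> \<in> ring_hom K R"
    and "geometrically_integral K R \<iota>"
    and "japanese K p B R \<iota>"
    and "residue_field_finite K R \<iota>"
    and "g10 = vdim (root_field K p 1)
           (quot_module (ring_module (norm_bc K R \<iota> p 1) (norm_scalar K R \<iota> p 1))
             (frac_emb (base_change K R \<iota> p 1) ` carrier (base_change K R \<iota> p 1)))"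
    and "g21 = vdim (root_field K p 2)
           (quot_module (ring_module (norm_bc K R \<iota> p 2) (norm_scalar K R \<iota> p 2))
             (norm_base_change_map K R \<iota> p 1 2 ` carrier (norm_base_change K R \<iota> p 1 2)))"
  shows "g10 \<ge> enat p * g21"
proof -
  have "dvr_setting K p R \<iota>"
    by (intro dvr_setting.intro root_tower.intro root_tower_axioms.intro dvr_setting_axioms.intro
        assms(1,5-7) has_char_prime[OF assms(1-3)])
  then show ?thesis
    unfolding assms(10,11) using assms(4,8,9) by (rule dvr_setting.genus_drop)
qed

end
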